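(* Let $n\ge 3$, let $(r_1,r_2)$ be a signature with $r_1+2r_2=n$, and let $C'$ be the union of all conjugacy classes of $S_n$ not contained in $A_n$. Assume the counting conjectures for $S_n$-fields of signature $(r_1,r_2)$, with associated function $f$, and the quadratic resolvent conjecture for $n$ with exponent $\beta_n>\frac{1}{4\sqrt e}$ (all stated in the context). Then, as $X\to\infty$, $$\frac{1}{|L_n^{(r_2)}(X)|}\sum_{K\in L_n^{(r_2)}(X)} N_{K,C'}=\sum_{q}\frac{\frac12 q}{1+f(q)}\prod_{p<q}\frac{\frac12+f(p)}{1+f(p)}+O\left(\frac1{\log X}\right),$$ where $q$ runs over all primes and the product is over primes $p<q$.
   Context: An $S_n$-field is a number field $K$ of degree $n$ over $\mathbb{Q}$ whose Galois closure $\widehat K$ over $\mathbb{Q}$ has Galois group $S_n$ (acting on the $n$ embeddings of $K$). Fields are counted up to isomorphism. $d_K$ denotes the discriminant of $K$. $L_n^{(r_2)}(X)$ is the set of $S_n$-fields $K$ of signature $(r_1,r_2)$ with $|d_K|<X$. For a prime $p$ unramified in $K$, $\mathrm{Frob}_p$ denotes a Frobenius automorphism of $p$ in $\mathrm{Gal}(\widehat K/\mathbb{Q})\cong S_n$ (well defined up to conjugacy). $N_{K,C'}$ is the smallest prime $p$ (unramified in $K$) with $\mathrm{Frob}_p\in C'$. Counting conjectures. Let $r_1,\dots,r_w$ denote the possible splitting types in $S_n$-fields of ramified primes. A local condition $\mathcal{LC}_p$ at a prime $p$ is either $S_{p,C_0}$, for a conjugacy class $C_0$ of $S_n$, meaning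 that $p$ is unramified with $\mathrm{Frob}_p\in C_0$, or $S_{p,r_j}$, meaning that $p$ is ramified with splitting type $r_j$. It is assumed that there are positive-valued functions $c_1(p),\dots,c_w(p)$ on primes with $\sum_{i=1}^w c_i(p)=f(p)$ and $f(p)=O(1/p)$; put $|S_{p,C_0}|=\frac{|C_0|}{|S_n|(1+f(p))}$ and $|S_{p,r_j}|=\frac{c_j(p)}{1+f(p)}$. For a finite set $\mathcal S=(\mathcal{LC}_p)$ of local conditions at distinct primes, put $|\mathcal S|=\prod_p|\mathcal{LC}_p|$, and let $L_n^{(r_2)}(X;\mathcal S)$ be the set of $K\in L_n^{(r_2)}(X)$ satisfying the local conditions $\mathcal S$. The conjectures state that for a constant $A(r_2)>0$ and some positive constants $\delta<1$ and $\gamma$, $$|L_n^{(r_2)}(X)|=A(r_2)X+O(X^\delta),\qquad |L_n^{(r_2)}(X;\mathcal S)|=|\mathcal S|A(r_2)X+O\Big(\Big(\prod_{p\in \mathcal S}p\Big)^\gamma X^\delta\Big),$$ where $\prod_{p\in\mathcal S}$ is over the primes at which conditions are imposed and the implied constant is uniform in the primes and local conditions. Quadratic resolvent conjecture for $n$ with exponent $\beta_n$ ($0<\beta_n<1/2$): the quadratic resolvent of an $S_n$-field $K$ is the quadratic field $\mathbb{Q}(\sqrt{d_K})$ (the subfield of $\widehat K$ fixed by $A_n$). For a quadratic field $F$ with discriminant $d_F$, let $QR_n(X,F)$ be the set of $S_n$-fields $K$ with quadratic resolvent $F$ and $|d_K|\le X$. The conjecture states that $|QR_n(X,F)|\ll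 (X/|d_F|)^{1-\beta_n}$, with implied constant independent of $F$ (and $X$). *)

theory Defs
  imports
    "HOL-Analysis.Infinite_Sum"
    "HOL-Library.Landau_Symbols"
    "Jordan_Normal_Form.Determinant"
    "HOL-Algebra.Embedded_Algebras"
    "HOL-Algebra.Generated_Fields"
    "HOL-Algebra.Group_Action"
    "HOL-Algebra.Ideal_Product"
    "HOL-Algebra.QuotRing"
    "HOL-Algebra.Sym_Groups"
begin

section \<open>Number fields\<close>

text \<open>
  Number fields are taken inside the complex numbers.  Every number field has such a copy, and
  fields are counted as classes under ring isomorphism, so nothing depends on the copy.
\<close>

definition complex_ring :: "complex ring" where
  "complex_ring = \<lparr>carrier = UNIV, mult = (*), one = 1, ring.zero = 0, add = (+)\<rparr>"

abbreviation subring_of_complex :: "complex set \<Rightarrow> complex ring" where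
  "subring_of_complex K \<equiv> complex_ring\<lparr>carrier := K\<rparr>"

definition number_field :: "complex set \<Rightarrow> bool" where
  "number_field K \<longleftrightarrow> subfield K complex_ring \<and> ring.finite_dimension complex_ring \<rat> K"

definition degree_over_Q :: "complex set \<Rightarrow> nat" where
  "degree_over_Q K = ring.dim complex_ring \<rat> K"

definition field_iso_rel :: "(complex set \<times> complex set) set" where
  "field_iso_rel = {(K, K'). number_field K \<and> number_field K' \<and>
                             subring_of_complex K \<simeq> subring_of_complex K'}"

definition iso_classes :: "complex set set \<Rightarrow> complex set set set" where
  "iso_classes A = A // field_iso_rel"

text \<open>
  Used only for invariants that agree on isomorphic fields.
\<close>

definition class_rep :: "complex set set \<Rightarrow> complex set" where
  "class_rep \<kappa> = (SOME K. K \<in> \<kappa>)"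

definition embeddings :: "complex set \<Rightarrow> (complex \<Rightarrow> complex) set" where
  "embeddings K = ring_hom (subring_of_complex K) complex_ring \<inter> extensional K"

definition has_signature :: "complex set \<Rightarrow> nat \<Rightarrow> nat \<Rightarrow> bool" where
  "has_signature K r1 r2 \<longleftrightarrow>
     card {\<sigma> \<in> embeddings K. \<sigma> ` K \<subseteq> \<real>} = r1 \<and>
     card {\<sigma> \<in> embeddings K. \<not> \<sigma> ` K \<subseteq> \<real>} = 2 * r2"

definition galois_closure :: "complex set \<Rightarrow> complex set" where
  "galois_closure K = generate_field complex_ring (\<Union>\<sigma>\<in>embeddings K. \<sigma> ` K)"

text \<open>
  Ring automorphisms of a field of characteristic 0 fix the rationals automatically.
\<close>

definition galois_group :: "complex set \<Rightarrow> (complex \<Rightarrow> complex) monoid" where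
  "galois_group L = (BijGroup L)
     \<lparr>carrier := ring_iso (subring_of_complex L) (subring_of_complex L) \<inter> extensional L\<rparr>"

definition Sn_field :: "nat \<Rightarrow> complex set \<Rightarrow> bool" where
  "Sn_field n K \<longleftrightarrow> number_field K \<and> degree_over_Q K = n \<and>
     (\<lambda>\<tau>\<in>carrier (galois_group (galois_closure K)). \<lambda>\<sigma>\<in>embeddings K. compose K \<tau> \<sigma>)
       \<in> iso (galois_group (galois_closure K)) (BijGroup (embeddings K))"


section \<open>Integers, discriminant, ramification\<close>

definition ring_of_integers :: "complex set \<Rightarrow> complex ring" where
  "ring_of_integers K = subring_of_complex {x \<in> K. algebraic_int x}"

definition integral_basis :: "complex set \<Rightarrow> (nat \<Rightarrow> complex) \<Rightarrow> bool" where
  "integral_basis K \<omega> \<longleftrightarrow>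
     bij_betw (\<lambda>a. \<Sum>i<degree_over_Q K. of_int (a i) * \<omega> i)
       ({..<degree_over_Q K} \<rightarrow>\<^sub>E (UNIV :: int set)) (carrier (ring_of_integers K))"

definition discriminant :: "complex set \<Rightarrow> int" where
  "discriminant K = (THE d. \<exists>\<omega> \<sigma>. integral_basis K \<omega> \<and>
     bij_betw \<sigma> {..<degree_over_Q K} (embeddings K) \<and>
     of_int d = (det (mat (degree_over_Q K) (degree_over_Q K) (\<lambda>(i, j). \<sigma> i (\<omega> j))))\<^sup>2)"

definition primes_above :: "complex set \<Rightarrow> nat \<Rightarrow> complex set set" where
  "primes_above K p = {P. primeideal P (ring_of_integers K) \<and> of_nat p \<in> P}"

definition ramification_index :: "complex set \<Rightarrow> nat \<Rightarrow> complex set \<Rightarrow> nat" where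
  "ramification_index K p P =
     (GREATEST e. of_nat p \<in> P [^]\<^bsub>ideals_set (ring_of_integers K)\<^esub> (e :: nat))"

text \<open>
  The subfield of the residue field generated by the empty set is its prime field.
\<close>

definition residue_degree :: "complex set \<Rightarrow> complex set \<Rightarrow> nat" where
  "residue_degree K P = (let k = ring_of_integers K Quot P
     in ring.dim k (generate_field k {}) (carrier k))"

definition unramified :: "complex set \<Rightarrow> nat \<Rightarrow> bool" where
  "unramified K p \<longleftrightarrow> (\<forall>P\<in>primes_above K p. ramification_index K p P = 1)"

text \<open>
  The multiset of pairs (ramification index, residue degree) of the primes above \<open>p\<close>.
\<close>

definition splitting_type :: "complex set \<Rightarrow> nat \<Rightarrow> (nat \<times> nat) multiset" where
  "splitting_type K p = image_mset (\<lambda>P. (ramification_index K p P, residue_degree K P))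
     (mset_set (primes_above K p))"

definition ramified_splitting_types :: "nat \<Rightarrow> (nat \<times> nat) multiset set" where
  "ramified_splitting_types n =
     {splitting_type K p | K p. Sn_field n K \<and> prime p \<and> \<not> unramified K p}"


section \<open>Conjugacy classes and Frobenius elements\<close>

definition conj_classes :: "nat \<Rightarrow> (nat \<Rightarrow> nat) set set" where
  "conj_classes n = orbits (sym_group n) (carrier (sym_group n))
     (\<lambda>g. \<lambda>h\<in>carrier (sym_group n). g \<otimes>\<^bsub>sym_group n\<^esub> h \<otimes>\<^bsub>sym_group n\<^esub> inv\<^bsub>sym_group n\<^esub> g)"

definition is_frobenius :: "complex set \<Rightarrow> nat \<Rightarrow> (complex \<Rightarrow> complex) \<Rightarrow> bool" where
  "is_frobenius L p \<tau> \<longleftrightarrow> \<tau> \<in> carrier (galois_group L) \<and>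
     (\<exists>P\<in>primes_above L p. \<forall>x\<in>carrier (ring_of_integers L). \<tau> x - x ^ p \<in> P)"

text \<open>
  \<open>Frob\<^sub>p \<in> C\<close>.  The identification of the Galois group with \<open>S\<^sub>n\<close> is by a numbering \<open>e\<close> of the
  embeddings of \<open>K\<close>.  For \<open>C\<close> closed under conjugation, neither the choice of the numbering nor
  that of the Frobenius element matters.
\<close>

definition frob_in :: "nat \<Rightarrow> complex set \<Rightarrow> nat \<Rightarrow> (nat \<Rightarrow> nat) set \<Rightarrow> bool" where
  "frob_in n K p C \<longleftrightarrow> (\<exists>\<tau> e \<pi>. is_frobenius (galois_closure K) p \<tau> \<and>
     bij_betw e {1..n} (embeddings K) \<and> \<pi> \<in> C \<and>
     (\<forall>i\<in>{1..n}. compose K \<tau> (e i) = e (\<pi> i)))"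

definition least_frob_prime :: "nat \<Rightarrow> (nat \<Rightarrow> nat) set \<Rightarrow> complex set \<Rightarrow> nat" where
  "least_frob_prime n C K = (LEAST p. prime p \<and> unramified K p \<and> frob_in n K p C)"

definition outside_alt :: "nat \<Rightarrow> (nat \<Rightarrow> nat) set" where
  "outside_alt n = \<Union>{C \<in> conj_classes n. \<not> C \<subseteq> carrier (alt_group n)}"


section \<open>Counting conjectures\<close>

definition Sn_fields :: "nat \<Rightarrow> nat \<Rightarrow> nat \<Rightarrow> real \<Rightarrow> complex set set" where
  "Sn_fields n r1 r2 X =
     {K. Sn_field n K \<and> has_signature K r1 r2 \<and> real_of_int \<bar>discriminant K\<bar> < X}"

definition Sn_classes :: "nat \<Rightarrow> nat \<Rightarrow> nat \<Rightarrow> real \<Rightarrow> complex set set set" where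
  "Sn_classes n r1 r2 X = iso_classes (Sn_fields n r1 r2 X)"

text \<open>
  \<open>Ram j\<close> stands for the \<open>j\<close>-th ramified splitting type in an enumeration \<open>r 1, \<dots>, r w\<close>.
\<close>

datatype local_cond = Unram "(nat \<Rightarrow> nat) set" | Ram nat

fun valid_cond :: "nat \<Rightarrow> nat \<Rightarrow> local_cond \<Rightarrow> bool" where
  "valid_cond n w (Unram C) \<longleftrightarrow> C \<in> conj_classes n"
| "valid_cond n w (Ram j) \<longleftrightarrow> j \<in> {1..w}"

fun satisfies_cond ::
  "nat \<Rightarrow> (nat \<Rightarrow> (nat \<times> nat) multiset) \<Rightarrow> complex set \<Rightarrow> nat \<Rightarrow> local_cond \<Rightarrow> bool" where
  "satisfies_cond n r K p (Unram C) \<longleftrightarrow> unramified K p \<and> frob_in n K p C"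
| "satisfies_cond n r K p (Ram j) \<longleftrightarrow> \<not> unramified K p \<and> splitting_type K p = r j"

fun cond_density ::
  "nat \<Rightarrow> (nat \<Rightarrow> nat \<Rightarrow> real) \<Rightarrow> (nat \<Rightarrow> real) \<Rightarrow> nat \<Rightarrow> local_cond \<Rightarrow> real" where
  "cond_density n c f p (Unram C) = real (card C) / (real (Coset.order (sym_group n)) * (1 + f p))"
| "cond_density n c f p (Ram j) = c j p / (1 + f p)"

definition Sn_classes_cond :: "nat \<Rightarrow> nat \<Rightarrow> nat \<Rightarrow> (nat \<Rightarrow> (nat \<times> nat) multiset) \<Rightarrow>
    nat set \<Rightarrow> (nat \<Rightarrow> local_cond) \<Rightarrow> real \<Rightarrow> complex set set set" where
  "Sn_classes_cond n r1 r2 r S LC X =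
     iso_classes {K \<in> Sn_fields n r1 r2 X. \<forall>p\<in>S. satisfies_cond n r K p (LC p)}"

text \<open>
  A set of local conditions is given by its finite set \<open>S\<close> of primes and the condition \<open>LC p\<close>
  at each \<open>p \<in> S\<close>.  The constant \<open>B\<close> bounds both error terms; it is quantified before \<open>X\<close>, \<open>S\<close> and
  \<open>LC\<close>, which is the required uniformity.  As \<open>card\<close> is 0 on infinite sets, the finiteness implicit
  in the count is stated separately.
\<close>

definition counting_conjectures :: "nat \<Rightarrow> nat \<Rightarrow> nat \<Rightarrow> (nat \<Rightarrow> real) \<Rightarrow> bool" where
  "counting_conjectures n r1 r2 f \<longleftrightarrow>
     (\<exists>w (r :: nat \<Rightarrow> (nat \<times> nat) multiset) (c :: nat \<Rightarrow> nat \<Rightarrow> real).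
        bij_betw r {1..w} (ramified_splitting_types n) \<and>
        (\<forall>j\<in>{1..w}. \<forall>p. prime p \<longrightarrow> 0 < c j p) \<and>
        (\<forall>p. prime p \<longrightarrow> (\<Sum>j=1..w. c j p) = f p) \<and>
        (\<exists>M. \<forall>p. prime p \<longrightarrow> f p \<le> M / real p) \<and>
        (\<exists>A \<delta> \<gamma> B :: real. 0 < A \<and> 0 < \<delta> \<and> \<delta> < 1 \<and> 0 < \<gamma> \<and>
           (\<forall>X\<ge>1. finite (Sn_classes n r1 r2 X) \<and>
              \<bar>real (card (Sn_classes n r1 r2 X)) - A * X\<bar> \<le> B * X powr \<delta>) \<and>
           (\<forall>X\<ge>1. \<forall>S LC. finite S \<and> (\<forall>p\<in>S. prime p \<and> valid_cond n w (LC p)) \<longrightarrow>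
              \<bar>real (card (Sn_classes_cond n r1 r2 r S LC X))
                - (\<Prod>p\<in>S. cond_density n c f p (LC p)) * A * X\<bar>
              \<le> B * real (\<Prod>p\<in>S. p) powr \<gamma> * X powr \<delta>)))"


section \<open>Quadratic resolvent conjecture\<close>

definition quadratic_resolvent :: "complex set \<Rightarrow> complex set" where
  "quadratic_resolvent K = generate_field complex_ring {csqrt (of_int (discriminant K))}"

definition QR :: "nat \<Rightarrow> real \<Rightarrow> complex set \<Rightarrow> complex set set set" where
  "QR n X F = iso_classes
     {K. Sn_field n K \<and> quadratic_resolvent K = F \<and> real_of_int \<bar>discriminant K\<bar> \<le> X}"

definition quadratic_resolvent_conjecture :: "nat \<Rightarrow> real \<Rightarrow> bool" where
  "quadratic_resolvent_conjecture n \<beta> \<longleftrightarrow> 0 < \<beta> \<and> \<beta> < 1 / 2 \<and>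
     (\<exists>B. \<forall>F. number_field F \<and> degree_over_Q F = 2 \<longrightarrow>
        (\<forall>X\<ge>1. finite (QR n X F) \<and>
           real (card (QR n X F)) \<le> B * (X / real_of_int \<bar>discriminant F\<bar>) powr (1 - \<beta>)))"

end

(* N_{K,C'} is the least prime whose Frobenius is odd.  For a prime q with q^q well below a power of X,
  the local densities give the proportion of fields with N_{K,C'} = q, and summing q times this
  proportion up to about sqrt(log X) yields the series.  An odd prime p with (d_K/p) = -1 has odd
  Frobenius, so the remaining fields are controlled by the least inert prime of Q(sqrt d_K): by the
  large sieve only few quadratic discriminants D <= X have no inert prime up to a power of log X, and
  for those N_{K,C'} is at most |D| X^eps by periodicity and at most X^(1/2+eps) by the variance of
  character sums over short windows.  Weighting the latter bounds with |QR_n(X,F)| saves a power of X. *)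
theory Submission
 imports
  Defs
  "HOL-Number_Theory.Number_Theory"
  "HOL-Real_Asymp.Real_Asymp"
  "HOL-Analysis.Convex"
  "HOL-Analysis.Summation_Tests"
  "HOL-Computational_Algebra.Fundamental_Theorem_Algebra"
  "HOL-Computational_Algebra.Squarefree"
  "Jordan_Normal_Form.Char_Poly"
begin

text \<open>Let D be the squarefree part of |d_K|. Up to constants, the resolvent count is
  (X/D)^(1-\<beta>), and N is at most D X^\<epsilon> or X^(1/2+\<epsilon>). The two products meet at
  D = sqrt X, where both are X^(1-\<beta>/2+\<epsilon>). Summing this over D is affordable because
  only X^(6/(A-2)) values of D occur, up to logarithms; this fixes the power A of log X up to which
  small primes are tested. For N between sqrt(log X) and (log X)^A the proportion of fields without
  an odd Frobenius at the primes up to sqrt(log X) decays faster than any power of log X, which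
  outweighs N itself. The obstacle is the square part m^2 of d_K: an inert prime of Q(sqrt d_K) that
  divides m may ramify in K, so the prime sought must avoid m. Inert primes dividing m are therefore
  sieved out of the character sums; their product is at most m, and m^2 D < X keeps the cost within
  a small power of X. On the algebraic side a square root of d_K is the determinant of an integral
  basis under the embeddings, and an automorphism multiplies it by the sign of its permutation. This
  makes parity of Frobenius visible modulo p.\<close>

section \<open>Chebyshev's lower bound for the number of primes\<close>

text \<open>Leibniz's harmonic triangle: 1/((n+1) C(n,k+1)) = 1/(n C(n-1,k)) - 1/((n+1) C(n,k)).
  Multiplied by the lcm, both terms on the right are integers by induction on k, which gives the
  multiplier \<open>z2 * int m - z1\<close>.\<close>

lemma choose_dvd_Lcm:
 fixes n k :: nat assumes "k \<le> n" shows "Suc n * (n choose k) dvd Lcm {1..Suc n}"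
proof -
 have main: "\<exists>z::int. real_of_int z * (real (Suc n) * real (n choose k)) = real (Lcm {1..Suc n})"
  if "k \<le> n" for n using that
 proof (induction k arbitrary: n)
  case 0
  have "Suc n dvd Lcm {1..Suc n}" by (rule dvd_Lcm) auto
  then obtain m where "Lcm {1..Suc n} = Suc n * m" by (elim dvdE)
  then have "real_of_int (int m) * (real (Suc n) * real (n choose 0)) = real (Lcm {1..Suc n})"
   by (simp only: of_nat_mult binomial_n_0) (simp only: of_int_of_nat_eq of_nat_1 mult_1_right mult.commute)
  then show ?case by blast
 next
  case (Suc k)
  then obtain n' where n': "n = Suc n'" by (cases n) auto
  from Suc.IH[of n] Suc.prems obtain z1 :: int where
   z1: "z1 * (real (Suc n) * real (n choose k)) = real (Lcm {1..Suc n})" by auto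
  from Suc.IH[of n'] Suc.prems n' obtain z2 :: int where
   z2: "z2 * (real (Suc n') * real (n' choose k)) = real (Lcm {1..Suc n'})" by auto
  have "Lcm {1..Suc n'} dvd Lcm {1..Suc n}" using n' by (intro Lcm_subset) auto
  then obtain m where "Lcm {1..Suc n} = Lcm {1..Suc n'} * m" by (elim dvdE)
  then have m: "real (Lcm {1..Suc n}) = real (Lcm {1..Suc n'}) * real m" by (simp only: of_nat_mult)
  define L where "L = real (Lcm {1..Suc n})"
  define b where "b = real (n choose k)"
  define b' where "b' = real (n' choose k)"
  define c where "c = real (n choose Suc k)"
  have "Suc k * (n choose Suc k) = (n - k) * (n choose k)"
   using binomial_absorption[of k n] binomial_absorb_comp[of n k] n' by simp
  then have c1: "real (Suc k) * c = (real n - real k) * b"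
   using Suc.prems unfolding b_def c_def of_nat_mult[symmetric] by (simp flip: of_nat_diff of_nat_mult)
  have "(n - k) * (n choose k) = n * (n' choose k)" using binomial_absorb_comp[of n k] n' by simp
  then have c2: "(real n - real k) * b = real n * b'"
   using Suc.prems unfolding b_def b'_def by (simp flip: of_nat_diff of_nat_mult)
  have e1: "z1 * (real (Suc n) * b) = L" using z1 unfolding L_def b_def .
  have e2: "z2 * real m * (real n * b') = L"
   using z2 n' unfolding L_def b'_def m by (simp add: mult_ac)
  have "real (Suc k) * ((real_of_int z2 * real m - real_of_int z1) * (real (Suc n) * c))
    = (real_of_int z2 * real m - real_of_int z1) * real (Suc n) * (real (Suc k) * c)"
   by (simp only: mult_ac)
  also have "... = real_of_int z2 * real m * (real n * b') * real (Suc n)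
    - real_of_int z1 * (real (Suc n) * b) * (real n - real k)"
   unfolding c1 by (subst c2[symmetric]) (simp only: left_diff_distrib right_diff_distrib mult_ac)
  also have "... = real (Suc k) * L" unfolding e1 e2 by (simp add: algebra_simps)
  finally have "(real_of_int z2 * real m - real_of_int z1) * (real (Suc n) * c) = L" by simp
  then have "real_of_int (z2 * int m - z1) * (real (Suc n) * c) = L" by simp
  then show ?case unfolding L_def c_def by blast
 qed
 from main[OF assms] obtain z :: int where
  "real_of_int z * (real (Suc n) * real (n choose k)) = real (Lcm {1..Suc n})" by auto
 then have "real_of_int (z * int (Suc n * (n choose k))) = real_of_int (int (Lcm {1..Suc n}))"
  by (simp only: of_int_mult of_int_of_nat_eq of_nat_mult)
 then have "z * int (Suc n * (n choose k)) = int (Lcm {1..Suc n})" by (simp only: of_int_eq_iff)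
 then have "int (Suc n * (n choose k)) dvd int (Lcm {1..Suc n})" by (metis dvd_triv_right)
 then show ?thesis by (simp only: int_dvd_int_iff)
qed

text \<open>Every prime power dividing the lcm is at most N: with \<open>e p\<close> the largest
  exponent such that p^(e p) is at most N, the lcm divides the product of these powers over the
  primes up to N.\<close>

lemma Lcm_le_power_primes:
 fixes N :: nat assumes "N > 0" shows "Lcm {1..N} \<le> N ^ card {p. prime p \<and> p \<le> N}"
proof -
 let ?P = "{p. prime p \<and> p \<le> N}"
 define e where "e p = (GREATEST k. p ^ k \<le> N)" for p :: nat
 have fin: "finite ?P" by (rule finite_subset[of _ "{..N}"]) auto
 have e: "p ^ e p \<le> N \<and> (\<forall>k. p ^ k \<le> N --> k \<le> e p)" if "prime p" for p
 proof -
  have bd: "k \<le> N" if "p ^ k \<le> N" for k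
  proof -
   have "k \<le> p ^ k" using prime_ge_2_nat[OF \<open>prime p\<close>] by (rule self_le_ge2_pow)
   from this that show ?thesis by (rule le_trans)
  qed
  have "p ^ 0 \<le> N" using assms by simp
  then show ?thesis unfolding e_def
   using GreatestI_nat[of "\<lambda>k. p ^ k \<le> N" 0 N] Greatest_le_nat[of "\<lambda>k. p ^ k \<le> N" _ N] bd by blast
 qed
 have "k dvd (\<Prod>p\<in>?P. p ^ e p)" if "k \<in> {1..N}" for k
 proof (rule multiplicity_le_imp_dvd)
  show "k \<noteq> 0" using that by auto
  fix p :: nat assume p: "prime p"
  show "multiplicity p k \<le> multiplicity p (\<Prod>p\<in>?P. p ^ e p)"
  proof (cases "p dvd k")
   case True
   have "p ^ multiplicity p k \<le> N" using that
    by (intro order_trans[OF Nat.dvd_imp_le[OF multiplicity_dvd]]) auto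
   then have 1: "multiplicity p k \<le> e p" using e[OF p] by blast
   have "p \<in> ?P" using p True that by (auto dest: dvd_imp_le)
   then have "multiplicity p (\<Prod>p\<in>?P. p ^ e p) = e p"
    by (subst multiplicity_prod_prime_powers) (use fin p in auto)
   then show ?thesis using 1 by simp
  qed (simp add: not_dvd_imp_multiplicity_0)
 qed
 then have "Lcm {1..N} dvd (\<Prod>p\<in>?P. p ^ e p)" by (intro Lcm_least) auto
 moreover have "(\<Prod>p\<in>?P. p ^ e p) > 0" by (intro prod_pos) (auto simp: prime_gt_0_nat)
 ultimately have "Lcm {1..N} \<le> (\<Prod>p\<in>?P. p ^ e p)" by (rule dvd_imp_le)
 also have "... \<le> (\<Prod>p\<in>?P. N)" by (intro prod_mono) (use e in auto)
 finally show ?thesis by simp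
qed

text \<open>With 2n+1 \<le> N \<le> 2n+2, the lcm of 1, ..., 2n+1 lies between C(2n,n), which is at
  least 4^n/(2n), and N to the number of primes. The constant 4 comes from n \<ge> (N-2)/2 and ln 4
  \<ge> 1, half of the main term being given up to absorb ln N.\<close>

lemma primes_count_lower:
 "\<forall>\<^sub>F N in sequentially. real N / (4 * ln (real N)) \<le> real (card {p. prime p \<and> p \<le> N})"
proof -
 have ev: "\<forall>\<^sub>F N in sequentially. real N / 4 + ln (real N) \<le> (real N - 2) / 2 * 1"
  by real_asymp
 from ev eventually_ge_at_top[of 3] show ?thesis
 proof eventually_elim
  case (elim N)
  define n where "n = (N - 1) div 2"
  have N: "N \<le> 2 * n + 2" "2 * n + 1 \<le> N" "n \<ge> 1" using elim(2) unfolding n_def by presburger+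
  have "real N \<le> real (2 * n + 2)" using N by (simp only: of_nat_le_iff)
  with N have n: "n \<ge> 1" "2 * n + 1 \<le> N" "real n \<ge> (real N - 2) / 2" by auto
  let ?P = "{p. prime p \<and> p \<le> N}"
  have "(2 * n) choose n \<le> Suc (2*n) * ((2 * n) choose n)" by simp
  also have "... \<le> Lcm {1..Suc (2*n)}"
   by (rule dvd_imp_le[OF choose_dvd_Lcm]) (auto intro!: Nat.gr0I simp: Lcm_0_iff simp del: Lcm_nat_insert)
  also have "... \<le> Suc (2*n) ^ card {p. prime p \<and> p \<le> Suc (2*n)}" by (rule Lcm_le_power_primes) simp
  also have "... \<le> N ^ card {p. prime p \<and> p \<le> Suc (2*n)}" using n by (intro power_mono) auto
  also have "... \<le> N ^ card ?P" using n elim(2)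
   by (intro power_increasing card_mono) (auto intro: finite_subset[of _ "{..N}"])
  finally have "real ((2 * n) choose n) \<le> real (N ^ card ?P)" by (simp only: of_nat_le_iff)
  moreover have "4 ^ n / (2 * real n) \<le> real ((2 * n) choose n)"
   using n central_binomial_lower_bound[of n] by simp
  ultimately have "4 ^ n / (2 * real n) \<le> real N ^ card ?P" by (simp only: of_nat_power)
  then have "ln (4 ^ n / (2 * real n)) \<le> ln (real N ^ card ?P)"
   using n elim(2) by (subst ln_le_cancel_iff) auto
  then have "real n * ln 4 - ln (2 * real n) \<le> card ?P * ln (real N)"
   using n elim(2) by (simp add: ln_div ln_realpow)
  moreover have "ln (2 * real n) \<le> ln (real N)" using n by (subst ln_le_cancel_iff) auto
  moreover have "1 \<le> ln (4 :: real)" using exp_le by (subst ln_ge_iff) auto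
  then have "(real N - 2) / 2 * 1 \<le> real n * ln 4" using n(1,3) by (intro mult_mono) simp_all
  ultimately have *: "real N / 4 \<le> card ?P * ln (real N)" using elim(1) by linarith
  have "ln (real N) > 0" using elim(2) by simp
  with * show ?case by (simp add: divide_le_eq mult.commute mult.left_commute)
 qed
qed

lemma cong_int_iff_mod: "[x = y] (mod m) \<longleftrightarrow> x mod m = y mod m" for x y m :: int
 by (rule unique_euclidean_semiring_class.cong_def)

lemma coprime_prime_intI: "prime p ==> \<not> int p dvd a ==> coprime a (int p)"
 using prime_imp_coprime[of "int p" a] by (subst coprime_commute) simp

section \<open>Real characters, the large sieve and least inert primes\<close>

section \<open>Sums of periodic functions\<close>

lemma sum_affine_mod:
 fixes F :: "int => 'a::comm_monoid_add"
 assumes m: "m > 0" and per: "\<And>x. F (x mod m) = F x" and co: "coprime a m"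
 shows "(\<Sum>x\<in>{0..<m}. F (a * x + b)) = (\<Sum>x\<in>{0..<m}. F x)"
proof -
 let ?f = "\<lambda>x. (a * x + b) mod m"
 have inj: "inj_on ?f {0..<m}"
 proof (rule inj_onI)
  fix x y assume *: "x \<in> {0..<m}" "y \<in> {0..<m}" "?f x = ?f y"
  have "[a * x = a * y] (mod m)" using *(3) by (metis cong_add_rcancel cong_int_iff_mod)
  then have "[x = y] (mod m)" using co by (simp add: cong_mult_lcancel)
  then show "x = y" using * by (simp add: cong_int_iff_mod)
 qed
 have "?f ` {0..<m} \<subseteq> {0..<m}" using m by auto
 then have "bij_betw ?f {0..<m} {0..<m}"
  using inj endo_inj_surj[of "{0..<m}" ?f] by (auto simp: bij_betw_def)
 from sum.reindex_bij_betw[OF this, of F] show ?thesis by (simp add: per)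
qed

lemma sum_crt_two:
 fixes F G :: "int => 'a::comm_semiring_1" assumes m: "m > 0" "n > 0" and co: "coprime m n"
  and F: "\<And>x. F (x mod m) = F x" and G: "\<And>x. G (x mod n) = G x"
 shows "(\<Sum>x\<in>{0..<m*n}. F x * G x) = (\<Sum>x\<in>{0..<m}. F x) * (\<Sum>x\<in>{0..<n}. G x)"
proof -
 let ?f = "\<lambda>x. (x mod m, x mod n)"
 have inj: "inj_on ?f {0..<m*n}"
 proof (rule inj_onI)
  fix x y assume *: "x \<in> {0..<m*n}" "y \<in> {0..<m*n}" "?f x = ?f y"
  have "[x = y] (mod m)" "[x = y] (mod n)" using *(3) by (auto simp: cong_int_iff_mod)
  then have "[x = y] (mod m * n)" using co by (simp add: coprime_cong_mult)
  then show "x = y" using * by (simp add: cong_int_iff_mod)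
 qed
 have sub: "?f ` {0..<m*n} \<subseteq> {0..<m} \<times> {0..<n}" using m by auto
 have "card (?f ` {0..<m*n}) = card ({0..<m} \<times> {0..<n})"
  using m by (subst card_image[OF inj]) (simp add: card_cartesian_product nat_mult_distrib)
 then have "?f ` {0..<m*n} = {0..<m} \<times> {0..<n}" using sub by (intro card_subset_eq) auto
 then have "bij_betw ?f {0..<m*n} ({0..<m} \<times> {0..<n})" using inj by (simp add: bij_betw_def)
 from sum.reindex_bij_betw[OF this, of "\<lambda>(u, v). F u * G v"]
 show ?thesis by (simp add: F G sum_product sum.cartesian_product)
qed

text \<open>The periodicity of the product is carried along in the induction, since the two-modulus
  case is applied to one factor and to the product of the others.\<close>

lemma sum_crt_prod:
 fixes F :: "'i => int => 'a::comm_semiring_1" assumes "finite I" "\<And>i. i \<in> I ==> m i > 0"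
  "\<And>i j. i \<in> I ==> j \<in> I ==> i \<noteq> j ==> coprime (m i) (m j)"
  "\<And>i x. i \<in> I ==> F i (x mod m i) = F i x"
 shows "(\<Sum>x\<in>{0..<(\<Prod>i\<in>I. m i)}. \<Prod>i\<in>I. F i x) = (\<Prod>i\<in>I. \<Sum>x\<in>{0..<m i}. F i x)
  \<and> (\<forall>x. (\<Prod>i\<in>I. F i (x mod (\<Prod>i\<in>I. m i))) = (\<Prod>i\<in>I. F i x))"
 using assms
proof (induction I rule: finite_induct)
 case empty
 have "{0..<1::int} = {0}" by auto
 then show ?case by simp
next
 case (insert i I)
 have IH: "(\<Sum>x\<in>{0..<(\<Prod>i\<in>I. m i)}. \<Prod>i\<in>I. F i x) = (\<Prod>i\<in>I. \<Sum>x\<in>{0..<m i}. F i x)"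
  "\<And>x. (\<Prod>i\<in>I. F i (x mod (\<Prod>i\<in>I. m i))) = (\<Prod>i\<in>I. F i x)"
  using insert by auto
 have pos: "(\<Prod>i\<in>I. m i) > 0" using insert.prems by (intro prod_pos) auto
 have co: "coprime (m i) (\<Prod>i\<in>I. m i)"
  using insert.prems(2)[of i] insert.hyps by (intro prod_coprime_right) auto
 have "(\<Sum>x\<in>{0..<m i * (\<Prod>i\<in>I. m i)}. F i x * (\<Prod>i\<in>I. F i x))
   = (\<Sum>x\<in>{0..<m i}. F i x) * (\<Sum>x\<in>{0..<(\<Prod>i\<in>I. m i)}. \<Prod>i\<in>I. F i x)"
  by (rule sum_crt_two) (use insert.prems pos co IH(2) in auto)
 moreover have "(\<Prod>j\<in>insert i I. F j (x mod (\<Prod>j\<in>insert i I. m j))) = (\<Prod>j\<in>insert i I. F j x)" for x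
 proof -
  have "F i (x mod (m i * (\<Prod>i\<in>I. m i))) = F i x"
   using insert.prems(3)[of i "x mod (m i * (\<Prod>i\<in>I. m i))"] insert.prems(3)[of i x]
   by (simp add: mod_mult2_eq mod_mod_cancel)
  moreover have "(\<Prod>j\<in>I. F j (x mod (m i * (\<Prod>i\<in>I. m i)))) = (\<Prod>j\<in>I. F j x)"
   using IH(2)[of "x mod (m i * (\<Prod>i\<in>I. m i))"] IH(2)[of x] by (simp add: mod_mod_cancel)
  ultimately show ?thesis using insert.hyps by simp
 qed
 ultimately show ?case using insert.hyps IH(1) by simp
qed

text \<open>Complete periods cancel and fewer than m terms of size at most 1 remain. The bound is
  linear in the modulus, without a saving of Polya-Vinogradov type.\<close>

lemma periodic_sum_bound:
 fixes F :: "int => int"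
 assumes m: "m > 0" and per: "\<And>x. F (x mod m) = F x" and z: "(\<Sum>x\<in>{0..<m}. F x) = 0"
  and bd: "\<And>x. \<bar>F x\<bar> \<le> 1"
 shows "\<bar>\<Sum>x\<in>{0..<int N}. F x\<bar> \<le> m"
proof (induction N rule: less_induct)
 case (less N)
 show ?case
 proof (cases "int N < m")
  case True
  have "\<bar>\<Sum>x\<in>{0..<int N}. F x\<bar> \<le> (\<Sum>x\<in>{0..<int N}. \<bar>F x\<bar>)" by (rule sum_abs)
  also have "... \<le> (\<Sum>x\<in>{0..<int N}. 1)" by (intro sum_mono bd)
  finally show ?thesis using True by simp
 next
  case False
  define N' where "N' = nat (int N - m)"
  have N': "int N = int N' + m" "N' < N" using False m unfolding N'_def by auto
  have "{0..<int N} = {0..<m} \<union> {m..<int N}" using False m by auto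
  then have "(\<Sum>x\<in>{0..<int N}. F x) = (\<Sum>x\<in>{0..<m}. F x) + (\<Sum>x\<in>{m..<int N}. F x)"
   by (simp add: sum.union_disjoint)
  also have "(\<Sum>x\<in>{m..<int N}. F x) = (\<Sum>x\<in>{0..<int N'}. F (x + m))"
   by (rule sum.reindex_bij_witness[of _ "\<lambda>x. x + m" "\<lambda>x. x - m"]) (use N' in auto)
  also have "... = (\<Sum>x\<in>{0..<int N'}. F x)"
  proof (rule sum.cong)
   fix x show "F (x + m) = F x" using per[of "x + m"] per[of x] by simp
  qed simp
  finally show ?thesis using less.IH[OF N'(2)] z by simp
 qed
qed

section \<open>The Legendre symbol\<close>

lemma Legendre_values: "Legendre a p \<in> {-1, 0, 1}" by (auto simp: Legendre_def)

lemma Legendre_abs_le: "\<bar>Legendre a p\<bar> \<le> 1" by (auto simp: Legendre_def)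

lemma Legendre_eq_0_iff: "Legendre a p = 0 \<longleftrightarrow> p dvd a"
 by (auto simp: Legendre_def cong_0_iff)

lemma Legendre_cong: "[a = b] (mod p) ==> Legendre a p = Legendre b p"
proof -
 assume ab: "[a = b] (mod p)"
 have 1: "[a = 0] (mod p) \<longleftrightarrow> [b = 0] (mod p)"
  using ab cong_trans[OF cong_sym[OF ab], of 0] cong_trans[OF ab, of 0] by blast
 have "[y\<^sup>2 = a] (mod p) \<longleftrightarrow> [y\<^sup>2 = b] (mod p)" for y
  using cong_trans[OF _ ab, of "y\<^sup>2"] cong_trans[OF _ cong_sym[OF ab], of "y\<^sup>2"] by blast
 then show ?thesis using 1 by (simp add: Legendre_def QuadRes_def)
qed

lemma Legendre_mod: "Legendre (a mod p) p = Legendre a p" by (rule Legendre_cong) simp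

text \<open>For p > 2 the values -1, 0, 1 are distinct modulo p, so Euler's criterion determines the
  symbol and not only its residue.\<close>

lemma Legendre_eqI:
 assumes "prime p" "2 < p" "[Legendre a (int p) = x] (mod int p)" "x \<in> {-1, 0, 1}"
 shows "Legendre a (int p) = x"
proof (rule ccontr)
 assume ne: "Legendre a (int p) \<noteq> x"
 have "int p dvd Legendre a (int p) - x" using assms(3) by (simp add: cong_iff_dvd_diff)
 then have "int p \<le> \<bar>Legendre a (int p) - x\<bar>" using ne
  by (metis abs_dvd_iff abs_ge_zero dvd_abs_iff eq_iff_diff_eq_0 not_less zdvd_imp_le zero_less_abs_iff)
 also have "... \<le> 2" using Legendre_values[of a "int p"] assms(4) by auto
 finally show False using assms(2) by simp
qed

lemma Legendre_mult: assumes "prime p" "2 < p"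
 shows "Legendre (a * b) (int p) = Legendre a (int p) * Legendre b (int p)"
proof (rule Legendre_eqI[OF assms])
 have "[Legendre (a * b) (int p) = (a * b) ^ ((p - 1) div 2)] (mod int p)"
  by (rule euler_criterion[OF assms])
 moreover have "[Legendre a (int p) * Legendre b (int p) = a ^ ((p - 1) div 2) * b ^ ((p - 1) div 2)] (mod int p)"
  by (intro cong_mult euler_criterion[OF assms])
 ultimately show "[Legendre (a * b) (int p) = Legendre a (int p) * Legendre b (int p)] (mod int p)"
  by (metis cong_sym cong_trans power_mult_distrib)
 show "Legendre a (int p) * Legendre b (int p) \<in> {- 1, 0, 1}"
  using Legendre_values[of a "int p"] Legendre_values[of b "int p"] by auto
qed

lemma Legendre_1: "prime p ==> Legendre 1 (int p) = 1"
 using prime_gt_1_nat[of p] by (auto simp: Legendre_def cong_0_iff QuadRes_def intro!: exI[of _ 1])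

lemma Legendre_prod: assumes "prime p" "2 < p"
 shows "Legendre (\<Prod>x\<in>A. f x) (int p) = (\<Prod>x\<in>A. Legendre (f x) (int p))"
 by (induction A rule: infinite_finite_induct)
  (simp_all add: Legendre_mult[OF assms] Legendre_1[OF assms(1)])

text \<open>A primitive root has order p - 1, so its power with exponent (p-1)/2 is not 1.\<close>

lemma ex_nonresidue: assumes "prime p" "2 < p" shows "\<exists>g. Legendre g (int p) = -1"
proof -
 from prime_primitive_root_exists[of p] assms obtain g where g: "residue_primroot p g"
  using prime_gt_1_nat by auto
 have co: "coprime p g" "ord p g = p - 1"
  using g assms by (auto simp: residue_primroot_def totient_prime)
 have "\<not> [g ^ ((p - 1) div 2) = 1] (mod p)"
 proof
  assume "[g ^ ((p - 1) div 2) = 1] (mod p)"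
  then have "p - 1 dvd (p - 1) div 2" using co ord_divides by metis
  then show False using assms(2) by (auto dest!: dvd_imp_le)
 qed
 then have ne: "\<not> [int g ^ ((p - 1) div 2) = 1] (mod int p)"
  using cong_int_iff[of "g ^ ((p - 1) div 2)" 1 p] by simp
 have "Legendre (int g) (int p) \<noteq> 1"
 proof
  assume "Legendre (int g) (int p) = 1"
  then have "[1 = int g ^ ((p - 1) div 2)] (mod int p)"
   using euler_criterion[OF assms, of "int g"] by simp
  from cong_sym[OF this] ne show False by blast
 qed
 moreover have "\<not> p dvd g"
 proof
  assume "p dvd g"
  then have "p dvd gcd p g" by simp
  then show False using co(1) assms(2) by simp
 qed
 then have "Legendre (int g) (int p) \<noteq> 0" unfolding Legendre_eq_0_iff int_dvd_int_iff .
 ultimately show ?thesis using Legendre_values[of "int g" "int p"] by auto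
qed

text \<open>Multiplication by a nonresidue permutes the residues and changes the sign of the
  sum.\<close>

lemma Legendre_sum_0: assumes "prime p" "2 < p"
 shows "(\<Sum>x\<in>{0..<int p}. Legendre x (int p)) = 0"
proof -
 obtain g where g: "Legendre g (int p) = -1" using ex_nonresidue[OF assms] by auto
 have "\<not> int p dvd g" using g Legendre_eq_0_iff[of g "int p"] by auto
 then have co: "coprime g (int p)" using assms(1) by (intro coprime_prime_intI)
 have "(\<Sum>x\<in>{0..<int p}. Legendre (g * x + 0) (int p)) = (\<Sum>x\<in>{0..<int p}. Legendre x (int p))"
  by (rule sum_affine_mod) (use assms co in \<open>auto simp: Legendre_mod\<close>)
 then show ?thesis by (simp add: Legendre_mult[OF assms] g sum_negf)
qed

text \<open>The correlation c(h) is the same for all h prime to p, by the substitution x -> h x, and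
  the sum of c(h) over all h vanishes because each inner sum does. As 0 \<le> c(0) \<le> p - 1, this
  common value lies between -1 and 0.\<close>

lemma Legendre_correlation: assumes "prime p" "2 < p"
 shows "\<bar>\<Sum>x\<in>{0..<int p}. Legendre x (int p) * Legendre (x + h) (int p)\<bar> \<le> (if int p dvd h then int p else 1)"
proof -
 define c where "c h = (\<Sum>x\<in>{0..<int p}. Legendre x (int p) * Legendre (x + h) (int p))" for h
 have p0: "int p > 0" using assms by simp
 have dil: "c h = c 1" if "\<not> int p dvd h" for h
 proof -
  have co: "coprime h (int p)" using that assms(1) by (intro coprime_prime_intI)
  have h1: "Legendre h (int p) * Legendre h (int p) = 1"
   using Legendre_values[of h "int p"] that by (auto simp: Legendre_eq_0_iff)
  have "Legendre (x mod int p + h) (int p) = Legendre (x + h) (int p)" for x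
   by (rule Legendre_cong) (simp add: cong_int_iff_mod mod_add_left_eq)
  then have per: "Legendre (x mod int p) (int p) * Legendre (x mod int p + h) (int p)
    = Legendre x (int p) * Legendre (x + h) (int p)" for x by (simp add: Legendre_mod)
  have "c h = (\<Sum>x\<in>{0..<int p}. Legendre (h * x + 0) (int p) * Legendre (h * x + 0 + h) (int p))"
   unfolding c_def
   by (rule sum_affine_mod[where F = "\<lambda>x. Legendre x (int p) * Legendre (x + h) (int p)"
      and b = 0, OF p0 per co, symmetric])
  also have "... = (\<Sum>x\<in>{0..<int p}. (Legendre h (int p) * Legendre h (int p)) * (Legendre x (int p) * Legendre (x + 1) (int p)))"
  proof (rule sum.cong)
   fix x
   have "h * x + 0 + h = h * (x + 1)" by (simp add: algebra_simps)
   then show "Legendre (h * x + 0) (int p) * Legendre (h * x + 0 + h) (int p)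
    = (Legendre h (int p) * Legendre h (int p)) * (Legendre x (int p) * Legendre (x + 1) (int p))"
    by (simp only: Legendre_mult[OF assms] add_0_right mult_ac)
  qed simp
  finally show ?thesis unfolding h1 c_def by simp
 qed
 have in0: "(\<Sum>h\<in>{0..<int p}. Legendre (x + h) (int p)) = 0" for x
  using sum_affine_mod[of "int p" "\<lambda>y. Legendre y (int p)" 1 x] p0 Legendre_sum_0[OF assms]
  by (simp add: Legendre_mod add.commute)
 have "(\<Sum>h\<in>{0..<int p}. c h) = (\<Sum>x\<in>{0..<int p}. Legendre x (int p) * (\<Sum>h\<in>{0..<int p}. Legendre (x + h) (int p)))"
  unfolding c_def by (subst sum.swap) (simp add: sum_distrib_left)
 then have sum0: "(\<Sum>h\<in>{0..<int p}. c h) = 0" unfolding in0 by simp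
 have "{0..<int p} = insert 0 {1..<int p}" using p0 by auto
 then have "(\<Sum>h\<in>{0..<int p}. c h) = c 0 + (\<Sum>h\<in>{1..<int p}. c h)" by simp
 also have "(\<Sum>h\<in>{1..<int p}. c h) = (\<Sum>h\<in>{1..<int p}. c 1)"
  by (intro sum.cong dil refl) (auto dest: zdvd_imp_le)
 finally have "c 0 = - ((int p - 1) * c 1)" using sum0 p0 by (simp add: of_nat_diff)
 moreover have "c 0 \<le> int p - 1"
 proof -
  have "c 0 = (\<Sum>x\<in>insert 0 {1..<int p}. Legendre x (int p) * Legendre x (int p))"
   unfolding c_def \<open>{0..<int p} = insert 0 {1..<int p}\<close> by simp
  also have "... = (\<Sum>x\<in>{1..<int p}. Legendre x (int p) * Legendre x (int p))"
   by (simp add: Legendre_eq_0_iff)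
  also have "... \<le> (\<Sum>x\<in>{1..<int p}. 1)"
  proof (rule sum_mono)
   fix x show "Legendre x (int p) * Legendre x (int p) \<le> 1"
    using Legendre_values[of x "int p"] by auto
  qed
  finally show ?thesis using p0 by simp
 qed
 moreover have "c 0 \<ge> 0" unfolding c_def by (auto intro!: sum_nonneg)
 ultimately have "(int p - 1) * (- c 1) \<le> (int p - 1) * 1" "(int p - 1) * (- c 1) \<ge> 0"
  by simp_all
 moreover have pp: "int p - 1 > 0" using assms(2) by simp
 ultimately have "- c 1 \<le> 1" "0 \<le> - c 1"
  using mult_le_cancel_left_pos[OF pp, of "- c 1" 1] zero_le_mult_iff[of "int p - 1" "- c 1"] by auto
 then have "\<bar>c 1\<bar> \<le> 1" by simp
 moreover have "\<bar>c h\<bar> \<le> int p"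
 proof -
  have 1: "\<bar>Legendre x (int p) * Legendre (x + h) (int p)\<bar> \<le> 1" for x
   using Legendre_values[of x "int p"] Legendre_values[of "x + h" "int p"] by auto
  have "\<bar>c h\<bar> \<le> (\<Sum>x\<in>{0..<int p}. \<bar>Legendre x (int p) * Legendre (x + h) (int p)\<bar>)"
   unfolding c_def by (rule sum_abs)
  also have "... \<le> (\<Sum>x\<in>{0..<int p}. 1)" by (intro sum_mono 1)
  finally show ?thesis by simp
 qed
 ultimately show ?thesis using dil[of h] unfolding c_def[symmetric] by simp
qed

section \<open>Real Dirichlet characters attached to square-free numbers\<close>

lemma Legendre_minus_1: assumes "prime p" "2 < p"
 shows "Legendre (-1) (int p) = (if p mod 4 = 1 then 1 else -1)"
proof (rule Legendre_eqI[OF assms])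
 have "odd p" using assms prime_odd_nat by auto
 then have pm: "p mod 4 = 1 \<or> p mod 4 = 3" by presburger
 have "(-1::int) ^ ((p - 1) div 2) = (if p mod 4 = 1 then 1 else -1)"
 proof (cases "p mod 4 = 1")
  case True
  then have "even ((p - 1) div 2)" by presburger
  then show ?thesis using True by simp
 next
  case False
  with pm have "p mod 4 = 3" by simp
  then have "odd ((p - 1) div 2)" by presburger
  then show ?thesis using False by simp
 qed
 then show "[Legendre (-1) (int p) = (if p mod 4 = 1 then 1 else -1)] (mod int p)"
  using euler_criterion[OF assms, of "-1"] by simp
qed auto

text \<open>Gauss's lemma: the doubled residues exceeding h = (p-1)/2 are the 2x with h/2 < x \<le>
  h, so the sign is the parity of h - (h div 2), which depends only on p modulo 8.\<close>

lemma Legendre_2: assumes "prime p" "2 < p"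
 shows "Legendre 2 (int p) = (if p mod 8 = 1 \<or> p mod 8 = 7 then 1 else -1)"
proof -
 have "odd p" using assms prime_odd_nat by auto
 have nd: "\<not> int p dvd 2" using assms(2) zdvd_imp_le[of "int p" 2] by auto
 have G: "GAUSS p 2" using assms nd by unfold_locales (auto simp: cong_0_iff)
 define h where "h = (int p - 1) div 2"
 have ph: "int p = 2 * h + 1" using \<open>odd p\<close> unfolding h_def by presburger
 have E: "GAUSS.E p 2 = (\<lambda>x. 2 * x) ` {h div 2<..h}"
 proof -
  have m: "(2 * x) mod int p = 2 * x" if "x \<in> {0<..h}" for x
   using that ph by (intro mod_pos_pos_trivial) auto
  have C: "GAUSS.C p 2 = (\<lambda>x. 2 * x) ` {0<..h}"
   unfolding GAUSS.C_def[OF G] GAUSS.B_def[OF G] GAUSS.A_def[OF G] h_def[symmetric] image_image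
   using m by (intro image_cong refl) (simp add: mult.commute)
  have "h \<ge> 0" using ph assms(2) by simp
  then show ?thesis unfolding GAUSS.E_def[OF G] C h_def[symmetric] by auto
 qed
 have "card (GAUSS.E p 2) = card {h div 2<..h}"
  unfolding E by (rule card_image) (auto simp: inj_on_def)
 then have cE: "card (GAUSS.E p 2) = nat (h - h div 2)" by simp
 have L: "Legendre 2 (int p) = (-1) ^ nat (h - h div 2)" using GAUSS.gauss_lemma[OF G] cE by simp
 have "p mod 8 = 1 \<or> p mod 8 = 3 \<or> p mod 8 = 5 \<or> p mod 8 = 7" using \<open>odd p\<close> by presburger
 moreover have "even (nat (h - h div 2)) \<longleftrightarrow> p mod 8 = 1 \<or> p mod 8 = 7"
 proof -
  have "h \<ge> 0" using ph assms(2) by simp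
  then have "h - h div 2 \<ge> 0" by presburger
  then have "even (nat (h - h div 2)) \<longleftrightarrow> even (h - h div 2)" by (rule even_nat_iff)
  also have "... \<longleftrightarrow> (2 * h + 1) mod 8 = 1 \<or> (2 * h + 1) mod 8 = 7" by presburger
  also have "... \<longleftrightarrow> p mod 8 = 1 \<or> p mod 8 = 7" unfolding ph[symmetric] by presburger
  finally show ?thesis .
 qed
 ultimately show ?thesis unfolding L by auto
qed

text \<open>On odd arguments \<open>chi4\<close> and \<open>chi8\<close> are the characters of Q(i)
  and Q(sqrt 2), giving (-1/p) and (2/p) at odd primes; even arguments are sent to 0 in
  \<open>char8\<close>.\<close>

definition chi4 :: "int => int" where "chi4 n = (if n mod 4 = 1 then 1 else -1)"
definition chi8 :: "int => int" where "chi8 n = (if n mod 8 = 1 \<or> n mod 8 = 7 then 1 else -1)"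

text \<open>With a and b taken modulo 2 these are the four real characters modulo 8.\<close>

definition char8 :: "nat => nat => int => int" where
 "char8 a b n = (if even n then 0 else chi4 n ^ a * chi8 n ^ b)"

text \<open>The form in which the quadratic symbol of a fixed squarefree integer is periodic in its
  argument: a character of modulus 8 times the product of S.\<close>

definition quad_char :: "nat => nat => nat set => int => int" where
 "quad_char a b S n = char8 a b n * (\<Prod>q\<in>S. Legendre n (int q))"

definition odd_primes :: "nat set => bool" where
 "odd_primes S \<longleftrightarrow> finite S \<and> (\<forall>q\<in>S. prime q \<and> 2 < q)"

lemma chi4_mult: "odd m ==> odd n ==> chi4 (m * n) = chi4 m * chi4 n"
proof -
 assume "odd m" "odd n"
 then have "m mod 4 = 1 \<or> m mod 4 = 3" "n mod 4 = 1 \<or> n mod 4 = 3" by presburger+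
 then show ?thesis unfolding chi4_def by (subst mod_mult_eq[symmetric]) auto
qed

lemma chi8_mult: "odd m ==> odd n ==> chi8 (m * n) = chi8 m * chi8 n"
proof -
 assume "odd m" "odd n"
 then have "m mod 8 = 1 \<or> m mod 8 = 3 \<or> m mod 8 = 5 \<or> m mod 8 = 7"
  "n mod 8 = 1 \<or> n mod 8 = 3 \<or> n mod 8 = 5 \<or> n mod 8 = 7" by presburger+
 moreover have "(m * n) mod 8 = ((m mod 8) * (n mod 8)) mod 8" by (simp add: mod_mult_eq)
 ultimately show ?thesis unfolding chi8_def by (elim disjE) simp_all
qed

lemma char8_mult: "char8 a b (m * n) = char8 a b m * char8 a b n"
 unfolding char8_def by (auto simp: chi4_mult chi8_mult power_mult_distrib mult_ac)

lemma char8_mod: "char8 a b (x mod 8) = char8 a b x"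
proof -
 have "x mod 8 mod 4 = x mod 4" by (rule mod_mod_cancel) simp
 moreover have "even (x mod 8) \<longleftrightarrow> even x" by presburger
 ultimately show ?thesis unfolding char8_def chi4_def chi8_def by simp
qed

lemma char8_values: "char8 a b n \<in> {-1, 0, 1}"
 unfolding char8_def chi4_def chi8_def by (auto simp: uminus_power_if)

lemma char8_sq: "a mod 2 = a' mod 2 ==> b mod 2 = b' mod 2 ==> char8 a b n * char8 a' b' n = char8 0 0 n"
proof -
 assume "a mod 2 = a' mod 2" "b mod 2 = b' mod 2"
 then have "even (a + a')" "even (b + b')" by presburger+
 then have "chi4 n ^ (a + a') = 1" "chi8 n ^ (b + b') = 1" unfolding chi4_def chi8_def by auto
 then show ?thesis unfolding char8_def by (auto simp: power_add mult_ac)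
qed

lemma sum_8: "(\<Sum>x\<in>{0..<8::int}. f x) = f 0 + f 1 + f 2 + f 3 + f 4 + f 5 + f 6 + f 7"
proof -
 have "{0..<8::int} = {0, 1, 2, 3, 4, 5, 6, 7}" by auto
 then show ?thesis by (simp add: add_ac)
qed

lemma char8_sum_0: "odd a \<or> odd b ==> (\<Sum>x\<in>{0..<8}. char8 a b x) = 0"
 unfolding sum_8 by (auto simp: char8_def chi4_def chi8_def uminus_power_if)

lemma quad_char_mult: assumes "odd_primes S"
 shows "quad_char a b S (m * n) = quad_char a b S m * quad_char a b S n"
proof -
 have "(\<Prod>q\<in>S. Legendre (m * n) (int q)) = (\<Prod>q\<in>S. Legendre m (int q) * Legendre n (int q))"
  using assms by (intro prod.cong refl Legendre_mult) (auto simp: odd_primes_def)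
 then show ?thesis unfolding quad_char_def char8_mult prod.distrib by (simp add: mult_ac)
qed

lemma quad_char_values: "quad_char a b S n \<in> {-1, 0, 1}"
proof -
 have "(\<Prod>q\<in>S. Legendre n (int q)) \<in> {-1, 0, 1}"
  by (induction S rule: infinite_finite_induct) (use Legendre_values in \<open>fastforce+\<close>)
 then show ?thesis unfolding quad_char_def using char8_values[of a b n] by auto
qed

lemma quad_char_abs_le: "\<bar>quad_char a b S n\<bar> \<le> 1"
 using quad_char_values[of a b S n] by auto

lemma quad_char_1: "odd_primes S ==> quad_char a b S 1 = 1"
 unfolding quad_char_def char8_def chi4_def chi8_def odd_primes_def by (simp add: Legendre_1)

lemma quad_char_eq_0_iff: assumes "odd_primes S"
 shows "quad_char a b S n = 0 \<longleftrightarrow> even n \<or> (\<exists>q\<in>S. int q dvd n)"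
proof -
 have "char8 a b n = 0 \<longleftrightarrow> even n" unfolding char8_def chi4_def chi8_def by auto
 then show ?thesis using assms unfolding quad_char_def odd_primes_def by (auto simp: Legendre_eq_0_iff)
qed

lemma quad_char_nonneg:
 assumes "odd_primes S" "n > 0" "\<And>p. prime p ==> p dvd n ==> quad_char a b S (int p) \<ge> 0"
 shows "quad_char a b S (int n) \<ge> 0" using assms(2,3)
proof (induction n rule: prime_divisors_induct)
 case (unit x)
 then show ?case by (simp add: quad_char_1[OF assms(1)])
next
 case (factor p x)
 then have "quad_char a b S (int p) \<ge> 0" "quad_char a b S (int x) \<ge> 0" by auto
 then show ?case by (simp add: quad_char_mult[OF assms(1)])
qed simp

lemma quad_char_prod: assumes "odd_primes S"
 shows "quad_char a b S (\<Prod>x\<in>A. f x) = (\<Prod>x\<in>A. quad_char a b S (f x))"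
 by (induction A rule: infinite_finite_induct)
  (simp_all add: quad_char_mult[OF assms] quad_char_1[OF assms])

lemma neg1_mod4: "(-1::int) ^ (k * ((q - 1) div 2)) = (if q mod 4 = 3 then (-1) ^ k else 1)" if "odd q" for q k :: nat
proof (cases "q mod 4 = 3")
 case True
 then have "odd ((q - 1) div 2)" by presburger
 then show ?thesis using True by (simp add: uminus_power_if)
next
 case False
 then have "even ((q - 1) div 2)" using that by presburger
 then show ?thesis using False by simp
qed

text \<open>Quadratic reciprocity with the sign expressed as a character of the varying prime p. The
  case p = q is included, both symbols being 0.\<close>

lemma Legendre_reciprocity: assumes "prime p" "2 < p" "prime q" "2 < q"
 shows "Legendre (int q) (int p) = Legendre (int p) (int q) * (if q mod 4 = 3 then chi4 (int p) else 1)"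
proof (cases "p = q")
 case True
 then have "Legendre (int q) (int p) = 0" "Legendre (int p) (int q) = 0" by (simp_all add: Legendre_eq_0_iff)
 then show ?thesis by simp
next
 case False
 have odd: "odd p" "odd q" using assms prime_odd_nat by auto
 have "\<not> int q dvd int p" using False assms primes_dvd_imp_eq by (auto simp: int_dvd_int_iff)
 then have sq: "Legendre (int p) (int q) * Legendre (int p) (int q) = 1"
  using Legendre_values[of "int p" "int q"] by (auto simp: Legendre_eq_0_iff)
 have e: "(if q mod 4 = 3 then (-1) ^ ((p - 1) div 2) else 1) = (if q mod 4 = 3 then chi4 (int p) else 1)"
 proof -
  have "(-1::int) ^ ((p - 1) div 2) = chi4 (int p)"
  proof (cases "p mod 4 = 1")
   case True
   then have "even ((p - 1) div 2)" "int p mod 4 = 1" by presburger+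
   then show ?thesis by (simp add: chi4_def)
  next
   case False
   then have "odd ((p - 1) div 2)" "int p mod 4 \<noteq> 1" using odd(1) by presburger+
   then show ?thesis by (simp add: chi4_def)
  qed
  then show ?thesis by simp
 qed
 have "Legendre (int q) (int p) = Legendre (int p) (int q) * (Legendre (int p) (int q) * Legendre (int q) (int p))"
  using sq by (simp flip: mult.assoc)
 also have "... = Legendre (int p) (int q) * (if q mod 4 = 3 then chi4 (int p) else 1)"
  using Quadratic_Reciprocity[OF assms False] neg1_mod4[OF odd(2), of "(p - 1) div 2"] e by simp
 finally show ?thesis .
qed

text \<open>\<open>disc_a\<close> and \<open>disc_b\<close> are the exponents of \<open>chi4\<close>
  and \<open>chi8\<close> in the character of the squarefree integer s times the product of T. The
  sign contributes (-1/p), each prime q = 3 mod 4 contributes a \<open>chi4\<close> through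
  reciprocity, and the factor 2 contributes (2/p).\<close>

definition disc_a :: "int => nat set => nat" where
 "disc_a s T = ((if s = -1 then 1 else 0) + card {q \<in> T. q mod 4 = 3}) mod 2"

definition disc_b :: "nat set => nat" where
 "disc_b T = (if 2 \<in> T then 1 else 0)"

lemma odd_primes_diff: assumes "finite T" "\<forall>q\<in>T. prime q" shows "odd_primes (T - {2})"
 unfolding odd_primes_def
proof (intro conjI ballI)
 fix q assume "q \<in> T - {2}"
 then have "prime q" "q \<noteq> 2" using assms(2) by auto
 then show "prime q" "2 < q" using prime_ge_2_nat[of q] by auto
qed (use assms in auto)

text \<open>Factor the discriminant into its sign, a possible 2 and odd primes, then flip each
  symbol by reciprocity: the prime p moves from the modulus to the argument of a periodic
  character.\<close>

lemma Legendre_eq_quad_char: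
 assumes T: "finite T" "\<forall>q\<in>T. prime q" and s: "s \<in> {-1, 1}" and p: "prime p" "2 < p"
 shows "Legendre (s * int (\<Prod>T)) (int p) = quad_char (disc_a s T) (disc_b T) (T - {2}) (int p)"
proof -
 let ?S = "T - {2}"
 have S: "odd_primes ?S" by (rule odd_primes_diff[OF T])
 have "odd p" using p prime_odd_nat by auto
 have "\<Prod>T = (if 2 \<in> T then 2 else 1) * \<Prod>?S" using T(1) by (auto simp: prod.remove)
 then have "Legendre (s * int (\<Prod>T)) (int p)
   = Legendre (s * ((if 2 \<in> T then 2 else 1) * (\<Prod>q\<in>?S. int q))) (int p)" by simp
 also have "... = Legendre s (int p) * (Legendre (if 2 \<in> T then 2 else 1) (int p) * (\<Prod>q\<in>?S. Legendre (int q) (int p)))"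
  by (simp only: Legendre_mult[OF p] Legendre_prod[OF p])
 also have "Legendre s (int p) = chi4 (int p) ^ (if s = -1 then 1 else 0)"
 proof -
  have "int p mod 4 = 1 \<longleftrightarrow> p mod 4 = 1" by presburger
  then show ?thesis using s Legendre_minus_1[OF p] Legendre_1[OF p(1)] by (auto simp: chi4_def)
 qed
 also have "Legendre (if 2 \<in> T then 2 else 1) (int p) = chi8 (int p) ^ disc_b T"
 proof -
  have "int p mod 8 = 1 \<longleftrightarrow> p mod 8 = 1" "int p mod 8 = 7 \<longleftrightarrow> p mod 8 = 7" by presburger+
  then show ?thesis using Legendre_2[OF p] Legendre_1[OF p(1)] by (auto simp: chi8_def disc_b_def)
 qed
 also have "(\<Prod>q\<in>?S. Legendre (int q) (int p))
   = (\<Prod>q\<in>?S. Legendre (int p) (int q) * (if q mod 4 = 3 then chi4 (int p) else 1))"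
  using S p by (intro prod.cong refl Legendre_reciprocity) (auto simp: odd_primes_def)
 also have "... = (\<Prod>q\<in>?S. Legendre (int p) (int q)) * chi4 (int p) ^ card {q \<in> ?S. q mod 4 = 3}"
  using T(1) by (simp add: prod.distrib prod.If_cases Int_def)
 also have "{q \<in> ?S. q mod 4 = 3} = {q \<in> T. q mod 4 = 3}" by auto
 finally have 1: "Legendre (s * int (\<Prod>T)) (int p) =
   chi4 (int p) ^ ((if s = -1 then 1 else 0) + card {q \<in> T. q mod 4 = 3}) * chi8 (int p) ^ disc_b T
    * (\<Prod>q\<in>?S. Legendre (int p) (int q))" by (simp add: power_add mult_ac)
 have "chi4 (int p) ^ k = chi4 (int p) ^ (k mod 2)" for k
  unfolding chi4_def by (cases "even k") (auto simp: odd_iff_mod_2_eq_one)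
 then show ?thesis unfolding 1 quad_char_def char8_def disc_a_def using \<open>odd p\<close> by simp
qed

text \<open>By the Chinese remainder theorem the sum over a complete period is a product of local
  sums, and one vanishing factor is enough.\<close>

lemma char_sum_zero:
 fixes K :: "int => int" and G :: "nat => int => int"
 assumes U: "odd_primes U" and K: "\<And>x. K (x mod 8) = K x"
  and G: "\<And>q x. q \<in> U ==> G q (x mod int q) = G q x"
  and z: "(\<Sum>x\<in>{0..<8}. K x) = 0 \<or> (\<exists>q\<in>U. (\<Sum>x\<in>{0..<int q}. G q x) = 0)"
  and bd: "\<And>x. \<bar>K x * (\<Prod>q\<in>U. G q x)\<bar> \<le> 1"
 shows "\<bar>\<Sum>x\<in>{0..<int N}. K x * (\<Prod>q\<in>U. G q x)\<bar> \<le> 8 * int (\<Prod>U)"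
proof -
 have cop: "\<And>q r. q \<in> U ==> r \<in> U ==> q \<noteq> r ==> coprime (int q) (int r)"
  using U by (auto simp: odd_primes_def primes_coprime)
 have c: "(\<Sum>x\<in>{0..<(\<Prod>q\<in>U. int q)}. \<Prod>q\<in>U. G q x) = (\<Prod>q\<in>U. \<Sum>x\<in>{0..<int q}. G q x)"
  "\<And>x. (\<Prod>q\<in>U. G q (x mod (\<Prod>q\<in>U. int q))) = (\<Prod>q\<in>U. G q x)"
  using sum_crt_prod[of U int G, OF _ _ cop G] U by (simp_all add: odd_primes_def prime_gt_0_nat)
 let ?M = "\<Prod>q\<in>U. int q"
 have M: "?M > 0" using U by (intro prod_pos) (auto simp: odd_primes_def)
 have "coprime (2::int) ?M"
 proof (rule prod_coprime_right)
  fix q assume "q \<in> U"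
  then have "odd q" using U prime_odd_nat by (auto simp: odd_primes_def)
  then show "coprime 2 (int q)" by simp
 qed
 then have "coprime (2 ^ 3) ?M" by (rule coprime_power_left_iff[THEN iffD2, OF disjI1])
 then have co: "coprime 8 ?M" by simp
 have "(\<Sum>x\<in>{0..<8 * ?M}. K x * (\<Prod>q\<in>U. G q x)) = (\<Sum>x\<in>{0..<8}. K x) * (\<Sum>x\<in>{0..<?M}. \<Prod>q\<in>U. G q x)"
  by (rule sum_crt_two) (use M co K c(2) in auto)
 also have "... = 0" using z U unfolding c(1) odd_primes_def by auto
 finally have z': "(\<Sum>x\<in>{0..<8 * ?M}. K x * (\<Prod>q\<in>U. G q x)) = 0" .
 have per: "K (x mod (8 * ?M)) * (\<Prod>q\<in>U. G q (x mod (8 * ?M))) = K x * (\<Prod>q\<in>U. G q x)" for x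
 proof -
  have "K (x mod (8 * ?M)) = K x" using K[of "x mod (8 * ?M)"] K[of x] by (simp add: mod_mod_cancel)
  moreover have "(\<Prod>q\<in>U. G q (x mod (8 * ?M))) = (\<Prod>q\<in>U. G q x)"
   using c(2)[of "x mod (8 * ?M)"] c(2)[of x] by (simp add: mod_mod_cancel)
  ultimately show ?thesis by simp
 qed
 have "\<bar>\<Sum>x\<in>{0..<int N}. K x * (\<Prod>q\<in>U. G q x)\<bar> \<le> 8 * ?M"
  by (rule periodic_sum_bound) (use M z' per bd in auto)
 then show ?thesis by simp
qed

lemma quad_char_sum_bound: assumes S: "odd_primes S" and nt: "S \<noteq> {} \<or> odd a \<or> odd b"
 shows "\<bar>\<Sum>x\<in>{0..<int N}. quad_char a b S x\<bar> \<le> 8 * int (\<Prod>S)"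
 unfolding quad_char_def
proof (rule char_sum_zero[OF S])
 show "char8 a b (x mod 8) = char8 a b x" for x by (rule char8_mod)
 show "Legendre (x mod int q) (int q) = Legendre x (int q)" for x q by (rule Legendre_mod)
 show "\<bar>char8 a b x * (\<Prod>q\<in>S. Legendre x (int q))\<bar> \<le> 1" for x
  using quad_char_abs_le[of a b S x] by (simp add: quad_char_def)
 show "(\<Sum>x\<in>{0..<8}. char8 a b x) = 0 \<or> (\<exists>q\<in>S. (\<Sum>x\<in>{0..<int q}. Legendre x (int q)) = 0)"
 proof (cases "S = {}")
  case True then show ?thesis using nt char8_sum_0 by auto
 next
  case False
  then obtain q where "q \<in> S" by auto
  then show ?thesis using S Legendre_sum_0 by (auto simp: odd_primes_def)
 qed
qed

text \<open>Near-orthogonality of distinct characters with the same part modulo 8: that part squares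
  to the principal character, and at a prime in exactly one of S and S' the local factor is a
  Legendre symbol, whose complete sum is 0.\<close>

lemma quad_char_prod_sum_bound: assumes S: "odd_primes S" "odd_primes S'" and ne: "S \<noteq> S'"
  and ab: "a mod 2 = a' mod 2" "b mod 2 = b' mod 2"
 shows "\<bar>\<Sum>x\<in>{0..<int N}. quad_char a b S x * quad_char a' b' S' x\<bar> \<le> 8 * int (\<Prod>S * \<Prod>S')"
proof -
 let ?U = "S \<union> S'"
 have fin: "finite S" "finite S'" using S by (auto simp: odd_primes_def)
 have U: "odd_primes ?U" using S by (auto simp: odd_primes_def)
 define G where "G q x = (if q \<in> S then Legendre x (int q) else 1) * (if q \<in> S' then Legendre x (int q) else 1)" for q x
 have e: "quad_char a b S x * quad_char a' b' S' x = char8 0 0 x * (\<Prod>q\<in>?U. G q x)" for x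
 proof -
  have "(\<Prod>q\<in>?U. if q \<in> S then Legendre x (int q) else 1) = (\<Prod>q\<in>S. Legendre x (int q))"
   "(\<Prod>q\<in>?U. if q \<in> S' then Legendre x (int q) else 1) = (\<Prod>q\<in>S'. Legendre x (int q))"
   using fin by (simp_all add: prod.If_cases Int_absorb1 Int_absorb2 Int_def flip: prod.inter_filter)
    (auto intro!: prod.cong)
  then have "(\<Prod>q\<in>?U. G q x) = (\<Prod>q\<in>S. Legendre x (int q)) * (\<Prod>q\<in>S'. Legendre x (int q))"
   unfolding G_def prod.distrib by simp
  then show ?thesis unfolding quad_char_def char8_sq[OF ab, symmetric] by (simp add: mult_ac)
 qed
 have "\<bar>\<Sum>x\<in>{0..<int N}. quad_char a b S x * quad_char a' b' S' x\<bar> \<le> 8 * int (\<Prod>?U)"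
  unfolding e
 proof (rule char_sum_zero[OF U])
  show "char8 0 0 (x mod 8) = char8 0 0 x" for x by (rule char8_mod)
  show "G q (x mod int q) = G q x" for x q unfolding G_def by (simp add: Legendre_mod)
  show "\<bar>char8 0 0 x * (\<Prod>q\<in>?U. G q x)\<bar> \<le> 1" for x
   unfolding e[symmetric] using quad_char_values[of a b S x] quad_char_values[of a' b' S' x] by auto
  from ne obtain q where q: "q \<in> ?U" "q \<in> S \<longleftrightarrow> q \<notin> S'" by auto
  then have "G q = (\<lambda>x. Legendre x (int q))" unfolding G_def by auto
  moreover have "(\<Sum>x\<in>{0..<int q}. Legendre x (int q)) = 0"
   using q(1) U by (intro Legendre_sum_0) (auto simp: odd_primes_def)
  ultimately have "(\<Sum>x\<in>{0..<int q}. G q x) = 0" by simp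
  with q(1) show "(\<Sum>x\<in>{0..<8}. char8 0 0 x) = 0 \<or> (\<exists>q\<in>?U. (\<Sum>x\<in>{0..<int q}. G q x) = 0)"
   by blast
 qed
 also have "\<Prod>?U \<le> \<Prod>S * \<Prod>S'"
 proof -
  have "\<Prod>?U dvd \<Prod>S * \<Prod>S'" using fin prod.union_inter[of S S' "\<lambda>x. x"] by (metis dvd_triv_left)
  moreover have "\<Prod>S * \<Prod>S' > 0" using S by (auto simp: odd_primes_def intro!: prod_pos)
  ultimately show ?thesis by (rule dvd_imp_le)
 qed
 finally show ?thesis by simp
qed

section \<open>A large sieve for quadratic characters\<close>

lemma card_subsets_meeting: assumes "finite P" "B \<subseteq> P" "j \<ge> 1"
 shows "card {Z. Z \<subseteq> P \<and> card Z = j \<and> Z \<inter> B \<noteq> {}} \<le> card B * (card P - 1 choose (j - 1))"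
proof -
 have "{Z. Z \<subseteq> P \<and> card Z = j \<and> Z \<inter> B \<noteq> {}}
   \<subseteq> (\<Union>p\<in>B. insert p ` {Z. Z \<subseteq> P - {p} \<and> card Z = j - 1})" (is "?L \<subseteq> ?R")
 proof
  fix Z assume "Z \<in> ?L"
  then obtain p where p: "Z \<subseteq> P" "card Z = j" "p \<in> Z" "p \<in> B" by auto
  have "finite Z" using p assms finite_subset by auto
  then have "Z = insert p (Z - {p})" "card (Z - {p}) = j - 1" using p by auto
  then show "Z \<in> ?R" using p by blast
 qed
 moreover have "finite ?R" using assms finite_subset[OF assms(2)] by (auto intro!: finite_imageI)
 ultimately have "card ?L \<le> card ?R" by (rule card_mono[rotated])
 also have "... \<le> (\<Sum>p\<in>B. card (insert p ` {Z. Z \<subseteq> P - {p} \<and> card Z = j - 1}))"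
  using finite_subset[OF assms(2,1)] by (rule card_UN_le)
 also have "... \<le> (\<Sum>p\<in>B. (card P - 1 choose (j - 1)))"
 proof (rule sum_mono)
  fix p assume "p \<in> B"
  then have "p \<in> P" using assms by auto
  have "card (insert p ` {Z. Z \<subseteq> P - {p} \<and> card Z = j - 1}) \<le> card {Z. Z \<subseteq> P - {p} \<and> card Z = j - 1}"
   by (rule card_image_le) (use assms in auto)
  also have "... = (card P - 1 choose (j - 1))"
   using \<open>p \<in> P\<close> assms(1) by (subst n_subsets) auto
  finally show "card (insert p ` {Z. Z \<subseteq> P - {p} \<and> card Z = j - 1}) \<le> (card P - 1 choose (j - 1))" .
 qed
 finally show ?thesis by simp
qed

lemma prime_factors_prod_primes:
 "finite Z ==> (\<And>p. p \<in> Z ==> prime p) ==> prime_factors (\<Prod>Z) = Z" for Z :: "nat set"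
proof -
 assume Z: "finite Z" "\<And>p. p \<in> Z ==> prime p"
 have "0 \<notin> Z" using Z(2) not_prime_0 by blast
 then have "\<Prod>Z \<noteq> 0" using Z(1) by (simp add: prod_zero_iff)
 show ?thesis
 proof (intro equalityI subsetI)
  fix x assume "x \<in> prime_factors (\<Prod>Z)"
  then have x: "prime x" "x dvd \<Prod>Z" by (auto simp: in_prime_factors_iff)
  then obtain z where "z \<in> Z" "x dvd z" using Z(1) by (auto simp: prime_dvd_prod_iff)
  then show "x \<in> Z" using primes_dvd_imp_eq[of x z] x Z(2) by auto
 next
  fix x assume "x \<in> Z"
  then have "x dvd \<Prod>Z" using Z(1) by (intro dvd_prodI)
  then show "x \<in> prime_factors (\<Prod>Z)"
   using \<open>x \<in> Z\<close> Z(2) \<open>\<Prod>Z \<noteq> 0\<close> by (simp add: in_prime_factors_iff)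
 qed
qed

text \<open>Each character of E is 1 on most products of j distinct primes of P, so its sum over
  these products is at least C/2. Adding over E, applying Cauchy-Schwarz and completing to all
  integers below y^j + 1 leaves a diagonal of size card E * N and correlations of at most 8 X^2
  each. The exponents a and b are common to E so that the correlations are controlled.\<close>

lemma large_sieve_quad_char:
 fixes P :: "nat set" and E :: "nat set set"
 assumes P: "finite P" "\<And>p. p \<in> P ==> prime p" "\<And>p. p \<in> P ==> p \<le> y"
  and E: "finite E" "\<And>S. S \<in> E ==> odd_primes S" "\<And>S. S \<in> E ==> \<Prod>S \<le> X"
  and k: "\<And>S. S \<in> E ==> card {p \<in> P. quad_char a b S (int p) \<noteq> 1} \<le> k"
  and kj: "4 * k * j \<le> card P" "j \<ge> 1" and X: "X > 0" "64 * X\<^sup>2 \<le> card P choose j"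
 shows "card E * (card P choose j) \<le> 8 * (y ^ j + 1)"
proof -
 define \<Z> where "\<Z> = {Z. Z \<subseteq> P \<and> card Z = j}"
 define C where "C = card P choose j"
 define chr where "chr S n = quad_char a b S n" for S n
 have fZ: "finite \<Z>" unfolding \<Z>_def using P by auto
 have cZ: "card \<Z> = C" unfolding \<Z>_def C_def by (rule n_subsets[OF P(1)])
 have "64 * X\<^sup>2 > 0" using X(1) by simp
 then have C0: "C > 0" using X(2) unfolding C_def by linarith
 then have P0: "card P > 0" using kj(2) unfolding C_def by (cases "card P") (auto simp: binomial_eq_0)
 \<comment> \<open>By the union bound at most k C(|P|-1, j-1) = k j C / |P| of the products contain
   one of the k bad primes. This is at most C/4, and each of them lowers the sum by at most
   2.\<close>
 have good: "int C \<le> 2 * (\<Sum>Z\<in>\<Z>. chr S (int (\<Prod>Z)))" if S: "S \<in> E" for S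
 proof -
  let ?B = "{p \<in> P. quad_char a b S (int p) \<noteq> 1}"
  let ?bad = "{Z \<in> \<Z>. Z \<inter> ?B \<noteq> {}}"
  have "?bad = {Z. Z \<subseteq> P \<and> card Z = j \<and> Z \<inter> ?B \<noteq> {}}" unfolding \<Z>_def by auto
  then have "card ?bad \<le> card ?B * (card P - 1 choose (j - 1))"
   using card_subsets_meeting[OF P(1) _ kj(2), of ?B] by simp
  also have "... \<le> k * (card P - 1 choose (j - 1))" using k[OF S] by simp
  finally have bad: "card ?bad \<le> k * (card P - 1 choose (j - 1))" .
  have "card P * (4 * card ?bad) \<le> card P * (4 * (k * (card P - 1 choose (j - 1))))"
   using bad by simp
  also have "... = 4 * k * (card P * (card P - 1 choose (j - 1)))" by (simp add: mult_ac)
  also have "card P * (card P - 1 choose (j - 1)) = j * C"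
   using binomial_absorption[of "j - 1" "card P"] kj(2) unfolding C_def by simp
  also have "4 * k * (j * C) \<le> card P * C" using kj(1) by (simp flip: mult.assoc)
  finally have b4: "4 * card ?bad \<le> C" using P0 by simp
  have "(\<Sum>Z\<in>\<Z>. (1::int) - (if Z \<in> ?bad then 2 else 0)) \<le> (\<Sum>Z\<in>\<Z>. chr S (int (\<Prod>Z)))"
  proof (rule sum_mono)
   fix Z assume Z: "Z \<in> \<Z>"
   show "(1::int) - (if Z \<in> ?bad then 2 else 0) \<le> chr S (int (\<Prod>Z))"
   proof (cases "Z \<in> ?bad")
    case True
    then show ?thesis using quad_char_values[of a b S "int (\<Prod>Z)"] unfolding chr_def by auto
   next
    case False
    have "quad_char a b S (int (\<Prod>Z)) = (\<Prod>p\<in>Z. quad_char a b S (int p))"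
     using quad_char_prod[OF E(2)[OF S], of a b int Z] by simp
    also have "... = 1" using False Z unfolding \<Z>_def by (intro prod.neutral) auto
    finally show ?thesis using False unfolding chr_def by simp
   qed
  qed
  also have "(\<Sum>Z\<in>\<Z>. (1::int) - (if Z \<in> ?bad then 2 else 0)) = int C - 2 * int (card ?bad)"
  proof -
   have "(\<Sum>Z\<in>\<Z>. (if Z \<in> ?bad then 2 else 0 :: int)) = (\<Sum>Z\<in>?bad. 2)"
    using fZ by (intro sum.mono_neutral_cong_right) auto
   then show ?thesis using cZ by (simp add: sum_subtractf)
  qed
  finally show ?thesis using b4 by linarith
 qed
 define g where "g n = (\<Sum>S\<in>E. chr S n)" for n
 define N where "N = y ^ j + 1"
 have g1: "int (card E) * int C \<le> 2 * (\<Sum>Z\<in>\<Z>. g (int (\<Prod>Z)))"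
 proof -
  have "int (card E) * int C = (\<Sum>S\<in>E. int C)" by simp
  also have "... \<le> (\<Sum>S\<in>E. 2 * (\<Sum>Z\<in>\<Z>. chr S (int (\<Prod>Z))))" by (intro sum_mono good)
  also have "... = 2 * (\<Sum>Z\<in>\<Z>. g (int (\<Prod>Z)))"
   unfolding g_def by (subst sum.swap) (simp add: sum_distrib_left)
  finally show ?thesis .
 qed
 have sq: "(\<Sum>Z\<in>\<Z>. g (int (\<Prod>Z)))\<^sup>2 \<le> int C * (\<Sum>Z\<in>\<Z>. (g (int (\<Prod>Z)))\<^sup>2)"
 proof -
  have "(\<Sum>Z\<in>\<Z>. real_of_int (g (int (\<Prod>Z))))\<^sup>2 \<le> (\<Sum>Z\<in>\<Z>. (real_of_int (g (int (\<Prod>Z))))\<^sup>2) * real (card \<Z>)"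
   by (rule sum_squared_le_sum_of_squares)
  then have "real_of_int ((\<Sum>Z\<in>\<Z>. g (int (\<Prod>Z)))\<^sup>2) \<le> real_of_int (int C * (\<Sum>Z\<in>\<Z>. (g (int (\<Prod>Z)))\<^sup>2))"
   using cZ by (simp add: mult.commute)
  then show ?thesis by (simp only: of_int_le_iff)
 qed
 \<comment> \<open>Unique factorization: the sum over subsets is a sum over distinct integers, so
   that it can be completed.\<close>
 have inj: "inj_on (\<lambda>Z. int (\<Prod>Z)) \<Z>"
 proof (rule inj_onI)
  fix Z Z' assume *: "Z \<in> \<Z>" "Z' \<in> \<Z>" "int (\<Prod>Z) = int (\<Prod>Z')"
  have "prime_factors (\<Prod>Z) = Z" "prime_factors (\<Prod>Z') = Z'"
   using * P finite_subset[OF _ P(1)] unfolding \<Z>_def by (auto intro!: prime_factors_prod_primes)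
  moreover have "\<Prod>Z = \<Prod>Z'" using *(3) by (simp only: of_nat_eq_iff)
  ultimately show "Z = Z'" by metis
 qed
 have "(\<Sum>Z\<in>\<Z>. (g (int (\<Prod>Z)))\<^sup>2) = (\<Sum>n\<in>(\<lambda>Z. int (\<Prod>Z)) ` \<Z>. (g n)\<^sup>2)"
  by (subst sum.reindex[OF inj]) (simp only: o_def)
 \<comment> \<open>Squares are nonnegative, so the sum may run over all integers below N; N exceeds
   every product of j primes up to y.\<close>
 also have "... \<le> (\<Sum>n\<in>{0..<int N}. (g n)\<^sup>2)"
 proof (rule sum_mono2)
  show "(\<lambda>Z. int (\<Prod>Z)) ` \<Z> \<subseteq> {0..<int N}"
  proof safe
   fix Z assume "Z \<in> \<Z>"
   then have Z: "Z \<subseteq> P" "card Z = j" unfolding \<Z>_def by auto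
   have "\<Prod>Z \<le> (\<Prod>p\<in>Z. y)" using Z P by (intro prod_mono) auto
   then have "\<Prod>Z < N" using Z unfolding N_def by simp
   then have "int (\<Prod>Z) < int N" by (simp only: of_nat_less_iff)
   then show "int (\<Prod>Z) \<in> {0..<int N}" by (intro atLeastLessThan_iff[THEN iffD2] conjI of_nat_0_le_iff)
  qed
 qed auto
 also have "... = (\<Sum>n\<in>{0..<int N}. \<Sum>S\<in>E. \<Sum>S'\<in>E. chr S n * chr S' n)"
  unfolding g_def power2_eq_square by (simp add: sum_product)
 also have "... = (\<Sum>S\<in>E. \<Sum>S'\<in>E. \<Sum>n\<in>{0..<int N}. chr S n * chr S' n)"
  by (subst sum.swap, rule sum.cong[OF refl], rule sum.swap)
 also have "... \<le> (\<Sum>S\<in>E. \<Sum>S'\<in>E. (if S = S' then int N else 0) + 8 * (int X)\<^sup>2)"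
 proof (intro sum_mono)
  fix S S' assume S: "S \<in> E" "S' \<in> E"
  show "(\<Sum>n\<in>{0..<int N}. chr S n * chr S' n) \<le> (if S = S' then int N else 0) + 8 * (int X)\<^sup>2"
  proof (cases "S = S'")
   case True
   have "(\<Sum>n\<in>{0..<int N}. chr S n * chr S' n) \<le> (\<Sum>n\<in>{0..<int N}. 1)"
   proof (rule sum_mono)
    fix n show "chr S n * chr S' n \<le> 1"
     using quad_char_values[of a b S n] quad_char_values[of a b S' n] unfolding chr_def by auto
   qed
   then have "(\<Sum>n\<in>{0..<int N}. chr S n * chr S' n) \<le> int N" by simp
   moreover have "0 \<le> (int X)\<^sup>2" by simp
   ultimately show ?thesis unfolding if_P[OF True] by linarith
  next
   case False
   have "(\<Sum>n\<in>{0..<int N}. chr S n * chr S' n) \<le> 8 * int (\<Prod>S * \<Prod>S')"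
    using quad_char_prod_sum_bound[OF E(2)[OF S(1)] E(2)[OF S(2)] False, of a a b b N]
    unfolding chr_def by simp
   also have "... \<le> 8 * int (X * X)"
    using mult_mono[OF E(3)[OF S(1)] E(3)[OF S(2)]] by (simp only: mult_le_cancel_left_pos of_nat_le_iff zero_less_numeral)
   finally show ?thesis using False by (simp add: power2_eq_square)
  qed
 qed
 also have "... = int (card E) * int N + (int (card E))\<^sup>2 * (8 * (int X)\<^sup>2)"
 proof -
  have "(\<Sum>S'\<in>E. (if S = S' then int N else 0) + 8 * (int X)\<^sup>2) = int N + int (card E) * (8 * (int X)\<^sup>2)"
   if "S \<in> E" for S using that E(1) by (simp add: sum.distrib)
  then show ?thesis by (simp add: algebra_simps power2_eq_square)
 qed
 finally have g2: "(\<Sum>Z\<in>\<Z>. (g (int (\<Prod>Z)))\<^sup>2) \<le> int (card E) * int N + (int (card E))\<^sup>2 * (8 * (int X)\<^sup>2)" .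
 show ?thesis
 proof (cases "card E = 0")
  case False
  define e where "e = int (card E)"
  define c where "c = int C"
  have pos: "e > 0" "c > 0" using False C0 by (auto simp: e_def c_def)
  have "(e * c)\<^sup>2 \<le> (2 * (\<Sum>Z\<in>\<Z>. g (int (\<Prod>Z))))\<^sup>2"
   using g1 pos by (intro power_mono) (auto simp: e_def c_def)
  also have "... \<le> 4 * (c * (e * int N + e\<^sup>2 * (8 * (int X)\<^sup>2)))"
   using sq mult_left_mono[OF g2, of "int C"] unfolding e_def c_def by (simp add: power_mult_distrib)
  finally have "(e * c) * (e * c) \<le> (e * c) * (4 * int N + 32 * e * (int X)\<^sup>2)"
   by (simp add: power2_eq_square algebra_simps)
  then have "e * c \<le> 4 * int N + 32 * e * (int X)\<^sup>2"
   using pos mult_left_le_imp_le[of "e * c" "e * c"] by simp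
  \<comment> \<open>The hypothesis on X makes the off-diagonal part 32 e X^2 at most half of e c, so
    it can be absorbed on the left.\<close>
  moreover have "64 * (int X)\<^sup>2 \<le> c" using X(2) unfolding c_def C_def
   using of_nat_le_iff[of "64 * X\<^sup>2" "card P choose j", where ?'a = int] by simp
  then have "e * (64 * (int X)\<^sup>2) \<le> e * c" using pos by (intro mult_left_mono) auto
  ultimately have "e * c \<le> 8 * int N" by linarith
  then have "int (card E * C) \<le> int (8 * N)" by (simp add: e_def c_def)
  then show ?thesis unfolding N_def C_def by (simp only: of_nat_le_iff)
 qed simp
qed

section \<open>Bounds for the least primes with character value -1\<close>

text \<open>Legendre's sieve. Removing the multiples of p subtracts the value at p times the same
  sieved sum of shorter length, so every prime of Q doubles the bound, uniformly in N.\<close>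

lemma sieved_sum_bound: assumes S: "odd_primes S" and nt: "S \<noteq> {} \<or> odd a \<or> odd b"
  and Q: "finite Q" "\<And>q. q \<in> Q ==> prime q"
 shows "\<bar>\<Sum>x\<in>{0..<int N}. quad_char a b S x * (if \<exists>q\<in>Q. int q dvd x then 0 else 1)\<bar>
  \<le> 2 ^ card Q * (8 * int (\<Prod>S))" using Q
proof (induction Q arbitrary: N rule: finite_induct)
 case empty
 then show ?case using quad_char_sum_bound[OF S nt, of N] by simp
next
 case (insert p Q)
 let ?chr = "quad_char a b S"
 let ?i = "\<lambda>x::int. if \<exists>q\<in>Q. int q dvd x then 0 else 1 :: int"
 have p: "prime p" "p > 0" using insert by (auto simp: prime_gt_0_nat)
 \<comment> \<open>The ceiling of N/p: the number of multiples of p in [0, N), counting 0.\<close>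
 define N' where "N' = (N + p - 1) div p"
 have N': "int p * m < int N \<longleftrightarrow> m < int N'" if m0: "m \<ge> 0" for m
 proof -
  obtain m' where m: "m = int m'" using m0 by (rule nonneg_int_cases)
  have "p * m' < N \<longleftrightarrow> m' < N'"
  proof -
   have "m' < N' \<longleftrightarrow> Suc m' * p \<le> N + p - 1"
    unfolding N'_def Suc_le_eq[symmetric] using p(2) by (rule less_eq_div_iff_mult_less_eq)
   also have "... \<longleftrightarrow> p * m' < N"
    unfolding mult_Suc using p(2) by (simp add: mult.commute[of m' p]) linarith
   finally show ?thesis by simp
  qed
  then show ?thesis unfolding m by (metis of_nat_less_iff of_nat_mult)
 qed
 have "(\<Sum>x\<in>{0..<int N}. ?chr x * (if \<exists>q\<in>insert p Q. int q dvd x then 0 else 1))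
   = (\<Sum>x\<in>{0..<int N}. ?chr x * ?i x) - (\<Sum>x\<in>{x\<in>{0..<int N}. int p dvd x}. ?chr x * ?i x)"
 proof -
  have "(\<Sum>x\<in>{x\<in>{0..<int N}. int p dvd x}. ?chr x * ?i x)
    = (\<Sum>x\<in>{0..<int N}. if int p dvd x then ?chr x * ?i x else 0)"
   by (rule sum.inter_filter) auto
  then show ?thesis by (simp only: sum_subtractf[symmetric]) (auto intro!: sum.cong)
 qed
 also have "(\<Sum>x\<in>{x\<in>{0..<int N}. int p dvd x}. ?chr x * ?i x) = (\<Sum>m\<in>{0..<int N'}. ?chr (int p * m) * ?i (int p * m))"
  by (rule sum.reindex_bij_witness[of _ "\<lambda>m. int p * m" "\<lambda>x. x div int p"])
   (use p N' in \<open>auto simp: zero_le_mult_iff pos_imp_zdiv_nonneg_iff elim!: dvdE\<close>)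
 also have "... = ?chr (int p) * (\<Sum>m\<in>{0..<int N'}. ?chr m * ?i m)"
 proof -
  have "int q dvd int p * m \<longleftrightarrow> int q dvd m" if "q \<in> Q" for q m
  proof -
   have "coprime (int q) (int p)" using that insert p primes_coprime[of q p] by (auto simp: coprime_int_iff)
   then show ?thesis by (simp add: coprime_dvd_mult_right_iff)
  qed
  then have "?i (int p * m) = ?i m" for m by auto
  then show ?thesis by (simp add: quad_char_mult[OF S] sum_distrib_left mult_ac)
 qed
 finally have e: "(\<Sum>x\<in>{0..<int N}. ?chr x * (if \<exists>q\<in>insert p Q. int q dvd x then 0 else 1))
   = (\<Sum>x\<in>{0..<int N}. ?chr x * ?i x) - ?chr (int p) * (\<Sum>m\<in>{0..<int N'}. ?chr m * ?i m)" .
 have IH: "\<bar>\<Sum>x\<in>{0..<int K}. ?chr x * ?i x\<bar> \<le> 2 ^ card Q * (8 * int (\<Prod>S))" for K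
  using insert by auto
 have "\<bar>?chr (int p) * (\<Sum>m\<in>{0..<int N'}. ?chr m * ?i m)\<bar> \<le> 1 * \<bar>\<Sum>m\<in>{0..<int N'}. ?chr m * ?i m\<bar>"
  unfolding abs_mult by (intro mult_right_mono quad_char_abs_le) auto
 then show ?case unfolding e using IH[of N] IH[of N'] insert.hyps by simp
qed

text \<open>If the character is nonnegative at the primes up to Y outside Q, then by
  multiplicativity it is nonnegative at every n \<le> Y free of primes of Q. The sieved sum then has
  no negative terms and counts each remaining prime with weight 1, while it is bounded independently
  of Y.\<close>

lemma primes_count_nonneg_char:
 assumes S: "odd_primes S" and nt: "S \<noteq> {} \<or> odd a \<or> odd b"
  and Q: "finite Q" "\<And>q. q \<in> Q ==> prime q"
  and nn: "\<And>p. prime p ==> p \<le> Y ==> 2 < p ==> p \<notin> Q ==> quad_char a b S (int p) \<ge> 0"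
 shows "card {p. prime p \<and> p \<le> Y} \<le> card S + card Q + 1 + 2 ^ card Q * 8 * \<Prod>S"
proof -
 let ?chr = "quad_char a b S"
 let ?i = "\<lambda>x::int. if \<exists>q\<in>Q. int q dvd x then 0 else 1 :: int"
 let ?P = "{p. prime p \<and> p \<le> Y} - (S \<union> Q \<union> {2})"
 have fS: "finite S" using S by (simp add: odd_primes_def)
 have finP: "finite {p. prime p \<and> p \<le> Y}" by (rule finite_subset[of _ "{..Y}"]) auto
 have nonneg: "?chr x * ?i x \<ge> 0" if "x \<in> {0..<int (Y + 1)}" for x
 proof (cases "\<exists>q\<in>Q. int q dvd x")
  case False
  have "x \<ge> 0" using that by simp
  then obtain n where n: "x = int n" by (rule nonneg_int_cases)
  show ?thesis
  proof (cases "n = 0")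
   case True
   then show ?thesis using n quad_char_eq_0_iff[OF S, of a b 0] by simp
  next
   case n0: False
   have "?chr (int n) \<ge> 0"
   proof (rule quad_char_nonneg[OF S])
    fix p assume p: "prime p" "p dvd n"
    have "p \<le> Y" using p n0 n that dvd_imp_le[of p n] by auto
    moreover have "p \<notin> Q" using False p n by auto
    moreover have "p = 2 \<or> 2 < p" using prime_ge_2_nat[OF p(1)] by auto
    moreover have "?chr (int 2) = 0" using quad_char_eq_0_iff[OF S, of a b 2] by simp
    ultimately show "?chr (int p) \<ge> 0" using nn[OF p(1)] by auto
   qed (use n0 in auto)
   then show ?thesis using n by simp
  qed
 qed simp
 have "int (card ?P) = (\<Sum>x\<in>int ` ?P. 1)" by (simp add: card_image)
 also have "... \<le> (\<Sum>x\<in>int ` ?P. ?chr x * ?i x)"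
 proof (rule sum_mono)
  fix x assume "x \<in> int ` ?P"
  then obtain p where p: "x = int p" "prime p" "p \<le> Y" "p \<notin> S" "p \<notin> Q" "p \<noteq> 2" by auto
  have p2: "2 < p" using p prime_ge_2_nat[of p] by auto
  have "\<not> int q dvd int p" if "prime q" "q \<noteq> p" for q
   using that p primes_dvd_imp_eq[of q p] by (auto simp: int_dvd_int_iff)
  then have 1: "\<not> (\<exists>q\<in>Q. int q dvd int p)" "\<not> (\<exists>q\<in>S. int q dvd int p)"
   using p(4,5) Q(2) S unfolding odd_primes_def by metis+
  have "odd p" using p p2 prime_odd_nat by auto
  then have "?chr (int p) \<noteq> 0" using quad_char_eq_0_iff[OF S, of a b "int p"] 1 by auto
  then have "?chr (int p) = 1" using nn[of p] p p2 quad_char_values[of a b S "int p"] by auto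
  then show "1 \<le> ?chr x * ?i x" using 1 p by auto
 qed
 also have "... \<le> (\<Sum>x\<in>{0..<int (Y + 1)}. ?chr x * ?i x)"
  using finP nonneg by (intro sum_mono2) auto
 also have "... \<le> 2 ^ card Q * (8 * int (\<Prod>S))"
  using sieved_sum_bound[OF S nt Q, of "Y + 1"] by linarith
 also have "... = int (2 ^ card Q * 8 * \<Prod>S)" by simp
 finally have "card ?P \<le> 2 ^ card Q * 8 * \<Prod>S" by (simp only: of_nat_le_iff)
 moreover have "card {p. prime p \<and> p \<le> Y} \<le> card (?P \<union> (S \<union> Q \<union> {2}))"
  using finP fS Q by (intro card_mono) auto
 moreover have "card (?P \<union> (S \<union> Q \<union> {2})) \<le> card ?P + card (S \<union> Q \<union> {2})" by (rule card_Un_le)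
 moreover have "card (S \<union> Q \<union> {2}) \<le> card S + card Q + 1"
  using card_Un_le[of "S \<union> Q" "{2}"] card_Un_le[of S Q] by simp
 ultimately show ?thesis by linarith
qed

lemma prod_primes_dvd:
 fixes h :: int assumes "finite A" "\<And>q. q \<in> A ==> prime q \<and> int q dvd h"
 shows "(\<Prod>q\<in>A. int q) dvd h" using assms
proof (induction A rule: finite_induct)
 case (insert p A)
 have "coprime (int p) (\<Prod>q\<in>A. int q)"
 proof (rule prod_coprime_right)
  fix q assume "q \<in> A"
  then have "coprime p q" using insert.hyps insert.prems[of p] insert.prems[of q]
   by (intro primes_coprime) auto
  then show "coprime (int p) (int q)" by simp
 qed
 then show ?case using insert by (simp add: divides_mult)
qed simp

text \<open>The correlation factors over the primes of S. A prime q contributes at most q if it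
  divides h and at most 1 otherwise, and the product of the distinct primes dividing h is at most
  |h|.\<close>

lemma prod_Legendre_correlation:
 fixes r M h :: int
 assumes S: "odd_primes S" and M: "\<And>q. q \<in> S ==> coprime M (int q)" and h: "h \<noteq> 0"
 defines "G \<equiv> \<lambda>k. \<Prod>q\<in>S. Legendre (r + M * k) (int q)"
 shows "\<bar>\<Sum>k\<in>{0..<int (\<Prod>S)}. G k * G (k + h)\<bar> \<le> \<bar>h\<bar>"
proof -
 let ?F = "\<lambda>q k. Legendre (r + M * k) (int q) * Legendre (r + M * (k + h)) (int q)"
 have fS: "finite S" using S by (simp add: odd_primes_def)
 have cop: "\<And>q r. q \<in> S ==> r \<in> S ==> q \<noteq> r ==> coprime (int q) (int r)"
  using S by (auto simp: odd_primes_def primes_coprime)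
 have per: "?F q (x mod int q) = ?F q x" for q x
 proof -
  have "Legendre (r + M * (x mod int q)) (int q) = Legendre (r + M * x) (int q)"
   by (intro Legendre_cong cong_add cong_mult cong_refl) (simp add: cong_int_iff_mod)
  moreover have "[r + M * (x mod int q + h) = r + M * (x + h)] (mod int q)"
   by (intro cong_add cong_mult cong_refl) (simp add: cong_int_iff_mod)
  ultimately show ?thesis using Legendre_cong by simp
 qed
 have "(\<Sum>k\<in>{0..<int (\<Prod>S)}. G k * G (k + h)) = (\<Sum>k\<in>{0..<(\<Prod>q\<in>S. int q)}. \<Prod>q\<in>S. ?F q k)"
  unfolding G_def by (simp add: prod.distrib)
 also have "... = (\<Prod>q\<in>S. \<Sum>k\<in>{0..<int q}. ?F q k)"
  using sum_crt_prod[of S int ?F, OF fS _ cop per] S by (simp add: odd_primes_def prime_gt_0_nat)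
 finally have e: "(\<Sum>k\<in>{0..<int (\<Prod>S)}. G k * G (k + h)) = (\<Prod>q\<in>S. \<Sum>k\<in>{0..<int q}. ?F q k)" .
 have loc: "\<bar>\<Sum>k\<in>{0..<int q}. ?F q k\<bar> \<le> (if int q dvd h then int q else 1)" if q: "q \<in> S" for q
 proof -
  have pq: "prime q" "2 < q" using S q by (auto simp: odd_primes_def)
  let ?L = "\<lambda>x. Legendre x (int q) * Legendre (x + M * h) (int q)"
  have "Legendre (x mod int q + M * h) (int q) = Legendre (x + M * h) (int q)" for x
   by (rule Legendre_cong) (simp add: cong_int_iff_mod mod_add_left_eq)
  then have perL: "?L (x mod int q) = ?L x" for x by (simp only: Legendre_mod)
  have "(\<Sum>k\<in>{0..<int q}. ?F q k) = (\<Sum>k\<in>{0..<int q}. ?L (M * k + r))"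
   by (intro sum.cong refl arg_cong2[where f = "(*)"] arg_cong2[where f = Legendre]) (simp_all add: algebra_simps)
  also have "... = (\<Sum>k\<in>{0..<int q}. ?L k)"
   by (rule sum_affine_mod[where F = ?L and b = r, OF _ perL M[OF q]]) (use pq in simp)
  finally have "\<bar>\<Sum>k\<in>{0..<int q}. ?F q k\<bar> \<le> (if int q dvd M * h then int q else 1)"
   using Legendre_correlation[OF pq, of "M * h"] by simp
  moreover have "int q dvd M * h \<longleftrightarrow> int q dvd h"
   using M[OF q] by (simp add: coprime_commute coprime_dvd_mult_right_iff)
  ultimately show ?thesis by simp
 qed
 have "\<bar>\<Prod>q\<in>S. \<Sum>k\<in>{0..<int q}. ?F q k\<bar> = (\<Prod>q\<in>S. \<bar>\<Sum>k\<in>{0..<int q}. ?F q k\<bar>)"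
  by (rule abs_prod)
 also have "... \<le> (\<Prod>q\<in>S. if int q dvd h then int q else 1)"
  by (intro prod_mono conjI loc) auto
 also have "... = (\<Prod>q\<in>{q\<in>S. int q dvd h}. int q)"
  using fS by (rule prod.inter_filter[symmetric])
 also have "... \<le> \<bar>h\<bar>"
 proof -
  have "(\<Prod>q\<in>{q\<in>S. int q dvd h}. int q) dvd h"
   by (rule prod_primes_dvd) (use S fS in \<open>auto simp: odd_primes_def\<close>)
  then show ?thesis using h dvd_imp_le_int[of h "\<Prod>q\<in>{q\<in>S. int q dvd h}. int q"]
   by (meson abs_ge_self dual_order.trans)
 qed
 finally show ?thesis unfolding e .
qed

text \<open>On opening the square, the H diagonal pairs cost at most one period each, and the fewer
  than H^2 others cost |i - j| < H each by the correlation bound.\<close>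

lemma window_mean_square:
 fixes r M :: int assumes S: "odd_primes S" and M: "\<And>q. q \<in> S ==> coprime M (int q)"
 defines "G \<equiv> \<lambda>k. \<Prod>q\<in>S. Legendre (r + M * k) (int q)"
 shows "(\<Sum>x\<in>{0..<int (\<Prod>S)}. (\<Sum>j\<in>{0..<int H}. G (x + j))\<^sup>2) \<le> int H * int (\<Prod>S) + int H ^ 3"
proof -
 let ?m = "int (\<Prod>S)"
 have m: "?m > 0" using S by (auto simp: odd_primes_def intro!: prod_pos)
 have Gabs: "\<bar>G k\<bar> \<le> 1" for k
  unfolding G_def abs_prod using Legendre_abs_le by (intro prod_le_1) auto
 have Gper: "G (x mod ?m) = G x" for x unfolding G_def
 proof (rule prod.cong[OF refl])
  fix q assume "q \<in> S"
  then have "int q dvd ?m" using S by (auto simp: odd_primes_def intro: dvd_prodI)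
  then have "[x mod ?m = x] (mod int q)" by (simp add: cong_int_iff_mod mod_mod_cancel)
  then show "Legendre (r + M * (x mod ?m)) (int q) = Legendre (r + M * x) (int q)"
   by (intro Legendre_cong cong_add cong_mult cong_refl)
 qed
 have corr: "(\<Sum>x\<in>{0..<?m}. G (x + i) * G (x + j)) \<le> (if i = j then ?m else 0) + int H"
  if ij: "i \<in> {0..<int H}" "j \<in> {0..<int H}" for i j
 proof (cases "i = j")
  case True
  have "(\<Sum>x\<in>{0..<?m}. G (x + i) * G (x + j)) \<le> (\<Sum>x\<in>{0..<?m}. 1)"
  proof (rule sum_mono)
   fix x
   have "\<bar>G (x + i) * G (x + j)\<bar> \<le> 1 * 1"
    unfolding abs_mult by (intro mult_mono Gabs) auto
   then show "G (x + i) * G (x + j) \<le> 1" by linarith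
  qed
  then show ?thesis using True m by simp
 next
  case False
  let ?F = "\<lambda>x. G x * G (x + (j - i))"
  have perF: "?F (x mod ?m) = ?F x" for x
  proof -
   have "G (x mod ?m + (j - i)) = G (x + (j - i))"
    using Gper[of "x mod ?m + (j - i)"] Gper[of "x + (j - i)"] by (simp add: mod_add_left_eq)
   then show ?thesis by (simp only: Gper)
  qed
  have "(\<Sum>x\<in>{0..<?m}. G (x + i) * G (x + j)) = (\<Sum>x\<in>{0..<?m}. ?F (1 * x + i))"
   by (simp add: algebra_simps)
  also have "... = (\<Sum>x\<in>{0..<?m}. ?F x)"
   by (rule sum_affine_mod[where F = ?F and b = i, OF m perF]) simp
  also have "... \<le> \<bar>j - i\<bar>"
   using prod_Legendre_correlation[OF S M, of "j - i" r] False unfolding G_def by simp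
  finally show ?thesis using False ij by auto
 qed
 have "(\<Sum>x\<in>{0..<?m}. (\<Sum>j\<in>{0..<int H}. G (x + j))\<^sup>2)
   = (\<Sum>x\<in>{0..<?m}. \<Sum>i\<in>{0..<int H}. \<Sum>j\<in>{0..<int H}. G (x + i) * G (x + j))"
  unfolding power2_eq_square by (simp add: sum_product)
 also have "... = (\<Sum>i\<in>{0..<int H}. \<Sum>j\<in>{0..<int H}. \<Sum>x\<in>{0..<?m}. G (x + i) * G (x + j))"
  by (subst sum.swap, rule sum.cong[OF refl], rule sum.swap)
 also have "... \<le> (\<Sum>i\<in>{0..<int H}. \<Sum>j\<in>{0..<int H}. (if i = j then ?m else 0) + int H)"
  by (intro sum_mono corr)
 also have "... = (\<Sum>i\<in>{0..<int H}. ?m + int H * int H)"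
  by (intro sum.cong refl) (simp add: sum.distrib)
 also have "... = int H * ?m + int H ^ 3" by (simp add: algebra_simps power3_eq_cube)
 finally show ?thesis .
qed

text \<open>Without negative terms there is no cancellation in the window sums, so their total is
  about H times the number of ones; Cauchy-Schwarz against the mean square over a full period limits
  this number. The term 2H accounts for the points near the two ends, and e is the constant sign
  that the part modulo 8 has on the progression.\<close>

lemma window_bound:
 fixes r M e :: int
 assumes S: "odd_primes S" and M: "\<And>q. q \<in> S ==> coprime M (int q)" and R: "R \<le> \<Prod>S"
  and e: "e \<in> {-1, 1}"
 defines "G \<equiv> \<lambda>k. \<Prod>q\<in>S. Legendre (r + M * k) (int q)"
 assumes nn: "\<And>k. k \<in> {0..<int R} ==> e * G k \<ge> 0"
  and H: "2 * H \<le> card {k \<in> {0..<int R}. e * G k = 1}"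
 shows "H * (card {k \<in> {0..<int R}. e * G k = 1} - 2 * H)\<^sup>2 \<le> R * (\<Prod>S + H\<^sup>2)"
proof (cases "H = 0")
 case False
 let ?m = "int (\<Prod>S)"
 define A where "A = {k \<in> {0..<int R}. e * G k = 1}"
 have cA: "card A \<le> R"
 proof -
  have "card A \<le> card {0..<int R}" unfolding A_def by (intro card_mono) auto
  then show ?thesis by simp
 qed
 then have HR: "2 * H \<le> R" using H unfolding A_def by simp
 define W where "W x = (\<Sum>j\<in>{0..<int H}. e * G (x + j))" for x
 let ?X = "{0..<int R - int H}"
 \<comment> \<open>A point of this inner range lies in H windows that start in \<open>?X\<close>,
   one for each offset j.\<close>
 let ?A' = "A \<inter> {int H..<int R - int H}"
 have "card A \<le> card (?A' \<union> {0..<int H} \<union> {int R - int H..<int R})"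
  unfolding A_def by (intro card_mono) auto
 also have "... \<le> card ?A' + card {0..<int H} + card {int R - int H..<int R}"
  by (meson add_le_mono1 card_Un_le dual_order.trans)
 finally have cA': "card A - 2 * H \<le> card ?A'" by simp
 have "int (H * card ?A') = (\<Sum>j\<in>{0..<int H}. \<Sum>k\<in>?A'. 1)" by simp
 also have "... \<le> (\<Sum>j\<in>{0..<int H}. \<Sum>x\<in>?X. e * G (x + j))"
 proof (rule sum_mono)
  fix j assume j: "j \<in> {0..<int H}"
  have "(\<Sum>k\<in>?A'. 1) = (\<Sum>k\<in>?A'. e * G k)" unfolding A_def by (intro sum.cong) auto
  also have "... \<le> (\<Sum>k\<in>{j..<int R - int H + j}. e * G k)"
   by (rule sum_mono2) (use j HR nn in \<open>auto simp: A_def\<close>)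
  also have "... = (\<Sum>x\<in>?X. e * G (x + j))"
   by (rule sum.reindex_bij_witness[of _ "\<lambda>x. x + j" "\<lambda>k. k - j"]) auto
  finally show "(\<Sum>k\<in>?A'. 1) \<le> (\<Sum>x\<in>?X. e * G (x + j))" .
 qed
 also have "... = (\<Sum>x\<in>?X. W x)" unfolding W_def by (rule sum.swap)
 finally have lower: "int (H * card ?A') \<le> (\<Sum>x\<in>?X. W x)" .
 have "(\<Sum>x\<in>?X. real_of_int (W x))\<^sup>2 \<le> (\<Sum>x\<in>?X. (real_of_int (W x))\<^sup>2) * real (card ?X)"
  by (rule sum_squared_le_sum_of_squares)
 then have "real_of_int ((\<Sum>x\<in>?X. W x)\<^sup>2) \<le> real_of_int ((\<Sum>x\<in>?X. (W x)\<^sup>2) * int (card ?X))"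
  by (simp only: of_int_power of_int_sum of_int_mult of_int_of_nat_eq)
 then have cs: "(\<Sum>x\<in>?X. W x)\<^sup>2 \<le> (\<Sum>x\<in>?X. (W x)\<^sup>2) * int (card ?X)" by (simp only: of_int_le_iff)
 have "(int (H * (card A - 2 * H)))\<^sup>2 \<le> (\<Sum>x\<in>?X. W x)\<^sup>2"
 proof (rule power_mono)
  have "H * (card A - 2 * H) \<le> H * card ?A'" using cA' by simp
  then have "int (H * (card A - 2 * H)) \<le> int (H * card ?A')" by (simp only: of_nat_le_iff)
  then show "int (H * (card A - 2 * H)) \<le> (\<Sum>x\<in>?X. W x)" using lower by linarith
 qed simp
 also note cs
 also have "(\<Sum>x\<in>?X. (W x)\<^sup>2) * int (card ?X) \<le> (int H * ?m + int H ^ 3) * int R"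
 proof (rule mult_mono)
  have "int R \<le> ?m" using R by (simp only: of_nat_le_iff)
  then have "(\<Sum>x\<in>?X. (W x)\<^sup>2) \<le> (\<Sum>x\<in>{0..<?m}. (W x)\<^sup>2)"
   by (intro sum_mono2) auto
  also have "... = (\<Sum>x\<in>{0..<?m}. (\<Sum>j\<in>{0..<int H}. G (x + j))\<^sup>2)"
   unfolding W_def sum_distrib_left[symmetric] power_mult_distrib using e by auto
  also have "... \<le> int H * ?m + int H ^ 3" unfolding G_def by (rule window_mean_square[OF S M])
  finally show "(\<Sum>x\<in>?X. (W x)\<^sup>2) \<le> int H * ?m + int H ^ 3" .
  show "0 \<le> int H * ?m + int H ^ 3"
   by (intro add_nonneg_nonneg mult_nonneg_nonneg zero_le_power of_nat_0_le_iff)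
  show "int (card ?X) \<le> int R" by simp
 qed simp
 finally have "(int (H * (card A - 2 * H)))\<^sup>2 \<le> (int H * ?m + int H ^ 3) * int R" .
 also have "(int H * ?m + int H ^ 3) * int R = int (H * (R * (\<Prod>S + H\<^sup>2)))"
  by (simp add: algebra_simps power2_eq_square power3_eq_cube)
 also have "(int (H * (card A - 2 * H)))\<^sup>2 = int (H * (H * (card A - 2 * H)\<^sup>2))"
  by (simp only: power2_eq_square of_nat_mult mult_ac)
 finally have "H * (H * (card A - 2 * H)\<^sup>2) \<le> H * (R * (\<Prod>S + H\<^sup>2))" by (simp only: of_nat_le_iff)
 then show ?thesis using False unfolding A_def by simp
qed simp

text \<open>Sieving by Q is replaced by a progression: some class c modulo 8 times the product of Q
  contains at least its share P1 of the primes. On it the part modulo 8 is constant and no member is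
  divisible by 2 or by a prime of Q, so the character keeps its sign throughout and the window bound
  applies.\<close>

lemma quad_char_window:
 assumes S: "odd_primes S" and Q: "finite Q" "\<And>q. q \<in> Q ==> prime q" "Q \<inter> S = {}"
  and nn: "\<And>p. prime p ==> p < 8 * \<Prod>Q * R ==> 2 < p ==> p \<notin> Q ==> quad_char a b S (int p) \<ge> 0"
  and R: "R \<le> \<Prod>S"
 shows "\<exists>P1. card {p. prime p \<and> p < 8 * \<Prod>Q * R} \<le> card S + card Q + 1 + 8 * \<Prod>Q * P1 \<and>
  (\<forall>H. 2 * H \<le> P1 --> H * (P1 - 2 * H)\<^sup>2 \<le> R * (\<Prod>S + H\<^sup>2))"
proof -
 let ?chr = "quad_char a b S"
 define M where "M = 8 * \<Prod>Q"
 define P where "P = {p. prime p \<and> p < M * R} - (S \<union> Q \<union> {2})"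
 have fS: "finite S" using S by (simp add: odd_primes_def)
 have Q0: "\<Prod>Q > 0" using Q by (auto intro!: prod_pos simp: prime_gt_0_nat)
 have M0: "M > 1" using Q0 unfolding M_def by simp
 have finP: "finite {p. prime p \<and> p < M * R}" by (rule finite_subset[of _ "{..<M*R}"]) auto
 have fP: "finite P" unfolding P_def using finP by auto
 define cl where "cl c = {p \<in> P. p mod M = c}" for c
 have cardP: "card P = (\<Sum>c<M. card (cl c))"
 proof -
  have "P = (\<Union>c\<in>{..<M}. cl c)" unfolding cl_def using M0 by auto
  moreover have "card (\<Union>c\<in>{..<M}. cl c) = (\<Sum>c<M. card (cl c))"
   by (rule card_UN_disjoint) (use fP in \<open>auto simp: cl_def\<close>)
  ultimately show ?thesis by simp
 qed
 \<comment> \<open>Pigeonhole over the M residue classes.\<close>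
 obtain c where c: "c < M" "card P \<le> M * card (cl c)"
 proof -
  have "\<exists>c<M. card P \<le> M * card (cl c)"
  proof (rule ccontr)
   assume "\<not> ?thesis"
   then have "\<forall>c<M. M * card (cl c) < card P" by auto
   then have "(\<Sum>c<M. M * card (cl c)) < (\<Sum>c<M. card P)"
    using M0 by (intro sum_strict_mono) auto
   then show False unfolding sum_distrib_left[symmetric] cardP[symmetric] by simp
  qed
  then show ?thesis using that by blast
 qed
 define P1 where "P1 = card (cl c)"
 have "card {p. prime p \<and> p < M * R} \<le> card (P \<union> (S \<union> Q \<union> {2}))"
  unfolding P_def using finP fS Q by (intro card_mono) auto
 also have "... \<le> card P + card (S \<union> Q \<union> {2})" by (rule card_Un_le)
 also have "card (S \<union> Q \<union> {2}) \<le> card S + card Q + 1"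
  using card_Un_le[of "S \<union> Q" "{2}"] card_Un_le[of S Q] by simp
 finally have first: "card {p. prime p \<and> p < M * R} \<le> card S + card Q + 1 + M * P1"
  using c(2) unfolding P1_def by linarith
 have second: "H * (P1 - 2 * H)\<^sup>2 \<le> R * (\<Prod>S + H\<^sup>2)" if H: "2 * H \<le> P1" for H
 proof (cases "P1 = 0")
  case True
  then show ?thesis using H by simp
 next
  case False
  then obtain p0 where p0: "p0 \<in> cl c" unfolding P1_def by (metis card.empty ex_in_conv)
  have p0': "prime p0" "p0 \<notin> Q" "p0 \<noteq> 2" "p0 mod M = c" using p0 unfolding cl_def P_def by auto
  \<comment> \<open>The class contains a prime p0 outside Q and different from 2; hence c is prime
    to M, and so is every member of the class.\<close>
  have cop: "\<not> q dvd c + M * k" if q: "q \<in> insert 2 Q" for q k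
  proof
   assume d: "q dvd c + M * k"
   have "prime q" using q Q by auto
   have "q dvd M" using q Q unfolding M_def by (auto intro: dvd_mult dvd_prodI)
   then have "q dvd c" using d by (meson dvd_add_left_iff dvd_mult2)
   then have "q dvd p0" using p0'(4) \<open>q dvd M\<close> by (metis dvd_mod_iff)
   then have "q = p0" using p0'(1) \<open>prime q\<close> by (simp add: primes_dvd_imp_eq)
   then show False using p0' q by auto
  qed
  define e where "e = char8 a b (int c)"
  have "odd c" using cop[of 2 0] by simp
  then have e: "e \<in> {-1, 1}" using char8_values[of a b "int c"] unfolding e_def char8_def chi4_def chi8_def by auto
  let ?G = "\<lambda>k. \<Prod>q\<in>S. Legendre (int c + int M * k) (int q)"
  \<comment> \<open>As 8 divides M, the factor modulo 8 is the constant e along the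
    progression.\<close>
  have chi: "?chr (int c + int M * k) = e * ?G k" for k
  proof -
   have "(int c + int M * k) mod 8 = int c mod 8" unfolding M_def
    by (simp add: mod_add_right_eq[symmetric] mult.assoc)
   then have "char8 a b (int c + int M * k) = char8 a b (int c)"
    using char8_mod[of a b "int c + int M * k"] char8_mod[of a b "int c"] by simp
   then show ?thesis unfolding quad_char_def e_def by simp
  qed
  have nonneg: "e * ?G k \<ge> 0" if k: "k \<in> {0..<int R}" for k
  proof -
   define k' where "k' = nat k"
   have k': "k = int k'" "k' < R" using k unfolding k'_def by auto
   have n: "c + M * k' < M * R"
   proof -
    have "c + M * k' < M + M * k'" using c by simp
    also have "... = M * Suc k'" by simp
    also have "... \<le> M * R" using k' by (intro mult_le_mono2) simp
    finally show ?thesis .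
   qed
   have n0: "c + M * k' > 0" using \<open>odd c\<close> by (cases c) auto
   have "?chr (int (c + M * k')) \<ge> 0"
   proof (rule quad_char_nonneg[OF S n0])
    fix p assume p: "prime p" "p dvd c + M * k'"
    have "p \<noteq> 2" "p \<notin> Q" using cop[of p k'] p by auto
    moreover have "2 < p" using \<open>p \<noteq> 2\<close> prime_ge_2_nat[OF p(1)] by auto
    moreover have "p < M * R" using dvd_imp_le[OF p(2) n0] n by simp
    ultimately show "?chr (int p) \<ge> 0" using nn[OF p(1)] unfolding M_def by simp
   qed
   then show ?thesis using chi[of k] k' by simp
  qed
  let ?K = "{k \<in> {0..<int R}. e * ?G k = 1}"
  have P1: "P1 \<le> card ?K"
  proof -
   have "(\<lambda>p. int (p div M)) ` cl c \<subseteq> ?K"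
   proof safe
    fix p assume p: "p \<in> cl c"
    then have p': "prime p" "p < M * R" "p \<notin> S" "p \<notin> Q" "p \<noteq> 2" "p mod M = c"
     unfolding cl_def P_def by auto
    have "p div M < R" using p'(2) by (intro less_mult_imp_div_less) (simp add: mult.commute)
    then show "int (p div M) \<in> {0..<int R}" by simp
    have "p = c + M * (p div M)" using p'(6) by (metis add.commute mult.commute div_mult_mod_eq)
    then have pe: "int p = int c + int M * int (p div M)" by (metis of_nat_add of_nat_mult)
    have "2 < p" using p'(1,5) prime_ge_2_nat[of p] by auto
    then have ge: "?chr (int p) \<ge> 0" using nn[OF p'(1)] p' unfolding M_def by simp
    have "odd p" using \<open>2 < p\<close> p' prime_odd_nat by auto
    moreover have "\<not> (\<exists>q\<in>S. int q dvd int p)"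
     using S p'(1,3) primes_dvd_imp_eq[of _ p] unfolding odd_primes_def int_dvd_int_iff by blast
    ultimately have "?chr (int p) \<noteq> 0" using quad_char_eq_0_iff[OF S] by simp
    then have "?chr (int p) = 1" using ge quad_char_values[of a b S "int p"] by auto
    then show "e * ?G (int (p div M)) = 1" using chi pe by metis
   qed
   moreover have "finite ?K" by (rule finite_subset[of _ "{0..<int R}"]) auto
   ultimately have "card ((\<lambda>p. int (p div M)) ` cl c) \<le> card ?K" by (intro card_mono)
   moreover have "inj_on (\<lambda>p. int (p div M)) (cl c)"
   proof (rule inj_onI)
    fix p p' assume "p \<in> cl c" "p' \<in> cl c" "int (p div M) = int (p' div M)"
    then have "p div M = p' div M" "p mod M = p' mod M" unfolding cl_def by auto
    then show "p = p'" by (metis div_mult_mod_eq)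
   qed
   ultimately show ?thesis unfolding P1_def by (simp add: card_image)
  qed
  have MS: "coprime (int M) (int q)" if "q \<in> S" for q
  proof -
   have q: "prime q" "2 < q" using that S by (auto simp: odd_primes_def)
   have "\<not> q dvd M"
   proof
    assume "q dvd M"
    then have "q dvd 2 ^ 3 \<or> q dvd \<Prod>Q" using q(1) unfolding M_def by (auto simp: prime_dvd_mult_iff)
    then show False
    proof
     assume "q dvd 2 ^ 3"
     then have "q dvd 2" using q(1) prime_dvd_power by blast
     then show False using q(2) by (auto dest: dvd_imp_le)
    next
     assume "q dvd \<Prod>Q"
     then obtain r where "r \<in> Q" "q dvd r" using q(1) Q(1) by (auto simp: prime_dvd_prod_iff)
     then show False using primes_dvd_imp_eq[of q r] q Q that by auto
    qed
   qed
   then show ?thesis using q(1) coprime_prime_intI[of q "int M"] by (simp add: int_dvd_int_iff)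
  qed
  have K2: "2 * H \<le> card ?K" using H P1 by simp
  have "H * (P1 - 2 * H)\<^sup>2 \<le> H * (card ?K - 2 * H)\<^sup>2"
   using P1 by (intro mult_le_mono2 power_mono diff_le_mono) auto
  also have "... \<le> R * (\<Prod>S + H\<^sup>2)" by (rule window_bound[OF S MS R e nonneg K2])
  finally show ?thesis .
 qed
 show ?thesis using first second unfolding M_def by blast
qed

section \<open>Small primes with prescribed quadratic character\<close>

text \<open>At an odd prime p this is the symbol of s times the product of T over p, written as a
  periodic function of p.\<close>

definition disc_char :: "int => nat set => int => int" where
 "disc_char s T = quad_char (disc_a s T) (disc_b T) (T - {2})"

text \<open>A squarefree integer is encoded by its sign s and its set T of primes. The last clause
  excludes 1, so that the square root generates a quadratic field and the character is
  nontrivial.\<close>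

definition sqfree_disc :: "int => nat set => bool" where
 "sqfree_disc s T \<longleftrightarrow> finite T \<and> (\<forall>q\<in>T. prime q) \<and> s \<in> {-1, 1} \<and> (s \<noteq> 1 \<or> T \<noteq> {})"

lemma two_power_card_primes_le:
 "finite Q ==> (\<And>q. q \<in> Q ==> prime q) ==> 2 ^ card Q \<le> \<Prod>Q" for Q :: "nat set"
 using prod_mono[of Q "\<lambda>_. 2" "\<lambda>q. q"] prime_ge_2_nat by simp

lemma card_primes_le_ln:
 assumes "finite Q" "\<And>q. q \<in> Q ==> prime q" "real (\<Prod>Q) \<le> X" "X \<ge> 1"
 shows "real (card Q) \<le> 2 * ln X"
proof -
 have "exp (real (card Q) * (1/2)) = exp (1/2) ^ card Q" by (rule exp_of_nat_mult)
 also have "... \<le> 2 ^ card Q"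
 proof (rule power_mono)
  have "exp (1/2) ^ 2 \<le> (2::real) ^ 2" using exp_le by (simp flip: exp_double)
  then show "exp (1/2) \<le> (2::real)" by (rule power2_le_imp_le) simp
 qed simp
 also have "... = real (2 ^ card Q)" by simp
 also have "... \<le> real (\<Prod>Q)" using two_power_card_primes_le[OF assms(1,2)] by (simp only: of_nat_le_iff)
 also have "... \<le> X" by fact
 finally have "real (card Q) * (1/2) \<le> ln X" using assms(4) by (subst ln_ge_iff) auto
 then show ?thesis by simp
qed

text \<open>At most K primes of Q are up to K, and the others, all larger than K, have product at
  most X.\<close>

lemma card_primes_le:
 assumes "finite Q" "\<And>q. q \<in> Q ==> prime q" "real (\<Prod>Q) \<le> X" "X \<ge> 1" "K \<ge> 2"
 shows "real (card Q) \<le> real K + ln X / ln (real K)"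
proof -
 let ?B = "{q \<in> Q. K < q}"
 have "Q \<subseteq> {1..K} \<union> ?B" using assms(2) by (auto simp: Suc_le_eq prime_gt_0_nat)
 then have "card Q \<le> card ({1..K} \<union> ?B)" using assms(1) by (intro card_mono) auto
 also have "... \<le> K + card ?B" using card_Un_le[of "{1..K}" ?B] by simp
 finally have 1: "card Q \<le> K + card ?B" .
 have "K ^ card ?B \<le> \<Prod>?B" using prod_mono[of ?B "\<lambda>_. K" "\<lambda>q. q"] by simp
 also have "... \<le> \<Prod>Q"
 proof (rule dvd_imp_le)
  show "\<Prod>?B dvd \<Prod>Q" using assms(1) by (intro prod_dvd_prod_subset) auto
  show "\<Prod>Q > 0" using assms(2) by (intro prod_pos) (auto simp: prime_gt_0_nat)
 qed
 finally have "real (K ^ card ?B) \<le> real (\<Prod>Q)" by (simp only: of_nat_le_iff)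
 then have "real K ^ card ?B \<le> X" using assms(3) by simp
 then have "ln (real K ^ card ?B) \<le> ln X" using assms(4,5) by (subst ln_le_cancel_iff) auto
 then have "real (card ?B) * ln (real K) \<le> ln X" using assms(5) by (simp add: ln_realpow)
 then have "real (card ?B) \<le> ln X / ln (real K)" using assms(5) by (simp add: le_divide_eq)
 then show ?thesis using 1 by linarith
qed

text \<open>The estimate of the divisor function for squarefree numbers. The cut K is taken with ln
  K \<ge> ln 2 / f, so that the primes above K contribute at most X^f.\<close>

lemma divisor_bound:
 fixes f :: real assumes "f > 0"
 shows "\<exists>c>0. \<forall>X\<ge>1. \<forall>Q. finite Q --> (\<forall>q\<in>Q. prime q) --> real (\<Prod>Q) \<le> X --> 2 ^ card Q \<le> c * X powr f"
proof -
 obtain K :: nat where K: "K \<ge> 2" "ln (real K) \<ge> ln 2 / f"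
 proof -
  define K where "K = max 2 (nat \<lceil>exp (ln 2 / f)\<rceil>)"
  have "exp (ln 2 / f) \<le> real K" unfolding K_def by linarith
  then have "ln 2 / f \<le> ln (real K)" by (subst ln_ge_iff) (auto simp: K_def)
  then show ?thesis using that[of K] by (simp add: K_def)
 qed
 have "2 ^ card Q \<le> 2 ^ K * X powr f"
  if *: "X \<ge> 1" "finite Q" "\<forall>q\<in>Q. prime q" "real (\<Prod>Q) \<le> X" for X :: real and Q :: "nat set"
 proof -
  have lK: "ln (real K) > 0" using K by simp
  have "ln 2 \<le> ln (real K) * f" using K assms by (simp add: pos_divide_le_eq)
  then have "ln 2 * ln X \<le> ln (real K) * f * ln X" using *(1) by (intro mult_right_mono) auto
  then have "ln X / ln (real K) * ln 2 \<le> f * ln X" using lK by (simp add: field_simps)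
  then have e: "2 powr (ln X / ln (real K)) \<le> X powr f" using *(1) by (simp add: powr_def)
  have "(2::real) ^ card Q = 2 powr real (card Q)" by (simp add: powr_realpow)
  also have "... \<le> 2 powr (real K + ln X / ln (real K))"
   using card_primes_le[OF *(2) _ *(4,1) K(1)] *(3) by (intro powr_mono) auto
  also have "... = 2 ^ K * 2 powr (ln X / ln (real K))" by (simp add: powr_add powr_realpow)
  also have "... \<le> 2 ^ K * X powr f" using e by simp
  finally show ?thesis .
 qed
 then show ?thesis by (intro exI[of _ "2 ^ K"]) auto
qed

abbreviation inert_le :: "int => nat set => nat => nat => bool" where
 "inert_le s T Y p \<equiv> prime p \<and> 2 < p \<and> p \<le> Y \<and> disc_char s T (int p) = -1"

context
 fixes s :: int and T :: "nat set" assumes sT: "sqfree_disc s T"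
begin

lemma sqfree_disc_facts:
 "odd_primes (T - {2})" "T - {2} \<noteq> {} \<or> odd (disc_a s T) \<or> odd (disc_b T)"
 "\<Prod>(T - {2}) \<le> \<Prod>T" "\<Prod>T \<le> 2 * \<Prod>(T - {2})" "\<Prod>(T - {2}) > 0"
proof -
 have T: "finite T" "\<forall>q\<in>T. prime q" "s \<in> {-1, 1}" "s \<noteq> 1 \<or> T \<noteq> {}" using sT by (auto simp: sqfree_disc_def)
 show S: "odd_primes (T - {2})" by (rule odd_primes_diff[OF T(1,2)])
 show "\<Prod>(T - {2}) > 0" using T by (auto intro!: prod_pos simp: prime_gt_0_nat)
 define b :: nat where "b = (if 2 \<in> T then 2 else 1)"
 have "1 \<le> b" "b \<le> 2" unfolding b_def by auto
 moreover have "\<Prod>T = b * \<Prod>(T - {2})"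
 proof (cases "2 \<in> T")
  case True
  then show ?thesis using prod.remove[OF T(1) True, of "\<lambda>x. x"] by (simp add: b_def)
 qed (simp add: b_def)
 ultimately show "\<Prod>(T - {2}) \<le> \<Prod>T" "\<Prod>T \<le> 2 * \<Prod>(T - {2})"
  by (metis mult_1 mult_le_mono1)+
 show "T - {2} \<noteq> {} \<or> odd (disc_a s T) \<or> odd (disc_b T)"
 proof (cases "2 \<in> T")
  case False
  then show ?thesis using T by (cases "T = {}") (auto simp: disc_a_def)
 qed (simp add: disc_b_def)
qed

lemma disc_char_values: "disc_char s T n \<in> {-1, 0, 1}"
 unfolding disc_char_def by (rule quad_char_values)

text \<open>Turns the negation of the desired conclusion into sieve data: if all inert primes up to
  Y divide m, they form a set Q of product at most m, disjoint from the odd primes of T, off which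
  the character is nonnegative up to Y.\<close>

lemma bad_primes: assumes bad: "\<forall>p. inert_le s T Y p --> p dvd m" and m: "m > 0"
 defines "Q \<equiv> {p. inert_le s T Y p}"
 shows "finite Q" "\<And>q. q \<in> Q ==> prime q" "Q \<inter> (T - {2}) = {}" "\<Prod>Q \<le> m"
  "\<And>p. prime p ==> p \<le> Y ==> 2 < p ==> p \<notin> Q ==> disc_char s T (int p) \<ge> 0"
proof -
 show fQ: "finite Q" unfolding Q_def by (rule finite_subset[of _ "{..Y}"]) auto
 show pQ: "\<And>q. q \<in> Q ==> prime q" unfolding Q_def by auto
 show "Q \<inter> (T - {2}) = {}"
 proof (rule ccontr)
  assume "Q \<inter> (T - {2}) \<noteq> {}"
  then obtain q where "q \<in> Q" "q \<in> T - {2}" by blast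
  then have "disc_char s T (int q) \<noteq> 0" "\<exists>r\<in>T - {2}. int r dvd int q"
   unfolding Q_def by (simp, blast intro: dvd_refl)
  then show False unfolding disc_char_def quad_char_eq_0_iff[OF sqfree_disc_facts(1)] by blast
 qed
 have "(\<Prod>q\<in>Q. int q) dvd int m" using fQ bad unfolding Q_def by (intro prod_primes_dvd) auto
 then have "int (\<Prod>Q) dvd int m" by simp
 then have "\<Prod>Q dvd m" by (simp only: int_dvd_int_iff)
 then show "\<Prod>Q \<le> m" using m by (rule dvd_imp_le)
 show "disc_char s T (int p) \<ge> 0" if "prime p" "p \<le> Y" "2 < p" "p \<notin> Q" for p
  using that disc_char_values[of "int p"] unfolding Q_def by auto
qed

end

text \<open>If all inert primes up to Y = D X^f divided m, sieving them out would leave at most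
  about D 2^|Q| primes up to Y, with 2^|Q| a constant times X^(f/3) at most. Chebyshev gives at
  least D X^f / (16 ln X) primes.\<close>

lemma small_prime_linear:
 fixes f :: real assumes f: "0 < f" "f < 1"
 shows "\<forall>\<^sub>F X in at_top. \<forall>s T m. sqfree_disc s T \<and> m > 0 \<and> real (m\<^sup>2 * \<Prod>T) < X -->
  (\<exists>p. prime p \<and> 2 < p \<and> real p \<le> real (\<Prod>T) * X powr f \<and> disc_char s T (int p) = -1 \<and> \<not> p dvd m)"
proof -
 obtain c where c: "c > 0" "\<And>X Q. X \<ge> 1 ==> finite Q ==> (\<forall>q\<in>Q. prime q) ==> real (\<Prod>Q) \<le> X
   ==> 2 ^ card Q \<le> c * X powr (f/3)" using divisor_bound[of "f/3"] f by auto
 obtain N0 where N0: "\<And>N. N \<ge> N0 ==> real N / (4 * ln (real N)) \<le> real (card {p. prime p \<and> p \<le> N})"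
  using primes_count_lower unfolding eventually_sequentially by auto
 \<comment> \<open>The final contradiction after division by D: the two sets of excluded primes cost
   4 ln X + 1, the sieved sum the last term on the left.\<close>
 have e1: "\<forall>\<^sub>F X in at_top. 4 * ln X + 1 + 8 * c * X powr (f/3) < X powr f / (16 * ln X)"
  using f c(1) by real_asymp
 have e2: "\<forall>\<^sub>F X in at_top. real N0 + 3 \<le> X powr f" using f by real_asymp
 from e1 e2 eventually_gt_at_top[of "2::real"] show ?thesis
 proof eventually_elim
  case (elim X)
  show ?case
  proof (intro allI impI, elim conjE)
   fix s T m
   assume sT: "sqfree_disc s T" and m: "m > 0" and less: "real (m\<^sup>2 * \<Prod>T) < X"
   note F = sqfree_disc_facts[OF sT]
   define D where "D = \<Prod>T"
   define Y where "Y = nat \<lfloor>real D * X powr f\<rfloor>"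
   have D: "D \<ge> 1" using F(3,5) unfolding D_def by linarith
   have L: "ln X > 0" using elim by simp
   have mD: "real m * real m * real D < X" using less by (simp add: D_def power2_eq_square)
   have mm: "real m \<le> real m * real m" "real m * real m \<le> real m * real m * real D" "real D \<le> real m * real m * real D"
    using m D by (auto simp: mult_le_cancel_left1 mult_le_cancel_right1 less_1_mult mult_ge1_I)
   have mX: "real m \<le> X" and DX: "real D \<le> X" using mD mm by linarith+
   have Xe: "X powr f \<ge> 3" using elim(2) by linarith
   have DXe: "X powr f \<le> real D * X powr f" using D Xe by (simp add: mult_le_cancel_right1)
   have Y: "real Y \<le> real D * X powr f" "real D * X powr f - 1 \<le> real Y"
    unfolding Y_def using DXe Xe by linarith+
   have YN: "Y \<ge> N0" "Y \<ge> 2" using Y(2) DXe elim(2) by linarith+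
   have "\<exists>p. inert_le s T Y p \<and> \<not> p dvd m"
   proof (rule ccontr)
    assume "\<not> ?thesis"
    then have bad: "\<forall>p. inert_le s T Y p --> p dvd m" by blast
    define Q where "Q = {p. inert_le s T Y p}"
    note Q = bad_primes[OF sT bad m, folded Q_def]
    have QX: "real (\<Prod>Q) \<le> X" using Q(4) mX by linarith
    have "card {p. prime p \<and> p \<le> Y} \<le> card (T - {2}) + card Q + 1 + 2 ^ card Q * 8 * \<Prod>(T - {2})"
     by (rule primes_count_nonneg_char[OF F(1,2) Q(1,2)]) (use Q(5) in \<open>auto simp: disc_char_def\<close>)
    also have "... \<le> card (T - {2}) + card Q + 1 + 2 ^ card Q * 8 * D"
     using F(3) unfolding D_def by simp
    finally have "real (card {p. prime p \<and> p \<le> Y}) \<le> real (card (T - {2}) + card Q + 1 + 2 ^ card Q * 8 * D)"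
     by (simp only: of_nat_le_iff)
    also have "... = real (card (T - {2})) + real (card Q) + 1 + 2 ^ card Q * 8 * real D" by simp
    also have "... \<le> 2 * ln X + 2 * ln X + 1 + (c * X powr (f/3)) * 8 * real D"
    proof (intro add_mono mult_right_mono)
     have "real (\<Prod>(T - {2})) \<le> X" using F(3) DX unfolding D_def by linarith
     then show "real (card (T - {2})) \<le> 2 * ln X"
      using F(1) elim by (intro card_primes_le_ln) (auto simp: odd_primes_def)
     show "real (card Q) \<le> 2 * ln X" using Q(1,2) QX elim by (intro card_primes_le_ln) auto
     show "2 ^ card Q \<le> c * X powr (f/3)" using Q(1,2) QX elim by (intro c(2)) auto
    qed auto
    also have "... \<le> (4 * ln X + 1 + 8 * c * X powr (f/3)) * real D"
    proof -
     have "4 * ln X + 1 \<le> (4 * ln X + 1) * real D" using D L by (simp add: mult_le_cancel_left1)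
     then show ?thesis by (simp add: algebra_simps)
    qed
    also have "... < X powr f / (16 * ln X) * real D"
     using elim(1) D by (intro mult_strict_right_mono) auto
    also have "... \<le> real Y / (4 * ln (real Y))"
    proof -
     have "real Y \<le> X * X"
     proof -
      have "X powr f \<le> X powr 1" using elim f by (intro powr_mono) auto
      then have "real D * X powr f \<le> X * X" using DX elim by (intro mult_mono) auto
      then show ?thesis using Y by linarith
     qed
     then have "ln (real Y) \<le> ln (X * X)" using YN elim by (subst ln_le_cancel_iff) auto
     also have "... = 2 * ln X" using elim by (simp add: ln_mult)
     finally have lY: "4 * ln (real Y) \<le> 8 * ln X" "4 * ln (real Y) > 0" using YN by auto
     have "X powr f / (16 * ln X) * real D = (real D * X powr f / 2) / (8 * ln X)" by (simp add: field_simps)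
     also have "... \<le> real Y / (8 * ln X)"
     proof (rule divide_right_mono)
      show "real D * X powr f / 2 \<le> real Y" using Y(2) DXe Xe by linarith
     qed (use L in simp)
     also have "... \<le> real Y / (4 * ln (real Y))" using lY by (intro divide_left_mono) auto
     finally show ?thesis .
    qed
    also have "... \<le> real (card {p. prime p \<and> p \<le> Y})" by (rule N0[OF YN(1)])
    finally show False by simp
   qed
   then obtain p where "prime p" "2 < p" "p \<le> Y" "disc_char s T (int p) = -1" "\<not> p dvd m" by blast
   then show "\<exists>p. prime p \<and> 2 < p \<and> real p \<le> real (\<Prod>T) * X powr f \<and> disc_char s T (int p) = -1 \<and> \<not> p dvd m"
    using Y(1) unfolding D_def by (intro exI[of _ p]) auto
  qed
 qed
qed

text \<open>On a progression with R of size sqrt n * X^f terms, where n is the odd part of D, the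
  window inequality forces R^2 to be at most n up to powers of ln X, a contradiction. The product of
  Q is at most m and m^2 D < X, so the progression ends before X^(1/2+2f); D \<ge> sqrt X ensures R
  \<le> n.\<close>

lemma small_prime_half:
 fixes f :: real assumes f: "0 < f" "f < 1/16"
 shows "\<forall>\<^sub>F X in at_top. \<forall>s T m. sqfree_disc s T \<and> m > 0 \<and> real (m\<^sup>2 * \<Prod>T) < X \<and> sqrt X \<le> real (\<Prod>T) -->
  (\<exists>p. prime p \<and> 2 < p \<and> real p \<le> X powr (1/2 + 2 * f) \<and> disc_char s T (int p) = -1 \<and> \<not> p dvd m)"
proof -
 obtain N0 where N0: "\<And>N. N \<ge> N0 ==> real N / (4 * ln (real N)) \<le> real (card {p. prime p \<and> p \<le> N})"
  using primes_count_lower unfolding eventually_sequentially by auto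
 have e1: "\<forall>\<^sub>F X in at_top. real N0 + 3 \<le> X powr f" using f by real_asymp
 have e2: "\<forall>\<^sub>F X in at_top. 16 * X powr (1/2 + f) \<le> X powr (1/2 + 2 * f)" using f by real_asymp
 have e3: "\<forall>\<^sub>F X in at_top. 4 * ln X + 1 \<le> X powr f / (16 * ln X)" using f by real_asymp
 have e4: "\<forall>\<^sub>F X in at_top. 2 * X powr f \<le> sqrt (sqrt X / 2)" using f by real_asymp
 have e5: "\<forall>\<^sub>F X in at_top. 16384 * (ln X)\<^sup>2 \<le> X powr f" using f by real_asymp
 have e6: "\<forall>\<^sub>F X in at_top. 33554432 * (ln X) ^ 4 < (X powr f)\<^sup>2" using f by real_asymp
 have e7: "\<forall>\<^sub>F X in at_top. X powr (1/2 + 2 * f) \<le> X" using f by real_asymp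
 from e1 e2 e3 e4 e5 e6 e7 eventually_gt_at_top[of "3::real"] show ?thesis
 proof eventually_elim
  case (elim X)
  show ?case
  proof (intro allI impI, elim conjE)
   fix s T m
   assume sT: "sqfree_disc s T" and m: "m > 0" and less: "real (m\<^sup>2 * \<Prod>T) < X" and big: "sqrt X \<le> real (\<Prod>T)"
   note F = sqfree_disc_facts[OF sT]
   define D where "D = \<Prod>T"
   define S where "S = T - {2}"
   define n where "n = \<Prod>S"
   define L where "L = ln X"
   have nD: "n \<le> D" "D \<le> 2 * n" "n > 0" using F(3,4,5) unfolding D_def S_def n_def by auto
   have L: "L \<ge> 1" unfolding L_def using elim(8) exp_le by (subst ln_ge_iff) linarith+
   have mD: "real m * real m * real D < X" using less by (simp add: D_def power2_eq_square)
   have mm: "real m \<le> real m * real m" "real m * real m \<le> real m * real m * real D" "real D \<le> real m * real m * real D"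
    using m nD by (auto simp: mult_le_cancel_left1 mult_le_cancel_right1 less_1_mult mult_ge1_I)
   have mX: "real m \<le> X" and DX: "real D \<le> X" using mD mm by linarith+
   define Y where "Y = nat \<lfloor>X powr (1/2 + 2 * f)\<rfloor>"
   have Y: "real Y \<le> X powr (1/2 + 2 * f)" "\<And>k. real k \<le> X powr (1/2 + 2 * f) ==> k \<le> Y"
    unfolding Y_def by (simp_all add: le_nat_floor)
   have "\<exists>p. inert_le s T Y p \<and> \<not> p dvd m"
   proof (rule ccontr)
    assume "\<not> ?thesis"
    then have bad: "\<forall>p. inert_le s T Y p --> p dvd m" by blast
    define Q where "Q = {p. inert_le s T Y p}"
    note Q = bad_primes[OF sT bad m, folded Q_def]
    have QX: "real (\<Prod>Q) \<le> X" using Q(4) mX by linarith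
    have Q1: "\<Prod>Q \<ge> 1" using Q(2) by (simp add: Suc_le_eq prod_pos prime_gt_0_nat)
    \<comment> \<open>Just above the length sqrt n at which the windows start to show
      cancellation.\<close>
    define R where "R = nat \<lceil>sqrt (real n) * X powr f\<rceil>"
    have Xe: "X powr f \<ge> 3" using elim(1) by linarith
    have sn: "sqrt (real n) \<ge> 1" using nD by simp
    have sX: "X powr f \<le> sqrt (real n) * X powr f" using sn Xe by (simp add: mult_le_cancel_right1)
    have R: "sqrt (real n) * X powr f \<le> real R" "real R \<le> sqrt (real n) * X powr f + 1"
     unfolding R_def using sX Xe by linarith+
    have R2: "real R \<le> 2 * (sqrt (real n) * X powr f)" using R sX Xe by linarith
    have RN: "real R \<ge> X powr f" using R sX by linarith
    have "2 * X powr f \<le> sqrt (real n)"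
    proof -
     have "sqrt X / 2 \<le> real n" using big nD(2) unfolding D_def by linarith
     then have "sqrt (sqrt X / 2) \<le> sqrt (real n)" by (rule real_sqrt_le_mono)
     then show ?thesis using elim(4) by linarith
    qed
    then have "2 * (sqrt (real n) * X powr f) \<le> sqrt (real n) * sqrt (real n)"
     using sn mult_left_mono[of "2 * X powr f" "sqrt (real n)" "sqrt (real n)"] by simp
    then have Rn: "R \<le> n" using R2 nD by simp
    let ?MR = "8 * \<Prod>Q * R"
    \<comment> \<open>The key size estimate: prod Q * sqrt n \<le> m sqrt D < sqrt X. The spare
      factor X^f absorbs the constant 16.\<close>
    have MRY: "?MR \<le> Y"
    proof (rule Y(2))
     have "real (\<Prod>Q) * sqrt (real n) \<le> sqrt X"
     proof (rule real_le_rsqrt)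
      have "(real (\<Prod>Q) * sqrt (real n))\<^sup>2 = real (\<Prod>Q) * real (\<Prod>Q) * real n"
       by (simp add: power_mult_distrib) (simp add: power2_eq_square)
      also have "... \<le> real m * real m * real D"
       using Q(4) nD by (intro mult_mono mult_nonneg_nonneg of_nat_0_le_iff of_nat_mono)
      finally show "(real (\<Prod>Q) * sqrt (real n))\<^sup>2 \<le> X" using mD by linarith
     qed
     then have "real (\<Prod>Q) * sqrt (real n) * X powr f \<le> sqrt X * X powr f"
      by (intro mult_right_mono) auto
     also have "... = X powr (1/2 + f)" using elim(8) by (simp add: powr_add powr_half_sqrt)
     finally have "16 * (real (\<Prod>Q) * sqrt (real n) * X powr f) \<le> X powr (1/2 + 2 * f)"
      using elim(2) by linarith
     moreover have "real ?MR \<le> 8 * real (\<Prod>Q) * (2 * (sqrt (real n) * X powr f))"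
      unfolding of_nat_mult using R2 by (intro mult_mono) (auto simp del: of_nat_prod)
     ultimately show "real ?MR \<le> X powr (1/2 + 2 * f)" by (simp add: mult_ac)
    qed
    have MRX: "real ?MR \<le> X" using MRY Y(1) elim(7) by linarith
    have nn: "\<And>p. prime p ==> p < ?MR ==> 2 < p ==> p \<notin> Q
      ==> quad_char (disc_a s T) (disc_b T) S (int p) \<ge> 0"
     using Q(5) MRY unfolding disc_char_def S_def by auto
    obtain P1 where P1: "card {p. prime p \<and> p < ?MR} \<le> card S + card Q + 1 + 8 * \<Prod>Q * P1"
     "\<And>H. 2 * H \<le> P1 ==> H * (P1 - 2 * H)\<^sup>2 \<le> R * (n + H\<^sup>2)"
     using quad_char_window[OF F(1)[folded S_def] Q(1,2) Q(3)[folded S_def] nn Rn[unfolded n_def]]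
     unfolding n_def by blast
    have MR8: "real ?MR \<ge> 8 * real R"
    proof -
     have "8 * 1 * R \<le> ?MR" using Q1 by (intro mult_le_mono) auto
     then show ?thesis by linarith
    qed
    \<comment> \<open>One less than the end point, since Chebyshev's bound counts primes up to N
      inclusive.\<close>
    define N where "N = ?MR - 1"
    have N: "real N = real ?MR - 1" "N \<ge> N0" "N \<ge> 2" using MR8 RN elim(1) unfolding N_def by linarith+
    have "real N / (4 * L) \<le> real N / (4 * ln (real N))"
    proof -
     have "ln (real N) \<le> L" unfolding L_def using N MRX elim(8) by (subst ln_le_cancel_iff) linarith+
     moreover have "ln (real N) > 0" using N(3) by simp
     ultimately show ?thesis using L by (intro divide_left_mono) auto
    qed
    also have "... \<le> real (card {p. prime p \<and> p \<le> N})" by (rule N0[OF N(2)])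
    also have "{p. prime p \<and> p \<le> N} = {p. prime p \<and> p < ?MR}" using N(3) unfolding N_def by auto
    also have "real (card ...) \<le> real (card S + card Q + 1 + 8 * \<Prod>Q * P1)" using P1(1) by (simp only: of_nat_le_iff)
    also have "... \<le> 2 * L + 2 * L + 1 + 8 * real (\<Prod>Q) * real P1"
    proof -
     have "real (\<Prod>S) \<le> X" using nD(1) DX unfolding n_def by linarith
     then have "real (card S) \<le> 2 * L"
      unfolding L_def using F(1) elim(8) by (intro card_primes_le_ln) (auto simp: odd_primes_def S_def)
     moreover have "real (card Q) \<le> 2 * L" unfolding L_def using Q(1,2) QX elim(8) by (intro card_primes_le_ln) auto
     ultimately show ?thesis by simp
    qed
    finally have b0: "(real ?MR - 1) / (4 * L) \<le> 4 * L + 1 + 8 * real (\<Prod>Q) * real P1" using N(1) by simp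
    define q where "q = real (\<Prod>Q)"
    define mr where "mr = real ?MR"
    have q1: "q \<ge> 1" unfolding q_def using Q1 by linarith
    have mr: "mr = 8 * q * real R" unfolding mr_def q_def by (simp only: of_nat_mult of_nat_numeral)
    have b1: "(mr - 1) / (4 * L) \<le> 4 * L + 1 + 8 * q * real P1" using b0 unfolding mr_def q_def .
    have mr8: "real R \<le> mr / 8" using MR8 unfolding mr_def by linarith
    \<comment> \<open>Chebyshev gives about 8 q R / (4 L) primes below 8 q R, of which the chosen
      class has its share; the 16 in place of 4 absorbs the remaining terms.\<close>
    have "8 * q * (real R / (16 * L)) \<le> 8 * q * real P1"
    proof -
     have "4 * L + 1 \<le> real R / (16 * L)"
      using elim(3) divide_right_mono[OF RN, of "16 * L"] L unfolding L_def by linarith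
     also have "... \<le> mr / 8 / (16 * L)" using mr8 L by (intro divide_right_mono) auto
     finally have 1: "4 * L + 1 \<le> mr / (128 * L)" by simp
     have "mr / 2 / (4 * L) \<le> (mr - 1) / (4 * L)"
      using mr8 RN Xe L by (intro divide_right_mono) linarith+
     then have 2: "mr / (8 * L) \<le> 4 * L + 1 + 8 * q * real P1" using b1 by simp
     define z where "z = mr / L"
     have z16: "8 * q * (real R / (16 * L)) = z / 16" unfolding z_def mr by simp
     have "mr / (128 * L) = z / 128" "mr / (8 * L) = z / 8" unfolding z_def by simp_all
     moreover have "z \<ge> 0" unfolding z_def using L mr8 by (intro divide_nonneg_nonneg) auto
     ultimately show ?thesis using 1 2 z16 by linarith
    qed
    moreover have "8 * q > 0" using q1 by linarith
    ultimately have P1R: "real R / (16 * L) \<le> real P1" by (rule mult_left_le_imp_le)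
    \<comment> \<open>P1 - 2H is at least R/(32 L), so the left side of the window inequality
      divided by R is at least H R / (1024 L^2). With 8192 = 8 * 1024, H^2 is at most an eighth of
      this, and the term n has to carry the rest.\<close>
    define H where "H = nat \<lfloor>real R / (8192 * L\<^sup>2)\<rfloor>"
    have L2: "L\<^sup>2 > 0" "L \<le> L\<^sup>2" using L by (auto simp: power2_eq_square)
    have H1: "real H \<le> real R / (8192 * L\<^sup>2)" "real R / (8192 * L\<^sup>2) - 1 \<le> real H"
    proof -
     have "real R / (8192 * L\<^sup>2) \<ge> 0" by simp
     then have "real H = of_int \<lfloor>real R / (8192 * L\<^sup>2)\<rfloor>" unfolding H_def by simp
     then show "real H \<le> real R / (8192 * L\<^sup>2)" "real R / (8192 * L\<^sup>2) - 1 \<le> real H" by linarith+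
    qed
    have "16384 * L\<^sup>2 \<le> real R" using elim(5) RN unfolding L_def by linarith
    then have "2 \<le> real R / (8192 * L\<^sup>2)" using L2 by (simp add: le_divide_eq)
    then have H2: "real R / (16384 * L\<^sup>2) \<le> real H" "real H \<ge> 1" using H1(2) by (simp_all)
    have "real R / (8192 * L\<^sup>2) \<le> real R / (8192 * L)" using L L2 by (intro divide_left_mono) auto
    also have "... \<le> real R / (64 * L)" using L by (intro divide_left_mono) auto
    finally have H3: "real H \<le> real R / (64 * L)" using H1 by linarith
    define z where "z = real R / L"
    have z: "real R / (64 * L) = z / 64" "real R / (16 * L) = z / 16" "z \<ge> 0" unfolding z_def using L by simp_all
    have "2 * real H \<le> real P1" using H3 P1R z by linarith
    then have HP: "2 * H \<le> P1" by linarith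
    have "real (P1 - 2 * H) = real P1 - 2 * real H" using HP by (simp add: of_nat_diff)
    then have "z / 32 \<le> real (P1 - 2 * H)" using H3 P1R z by linarith
    then have "(z / 32)\<^sup>2 \<le> (real (P1 - 2 * H))\<^sup>2" using z by (intro power_mono) auto
    then have "real H * (z / 32)\<^sup>2 \<le> real H * (real (P1 - 2 * H))\<^sup>2" by (intro mult_left_mono) auto
    also have "... = real (H * (P1 - 2 * H)\<^sup>2)" by simp
    also have "... \<le> real (R * (n + H\<^sup>2))" using P1(2)[OF HP] by (simp only: of_nat_le_iff)
    also have "... = real R * (real n + real H * real H)" by (simp add: power2_eq_square)
    finally have k1: "real H * (z / 32)\<^sup>2 \<le> real R * (real n + real H * real H)" .
    have R0: "real R > 0" using RN Xe by linarith
    have "real H * (z / 32)\<^sup>2 = real R * (real H * real R / (1024 * L\<^sup>2))"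
     unfolding z_def by (simp add: power2_eq_square)
    with k1 have "real R * (real H * real R / (1024 * L\<^sup>2)) \<le> real R * (real n + real H * real H)" by simp
    then have k2: "real H * real R / (1024 * L\<^sup>2) \<le> real n + real H * real H"
     using R0 by (rule mult_left_le_imp_le)
    have "real H * real H \<le> real H * (real R / (8192 * L\<^sup>2))" using H1 by (intro mult_left_mono) auto
    moreover define w where "w = real H * real R / L\<^sup>2"
    have "real H * (real R / (8192 * L\<^sup>2)) = w / 8192" "real H * real R / (1024 * L\<^sup>2) = w / 1024"
     "w \<ge> 0" unfolding w_def by simp_all
    ultimately have k3: "w / 2048 \<le> real n" using k2 by linarith
    have "real R / (16384 * L\<^sup>2) * (real R / L\<^sup>2) \<le> real H * (real R / L\<^sup>2)"
     using H2 by (intro mult_right_mono) auto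
    also have "... = w" unfolding w_def by simp
    finally have "(real R)\<^sup>2 / (16384 * L ^ 4) \<le> w"
     by (simp add: power2_eq_square power4_eq_xxxx mult_ac)
    then have "(real R)\<^sup>2 / (16384 * L ^ 4) \<le> 2048 * real n" using k3 by linarith
    then have "(real R)\<^sup>2 \<le> 2048 * real n * (16384 * L ^ 4)" using L by (simp add: pos_divide_le_eq)
    moreover have "(sqrt (real n) * X powr f)\<^sup>2 \<le> (real R)\<^sup>2"
     using R(1) by (intro power_mono) auto
    ultimately have "real n * (X powr f)\<^sup>2 \<le> real n * (33554432 * L ^ 4)"
     by (simp add: power_mult_distrib mult_ac)
    then have "(X powr f)\<^sup>2 \<le> 33554432 * L ^ 4" using nD(3) by simp
    then show False using elim(6) unfolding L_def by linarith
   qed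
   then obtain p where "prime p" "2 < p" "p \<le> Y" "disc_char s T (int p) = -1" "\<not> p dvd m" by blast
   then show "\<exists>p. prime p \<and> 2 < p \<and> real p \<le> X powr (1/2 + 2 * f) \<and> disc_char s T (int p) = -1 \<and> \<not> p dvd m"
    using Y(1) by (intro exI[of _ p]) auto
  qed
 qed
qed

section \<open>Discriminants without small inert primes\<close>

text \<open>The allowance 4 ln X is for the primes at which the character differs from 1 although
  the field has no small odd Frobenius: divisors of the square part of the discriminant and members
  of T, at most 2 ln X of each.\<close>

definition exceptional :: "nat => real => (int \<times> nat set) set" where
 "exceptional A X = {(s, T). sqfree_disc s T \<and> real (\<Prod>T) \<le> X \<and>
   real (card {p. prime p \<and> 2 < p \<and> real p \<le> ln X ^ A \<and> disc_char s T (int p) \<noteq> 1}) \<le> 4 * ln X}"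

lemma finite_exceptional: "finite (exceptional A X)"
proof (rule finite_subset)
 show "exceptional A X \<subseteq> {-1, 1} \<times> Pow {..nat \<lfloor>X\<rfloor>}"
 proof (rule subsetI)
  fix e assume "e \<in> exceptional A X"
  then obtain s T where e: "e = (s, T)" and sT: "sqfree_disc s T" "real (\<Prod>T) \<le> X"
   unfolding exceptional_def by auto
  have "q \<le> nat \<lfloor>X\<rfloor>" if q: "q \<in> T" for q
  proof -
   have "q dvd \<Prod>T" using sT q by (intro dvd_prodI) (auto simp: sqfree_disc_def)
   moreover have "\<Prod>T > 0" using sT by (intro prod_pos) (auto simp: sqfree_disc_def prime_gt_0_nat)
   ultimately have "q \<le> \<Prod>T" by (rule dvd_imp_le)
   then have "real q \<le> X" using sT(2) by linarith
   then show ?thesis by (rule le_nat_floor)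
  qed
  then show "e \<in> {-1, 1} \<times> Pow {..nat \<lfloor>X\<rfloor>}" using sT(1) e unfolding sqfree_disc_def by auto
 qed
qed auto

text \<open>The large sieve with the primes up to L^A, L = ln X, and j about 3 L / ((A-2) ln L).
  Then C is at least X^3, and y^j / C is at most L^(2j), which is L^2 X^(6/(A-2)). The factor 128 is
  16 for each of 8 classes of discriminants.\<close>

lemma card_exceptional:
 fixes A :: nat assumes A: "A \<ge> 4"
 shows "\<forall>\<^sub>F X in at_top. real (card (exceptional A X)) \<le> 128 * (ln X)\<^sup>2 * X powr (6 / real (A - 2))"
proof -
 obtain N0 where N0: "\<And>N. N \<ge> N0 ==> real N / (4 * ln (real N)) \<le> real (card {p. prime p \<and> p \<le> N})"
  using primes_count_lower unfolding eventually_sequentially by auto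
 define A2 where "A2 = real (A - 2)"
 have A2: "A2 \<ge> 2" "A2 = real A - 2" using A unfolding A2_def by auto
 have e1: "\<forall>\<^sub>F X::real in at_top. 16 * real A * ln (ln X) * 2 + 16 \<le> ln X" by real_asymp
 have e2: "\<forall>\<^sub>F X::real in at_top. real N0 + 20 \<le> ln X" by real_asymp
 have e3: "\<forall>\<^sub>F X::real in at_top. 3 * ln X / (A2 * ln (ln X)) + 1 \<le> ln X" using A2 by real_asymp
 have e4: "\<forall>\<^sub>F X::real in at_top. 1 \<le> ln (ln X)" by real_asymp
 from e1 e2 e3 e4 eventually_gt_at_top[of "64::real"] show ?thesis
 proof eventually_elim
  case (elim X)
  define L where "L = ln X"
  define l where "l = ln L"
  have L: "L \<ge> 20" "real N0 \<le> L" using elim(2) unfolding L_def by linarith+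
  have l: "l \<ge> 1" using elim(4) unfolding l_def L_def .
  have LA: "L ^ A = L * L ^ (A - 1)" "L ^ (A - 1) = L * L ^ (A - 2)" "L ^ (A - 2) \<ge> L ^ 2"
   using A L by (simp_all flip: power_Suc add: Suc_diff_Suc numeral_2_eq_2 power_increasing)
  have LA0: "L ^ (A - 2) \<ge> 1" using L by (intro one_le_power) auto
  have LA1: "L ^ (A - 1) \<ge> L" using LA(2) LA0 L by (simp add: mult_le_cancel_left1)
  have LAL: "L ^ A \<ge> L" using LA(1) LA1 L by (simp add: mult_le_cancel_left1)
  define y where "y = nat \<lfloor>L ^ A\<rfloor>"
  have y: "real y \<le> L ^ A" "L ^ A - 1 \<le> real y"
  proof -
   have "L ^ A \<ge> 0" using L by simp
   then have "real y = of_int \<lfloor>L ^ A\<rfloor>" unfolding y_def by simp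
   then show "real y \<le> L ^ A" "L ^ A - 1 \<le> real y" by linarith+
  qed
  have yN: "y \<ge> N0" "y \<ge> 2"
  proof -
   have "real N0 + 19 \<le> real y" using y(2) LAL elim(2) unfolding L_def by linarith
   then show "y \<ge> N0" "y \<ge> 2" by linarith+
  qed
  define P where "P = {p. prime p \<and> 2 < p \<and> p \<le> y}"
  have fP: "finite P" unfolding P_def by (rule finite_subset[of _ "{..y}"]) auto
  have Py: "{p. prime p \<and> 2 < p \<and> real p \<le> L ^ A \<and> Q p} = {p \<in> P. Q p}" for Q
  proof -
   have "real p \<le> L ^ A \<longleftrightarrow> p \<le> y" for p
    using y(1) le_nat_floor[of p "L ^ A"] unfolding y_def[symmetric] by auto
   then show ?thesis unfolding P_def by auto
  qed
  have cP: "L ^ (A - 1) \<le> real (card P)"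
  proof -
   have "card {p. prime p \<and> p \<le> y} \<le> card (insert 2 P)"
   proof (rule card_mono)
    show "{p. prime p \<and> p \<le> y} \<subseteq> insert 2 P"
     unfolding P_def using prime_ge_2_nat le_neq_implies_less by blast
   qed (use fP in auto)
   also have "... \<le> card P + 1" by (simp add: card_insert_if fP)
   finally have 1: "real (card {p. prime p \<and> p \<le> y}) \<le> real (card P) + 1" by linarith
   have "ln (real y) \<le> ln (L ^ A)" using y(1) yN L by (subst ln_le_cancel_iff) auto
   also have "... = real A * l" using L unfolding l_def by (simp add: ln_realpow)
   finally have ly: "ln (real y) \<le> real A * l" .
   have "ln (real y) > 0" using yN by simp
   then have "real y / (4 * (real A * l)) \<le> real y / (4 * ln (real y))"
    using ly A l by (intro divide_left_mono) auto
   moreover have "L ^ A / 2 / (4 * (real A * l)) \<le> real y / (4 * (real A * l))"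
    using y(2) LAL L l by (intro divide_right_mono) auto
   ultimately have 2: "L ^ A / 2 / (4 * (real A * l)) \<le> real (card P) + 1"
    using N0[OF yN(1)] 1 by linarith
   have "2 * (8 * real A * l) \<le> L"
   proof -
    have "real A * l \<ge> 0" using l by simp
    then show ?thesis using elim(1) unfolding L_def[symmetric] l_def[symmetric] by linarith
   qed
   then have "2 * (8 * real A * l) * L ^ (A - 1) \<le> L ^ A"
    unfolding LA(1) using L by (intro mult_right_mono) auto
   then have "2 * L ^ (A - 1) \<le> L ^ A / (8 * real A * l)" using A l by (simp add: le_divide_eq mult_ac)
   also have "... = L ^ A / 2 / (4 * (real A * l))" by simp
   finally have "2 * L ^ (A - 1) \<le> real (card P) + 1" using 2 by linarith
   then show ?thesis using LA1 L by linarith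
  qed
  \<comment> \<open>The least j for which (L^(A-2))^j reaches X^3, which dominates 64 X^2.\<close>
  define j where "j = nat \<lceil>3 * L / (A2 * l)\<rceil>"
  have j0: "3 * L / (A2 * l) > 0" using L A2 l by simp
  have j: "3 * L / (A2 * l) \<le> real j" "real j \<le> 3 * L / (A2 * l) + 1" "j \<ge> 1"
   unfolding j_def using j0 by linarith+
  have jL: "real j \<le> L" using j(2) elim(3) unfolding L_def l_def by linarith
  define k where "k = nat \<lfloor>4 * L\<rfloor>"
  have k: "real k \<le> 4 * L" unfolding k_def using L by linarith
  have "real (4 * k * j) \<le> 4 * (4 * L) * L"
   unfolding of_nat_mult using k jL L by (intro mult_mono) auto
  also have "... \<le> L ^ (A - 1)"
  proof -
   have "16 * L ^ 2 \<le> L * L ^ 2" using L by (intro mult_right_mono) auto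
   also have "... \<le> L * L ^ (A - 2)" using LA(3) L by (intro mult_left_mono) auto
   finally show ?thesis using LA(2) by (simp add: power2_eq_square)
  qed
  finally have "real (4 * k * j) \<le> real (card P)" using cP by linarith
  then have kj: "4 * k * j \<le> card P" by linarith
  have jP: "j \<le> card P" using jL LA1 cP by linarith
  define C where "C = card P choose j"
  \<comment> \<open>C(|P|, j) is at least (|P|/j)^j. Of the exponent A, one power of L is lost in
    Chebyshev's bound for |P| and one to j \<le> L.\<close>
  have C1: "(L ^ (A - 2)) ^ j \<le> real C"
  proof -
   have "L ^ (A - 2) \<le> real (card P) / real j"
   proof -
    have "L ^ (A - 2) * real j \<le> L ^ (A - 2) * L" using jL L by (intro mult_left_mono) auto
    also have "... \<le> real (card P)" using cP LA(2) by (simp add: mult.commute)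
    finally show ?thesis using j(3) by (simp add: le_divide_eq)
   qed
   then have "(L ^ (A - 2)) ^ j \<le> (real (card P) / real j) ^ j" using L by (intro power_mono) auto
   also have "... \<le> real C" unfolding C_def using binomial_ge_n_over_k_pow_k[OF jP] by simp
   finally show ?thesis .
  qed
  have lnLj: "ln ((L ^ (A - 2)) ^ j) = real j * (A2 * l)"
   using L unfolding A2_def l_def by (simp add: ln_realpow)
  have "3 * L \<le> real j * (A2 * l)" using j(1) A2 l by (simp add: divide_le_eq)
  then have "X powr 3 \<le> (L ^ (A - 2)) ^ j"
   unfolding lnLj[symmetric] using elim(5) L by (simp add: powr_def L_def ln_ge_iff)
  then have C2: "X ^ 3 \<le> real C" using C1 elim(5) by (simp add: powr_numeral)
  define Xn where "Xn = nat \<lfloor>X\<rfloor>"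
  have Xn: "real Xn \<le> X" "Xn > 0" unfolding Xn_def using elim(5) by linarith+
  have "real (64 * Xn\<^sup>2) \<le> 64 * X\<^sup>2" using Xn by simp
  also have "... \<le> X * X\<^sup>2" using elim(5) by (intro mult_right_mono) auto
  also have "... = X ^ 3" by (simp add: power2_eq_square power3_eq_cube)
  finally have "real (64 * Xn\<^sup>2) \<le> real C" using C2 by linarith
  then have XC: "64 * Xn\<^sup>2 \<le> card P choose j" unfolding C_def by (simp only: of_nat_le_iff)
  define W where "W = 16 * (L\<^sup>2 * X powr (6 / A2))"
  \<comment> \<open>The sieve needs a common character modulo 8, hence the splitting by a and b.
    With s and b fixed, deleting 2 from T is also injective.\<close>
  define Es where "Es s a b = {e \<in> exceptional A X. fst e = s \<and> disc_a (fst e) (snd e) = a \<and> disc_b (snd e) = b}" for s a b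
  have part: "real (card (Es s a b)) \<le> W" for s a b
  proof -
   let ?E = "Es s a b"
   let ?f = "\<lambda>e :: int \<times> nat set. snd e - {2 :: nat}"
   have inj: "inj_on ?f ?E"
   proof (rule inj_onI)
    fix e e' assume *: "e \<in> ?E" "e' \<in> ?E" "snd e - {2} = snd e' - {2}"
    then have "2 \<in> snd e \<longleftrightarrow> 2 \<in> snd e'" unfolding Es_def disc_b_def by (auto split: if_splits)
    then have "snd e = snd e'" using *(3) by blast
    then show "e = e'" using * unfolding Es_def by (simp add: prod_eq_iff)
   qed
   have fE: "finite ?E" unfolding Es_def using finite_exceptional[of A X] by simp
   have "card (?f ` ?E) * (card P choose j) \<le> 8 * (y ^ j + 1)"
   proof (rule large_sieve_quad_char[where a = a and b = b and k = k and X = Xn])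
    show "finite P" by fact
    show "prime p" "p \<le> y" if "p \<in> P" for p using that unfolding P_def by auto
    show "finite (?f ` ?E)" using fE by simp
    fix S assume "S \<in> ?f ` ?E"
    then obtain T where T: "(s, T) \<in> exceptional A X" "disc_a s T = a" "disc_b T = b" "S = T - {2}"
     unfolding Es_def by auto
    then have sT: "sqfree_disc s T" "real (\<Prod>T) \<le> X" unfolding exceptional_def by auto
    note F = sqfree_disc_facts[OF sT(1)]
    show "odd_primes S" using F T(4) by simp
    have "real (\<Prod>S) \<le> X" using F(3) sT(2) unfolding T(4) by linarith
    then show "\<Prod>S \<le> Xn" unfolding Xn_def by (rule le_nat_floor)
    have "real (card {p \<in> P. disc_char s T (int p) \<noteq> 1}) \<le> 4 * L"
     using T(1) unfolding exceptional_def L_def[symmetric] Py by auto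
    then have "card {p \<in> P. disc_char s T (int p) \<noteq> 1} \<le> k" unfolding k_def by (rule le_nat_floor)
    then show "card {p \<in> P. quad_char a b S (int p) \<noteq> 1} \<le> k" unfolding disc_char_def using T by simp
   qed (use kj j Xn XC in auto)
   then have "card ?E * C \<le> 8 * (y ^ j + 1)" unfolding C_def by (simp add: card_image[OF inj])
   then have "real (card ?E * C) \<le> real (8 * (y ^ j + 1))" by (simp only: of_nat_le_iff)
   then have "real (card ?E) * real C \<le> 8 * (real y ^ j + 1)" by simp
   also have "... \<le> 16 * (L ^ A) ^ j"
   proof -
    have "real y ^ j \<le> (L ^ A) ^ j" using y by (intro power_mono) auto
    moreover have "1 \<le> (L ^ A) ^ j" using LAL L by (intro one_le_power) auto
    ultimately have "real y ^ j + 1 \<le> (L ^ A) ^ j + (L ^ A) ^ j" by (rule add_mono)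
    then have "8 * (real y ^ j + 1) \<le> 8 * ((L ^ A) ^ j + (L ^ A) ^ j)" by (intro mult_left_mono) simp_all
    then show ?thesis by simp
   qed
   also have "(L ^ A) ^ j = (L ^ (A - 2)) ^ j * (L\<^sup>2) ^ j"
    using LA by (simp flip: power_mult_distrib add: power2_eq_square mult_ac)
   finally have "real (card ?E) * (L ^ (A - 2)) ^ j \<le> 16 * ((L ^ (A - 2)) ^ j * (L\<^sup>2) ^ j)"
    using mult_left_mono[OF C1, of "real (card ?E)"] by linarith
   moreover have "(L ^ (A - 2)) ^ j > 0" using L by simp
   ultimately have "real (card ?E) \<le> 16 * (L\<^sup>2) ^ j" by simp
   also have "(L\<^sup>2) ^ j \<le> L\<^sup>2 * X powr (6 / A2)"
   proof -
    have "(L\<^sup>2) ^ j = exp (real j * (2 * l))"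
     using L unfolding l_def by (simp add: exp_of_nat_mult exp_double)
    also have "... \<le> exp (6 / A2 * L + 2 * l)"
    proof -
     have "real j * (2 * l) \<le> (3 * L / (A2 * l) + 1) * (2 * l)" using j(2) l by (intro mult_right_mono) auto
     also have "... = 6 / A2 * L + 2 * l" using A2 l by (simp add: field_simps)
     finally show ?thesis by simp
    qed
    also have "... = L\<^sup>2 * X powr (6 / A2)"
     using L elim(5) by (simp add: exp_add powr_def L_def l_def exp_double)
    finally show ?thesis .
   qed
   finally show ?thesis unfolding W_def by simp
  qed
  define I where "I = {-1, 1 :: int} \<times> {0, 1 :: nat} \<times> {0, 1 :: nat}"
  have fI: "finite I" "card I = 8" unfolding I_def by (simp_all add: card_cartesian_product)
  have "exceptional A X \<subseteq> (\<Union>x\<in>I. Es (fst x) (fst (snd x)) (snd (snd x)))"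
  proof (rule subsetI)
   fix e assume e: "e \<in> exceptional A X"
   then have "fst e \<in> {-1, 1}" unfolding exceptional_def sqfree_disc_def by auto
   moreover have "disc_a (fst e) (snd e) \<in> {0, 1}" "disc_b (snd e) \<in> {0, 1}" unfolding disc_a_def disc_b_def by auto
   ultimately show "e \<in> (\<Union>x\<in>I. Es (fst x) (fst (snd x)) (snd (snd x)))"
    using e unfolding I_def Es_def
    by (intro UN_I[of "(fst e, disc_a (fst e) (snd e), disc_b (snd e))"]) auto
  qed
  then have "card (exceptional A X) \<le> card (\<Union>x\<in>I. Es (fst x) (fst (snd x)) (snd (snd x)))"
   by (rule card_mono[rotated]) (use fI finite_exceptional[of A X] in \<open>auto simp: Es_def\<close>)
  also have "... \<le> (\<Sum>x\<in>I. card (Es (fst x) (fst (snd x)) (snd (snd x))))"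
   by (rule card_UN_le[OF fI(1)])
  finally have "real (card (exceptional A X)) \<le> real (\<Sum>x\<in>I. card (Es (fst x) (fst (snd x)) (snd (snd x))))"
   by (simp only: of_nat_le_iff)
  also have "... = (\<Sum>x\<in>I. real (card (Es (fst x) (fst (snd x)) (snd (snd x)))))" by simp
  also have "... \<le> (\<Sum>x\<in>I. W)" by (intro sum_mono part)
  also have "... = 8 * W" by (simp add: fI(2))
  finally show ?case unfolding W_def A2_def L_def by simp
 qed
qed

section \<open>The contribution of the fields without a small prime of odd Frobenius\<close>

lemma sqfree_decomposition:
 fixes n :: nat assumes "n > 0"
 shows "\<exists>T m. finite T \<and> (\<forall>q\<in>T. prime q) \<and> m > 0 \<and> n = m\<^sup>2 * \<Prod>T"
 using assms
proof (induction n rule: prime_divisors_induct)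
 case (unit x)
 then show ?case by (intro exI[of _ "{}"] exI[of _ 1]) simp
next
 case (factor p x)
 then obtain T m where Tm: "finite T" "\<forall>q\<in>T. prime q" "m > 0" "x = m\<^sup>2 * \<Prod>T" by auto
 show ?case
 proof (cases "p \<in> T")
  case True
  then have "p * x = (p * m)\<^sup>2 * \<Prod>(T - {p})"
   using Tm prod.remove[OF Tm(1) True, of "\<lambda>x. x"] by (simp add: power2_eq_square mult_ac)
  then show ?thesis using Tm factor by (intro exI[of _ "T - {p}"] exI[of _ "p * m"]) (auto simp: prime_gt_0_nat)
 next
  case False
  then have "p * x = m\<^sup>2 * \<Prod>(insert p T)" using Tm by simp
  then show ?thesis using Tm factor by (intro exI[of _ "insert p T"] exI[of _ m]) auto
 qed
qed simp

text \<open>Stated without number fields: d is the discriminant and G the set of primes with odd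
  Frobenius, known only through the inertness criterion and the resolvent count. Fields whose primes
  in G all exceed (ln X)^A have an exceptional squarefree part; the sum is grouped by this
  part.\<close>

lemma tail_bound:
 fixes Cl :: "real => 'c set" and d :: "'c => int" and G :: "'c => nat set" and \<beta> B :: real
 assumes \<beta>: "0 < \<beta>" "\<beta> < 1/2" and fin: "\<And>X. X \<ge> 1 ==> finite (Cl X)"
  and d: "\<And>X K. K \<in> Cl X ==> d K \<noteq> 0 \<and> real_of_int \<bar>d K\<bar> < X \<and> (\<nexists>k. d K = k\<^sup>2)"
  and inert: "\<And>X K p. K \<in> Cl X ==> prime p ==> 2 < p ==> \<not> int p dvd d K ==> Legendre (d K) (int p) = -1 ==> p \<in> G K"
  and resolvent: "\<And>X s T. X \<ge> 1 ==> sqfree_disc s T ==>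
   real (card {K \<in> Cl X. \<exists>m. d K = m\<^sup>2 * (s * int (\<Prod>T))}) \<le> B * (X / real (\<Prod>T)) powr (1 - \<beta>)"
 shows "\<exists>A C. \<forall>\<^sub>F X in at_top.
  (\<Sum>K\<in>{K \<in> Cl X. \<forall>p\<in>G K. ln X ^ A < real p}. real (LEAST p. p \<in> G K)) \<le> C * X powr (1 - \<beta>/8)"
proof -
 \<comment> \<open>Exponent budget: the bound 1 - \<beta>/2 + 2r for one discriminant, plus
   \<beta>/16 for logarithms and \<beta>/8 for the number of discriminants, equals 1 -
   \<beta>/4.\<close>
 define r where "r = \<beta> / 32"
 have r: "0 < r" "r < 1" "r < 1/16" using \<beta> unfolding r_def by auto
 \<comment> \<open>Chosen so that A - 2 \<ge> 48/\<beta>, that is, 6/(A-2) \<le> \<beta>/8.\<close>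
 define A :: nat where "A = 4 + nat \<lceil>48 / \<beta>\<rceil>"
 define \<eta> where "\<eta> = 6 / real (A - 2)"
 have \<eta>: "\<eta> \<le> \<beta> / 8"
 proof -
  define z where "z = real (A - 2)"
  have "48 / \<beta> \<le> z" unfolding z_def A_def by linarith
  then have "48 \<le> z * \<beta>" using \<beta> by (simp add: pos_divide_le_eq)
  moreover have "z > 0" unfolding z_def A_def by simp
  ultimately show ?thesis unfolding \<eta>_def z_def[symmetric] by (simp add: pos_divide_le_eq mult.commute)
 qed
 define B' where "B' = max B 0"
 have decomp: "\<exists>s T m. sqfree_disc s T \<and> m > 0 \<and> d K = (int m)\<^sup>2 * (s * int (\<Prod>T)) \<and> real (m\<^sup>2 * \<Prod>T) < X"
  if K: "K \<in> Cl X" for X K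
 proof -
  note dd = d[OF K]
  obtain T m where Tm: "finite T" "\<forall>q\<in>T. prime q" "m > 0" "nat \<bar>d K\<bar> = m\<^sup>2 * \<Prod>T"
   using sqfree_decomposition[of "nat \<bar>d K\<bar>"] dd by auto
  define s where "s = sgn (d K)"
  have s: "s \<in> {-1, 1}" using dd unfolding s_def by (auto simp: sgn_if)
  have ad: "\<bar>d K\<bar> = int (m\<^sup>2 * \<Prod>T)" using Tm(4) by (metis abs_ge_zero int_nat_eq)
  have "d K = s * \<bar>d K\<bar>" unfolding s_def by (rule mult_sgn_abs[symmetric])
  then have e: "d K = (int m)\<^sup>2 * (s * int (\<Prod>T))" unfolding ad by simp
  moreover have "sqfree_disc s T"
  proof -
   have "s \<noteq> 1 \<or> T \<noteq> {}"
   proof (rule ccontr)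
    assume "\<not> ?thesis"
    then have "d K = (int m)\<^sup>2" using e by simp
    then show False using dd by blast
   qed
   then show ?thesis using Tm s unfolding sqfree_disc_def by auto
  qed
  moreover have "real (m\<^sup>2 * \<Prod>T) < X"
  proof -
   have "real (m\<^sup>2 * \<Prod>T) = real_of_int \<bar>d K\<bar>" unfolding ad by (simp only: of_int_of_nat_eq)
   then show ?thesis using dd by linarith
  qed
  ultimately show ?thesis using Tm(3) by blast
 qed
 have good: "p \<in> G K"
  if "K \<in> Cl X" "sqfree_disc s T" "d K = (int m)\<^sup>2 * (s * int (\<Prod>T))" "prime p" "2 < p"
   "disc_char s T (int p) = -1" "\<not> p dvd m" for X K s T m p
 proof -
  have L: "Legendre (s * int (\<Prod>T)) (int p) = -1"
   using Legendre_eq_quad_char[of T s p] that unfolding disc_char_def sqfree_disc_def by auto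
  have "Legendre (int m) (int p) \<noteq> 0" using that(7) by (simp add: Legendre_eq_0_iff)
  then have "Legendre (int m) (int p) * Legendre (int m) (int p) = 1"
   using Legendre_values[of "int m" "int p"] by auto
  moreover have "Legendre (d K) (int p)
    = (Legendre (int m) (int p) * Legendre (int m) (int p)) * Legendre (s * int (\<Prod>T)) (int p)"
   unfolding that(3) power2_eq_square by (simp only: Legendre_mult[OF that(4,5)] mult.assoc)
  ultimately have "Legendre (d K) (int p) = -1" using L by (simp only: mult_1)
  moreover have "\<not> int p dvd d K" using calculation Legendre_eq_0_iff[of "d K" "int p"] by auto
  ultimately show ?thesis using inert[OF that(1,4,5)] by blast
 qed
 have f1: "\<forall>\<^sub>F X in at_top. 128 * (ln X)\<^sup>2 \<le> X powr (\<beta> / 16)" using \<beta> by real_asymp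
 from card_exceptional[of A] have f2: "\<forall>\<^sub>F X in at_top. real (card (exceptional A X)) \<le> 128 * (ln X)\<^sup>2 * X powr \<eta>"
  unfolding \<eta>_def A_def by simp
 from f1 f2 small_prime_linear[OF r(1,2)] small_prime_half[OF r(1,3)] eventually_gt_at_top[of "1::real"]
 have "\<forall>\<^sub>F X in at_top. (\<Sum>K\<in>{K \<in> Cl X. \<forall>p\<in>G K. ln X ^ A < real p}. real (LEAST p. p \<in> G K)) \<le> B' * X powr (1 - \<beta>/8)"
 proof eventually_elim
  case (elim X)
  let ?Tl = "{K \<in> Cl X. \<forall>p\<in>G K. ln X ^ A < real p}"
  have finT: "finite ?Tl" using fin[of X] elim by simp
  obtain sf Tf mf where dec: "\<And>K. K \<in> Cl X ==> sqfree_disc (sf K) (Tf K) \<and> mf K > 0 \<and>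
    d K = (int (mf K))\<^sup>2 * (sf K * int (\<Prod>(Tf K))) \<and> real ((mf K)\<^sup>2 * \<Prod>(Tf K)) < X"
   using decomp[of _ X] by metis
  define g where "g K = (sf K, Tf K)" for K
  have mT: "real (mf K) \<le> X" "real (\<Prod>(Tf K)) \<le> X" "\<Prod>(Tf K) \<ge> 1" if "K \<in> Cl X" for K
  proof -
   note D = dec[OF that]
   have T: "\<Prod>(Tf K) \<ge> 1" using D sqfree_disc_facts(3,5)[of "sf K" "Tf K"] by linarith
   then have "mf K * 1 * 1 \<le> mf K * mf K * \<Prod>(Tf K)" "1 * 1 * \<Prod>(Tf K) \<le> mf K * mf K * \<Prod>(Tf K)"
    using D by (intro mult_le_mono; simp)+
   then have "real (mf K) \<le> real ((mf K)\<^sup>2 * \<Prod>(Tf K))" "real (\<Prod>(Tf K)) \<le> real ((mf K)\<^sup>2 * \<Prod>(Tf K))"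
    unfolding of_nat_le_iff by (simp_all add: power2_eq_square)
   then show "real (mf K) \<le> X" "real (\<Prod>(Tf K)) \<le> X" "\<Prod>(Tf K) \<ge> 1" using D T by linarith+
  qed
  \<comment> \<open>A prime up to (ln X)^A outside T at which the character is not 1 has value -1.
    It would lie in G unless it divides the square part, so the primes counted in
    \<open>exceptional\<close> divide m or lie in T.\<close>
  have gE: "g K \<in> exceptional A X" if K: "K \<in> ?Tl" for K
  proof -
   have K': "K \<in> Cl X" using K by simp
   note D = dec[OF K'] and M = mT[OF K']
   let ?s = "sf K" and ?T = "Tf K" and ?m = "mf K"
   have T: "finite ?T" "\<And>q. q \<in> ?T ==> prime q" using D unfolding sqfree_disc_def by auto
   let ?Q = "{p. prime p \<and> p dvd ?m}"
   have fQ: "finite ?Q" by (rule finite_subset[of _ "{..?m}"]) (use D in \<open>auto dest: dvd_imp_le\<close>)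
   have "(\<Prod>q\<in>?Q. int q) dvd int ?m" using fQ by (intro prod_primes_dvd) auto
   then have "int (\<Prod>?Q) dvd int ?m" by simp
   then have "\<Prod>?Q dvd ?m" by (simp only: int_dvd_int_iff)
   then have "\<Prod>?Q \<le> ?m" using D by (intro dvd_imp_le) auto
   then have "real (\<Prod>?Q) \<le> X" using M(1) by linarith
   then have cQ: "real (card ?Q) \<le> 2 * ln X" using fQ elim by (intro card_primes_le_ln) auto
   have cT: "real (card ?T) \<le> 2 * ln X" using T M elim by (intro card_primes_le_ln) auto
   have "{p. prime p \<and> 2 < p \<and> real p \<le> ln X ^ A \<and> disc_char ?s ?T (int p) \<noteq> 1} \<subseteq> ?Q \<union> ?T"
   proof safe
    fix p assume p: "prime p" "2 < p" "real p \<le> ln X ^ A" "disc_char ?s ?T (int p) \<noteq> 1" "p \<notin> ?T"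
    have "\<not> (\<exists>q\<in>?T - {2}. int q dvd int p)"
     using p(1,5) T(2) primes_dvd_imp_eq[of _ p] unfolding int_dvd_int_iff by blast
    moreover have "odd p" using p prime_odd_nat by auto
    ultimately have "disc_char ?s ?T (int p) \<noteq> 0"
     unfolding disc_char_def quad_char_eq_0_iff[OF sqfree_disc_facts(1)[OF conjunct1[OF D]]] by auto
    then have "disc_char ?s ?T (int p) = -1"
     using p(4) disc_char_values[OF conjunct1[OF D], of "int p"] by auto
    moreover have "p \<notin> G K" using K p(3) by fastforce
    ultimately show "p dvd ?m" using good[OF K' _ _ p(1,2)] D by blast
   qed
   then have "card {p. prime p \<and> 2 < p \<and> real p \<le> ln X ^ A \<and> disc_char ?s ?T (int p) \<noteq> 1} \<le> card (?Q \<union> ?T)"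
    using fQ T by (intro card_mono) auto
   also have "... \<le> card ?Q + card ?T" by (rule card_Un_le)
   finally have "real (card {p. prime p \<and> 2 < p \<and> real p \<le> ln X ^ A \<and> disc_char ?s ?T (int p) \<noteq> 1}) \<le> 4 * ln X"
    using cQ cT by linarith
   then show ?thesis using D M unfolding g_def exceptional_def by auto
  qed
  have bound: "(\<Sum>K\<in>{K \<in> ?Tl. g K = e}. real (LEAST p. p \<in> G K)) \<le> B' * X powr (1 - \<beta>/2 + 2 * r)"
   if e: "e \<in> exceptional A X" for e
  proof -
   obtain s T where e': "e = (s, T)" "sqfree_disc s T" "real (\<Prod>T) \<le> X" using e unfolding exceptional_def by auto
   define D where "D = real (\<Prod>T)"
   have D1: "D \<ge> 1" using sqfree_disc_facts(3,5)[OF e'(2)] unfolding D_def by linarith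
   \<comment> \<open>The windows are used for D \<ge> sqrt X and periodicity below; at D = sqrt X
     both bounds have the same exponent up to r.\<close>
   define Nm where "Nm = (if sqrt X \<le> D then X powr (1/2 + 2 * r) else D * X powr r)"
   have Nm: "real (LEAST p. p \<in> G K) \<le> Nm" if K: "K \<in> ?Tl" "g K = e" for K
   proof -
    have K': "K \<in> Cl X" "sf K = s" "Tf K = T" using K e' unfolding g_def by auto
    note dk = dec[OF K'(1), unfolded K'(2,3)]
    have "\<exists>p. prime p \<and> 2 < p \<and> real p \<le> Nm \<and> disc_char s T (int p) = -1 \<and> \<not> p dvd mf K"
    proof (cases "sqrt X \<le> D")
     case True
     then show ?thesis using elim(4) dk unfolding D_def Nm_def by auto
    next
     case False
     then show ?thesis using elim(3) dk unfolding D_def Nm_def by auto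
    qed
    then obtain p where p: "prime p" "2 < p" "real p \<le> Nm" "disc_char s T (int p) = -1" "\<not> p dvd mf K" by blast
    have "p \<in> G K" using good[OF K'(1) _ _ p(1,2,4,5)] dk by blast
    then have "(LEAST p. p \<in> G K) \<le> p" by (rule Least_le)
    then show ?thesis using p(3) by linarith
   qed
   have Nm0: "Nm \<ge> 0" unfolding Nm_def using D1 by simp
   have "(\<Sum>K\<in>{K \<in> ?Tl. g K = e}. real (LEAST p. p \<in> G K)) \<le> (\<Sum>K\<in>{K \<in> ?Tl. g K = e}. Nm)"
    by (intro sum_mono) (use Nm in auto)
   also have "... = real (card {K \<in> ?Tl. g K = e}) * Nm" by simp
   also have "... \<le> (B' * (X / D) powr (1 - \<beta>)) * Nm"
   proof (rule mult_right_mono[OF _ Nm0])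
    have "card {K \<in> ?Tl. g K = e} \<le> card {K \<in> Cl X. \<exists>m. d K = m\<^sup>2 * (s * int (\<Prod>T))}"
    proof (rule card_mono)
     show "{K \<in> ?Tl. g K = e} \<subseteq> {K \<in> Cl X. \<exists>m. d K = m\<^sup>2 * (s * int (\<Prod>T))}"
      using dec unfolding g_def e'(1) by blast
    qed (use fin[of X] elim in auto)
    then have "real (card {K \<in> ?Tl. g K = e}) \<le> real (card {K \<in> Cl X. \<exists>m. d K = m\<^sup>2 * (s * int (\<Prod>T))})"
     by (simp only: of_nat_le_iff)
    also have "... \<le> B * (X / D) powr (1 - \<beta>)"
     unfolding D_def by (rule resolvent[OF less_imp_le[OF elim(5)] e'(2)])
    also have "... \<le> B' * (X / D) powr (1 - \<beta>)" unfolding B'_def by (intro mult_right_mono) auto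
    finally show "real (card {K \<in> ?Tl. g K = e}) \<le> B' * (X / D) powr (1 - \<beta>)" .
   qed
   also have "... = B' * ((X / D) powr (1 - \<beta>) * Nm)" by simp
   also have "... \<le> B' * X powr (1 - \<beta>/2 + 2 * r)"
   proof (rule mult_left_mono)
    have X1: "X > 1" by fact
    show "(X / D) powr (1 - \<beta>) * Nm \<le> X powr (1 - \<beta>/2 + 2 * r)"
    proof (cases "sqrt X \<le> D")
     case True
     have "X / D \<le> X / sqrt X" using True X1 D1 by (intro divide_left_mono) auto
     also have "... = X powr (1/2)" using X1 by (simp add: real_div_sqrt powr_half_sqrt)
     finally have "(X / D) powr (1 - \<beta>) \<le> (X powr (1/2)) powr (1 - \<beta>)"
      using \<beta> D1 X1 by (intro powr_mono2) auto
     then have "(X / D) powr (1 - \<beta>) * Nm \<le> (X powr (1/2)) powr (1 - \<beta>) * Nm" using Nm0 by (rule mult_right_mono)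
     also have "... = X powr (1 - \<beta>/2 + 2 * r)"
     proof -
      have "1 / 2 * (1 - \<beta>) + (1/2 + 2 * r) = 1 - \<beta>/2 + 2 * r" by (simp add: field_simps)
      then show ?thesis by (simp only: Nm_def if_P[OF True] powr_powr powr_add[symmetric])
     qed
     finally show ?thesis .
    next
     case False
     have "(X / D) powr (1 - \<beta>) = X powr (1 - \<beta>) / D powr (1 - \<beta>)"
      by (rule powr_divide)
     moreover have "D = D powr (1 - \<beta>) * D powr \<beta>" using D1 by (simp add: powr_add[symmetric])
     then have "Nm = D powr (1 - \<beta>) * D powr \<beta> * X powr r" using False by (simp add: Nm_def)
     ultimately have "(X / D) powr (1 - \<beta>) * Nm
       = X powr (1 - \<beta>) / D powr (1 - \<beta>) * (D powr (1 - \<beta>) * D powr \<beta> * X powr r)" by simp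
     also have "... = X powr (1 - \<beta> + r) * D powr \<beta>" using D1 by (simp add: powr_add)
     also have "... \<le> X powr (1 - \<beta> + r) * (X powr (1/2)) powr \<beta>"
      using False D1 \<beta> X1 by (intro mult_left_mono powr_mono2) (auto simp: powr_half_sqrt)
     also have "... = X powr (1 - \<beta>/2 + r)"
     proof -
      have "1 - \<beta> + r + 1 / 2 * \<beta> = 1 - \<beta>/2 + r" by (simp add: field_simps)
      then show ?thesis by (simp only: powr_powr powr_add[symmetric])
     qed
     also have "... \<le> X powr (1 - \<beta>/2 + 2 * r)" using X1 r by (intro powr_mono) auto
     finally show ?thesis .
    qed
   qed (simp add: B'_def)
   finally show ?thesis .
  qed
  have "(\<Sum>K\<in>?Tl. real (LEAST p. p \<in> G K))
    = (\<Sum>e\<in>exceptional A X. \<Sum>K\<in>{K \<in> ?Tl. g K = e}. real (LEAST p. p \<in> G K))"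
   by (rule sum.group[symmetric]) (use finT finite_exceptional gE in auto)
  also have "... \<le> (\<Sum>e\<in>exceptional A X. B' * X powr (1 - \<beta>/2 + 2 * r))"
   by (intro sum_mono bound)
  also have "... = real (card (exceptional A X)) * (B' * X powr (1 - \<beta>/2 + 2 * r))" by simp
  also have "... \<le> (X powr (\<beta> / 16) * X powr (\<beta> / 8)) * (B' * X powr (1 - \<beta>/2 + 2 * r))"
  proof (rule mult_right_mono)
   have "X powr \<eta> \<le> X powr (\<beta> / 8)" using \<eta> elim(5) by (intro powr_mono) auto
   then have "128 * (ln X)\<^sup>2 * X powr \<eta> \<le> X powr (\<beta> / 16) * X powr (\<beta> / 8)"
    using elim(1) by (intro mult_mono) auto
   then show "real (card (exceptional A X)) \<le> X powr (\<beta> / 16) * X powr (\<beta> / 8)" using elim(2) by linarith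
  qed (simp add: B'_def)
  also have "... = B' * (X powr (\<beta> / 16) * X powr (\<beta> / 8) * X powr (1 - \<beta>/2 + 2 * r))" by simp
  also have "X powr (\<beta> / 16) * X powr (\<beta> / 8) * X powr (1 - \<beta>/2 + 2 * r) = X powr (1 - \<beta>/4)"
  proof -
   have "\<beta> / 16 + \<beta> / 8 + (1 - \<beta>/2 + 2 * r) = 1 - \<beta>/4" unfolding r_def by (simp add: field_simps)
   then show ?thesis by (simp only: powr_add[symmetric])
  qed
  also have "B' * X powr (1 - \<beta>/4) \<le> B' * X powr (1 - \<beta>/8)"
   using elim(5) \<beta> by (intro mult_left_mono powr_mono) (auto simp: B'_def)
  finally show ?case .
 qed
 then show ?thesis by blast
qed

section \<open>The average of the least prime under abstract counting hypotheses\<close>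

section \<open>The average\<close>

text \<open>The predicted proportion of fields with no odd Frobenius at the primes up to y. Ramified
  primes count as survivors, whence 1/2 + f p in the numerator.\<close>

definition survival :: "(nat => real) => nat => real" where
 "survival f y = (\<Prod>p | prime p \<and> p \<le> y. (1/2 + f p) / (1 + f p))"

definition first_density :: "(nat => real) => nat => real" where
 "first_density f q = (1/2) / (1 + f q) * (\<Prod>p | prime p \<and> p < q. (1/2 + f p) / (1 + f p))"

lemma finite_primes_le: "finite {p::nat. prime p \<and> p \<le> y}"
 by (rule finite_subset[of _ "{..y}"]) auto

lemma first_density_nonneg: assumes "\<And>p. prime p ==> 0 \<le> f p" "prime q"
 shows "0 \<le> first_density f q" unfolding first_density_def using assms
 by (intro mult_nonneg_nonneg divide_nonneg_nonneg prod_nonneg) (auto simp: add_nonneg_nonneg)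

lemma first_density_le_survival: assumes f: "\<And>p. prime p ==> 0 \<le> f p" and q: "prime q"
 shows "first_density f q \<le> survival f q"
proof -
 have "{p. prime p \<and> p \<le> q} = insert q {p. prime p \<and> p < q}" using q by auto
 moreover have "finite {p. prime p \<and> p < q}" by (rule finite_subset[of _ "{..q}"]) auto
 ultimately have "survival f q = (1/2 + f q) / (1 + f q) * (\<Prod>p | prime p \<and> p < q. (1/2 + f p) / (1 + f p))"
  unfolding survival_def by simp
 moreover have "(1/2) / (1 + f q) \<le> (1/2 + f q) / (1 + f q)"
  using f[OF q] by (intro divide_right_mono) auto
 moreover have "0 \<le> (\<Prod>p | prime p \<and> p < q. (1/2 + f p) / (1 + f p))"
  using f by (intro prod_nonneg divide_nonneg_nonneg) (auto simp: add_nonneg_nonneg)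
 ultimately show ?thesis unfolding first_density_def by (simp only: mult_right_mono)
qed

text \<open>Since f p is O(1/p), all but finitely many factors are at most 3/4, and 3/4 to the
  number of primes up to y is smaller than any power of 1/y.\<close>

lemma survival_decay:
 fixes f :: "nat => real"
 assumes f: "\<And>p. prime p ==> 0 \<le> f p" "\<And>p. prime p ==> f p \<le> Mf / real p"
 shows "\<exists>C>0. \<forall>y\<ge>1. survival f y \<le> C / real y ^ k"
proof -
 \<comment> \<open>Beyond p0 the bound Mf/p is at most 1, and (1/2 + t)/(1 + t) \<le> 3/4 for t
   \<le> 1.\<close>
 define p0 where "p0 = nat \<lceil>Mf\<rceil>"
 let ?t = "\<lambda>p. (1/2 + f p) / (1 + f p)"
 have t1: "0 \<le> ?t p" "?t p \<le> 1" if "prime p" for p using f(1)[OF that] by (auto simp: divide_le_eq)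
 have t2: "?t p \<le> 3/4" if "prime p" "p0 < p" for p
 proof -
  have "Mf < real p" using that(2) unfolding p0_def by linarith
  then have "Mf / real p \<le> 1" using that by (simp add: divide_le_eq)
  then have "f p \<le> 1" using f(2)[OF that(1)] by linarith
  then show ?thesis using f(1)[OF that(1)] by (simp add: divide_le_eq)
 qed
 have s: "survival f y \<le> (3/4) ^ (card {p. prime p \<and> p \<le> y} - (p0 + 1))" for y
 proof -
  let ?P = "{p. prime p \<and> p \<le> y}" and ?B = "{p. prime p \<and> p0 < p \<and> p \<le> y}"
  have fP: "finite ?P" by (rule finite_primes_le)
  have fB: "finite ?B" by (rule finite_subset[OF _ fP]) auto
  have "survival f y = (\<Prod>p\<in>?B. ?t p) * (\<Prod>p\<in>?P - ?B. ?t p)"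
   unfolding survival_def using prod.subset_diff[of ?B ?P ?t] fP by (simp add: mult.commute Collect_mono)
  also have "... \<le> (\<Prod>p\<in>?B. ?t p) * 1"
   using t1 by (intro mult_left_mono prod_le_1 prod_nonneg) auto
  also have "(\<Prod>p\<in>?B. ?t p) * 1 \<le> (\<Prod>p\<in>?B. 3/4)"
   unfolding mult_1_right by (intro prod_mono) (use t1 t2 in auto)
  also have "... = (3/4) ^ card ?B" by simp
  also have "... \<le> (3/4) ^ (card ?P - (p0 + 1))"
  proof (rule power_decreasing)
   have "card ?P \<le> card (?B \<union> {..p0})" using fB by (intro card_mono) auto
   also have "... \<le> card ?B + card {..p0}" by (rule card_Un_le)
   finally show "card ?P - (p0 + 1) \<le> card ?B" by simp
  qed auto
  finally show ?thesis .
 qed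
 have e: "\<forall>\<^sub>F y in sequentially. (3/4 :: real) powr (real y / (4 * ln (real y)) - (real p0 + 1)) \<le> 1 / real y ^ k"
  by real_asymp
 from e primes_count_lower eventually_ge_at_top[of 1]
 have "\<forall>\<^sub>F y in sequentially. survival f y \<le> 1 / real y ^ k"
 proof eventually_elim
  case (elim y)
  have "survival f y \<le> (3/4) ^ (card {p. prime p \<and> p \<le> y} - (p0 + 1))" by (rule s)
  also have "... = (3/4) powr real (card {p. prime p \<and> p \<le> y} - (p0 + 1))" by (simp add: powr_realpow)
  also have "... \<le> (3/4) powr (real y / (4 * ln (real y)) - (real p0 + 1))"
   using elim(2) by (intro powr_mono') auto
  finally show ?case using elim(1) by linarith
 qed
 then obtain N where N: "\<And>y. y \<ge> N ==> survival f y \<le> 1 / real y ^ k"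
  unfolding eventually_sequentially by auto
 define C where "C = 1 + real N ^ k"
 have "survival f y \<le> C / real y ^ k" if "y \<ge> 1" for y
 proof (cases "y \<ge> N")
  case True
  have "1 / real y ^ k \<le> C / real y ^ k" unfolding C_def by (intro divide_right_mono) auto
  then show ?thesis using N[OF True] by linarith
 next
  case False
  have "survival f y \<le> 1" unfolding survival_def using t1 by (intro prod_le_1) auto
  also have "1 \<le> C / real y ^ k"
  proof -
   have "real y ^ k \<le> real N ^ k" using False by (intro power_mono) auto
   then show ?thesis using that unfolding C_def by (simp add: le_divide_eq)
  qed
  finally show ?thesis .
 qed
 moreover have "C > 0" unfolding C_def by (simp add: add_pos_nonneg)
 ultimately show ?thesis by blast
qed

text \<open>With decay of order 5 the terms are at most C/q^4. Splitting this as q^-2 times q^-2,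
  one factor gives convergence and the other the rate 1/y^2 of the tail.\<close>

lemma density_has_sum:
 fixes f :: "nat => real"
 assumes f: "\<And>p. prime p ==> 0 \<le> f p" "\<And>p. prime p ==> f p \<le> Mf / real p"
 defines "g \<equiv> \<lambda>q. real q * first_density f q"
 shows "\<exists>M C. (g has_sum M) {q. prime q} \<and>
  (\<forall>y\<ge>1. \<bar>M - (\<Sum>q | prime q \<and> q \<le> y. g q)\<bar> \<le> C / (real y)\<^sup>2)"
proof -
 obtain C where C: "C > 0" "\<And>y. y \<ge> 1 ==> survival f y \<le> C / real y ^ 5"
  using survival_decay[OF f, of 5] by auto
 have g0: "0 \<le> g q" if "prime q" for q
  unfolding g_def using first_density_nonneg[OF f(1) that] by simp
 have gb: "g q \<le> C / (real q)\<^sup>2 * (1 / (real q)\<^sup>2)" if "prime q" for q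
 proof -
  have q: "q \<ge> 1" using prime_gt_0_nat[OF that] by simp
  have "first_density f q \<le> survival f q"
   by (rule first_density_le_survival) (use f that in auto)
  then have "first_density f q \<le> C / real q ^ 5" using C(2)[OF q] by linarith
  then have "g q \<le> real q * (C / real q ^ 5)" unfolding g_def by (intro mult_left_mono) auto
  also have "... = C / (real q)\<^sup>2 * (1 / (real q)\<^sup>2)" using q by (simp add: field_simps eval_nat_numeral)
  finally show ?thesis .
 qed
 have "summable (\<lambda>n. 1 / (real n)\<^sup>2)"
  using inverse_power_summable[of 2, where ?'a = real] by (simp add: inverse_eq_divide)
 then have s2: "(\<lambda>n. 1 / (real n)\<^sup>2) summable_on UNIV"
  by (intro summable_nonneg_imp_summable_on) auto
 define Z where "Z = infsum (\<lambda>n. 1 / (real n)\<^sup>2) UNIV"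
 have sP: "(\<lambda>n. 1 / (real n)\<^sup>2) summable_on Q" for Q using summable_on_subset_banach[OF s2] by blast
 have gb1: "g q \<le> C * (1 / (real q)\<^sup>2)" if "prime q" for q
 proof -
  have "real q \<ge> 1" using prime_gt_0_nat[OF that] by linarith
  then have "C / (real q)\<^sup>2 \<le> C" using C(1) by (simp add: divide_le_eq mult_le_cancel_left1 one_le_power)
  then show ?thesis using gb[OF that] by (meson mult_right_mono order_trans zero_le_divide_1_iff zero_le_power2)
 qed
 have gs: "g summable_on {q. prime q}"
  by (rule summable_on_comparison_test[OF summable_on_cmult_right[OF sP, of C]]) (use g0 gb1 in auto)
 define M where "M = infsum g {q. prime q}"
 have M: "(g has_sum M) {q. prime q}" unfolding M_def using gs by (rule has_sum_infsum)
 have "\<bar>M - (\<Sum>q | prime q \<and> q \<le> y. g q)\<bar> \<le> C * Z / (real y)\<^sup>2" if y: "y \<ge> 1" for y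
 proof -
  let ?P = "{q. prime q \<and> q \<le> y}" and ?R = "{q. prime q \<and> y < q}"
  have u: "{q. prime q} = ?P \<union> ?R" by auto
  have gR: "g summable_on ?R" by (rule summable_on_subset_banach[OF gs]) auto
  have "M = infsum g ?P + infsum g ?R"
   unfolding M_def u by (rule infsum_Un_disjoint) (auto simp: gR finite_primes_le)
  then have e: "M - (\<Sum>q | prime q \<and> q \<le> y. g q) = infsum g ?R" by (simp add: finite_primes_le)
  have "infsum g ?R \<le> infsum (\<lambda>n. C / (real y)\<^sup>2 * (1 / (real n)\<^sup>2)) ?R"
  proof (rule infsum_mono[OF gR summable_on_cmult_right[OF sP]])
   fix q assume q: "q \<in> ?R"
   have "C / (real q)\<^sup>2 \<le> C / (real y)\<^sup>2"
    using q y C(1) by (intro divide_left_mono power_mono mult_pos_pos) auto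
   then have "C / (real q)\<^sup>2 * (1 / (real q)\<^sup>2) \<le> C / (real y)\<^sup>2 * (1 / (real q)\<^sup>2)"
    by (rule mult_right_mono) auto
   then show "g q \<le> C / (real y)\<^sup>2 * (1 / (real q)\<^sup>2)" using gb[of q] q by auto
  qed
  also have "... = C / (real y)\<^sup>2 * infsum (\<lambda>n. 1 / (real n)\<^sup>2) ?R" by (rule infsum_cmult_right')
  also have "... \<le> C / (real y)\<^sup>2 * Z"
  proof (rule mult_left_mono)
   show "infsum (\<lambda>n. 1 / (real n)\<^sup>2) ?R \<le> Z"
    unfolding Z_def by (rule infsum_mono_neutral[OF sP s2]) auto
  qed (use C in auto)
  finally have "infsum g ?R \<le> C * Z / (real y)\<^sup>2" by simp
  moreover have "infsum g ?R \<ge> 0" by (rule infsum_nonneg) (use g0 in auto)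
  ultimately show ?thesis unfolding e by simp
 qed
 then show ?thesis using M by blast
qed

text \<open>The fields are divided by whether their least prime is at most y, between y and (ln
  X)^A, or larger, with y about sqrt(ln X). Truncating the series at y costs 1/y^2, which is of
  order 1/ln X; all other errors are made at most of this order.\<close>

theorem average_of_least_prime:
 fixes Cl :: "real => 'c set" and G :: "'c => nat set" and f :: "nat => real"
 assumes f: "\<And>p. prime p ==> 0 \<le> f p" "\<And>p. prime p ==> f p \<le> Mf / real p"
  and fin: "\<And>X. X \<ge> 1 ==> finite (Cl X)" and G: "\<And>X v p. p \<in> G v ==> prime p"
  and par: "A0 > 0" "0 < \<delta>" "\<delta> < 1" "0 \<le> K" "1 \<le> W" "0 \<le> \<gamma>"
  and cnt: "\<And>X. X \<ge> 1 ==> \<bar>real (card (Cl X)) - A0 * X\<bar> \<le> B * X powr \<delta>"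
  and ev: "\<And>X q. X \<ge> 1 ==> prime q ==>
   \<bar>real (card {v \<in> Cl X. q \<in> G v \<and> (\<forall>p<q. p \<notin> G v)}) - first_density f q * A0 * X\<bar>
    \<le> K * (W * real q powr \<gamma>) ^ q * X powr \<delta>"
  and su: "\<And>X y. X \<ge> 1 ==> y \<ge> 1 ==>
   real (card {v \<in> Cl X. \<forall>p\<le>y. p \<notin> G v}) \<le> survival f y * A0 * X + K * (W * real y powr \<gamma>) ^ y * X powr \<delta>"
  and tail: "\<eta> > 0" "\<forall>\<^sub>F X in at_top.
   (\<Sum>v\<in>{v \<in> Cl X. \<forall>p\<in>G v. ln X ^ A < real p}. real (LEAST p. p \<in> G v)) \<le> C3 * X powr (1 - \<eta>)"
 shows "\<exists>M. ((\<lambda>q. real q * first_density f q) has_sum M) {q. prime q} \<and>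
  (\<lambda>X. (\<Sum>v\<in>Cl X. real (LEAST p. p \<in> G v)) / real (card (Cl X)) - M) \<in> O(\<lambda>X. 1 / ln X)"
proof -
 let ?N = "\<lambda>v. real (LEAST p. p \<in> G v)"
 let ?g = "\<lambda>q. real q * first_density f q"
 obtain M C1 where M: "(?g has_sum M) {q. prime q}"
  and C1: "\<And>y. y \<ge> 1 ==> \<bar>M - (\<Sum>q | prime q \<and> q \<le> y. ?g q)\<bar> \<le> C1 / (real y)\<^sup>2"
  using density_has_sum[OF f] by blast
 \<comment> \<open>The exponent 2A + 2 turns y^2 \<ge> L/4 into a decay L^(-A-1), which leaves 1/L
   after multiplication by the bound L^A for the least prime in the middle range.\<close>
 obtain C2 where C2: "C2 > 0" "\<And>y. y \<ge> 1 ==> survival f y \<le> C2 / real y ^ (2 * A + 2)"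
  using survival_decay[OF f] by blast
 \<comment> \<open>The parameters are enlarged to strictly positive ones, which settles the signs in
   the asymptotic comparisons that follow.\<close>
 define w where "w = ln W + 1"
 define K' where "K' = K + 1"
 define \<gamma>' where "\<gamma>' = \<gamma> + 1"
 have w: "w > 0" "K' > 0" "\<gamma>' > 0" unfolding w_def K'_def \<gamma>'_def using par by (auto simp: add_nonneg_pos)
 define Er where "Er X = K' * exp (sqrt (ln X) * (w + \<gamma>' * ln (ln X))) * X powr \<delta>" for X
 define C1' where "C1' = \<bar>C1\<bar> * 4"
 define C2' where "C2' = C2 * 4 ^ (A + 1)"
 define C3' where "C3' = \<bar>C3\<bar>"
 define M' where "M' = \<bar>M\<bar> * \<bar>B\<bar>"
 define Ct where "Ct = 2 / A0 * (A0 * C1' + 1 + A0 * C2' + 1 + 1 + 1)"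
 have r1: "\<forall>\<^sub>F X in at_top. ln X * Er X \<le> 1 * X / ln X"
  unfolding Er_def using par w by real_asymp
 have r2: "\<forall>\<^sub>F X in at_top. ln X ^ A * Er X \<le> 1 * X / ln X"
  unfolding Er_def using par w by real_asymp
 have r3: "\<forall>\<^sub>F X in at_top. C3' * X powr (1 - \<eta>) \<le> 1 * X / ln X"
  using tail(1) by real_asymp
 have r4: "\<forall>\<^sub>F X in at_top. M' * X powr \<delta> \<le> 1 * X / ln X"
  using par by real_asymp
 have r5: "\<forall>\<^sub>F X in at_top. \<bar>B\<bar> * X powr \<delta> \<le> A0 / 2 * X"
  using par by real_asymp
 have "\<forall>\<^sub>F X in at_top. \<bar>(\<Sum>v\<in>Cl X. ?N v) / real (card (Cl X)) - M\<bar> \<le> Ct * (1 / ln X)"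
  using r1 r2 r3 r4 r5 tail(2) eventually_gt_at_top[of "exp 4"]
 proof eventually_elim
  case (elim X)
  have X1: "X > 1" using elim(7) by (meson less_trans one_less_exp_iff zero_less_numeral)
  define L where "L = ln X"
  have L: "L > 4" unfolding L_def using elim(7) X1 by (metis exp_gt_zero ln_exp ln_less_cancel_iff less_trans zero_less_one)
  \<comment> \<open>L > 4 gives sqrt L \<ge> 2, hence y \<ge> 1 and y \<ge> sqrt L / 2.\<close>
  define y where "y = nat \<lfloor>sqrt L\<rfloor>"
  have sL: "sqrt L \<ge> 2" using L real_sqrt_le_mono[of 4 L] by simp
  have y: "real y \<le> sqrt L" "sqrt L - 1 \<le> real y" "y \<ge> 1"
   unfolding y_def using sL by linarith+
  have yL: "real y * real y \<le> L" using mult_mono[OF y(1) y(1)] L by simp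
  have y2: "L / 4 \<le> (real y)\<^sup>2"
  proof -
   have "sqrt L / 2 \<le> real y" using y(2) sL by linarith
   then have "(sqrt L / 2)\<^sup>2 \<le> (real y)\<^sup>2" using L by (intro power_mono) auto
   then show ?thesis using L by (simp add: power_divide)
  qed
  \<comment> \<open>For q up to sqrt L the power (W q^\<gamma>)^q is exp of O(sqrt L * ln L), which
    is X^o(1); the saving from X^\<delta> survives.\<close>
  have err: "K * (W * real q powr \<gamma>) ^ q * X powr \<delta> \<le> Er X" if q: "1 \<le> q" "q \<le> y" for q
  proof -
   have q0: "real q > 0" using q by simp
   have "real q \<le> sqrt L" using q y by linarith
   moreover have "sqrt L * 1 \<le> sqrt L * sqrt L" using sL L by (intro mult_left_mono) auto
   then have "sqrt L \<le> L" using L by simp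
   ultimately have lq: "ln (real q) \<le> ln L" using q0 L by (subst ln_le_cancel_iff) auto
   have lnL: "ln L \<ge> 0" using L by simp
   have W0: "ln W \<ge> 0" using par by simp
   have "(W * real q powr \<gamma>) ^ q = exp (ln W + \<gamma> * ln (real q)) ^ q"
    using par q0 by (simp add: exp_add powr_def)
   also have "... = exp (real q * (ln W + \<gamma> * ln (real q)))" by (rule exp_of_nat_mult[symmetric])
   also have "... \<le> exp (sqrt L * (w + \<gamma>' * ln L))"
   proof -
    have "\<gamma> * ln (real q) \<le> \<gamma>' * ln L" unfolding \<gamma>'_def using lq lnL par q by (intro mult_mono) auto
    then have "ln W + \<gamma> * ln (real q) \<le> w + \<gamma>' * ln L" unfolding w_def by linarith
    moreover have "0 \<le> ln W + \<gamma> * ln (real q)" using W0 par q by (intro add_nonneg_nonneg mult_nonneg_nonneg) auto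
    moreover have "0 \<le> sqrt L" using L by simp
    ultimately have "real q * (ln W + \<gamma> * ln (real q)) \<le> sqrt L * (w + \<gamma>' * ln L)"
     using \<open>real q \<le> sqrt L\<close> by (intro mult_mono)
    then show ?thesis by simp
   qed
   finally have "(W * real q powr \<gamma>) ^ q \<le> exp (sqrt L * (w + \<gamma>' * ln L))" .
   moreover have "0 \<le> (W * real q powr \<gamma>) ^ q" using par by simp
   ultimately have "K * (W * real q powr \<gamma>) ^ q \<le> K' * exp (sqrt L * (w + \<gamma>' * ln L))"
    unfolding K'_def using par by (intro mult_mono) auto
   then show ?thesis unfolding Er_def L_def[symmetric] by (intro mult_right_mono) auto
  qed
  have Er0: "Er X \<ge> 0" unfolding Er_def using w by simp
  let ?Cl = "Cl X"
  have finC: "finite ?Cl" using fin X1 by simp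
  let ?ev = "\<lambda>q. {v \<in> ?Cl. q \<in> G v \<and> (\<forall>p<q. p \<notin> G v)}"
  let ?A1 = "{v \<in> ?Cl. \<exists>p\<le>y. p \<in> G v}"
  let ?A2 = "{v \<in> ?Cl. (\<forall>p\<le>y. p \<notin> G v) \<and> (\<exists>p\<in>G v. real p \<le> L ^ A)}"
  let ?A3 = "{v \<in> ?Cl. (\<forall>p\<le>y. p \<notin> G v) \<and> (\<forall>p\<in>G v. L ^ A < real p)}"
  have union: "sum h (U \<union> (V \<union> W)) = sum h U + (sum h V + sum h W)"
   if "finite U" "finite V" "finite W" "U \<inter> (V \<union> W) = {}" "V \<inter> W = {}"
   for h :: "'c => real" and U V W using that by (simp add: sum.union_disjoint)
  have "?A1 \<inter> (?A2 \<union> ?A3) = {}" by blast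
  moreover have "?A2 \<inter> ?A3 = {}"
  proof (rule equals0I)
   fix v assume "v \<in> ?A2 \<inter> ?A3"
   then obtain p where "real p \<le> L ^ A" "L ^ A < real p" by blast
   then show False by linarith
  qed
  moreover have "?Cl = ?A1 \<union> (?A2 \<union> ?A3)"
  proof -
   have "real p \<le> L ^ A \<or> L ^ A < real p" for p by linarith
   then show ?thesis by blast
  qed
  ultimately have split: "(\<Sum>v\<in>?Cl. ?N v) = (\<Sum>v\<in>?A1. ?N v) + ((\<Sum>v\<in>?A2. ?N v) + (\<Sum>v\<in>?A3. ?N v))"
   using union[of ?A1 ?A2 ?A3 ?N] finC by simp
  let ?P = "{q. prime q \<and> q \<le> y}"
  have least: "(LEAST p. p \<in> G v) = q" if "v \<in> ?ev q" for v q
   using that by (intro Least_equality) (auto simp: not_less[symmetric])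
  have S1: "(\<Sum>v\<in>?A1. ?N v) = (\<Sum>q\<in>?P. real q * real (card (?ev q)))"
  proof -
   have sub: "(LEAST p. p \<in> G v) \<in> ?P" if "v \<in> ?A1" for v
   proof -
    from that obtain p where p: "p \<le> y" "p \<in> G v" by auto
    have "(LEAST p. p \<in> G v) \<in> G v" using p(2) by (rule LeastI)
    moreover have "(LEAST p. p \<in> G v) \<le> p" using p(2) by (rule Least_le)
    ultimately show ?thesis using G p(1) by auto
   qed
   have eq: "{v \<in> ?A1. (LEAST p. p \<in> G v) = q} = ?ev q" if q: "q \<in> ?P" for q
   proof (intro equalityI subsetI)
    fix v assume k: "v \<in> {v \<in> ?A1. (LEAST p. p \<in> G v) = q}"
    then obtain p where "p \<in> G v" by auto
    then have "q \<in> G v" using k LeastI[of "\<lambda>p. p \<in> G v" p] by auto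
    moreover have "\<forall>p<q. p \<notin> G v"
    proof (intro allI impI)
     fix p assume "p < q"
     then have "p < (LEAST p. p \<in> G v)" using k by simp
     then show "p \<notin> G v" by (rule not_less_Least)
    qed
    ultimately show "v \<in> ?ev q" using k by auto
   next
    fix v assume "v \<in> ?ev q"
    then show "v \<in> {v \<in> ?A1. (LEAST p. p \<in> G v) = q}" using least q by auto
   qed
   have "(\<Sum>v\<in>?A1. ?N v) = (\<Sum>q\<in>?P. \<Sum>v\<in>{v \<in> ?A1. (LEAST p. p \<in> G v) = q}. ?N v)"
    by (rule sum.group[symmetric]) (use finC sub finite_primes_le in auto)
   also have "... = (\<Sum>q\<in>?P. \<Sum>v\<in>?ev q. ?N v)" by (intro sum.cong refl) (use eq in auto)
   also have "... = (\<Sum>q\<in>?P. \<Sum>v\<in>?ev q. real q)"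
    by (intro sum.cong refl) (simp add: least)
   finally show ?thesis by (simp add: mult.commute)
  qed
  have S1b: "\<bar>(\<Sum>v\<in>?A1. ?N v) - A0 * X * (\<Sum>q\<in>?P. ?g q)\<bar> \<le> L * Er X"
  proof -
   have "(\<Sum>v\<in>?A1. ?N v) - A0 * X * (\<Sum>q\<in>?P. ?g q)
     = (\<Sum>q\<in>?P. real q * (real (card (?ev q)) - first_density f q * A0 * X))"
    unfolding S1 sum_distrib_left sum_subtractf[symmetric] by (intro sum.cong refl) (simp add: algebra_simps)
   also have "\<bar>...\<bar> \<le> (\<Sum>q\<in>?P. \<bar>real q * (real (card (?ev q)) - first_density f q * A0 * X)\<bar>)" by (rule sum_abs)
   also have "... \<le> (\<Sum>q\<in>?P. real y * Er X)"
   proof (rule sum_mono)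
    fix q assume q: "q \<in> ?P"
    then have q1: "1 \<le> q" "q \<le> y" "prime q" using prime_gt_0_nat by (auto simp: Suc_le_eq)
    have "\<bar>real (card (?ev q)) - first_density f q * A0 * X\<bar> \<le> Er X"
     using ev[OF less_imp_le[OF X1] q1(3)] err[OF q1(1,2)] by linarith
    then show "\<bar>real q * (real (card (?ev q)) - first_density f q * A0 * X)\<bar> \<le> real y * Er X"
     unfolding abs_mult using q1 by (intro mult_mono) auto
   qed
   also have "... = real (card ?P) * (real y * Er X)" by simp
   also have "... \<le> real y * (real y * Er X)"
   proof (rule mult_right_mono)
    have "card ?P \<le> card {1..y}" by (intro card_mono) (auto dest: prime_gt_0_nat)
    then show "real (card ?P) \<le> real y" by simp
   qed (use Er0 in auto)
   also have "... \<le> L * Er X" using mult_right_mono[OF yL Er0] by (simp add: mult.assoc)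
   finally show ?thesis .
  qed
  have S2: "(\<Sum>v\<in>?A2. ?N v) \<le> A0 * C2' * (X / L) + X / L"
  proof -
   have "(\<Sum>v\<in>?A2. ?N v) \<le> (\<Sum>v\<in>?A2. L ^ A)"
   proof (rule sum_mono)
    fix v assume "v \<in> ?A2"
    then obtain p where p: "p \<in> G v" "real p \<le> L ^ A" by auto
    have "(LEAST p. p \<in> G v) \<le> p" using p(1) by (rule Least_le)
    then show "?N v \<le> L ^ A" using p(2) by linarith
   qed
   also have "... = L ^ A * real (card ?A2)" by simp
   also have "... \<le> L ^ A * (survival f y * A0 * X + Er X)"
   proof (rule mult_left_mono)
    have "card ?A2 \<le> card {v \<in> ?Cl. \<forall>p\<le>y. p \<notin> G v}" using finC by (intro card_mono) auto
    then have "real (card ?A2) \<le> real (card {v \<in> ?Cl. \<forall>p\<le>y. p \<notin> G v})" by simp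
    then show "real (card ?A2) \<le> survival f y * A0 * X + Er X"
     using su[OF less_imp_le[OF X1] y(3)] err[OF y(3) order_refl] by linarith
   qed (use L in auto)
   also have "... = A0 * X * (L ^ A * survival f y) + L ^ A * Er X" by (simp add: algebra_simps)
   also have "... \<le> A0 * X * (C2' / L) + X / L"
   proof (rule add_mono)
    have "survival f y \<le> C2 / real y ^ (2 * A + 2)" by (rule C2(2)[OF y(3)])
    also have "real y ^ (2 * A + 2) = ((real y)\<^sup>2) ^ (A + 1)" by (simp only: power_mult[symmetric]) simp
    also have "C2 / ((real y)\<^sup>2) ^ (A + 1) \<le> C2 / (L / 4) ^ (A + 1)"
     using y2 L C2 y by (intro divide_left_mono power_mono mult_pos_pos zero_less_power) auto
    also have "... = C2' / L ^ (A + 1)" unfolding C2'_def by (simp add: power_divide)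
    finally have "L ^ A * survival f y \<le> L ^ A * (C2' / L ^ (A + 1))" using L by (intro mult_left_mono) auto
    also have "... = C2' / L" using L by simp
    finally show "A0 * X * (L ^ A * survival f y) \<le> A0 * X * (C2' / L)"
     using par X1 by (intro mult_left_mono) auto
    show "L ^ A * Er X \<le> X / L" using elim(2) unfolding L_def by simp
   qed
   finally show ?thesis by (simp add: mult_ac)
  qed
  have S20: "(\<Sum>v\<in>?A2. ?N v) \<ge> 0" "(\<Sum>v\<in>?A3. ?N v) \<ge> 0" by (auto intro!: sum_nonneg)
  have S3: "(\<Sum>v\<in>?A3. ?N v) \<le> X / L"
  proof -
   have "(\<Sum>v\<in>?A3. ?N v) \<le> (\<Sum>v\<in>{v \<in> ?Cl. \<forall>p\<in>G v. L ^ A < real p}. ?N v)"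
    using finC by (intro sum_mono2) auto
   also have "... \<le> C3 * X powr (1 - \<eta>)" using elim(6) unfolding L_def .
   also have "... \<le> C3' * X powr (1 - \<eta>)" unfolding C3'_def by (intro mult_right_mono) auto
   finally show ?thesis using elim(3) unfolding L_def by simp
  qed
  have R: "\<bar>A0 * X * (\<Sum>q\<in>?P. ?g q) - A0 * X * M\<bar> \<le> A0 * C1' * (X / L)"
  proof -
   have "\<bar>M - (\<Sum>q\<in>?P. ?g q)\<bar> \<le> C1 / (real y)\<^sup>2" by (rule C1[OF y(3)])
   also have "... \<le> \<bar>C1\<bar> / (real y)\<^sup>2" by (intro divide_right_mono) auto
   also have "... \<le> \<bar>C1\<bar> / (L / 4)" using y2 L y by (intro divide_left_mono) auto
   finally have "\<bar>M - (\<Sum>q\<in>?P. ?g q)\<bar> \<le> C1' / L" unfolding C1'_def by simp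
   then have "(A0 * X) * \<bar>M - (\<Sum>q\<in>?P. ?g q)\<bar> \<le> (A0 * X) * (C1' / L)"
    using par X1 by (intro mult_left_mono) auto
   moreover have "\<bar>A0 * X * (\<Sum>q\<in>?P. ?g q) - A0 * X * M\<bar> = (A0 * X) * \<bar>M - (\<Sum>q\<in>?P. ?g q)\<bar>"
    using par X1 by (simp add: right_diff_distrib[symmetric] abs_mult abs_minus_commute)
   ultimately show ?thesis by (simp add: mult_ac)
  qed
  define c where "c = real (card ?Cl)"
  have cb: "\<bar>c - A0 * X\<bar> \<le> \<bar>B\<bar> * X powr \<delta>"
  proof -
   have "B * X powr \<delta> \<le> \<bar>B\<bar> * X powr \<delta>" by (intro mult_right_mono) auto
   then show ?thesis using cnt[OF less_imp_le[OF X1]] unfolding c_def by linarith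
  qed
  have cX: "c \<ge> A0 / 2 * X" using cb elim(5) by linarith
  have c0: "c > 0" using cX par X1 by (smt (verit) divide_pos_pos mult_pos_pos)
  have Mc: "\<bar>A0 * X * M - c * M\<bar> \<le> X / L"
  proof -
   have "\<bar>A0 * X * M - c * M\<bar> = \<bar>M\<bar> * \<bar>c - A0 * X\<bar>"
    by (simp only: left_diff_distrib[symmetric] abs_mult) (simp add: abs_minus_commute)
   also have "... \<le> \<bar>M\<bar> * (\<bar>B\<bar> * X powr \<delta>)" using cb by (intro mult_left_mono) auto
   also have "... = M' * X powr \<delta>" unfolding M'_def by simp
   finally show ?thesis using elim(4) unfolding L_def by simp
  qed
  have E1: "L * Er X \<le> X / L" using elim(1) unfolding L_def by simp
  define u where "u = X / L"
  have "\<bar>(\<Sum>v\<in>?Cl. ?N v) - c * M\<bar> \<le> (A0 * C1' * u) + u + (A0 * C2' * u) + u + u + u"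
   using split S1b S2 S20 S3 R Mc E1 unfolding u_def[symmetric] by linarith
  also have "... = (A0 * C1' + 1 + A0 * C2' + 1 + 1 + 1) * u" by (simp add: algebra_simps)
  finally have fin1: "\<bar>(\<Sum>v\<in>?Cl. ?N v) - c * M\<bar> \<le> (A0 * C1' + 1 + A0 * C2' + 1 + 1 + 1) * u" .
  have "(\<Sum>v\<in>?Cl. ?N v) / c - M = ((\<Sum>v\<in>?Cl. ?N v) - c * M) / c" using c0 by (simp add: field_simps)
  then have "\<bar>(\<Sum>v\<in>?Cl. ?N v) / c - M\<bar> = \<bar>(\<Sum>v\<in>?Cl. ?N v) - c * M\<bar> / c" using c0 by simp
  also have "... \<le> (A0 * C1' + 1 + A0 * C2' + 1 + 1 + 1) * u / c" using fin1 c0 by (intro divide_right_mono) auto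
  also have "... \<le> (A0 * C1' + 1 + A0 * C2' + 1 + 1 + 1) * u / (A0 / 2 * X)"
  proof (rule divide_left_mono[OF cX])
   show "0 \<le> (A0 * C1' + 1 + A0 * C2' + 1 + 1 + 1) * u"
    unfolding u_def C1'_def C2'_def using par C2 X1 L by (intro mult_nonneg_nonneg add_nonneg_nonneg divide_nonneg_nonneg) auto
   show "0 < c * (A0 / 2 * X)" using c0 par X1 by simp
  qed
  also have "... = Ct * (1 / L)" unfolding Ct_def u_def using par X1 L by (simp add: field_simps)
  finally show ?case unfolding c_def L_def .
 qed
 then have "(\<lambda>X. (\<Sum>v\<in>Cl X. ?N v) / real (card (Cl X)) - M) \<in> O(\<lambda>X. 1 / ln X)"
 proof (intro bigoI[where c = Ct], elim eventually_rev_mp, intro eventually_mono[OF eventually_gt_at_top[of 1]] impI)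
  fix X :: real assume "1 < X" "\<bar>(\<Sum>v\<in>Cl X. ?N v) / real (card (Cl X)) - M\<bar> \<le> Ct * (1 / ln X)"
  then show "norm ((\<Sum>v\<in>Cl X. ?N v) / real (card (Cl X)) - M) \<le> Ct * norm (1 / ln X)" by simp
 qed
 then show ?thesis using M by blast
qed

section \<open>Algebraic number theory inside the complex numbers\<close>

section \<open>Subfields of the complex numbers\<close>

text \<open>As \<open>inverse 0 = 0\<close>, closure under inverses can be demanded of all elements.
  The predicate is the concrete form of \<open>subfield\<close>, free of record notation.\<close>

definition csubfield :: "complex set => bool" where
 "csubfield F \<longleftrightarrow> 1 \<in> F \<and> (\<forall>x\<in>F. \<forall>y\<in>F. x + y \<in> F \<and> x * y \<in> F) \<and> (\<forall>x\<in>F. - x \<in> F \<and> inverse x \<in> F)"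

lemma complex_ring_simps [simp]:
 "carrier complex_ring = UNIV" "x \<otimes>\<^bsub>complex_ring\<^esub> y = x * y" "\<one>\<^bsub>complex_ring\<^esub> = 1"
 "\<zero>\<^bsub>complex_ring\<^esub> = 0" "x \<oplus>\<^bsub>complex_ring\<^esub> y = x + y"
 by (simp_all add: complex_ring_def)

lemma complex_ring_field: "field complex_ring"
proof (rule cring.cring_fieldI)
 show cr: "cring complex_ring"
 proof (rule cringI)
  show "abelian_group complex_ring"
  proof (rule abelian_groupI)
   fix x show "\<exists>y\<in>carrier complex_ring. y \<oplus>\<^bsub>complex_ring\<^esub> x = \<zero>\<^bsub>complex_ring\<^esub>"
    by (intro bexI[of _ "- x"]) auto
  qed (auto simp: add_ac)
  show "Group.comm_monoid complex_ring" by (rule comm_monoidI) (auto simp: mult_ac)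
 qed (auto simp: algebra_simps)
 show "Units complex_ring = carrier complex_ring - {\<zero>\<^bsub>complex_ring\<^esub>}"
 proof (intro equalityI subsetI)
  fix x assume "x \<in> Units complex_ring"
  then show "x \<in> carrier complex_ring - {\<zero>\<^bsub>complex_ring\<^esub>}" unfolding Units_def by auto
 next
  fix x assume "x \<in> carrier complex_ring - {\<zero>\<^bsub>complex_ring\<^esub>}"
  then have "inverse x * x = 1" "x * inverse x = 1" by auto
  then show "x \<in> Units complex_ring" unfolding Units_def by auto
 qed
qed

lemma complex_ring_a_inv [simp]: "\<ominus>\<^bsub>complex_ring\<^esub> x = - x"
proof -
 interpret C: field complex_ring by (rule complex_ring_field)
 show ?thesis using C.minus_equality[of "- x" x] by simp
qed

lemma complex_ring_m_inv [simp]: "x \<noteq> 0 ==> inv\<^bsub>complex_ring\<^esub> x = inverse x"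
proof -
 interpret C: field complex_ring by (rule complex_ring_field)
 show "x \<noteq> 0 ==> inv\<^bsub>complex_ring\<^esub> x = inverse x" using C.inv_unique'[of x "inverse x"] by simp
qed

lemma csubfield_props: assumes "csubfield F"
 shows "1 \<in> F" "0 \<in> F" "x \<in> F ==> y \<in> F ==> x + y \<in> F" "x \<in> F ==> y \<in> F ==> x * y \<in> F"
  "x \<in> F ==> - x \<in> F" "x \<in> F ==> inverse x \<in> F" "x \<in> F ==> y \<in> F ==> x - y \<in> F"
  "x \<in> F ==> y \<in> F ==> x / y \<in> F"
proof -
 show 1: "1 \<in> F" and add: "x \<in> F ==> y \<in> F ==> x + y \<in> F" and mult: "x \<in> F ==> y \<in> F ==> x * y \<in> F"
  and neg: "x \<in> F ==> - x \<in> F" and inv: "x \<in> F ==> inverse x \<in> F" for x y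
  using assms by (auto simp: csubfield_def)
 show "0 \<in> F" using add[OF 1 neg[OF 1]] by simp
 show "x \<in> F ==> y \<in> F ==> x - y \<in> F" using add[of x "- y"] neg[of y] by simp
 show "x \<in> F ==> y \<in> F ==> x / y \<in> F" using mult[of x "inverse y"] inv[of y] by (simp add: divide_inverse)
qed

lemma csubfield_sum: "csubfield F ==> (\<And>i. i \<in> A ==> f i \<in> F) ==> sum f A \<in> F"
 by (induction A rule: infinite_finite_induct) (auto simp: csubfield_props)

lemma csubfield_prod: "csubfield F ==> (\<And>i. i \<in> A ==> f i \<in> F) ==> prod f A \<in> F"
 by (induction A rule: infinite_finite_induct) (auto simp: csubfield_props)

lemma csubfield_power: "csubfield F ==> x \<in> F ==> x ^ n \<in> F"
 by (induction n) (auto simp: csubfield_props)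

lemma csubfield_of_int: "csubfield F ==> of_int z \<in> F"
proof -
 assume F: "csubfield F"
 have "of_nat n \<in> F" for n by (induction n) (auto simp: csubfield_props[OF F])
 then show ?thesis by (cases z rule: int_cases2) (auto simp: csubfield_props[OF F])
qed

lemma csubfield_Rats: "csubfield F ==> \<rat> \<subseteq> F"
 using csubfield_of_int csubfield_props(8) by (auto elim!: Rats_cases' simp: )

lemma csubfield_Rats_is: "csubfield \<rat>" unfolding csubfield_def by auto

lemma subfield_complex_iff: "subfield F complex_ring \<longleftrightarrow> csubfield F"
proof
 interpret C: field complex_ring by (rule complex_ring_field)
 assume F: "subfield F complex_ring"
 note R = subringE[OF subfieldE(1)[OF F]]
 have "inverse x \<in> F" if "x \<in> F" for x
 proof (cases "x = 0")
  case False
  then show ?thesis using C.subfield_m_inv(1)[OF F, of x] that by simp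
 qed (use R(2) in simp)
 then show "csubfield F" using R unfolding csubfield_def by auto
next
 interpret C: field complex_ring by (rule complex_ring_field)
 assume F: "csubfield F"
 show "subfield F complex_ring"
 proof (rule C.subfieldI')
  show "subring F complex_ring" by (rule C.subringI) (use csubfield_props[OF F] in auto)
  show "inv\<^bsub>complex_ring\<^esub> k \<in> F" if "k \<in> F - {\<zero>\<^bsub>complex_ring\<^esub>}" for k
   using that csubfield_props(6)[OF F, of k] by auto
 qed
qed

lemma generate_field_complex:
 shows "csubfield (generate_field complex_ring H)" "H \<subseteq> generate_field complex_ring H"
  "csubfield F ==> H \<subseteq> F ==> generate_field complex_ring H \<subseteq> F"
proof -
 interpret C: field complex_ring by (rule complex_ring_field)
 show "csubfield (generate_field complex_ring H)"
  using C.generate_field_is_subfield[of H] by (simp add: subfield_complex_iff)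
 show "H \<subseteq> generate_field complex_ring H" by (auto intro: generate_field.incl)
 show "csubfield F ==> H \<subseteq> F ==> generate_field complex_ring H \<subseteq> F"
  using C.generate_field_min_subfield1[of H F] by (simp add: subfield_complex_iff)
qed

lemma combine_complex:
 "length Ks = length Us ==> ring.combine complex_ring Ks Us = (\<Sum>i<length Us. Ks ! i * Us ! i)"
proof (induction Ks Us rule: list_induct2)
 case Nil
 interpret C: field complex_ring by (rule complex_ring_field)
 show ?case by simp
next
 case (Cons k Ks u Us)
 interpret C: field complex_ring by (rule complex_ring_field)
 show ?case using Cons by (simp add: sum.lessThan_Suc_shift del: sum.lessThan_Suc)
qed

subsection \<open>Minimal polynomials\<close>

definition poly_over :: "complex set => complex poly => bool" where
 "poly_over F p \<longleftrightarrow> (\<forall>i. poly.coeff p i \<in> F)"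

text \<open>Any nonzero polynomial of least degree qualifies, so the minimal polynomial is fixed
  only up to a scalar.\<close>

definition min_poly_over :: "complex set => complex => complex poly => bool" where
 "min_poly_over F z m \<longleftrightarrow> poly_over F m \<and> m \<noteq> 0 \<and> poly m z = 0 \<and>
   (\<forall>p. poly_over F p \<and> p \<noteq> 0 \<and> poly p z = 0 --> degree m \<le> degree p)"

context
 fixes F assumes F: "csubfield F"
begin

lemma poly_over_simps:
 "poly_over F 0" "c \<in> F ==> poly_over F [:c:]" "poly_over F p ==> poly_over F q ==> poly_over F (p + q)"
 "poly_over F p ==> poly_over F q ==> poly_over F (p - q)"
 "poly_over F p ==> poly_over F q ==> poly_over F (p * q)" "c \<in> F ==> poly_over F (Polynomial.monom c n)"
 "c \<in> F ==> poly_over F p ==> poly_over F (pCons c p)" "poly_over F p ==> poly_over F (pderiv p)"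
 "poly_over F p ==> x \<in> F ==> poly p x \<in> F"
proof -
 note P = csubfield_props[OF F]
 show "poly_over F 0" "c \<in> F ==> poly_over F [:c:]" "c \<in> F ==> poly_over F (Polynomial.monom c n)"
  "c \<in> F ==> poly_over F p ==> poly_over F (pCons c p)"
  using P by (auto simp: poly_over_def coeff_pCons split: nat.splits)
 show "poly_over F p ==> poly_over F q ==> poly_over F (p + q)"
  "poly_over F p ==> poly_over F q ==> poly_over F (p - q)" using P by (auto simp: poly_over_def)
 show "poly_over F p ==> poly_over F q ==> poly_over F (p * q)"
  using P by (auto simp: poly_over_def coeff_mult intro!: csubfield_sum[OF F])
 show "poly_over F p ==> poly_over F (pderiv p)" unfolding poly_over_def coeff_pderiv
  using P(4) csubfield_of_int[OF F, of "int k" for k] by (metis of_int_of_nat_eq)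
 show "poly_over F p ==> x \<in> F ==> poly p x \<in> F"
  unfolding poly_altdef poly_over_def using P by (intro csubfield_sum[OF F] P(4) csubfield_power[OF F]) auto
qed

lemma poly_over_pcompose: "poly_over F p ==> poly_over F q ==> poly_over F (pcompose p q)"
proof (induction p)
 case (pCons a p)
 have "a \<in> F" using pCons.prems(1) by (auto simp: poly_over_def coeff_pCons split: nat.splits dest: spec[of _ 0])
 moreover have "poly_over F p" unfolding poly_over_def
 proof
  fix i show "poly.coeff p i \<in> F" using pCons.prems(1) unfolding poly_over_def by (metis coeff_pCons_Suc)
 qed
 ultimately show ?case using pCons by (simp add: pcompose_pCons poly_over_simps)
qed (simp add: poly_over_simps)

lemma poly_over_division: assumes m: "poly_over F m" "m \<noteq> 0" and p: "poly_over F p"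
 shows "\<exists>q r. poly_over F q \<and> poly_over F r \<and> p = q * m + r \<and> (r = 0 \<or> degree r < degree m)"
 using p
proof (induction "degree p" arbitrary: p rule: less_induct)
 case less
 show ?case
 proof (cases "p = 0 \<or> degree p < degree m")
  case True
  then show ?thesis using less.prems poly_over_simps(1) by (intro exI[of _ 0] exI[of _ p]) auto
 next
  case False
  define c where "c = lead_coeff p / lead_coeff m"
  define t where "t = Polynomial.monom c (degree p - degree m)"
  have "c \<in> F" unfolding c_def using less.prems m csubfield_props(8)[OF F] by (auto simp: poly_over_def)
  then have t: "poly_over F t" unfolding t_def by (rule poly_over_simps)
  define p' where "p' = p - t * m"
  have p': "poly_over F p'" unfolding p'_def using less.prems t m by (intro poly_over_simps)
  have c0: "c \<noteq> 0" unfolding c_def using False m by auto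
  have dt: "degree (t * m) = degree p" "poly.coeff (t * m) (degree p) = lead_coeff p"
  proof -
   have "t \<noteq> 0" unfolding t_def using c0 by simp
   then show d: "degree (t * m) = degree p"
    using m False c0 by (simp add: degree_mult_eq t_def degree_monom_eq)
   have "lead_coeff (t * m) = lead_coeff t * lead_coeff m" by (rule lead_coeff_mult)
   then show "poly.coeff (t * m) (degree p) = lead_coeff p"
    unfolding d using m c0 by (simp add: t_def degree_monom_eq c_def)
  qed
  have "degree p' \<le> degree p" unfolding p'_def using dt by (intro degree_diff_le) auto
  moreover have "poly.coeff p' (degree p) = 0" unfolding p'_def using dt by simp
  ultimately have "p' = 0 \<or> degree p' < degree p" by (rule eq_zero_or_degree_less)
  then have "\<exists>q r. poly_over F q \<and> poly_over F r \<and> p' = q * m + r \<and> (r = 0 \<or> degree r < degree m)"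
  proof
   assume "p' = 0"
   then show ?thesis using poly_over_simps(1) by (intro exI[of _ 0] exI[of _ 0]) auto
  next
   assume "degree p' < degree p"
   then show ?thesis using less.hyps p' by blast
  qed
  then obtain q r where "poly_over F q" "poly_over F r" "p' = q * m + r" "r = 0 \<or> degree r < degree m" by blast
  then show ?thesis using t
   by (intro exI[of _ "q + t"] exI[of _ r]) (auto simp: p'_def algebra_simps poly_over_simps)
 qed
qed

lemma min_poly_exists: assumes "poly_over F p" "p \<noteq> 0" "poly p z = 0"
 shows "\<exists>m. min_poly_over F z m"
 using ex_has_least_nat[of "\<lambda>p. poly_over F p \<and> p \<noteq> 0 \<and> poly p z = 0" p degree] assms
 unfolding min_poly_over_def by blast

lemma min_poly_dvd: assumes m: "min_poly_over F z m" and p: "poly_over F p" "poly p z = 0"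
 shows "\<exists>q. poly_over F q \<and> p = q * m"
proof -
 obtain q r where qr: "poly_over F q" "poly_over F r" "p = q * m + r" "r = 0 \<or> degree r < degree m"
  using poly_over_division[OF _ _ p(1), of m] m unfolding min_poly_over_def by blast
 have "poly r z = 0" using p(2) qr(3) m by (simp add: min_poly_over_def)
 then have "r = 0" using qr m unfolding min_poly_over_def by force
 then show ?thesis using qr by auto
qed

text \<open>Irreducibility in disguise: if n is minimal for w, then m = h n. If z is a root of h,
  minimality of m forces n to be constant; otherwise z is a root of n and the degrees agree.\<close>

lemma min_poly_conj: assumes m: "min_poly_over F z m" and w: "poly m w = 0"
 shows "min_poly_over F w m"
proof -
 have mF: "poly_over F m" "m \<noteq> 0" "poly m z = 0" using m by (auto simp: min_poly_over_def)
 obtain n where n: "min_poly_over F w n" using min_poly_exists[OF mF(1,2) w] by blast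
 then have nF: "poly_over F n" "n \<noteq> 0" by (auto simp: min_poly_over_def)
 obtain h where h: "poly_over F h" "m = h * n" using min_poly_dvd[OF n mF(1) w] by blast
 have h0: "h \<noteq> 0" using h mF by auto
 have deg: "degree m = degree h + degree n" unfolding h(2) using h0 nF(2) by (rule degree_mult_eq)
 have "degree m \<le> degree n"
 proof -
  have "poly h z = 0 \<or> poly n z = 0" using mF(3) h(2) by auto
  then show ?thesis
  proof
   assume "poly h z = 0"
   then have "degree m \<le> degree h" using m h h0 unfolding min_poly_over_def by blast
   then have "degree n = 0" using deg by simp
   then obtain c where "n = [:c:]" by (rule degree_eq_zeroE)
   then show ?thesis using n by (auto simp: min_poly_over_def)
  next
   assume "poly n z = 0"
   then show ?thesis using m nF unfolding min_poly_over_def by blast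
  qed
 qed
 then show ?thesis using n mF w unfolding min_poly_over_def by (meson le_trans)
qed

text \<open>Separability in characteristic 0: the derivative is nonzero of smaller degree, so it
  shares no root with m, which is minimal for each of its roots.\<close>

lemma min_poly_roots: assumes m: "min_poly_over F z m"
 shows "card {w. poly m w = 0} = degree m" "degree m > 0"
proof -
 have mF: "poly_over F m" "m \<noteq> 0" "poly m z = 0" using m by (auto simp: min_poly_over_def)
 show d0: "degree m > 0"
 proof (rule ccontr)
  assume "\<not> degree m > 0"
  then obtain c where "m = [:c:]" by (auto elim: degree_eq_zeroE)
  then show False using mF by auto
 qed
 have "rsquarefree m" unfolding rsquarefree_roots
 proof (intro allI notI, elim conjE)
  fix a assume a: "poly m a = 0" "poly (pderiv m) a = 0"
  have "min_poly_over F a m" by (rule min_poly_conj[OF m a(1)])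
  moreover have "pderiv m \<noteq> 0" using d0 by (simp add: pderiv_eq_0_iff)
  ultimately have "degree m \<le> degree (pderiv m)" using a poly_over_simps(8)[OF mF(1)] unfolding min_poly_over_def by blast
  then show False using d0 by (simp add: degree_pderiv)
 qed
 then have dec: "smult (lead_coeff m) (\<Prod>z | poly m z = 0. [:- z, 1:]) = m"
  by (rule complex_poly_decompose_rsquarefree)
 have "degree m = degree (\<Prod>z | poly m z = 0. [:- z, 1:])"
  by (subst dec[symmetric]) (use mF in simp)
 also have "... = (\<Sum>z | poly m z = 0. degree [:- z, 1:])" by (rule degree_prod_eq_sum_degree) auto
 finally show "card {w. poly m w = 0} = degree m" by simp
qed

end

subsection \<open>Algebraic integers\<close>

definition int_span :: "complex set => complex set" where
 "int_span V = {\<Sum>v\<in>V. of_int (c v) * v | c. True}"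

lemma int_span_closed: assumes "finite V"
 shows "v \<in> V ==> v \<in> int_span V" "x \<in> int_span V ==> y \<in> int_span V ==> x + y \<in> int_span V"
  "0 \<in> int_span V" "x \<in> int_span V ==> of_int k * x \<in> int_span V"
proof -
 show "v \<in> V ==> v \<in> int_span V" unfolding int_span_def
 proof (intro CollectI exI[of _ "\<lambda>u. if u = v then 1 else 0"] conjI TrueI)
  assume "v \<in> V"
  have "(\<Sum>u\<in>V. of_int (if u = v then 1 else 0) * u) = (\<Sum>u\<in>V. if u = v then u else 0)"
   by (intro sum.cong) auto
  then show "v = (\<Sum>u\<in>V. of_int (if u = v then 1 else 0) * u)" using \<open>v \<in> V\<close> assms by simp
 qed
 show "x \<in> int_span V ==> y \<in> int_span V ==> x + y \<in> int_span V" unfolding int_span_def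
 proof clarify
  fix c d show "\<exists>e. (\<Sum>v\<in>V. of_int (c v) * v) + (\<Sum>v\<in>V. of_int (d v) * v) = (\<Sum>v\<in>V. of_int (e v) * v) \<and> True"
   by (intro exI[of _ "\<lambda>v. c v + d v"]) (simp add: sum.distrib algebra_simps)
 qed
 show "0 \<in> int_span V" unfolding int_span_def by (auto intro!: exI[of _ "\<lambda>_. 0"])
 show "x \<in> int_span V ==> of_int k * x \<in> int_span V" unfolding int_span_def
 proof clarify
  fix c show "\<exists>e. of_int k * (\<Sum>v\<in>V. of_int (c v) * v) = (\<Sum>v\<in>V. of_int (e v) * v) \<and> True"
   by (intro exI[of _ "\<lambda>v. k * c v"]) (simp add: sum_distrib_left mult_ac)
 qed
qed

lemma int_span_sum: "finite V ==> (\<And>i. i \<in> A ==> f i \<in> int_span V) ==> sum f A \<in> int_span V"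
 by (induction A rule: infinite_finite_induct) (auto simp: int_span_closed)

lemma int_span_mult:
 assumes V: "finite V" and a: "\<And>v. v \<in> V ==> a * v \<in> int_span V" and x: "x \<in> int_span V"
 shows "a * x \<in> int_span V"
proof -
 obtain c where "x = (\<Sum>v\<in>V. of_int (c v) * v)" using x by (auto simp: int_span_def)
 then have "a * x = (\<Sum>v\<in>V. of_int (c v) * (a * v))" by (simp add: sum_distrib_left mult_ac)
 also have "... \<in> int_span V" using V a by (intro int_span_sum int_span_closed(4)) auto
 finally show ?thesis .
qed

text \<open>The determinant trick: x is an eigenvalue of the integer matrix by which it acts on V,
  hence a root of a monic integer polynomial.\<close>

lemma algebraic_int_if_int_span:
 assumes V: "finite V" "v0 \<in> V" "v0 \<noteq> 0" and x: "\<And>v. v \<in> V ==> x * v \<in> int_span V"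
 shows "algebraic_int x"
proof -
 define n where "n = card V"
 obtain e where e: "bij_betw e {0..<n} V" using ex_bij_betw_nat_finite[OF V(1)] unfolding n_def by blast
 have "\<forall>v\<in>V. \<exists>c. x * v = (\<Sum>u\<in>V. of_int (c u :: int) * u)" using x by (auto simp: int_span_def)
 then obtain c :: "complex => complex => int" where c: "\<And>v. v \<in> V ==> x * v = (\<Sum>u\<in>V. of_int (c v u) * u)" by metis
 define A where "A = Matrix.mat n n (\<lambda>(i, j). c (e i) (e j))"
 define B :: "complex mat" where "B = map_mat of_int A"
 have A: "A \<in> carrier_mat n n" unfolding A_def by simp
 have B: "B \<in> carrier_mat n n" unfolding B_def using A by simp
 define w where "w = Matrix.vec n e"
 have "B *\<^sub>v w = x \<cdot>\<^sub>v w"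
 proof (rule eq_vecI)
  fix i assume "i < dim_vec (x \<cdot>\<^sub>v w)"
  then have i: "i < n" by (simp add: w_def)
  have "(B *\<^sub>v w) $ i = (\<Sum>j\<in>{0..<n}. of_int (c (e i) (e j)) * e j)"
   using i by (simp add: B_def A_def w_def scalar_prod_def)
  also have "... = (\<Sum>u\<in>V. of_int (c (e i) u) * u)"
   using sum.reindex_bij_betw[OF e, of "\<lambda>u. of_int (c (e i) u) * u"] by simp
  also have "... = x * e i" using c[of "e i"] e i by (auto simp: bij_betw_def)
  finally show "(B *\<^sub>v w) $ i = (x \<cdot>\<^sub>v w) $ i" using i by (simp add: w_def)
 qed (simp add: B_def A_def w_def)
 moreover have "w \<noteq> 0\<^sub>v n"
 proof
  assume "w = 0\<^sub>v n"
  obtain i where "i < n" "e i = v0" using e V(2) by (auto simp: bij_betw_def image_iff)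
  then have "w $ i = v0" by (simp add: w_def)
  then show False using \<open>w = 0\<^sub>v n\<close> \<open>i < n\<close> V(3) by simp
 qed
 ultimately have "eigenvalue B x"
  unfolding eigenvalue_def eigenvector_def using B by (intro exI[of _ w]) (auto simp: w_def)
 then have "poly (char_poly B) x = 0" using eigenvalue_root_char_poly[OF B] by simp
 then have "poly (map_poly of_int (char_poly A)) x = 0"
  unfolding B_def by (simp add: of_int_hom.char_poly_hom[OF A])
 moreover have "lead_coeff (char_poly A) = 1" using degree_monic_char_poly[OF A] by simp
 ultimately show ?thesis unfolding algebraic_int_altdef_ipoly by blast
qed

lemma algebraic_int_power_span: assumes "algebraic_int (a :: complex)"
 shows "\<exists>m>0. \<exists>c :: nat => int. a ^ m = (\<Sum>i<m. of_int (c i) * a ^ i)"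
proof -
 obtain p where p: "poly (map_poly of_int p) a = 0" "lead_coeff p = 1"
  using assms unfolding algebraic_int_altdef_ipoly by blast
 define m where "m = degree p"
 have "m > 0"
 proof (rule ccontr)
  assume "\<not> m > 0"
  then obtain c where "p = [:c:]" unfolding m_def by (auto elim: degree_eq_zeroE)
  then show False using p by simp
 qed
 have "0 = (\<Sum>i\<le>m. of_int (poly.coeff p i) * a ^ i)"
  using p(1) unfolding poly_altdef m_def by (simp add: degree_map_poly coeff_map_poly)
 also have "{..m} = insert m {..<m}" by auto
 finally have "0 = a ^ m + (\<Sum>i<m. of_int (poly.coeff p i) * a ^ i)"
  using p(2) unfolding m_def by simp
 then have "a ^ m = (\<Sum>i<m. of_int (- poly.coeff p i) * a ^ i)"
  by (simp add: sum_negf eq_neg_iff_add_eq_0)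
 then show ?thesis using \<open>m > 0\<close> by (intro exI[of _ m] exI[of _ "\<lambda>i. - poly.coeff p i"] conjI)
qed

text \<open>The finitely many products a^i b^j below the degrees span a module stable under a and b,
  and therefore under a + b and a b.\<close>

lemma algebraic_int_add_mult: assumes "algebraic_int (a :: complex)" "algebraic_int b"
 shows "algebraic_int (a + b)" "algebraic_int (a * b)"
proof -
 obtain m c where m: "m > 0" "a ^ m = (\<Sum>i<m. of_int (c i :: int) * a ^ i)" using algebraic_int_power_span[OF assms(1)] by blast
 obtain n d where n: "n > 0" "b ^ n = (\<Sum>i<n. of_int (d i :: int) * b ^ i)" using algebraic_int_power_span[OF assms(2)] by blast
 define V where "V = (\<lambda>(i, j). a ^ i * b ^ j) ` ({..<m} \<times> {..<n})"
 have V: "finite V" unfolding V_def by simp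
 have V1: "a ^ i * b ^ j \<in> int_span V" if "i < m" "j < n" for i j
  using that by (intro int_span_closed(1)[OF V]) (auto simp: V_def)
 have aV: "a * v \<in> int_span V" if v: "v \<in> V" for v
 proof -
  obtain i j where ij: "i < m" "j < n" "v = a ^ i * b ^ j" using v by (auto simp: V_def)
  show ?thesis
  proof (cases "Suc i < m")
   case True
   then show ?thesis using V1[of "Suc i" j] ij by (simp add: mult_ac)
  next
   case False
   then have im: "m = Suc i" using ij by simp
   have "a * v = a ^ m * b ^ j" unfolding ij(3) im by (simp add: mult_ac)
   also have "... = (\<Sum>k<m. of_int (c k) * (a ^ k * b ^ j))"
    unfolding m(2) by (simp only: sum_distrib_right mult.assoc)
   also have "... \<in> int_span V" using V1 ij by (intro int_span_sum int_span_closed(4) V) auto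
   finally show ?thesis .
  qed
 qed
 have bV: "b * v \<in> int_span V" if v: "v \<in> V" for v
 proof -
  obtain i j where ij: "i < m" "j < n" "v = a ^ i * b ^ j" using v by (auto simp: V_def)
  show ?thesis
  proof (cases "Suc j < n")
   case True
   then show ?thesis using V1[of i "Suc j"] ij by (simp add: mult_ac)
  next
   case False
   then have jn: "n = Suc j" using ij by simp
   have "b * v = a ^ i * b ^ n" unfolding ij(3) jn by (simp add: mult_ac)
   also have "... = (\<Sum>k<n. of_int (d k) * (a ^ i * b ^ k))"
    unfolding n(2) by (simp only: sum_distrib_left mult.left_commute)
   also have "... \<in> int_span V" using V1 ij by (intro int_span_sum int_span_closed(4) V) auto
   finally show ?thesis .
  qed
 qed
 have one: "1 \<in> V" "(1::complex) \<noteq> 0" unfolding V_def using m n by (auto simp: image_iff intro!: bexI[of _ 0])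
 show "algebraic_int (a + b)"
  by (rule algebraic_int_if_int_span[OF V one]) (simp add: distrib_right int_span_closed[OF V] aV bV)
 show "algebraic_int (a * b)"
  by (rule algebraic_int_if_int_span[OF V one]) (simp add: mult.assoc int_span_mult[OF V aV] bV)
qed

lemma algebraic_int_of_int [simp]: "algebraic_int (of_int k :: complex)"
 by (rule int_imp_algebraic_int) simp

lemma algebraic_int_diff: "algebraic_int (a :: complex) ==> algebraic_int b ==> algebraic_int (a - b)"
 using algebraic_int_add_mult(1)[of a "- b"] by simp

lemma algebraic_int_sum: "(\<And>i. i \<in> A ==> algebraic_int (f i :: complex)) ==> algebraic_int (sum f A)"
 by (induction A rule: infinite_finite_induct) (auto simp: algebraic_int_add_mult)

lemma algebraic_int_prod: "(\<And>i. i \<in> A ==> algebraic_int (f i :: complex)) ==> algebraic_int (prod f A)"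
 by (induction A rule: infinite_finite_induct) (auto simp: algebraic_int_add_mult)

lemma algebraic_int_power: "algebraic_int (a :: complex) ==> algebraic_int (a ^ n)"
 by (induction n) (auto simp: algebraic_int_add_mult)

text \<open>With k the leading coefficient of an integer polynomial for x, multiplication by k x
  preserves the span of 1, x, ..., x^(n-1).\<close>

lemma algebraic_int_multiple: assumes "algebraic (x :: complex)"
 shows "\<exists>k::int. k \<noteq> 0 \<and> algebraic_int (of_int k * x)"
proof -
 obtain p where p: "p \<noteq> 0" "poly (map_poly of_int p) x = 0" using assms by (rule algebraicE')
 define n where "n = degree p"
 define k where "k = lead_coeff p"
 have k0: "k \<noteq> 0" unfolding k_def using p by simp
 have n0: "n > 0"
 proof (rule ccontr)
  assume "\<not> n > 0"
  then obtain c where "p = [:c:]" unfolding n_def by (auto elim: degree_eq_zeroE)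
  then show False using p by simp
 qed
 have "0 = (\<Sum>i\<le>n. of_int (poly.coeff p i) * x ^ i)"
  using p(2) unfolding poly_altdef n_def by (simp add: degree_map_poly coeff_map_poly)
 also have "{..n} = insert n {..<n}" by auto
 finally have e: "of_int k * x ^ n = - (\<Sum>i<n. of_int (poly.coeff p i) * x ^ i)"
  unfolding k_def n_def by (simp add: eq_neg_iff_add_eq_0)
 define V where "V = (\<lambda>i. x ^ i) ` {..<n}"
 have V: "finite V" "1 \<in> V" unfolding V_def using n0 by (auto simp: image_iff intro!: bexI[of _ 0])
 have VS: "of_int c * x ^ i \<in> int_span V" if "i < n" for i c
  using that by (intro int_span_closed(4,1)[OF V(1)]) (auto simp: V_def)
 have "algebraic_int (of_int k * x)"
 proof (rule algebraic_int_if_int_span[OF V])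
  fix v assume "v \<in> V"
  then obtain i where i: "i < n" "v = x ^ i" by (auto simp: V_def)
  show "of_int k * x * v \<in> int_span V"
  proof (cases "Suc i < n")
   case True
   then show ?thesis using VS[of "Suc i" k] i by (simp add: mult_ac)
  next
   case False
   then have "Suc i = n" using i by simp
   then have "of_int k * x * v = of_int k * x ^ n" using i by (metis mult.assoc power_Suc)
   also have "... = (\<Sum>i<n. of_int (- poly.coeff p i) * x ^ i)" unfolding e by (simp add: sum_negf)
   finally show ?thesis by (simp only:) (intro int_span_sum V(1) VS, simp)
  qed
 qed simp
 then show ?thesis using k0 by blast
qed

lemma algebraic_add_int_mult: assumes "algebraic (a :: complex)" "algebraic b"
 shows "algebraic (a + of_int t * b)"
proof -
 obtain k where k: "k \<noteq> 0" "algebraic_int (of_int k * a)" using algebraic_int_multiple[OF assms(1)] by blast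
 obtain l where l: "l \<noteq> 0" "algebraic_int (of_int l * b)" using algebraic_int_multiple[OF assms(2)] by blast
 have "of_int (k * l) * (a + of_int t * b) = of_int l * (of_int k * a) + of_int (k * t) * (of_int l * b)"
  by (simp add: algebra_simps)
 then have "algebraic_int (of_int (k * l) * (a + of_int t * b))"
  using k l algebraic_int_add_mult algebraic_int_of_int by metis
 then have "algebraic (of_int (k * l) * (a + of_int t * b))" by (rule algebraic_int_imp_algebraic)
 then obtain p where p: "\<And>i. poly.coeff p i \<in> \<int>" "p \<noteq> 0" "poly p (of_int (k * l) * (a + of_int t * b)) = 0"
  unfolding algebraic_def by blast
 define q where "q = pcompose p [:0, of_int (k * l):]"
 have "poly_over \<rat> p" unfolding poly_over_def using p(1) Ints_subset_Rats by blast
 moreover have "poly_over \<rat> [:0, of_int (k * l):]" by (intro poly_over_simps[OF csubfield_Rats_is]) auto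
 ultimately have "poly_over \<rat> q" unfolding q_def by (rule poly_over_pcompose[OF csubfield_Rats_is])
 then have "\<And>i. poly.coeff q i \<in> \<rat>" unfolding poly_over_def by blast
 moreover have "q \<noteq> 0" unfolding q_def using p(2) k l by (simp add: pcompose_eq_0_iff)
 moreover have "poly q (a + of_int t * b) = 0" unfolding q_def using p(3) by (simp add: poly_pcompose mult_ac)
 ultimately show ?thesis by (rule algebraicI')
qed

subsection \<open>Simple extensions and primitive elements\<close>

text \<open>The ring Q[z], which for algebraic z is already the field Q(z).\<close>

definition rat_adjoin :: "complex => complex set" where
 "rat_adjoin z = {poly p z | p. poly_over \<rat> p}"

lemmas poly_over_Rats = poly_over_simps[OF csubfield_Rats_is]

lemma rat_adjoinI: "poly_over \<rat> p ==> poly p z \<in> rat_adjoin z"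
 by (auto simp: rat_adjoin_def)

lemma rat_adjoin_self: "z \<in> rat_adjoin z"
 using rat_adjoinI[of "[:0, 1:]" z] by (simp add: poly_over_Rats)

lemma rat_adjoin_subset: "csubfield F ==> z \<in> F ==> rat_adjoin z \<subseteq> F"
proof
 fix x assume F: "csubfield F" "z \<in> F" and "x \<in> rat_adjoin z"
 then obtain p where p: "poly_over \<rat> p" "x = poly p z" by (auto simp: rat_adjoin_def)
 have "poly_over F p" using p csubfield_Rats[OF F(1)] by (auto simp: poly_over_def)
 then show "x \<in> F" using p F by (simp add: poly_over_simps)
qed

lemma algebraic_min_poly: assumes "algebraic z"
 obtains m where "min_poly_over \<rat> z m"
proof -
 obtain p where "\<forall>i. poly.coeff p i \<in> \<rat>" "p \<noteq> 0" "poly p z = 0"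
  using assms unfolding algebraic_altdef by blast
 then show ?thesis using min_poly_exists[OF csubfield_Rats_is, of p z] that by (auto simp: poly_over_def)
qed

lemma min_poly_algebraic: "min_poly_over \<rat> z m ==> algebraic z"
 unfolding min_poly_over_def poly_over_def by (auto intro: algebraicI')

text \<open>Inverses come from a Euclidean recursion: dividing m by p expresses the product of q(z)
  and p(z) as minus a remainder of smaller degree, which is nonzero at z by minimality and
  invertible by induction.\<close>

lemma csubfield_rat_adjoin: assumes "algebraic z" shows "csubfield (rat_adjoin z)"
proof -
 obtain m where m: "min_poly_over \<rat> z m" using algebraic_min_poly[OF assms] .
 have mF: "poly_over \<rat> m" "m \<noteq> 0" "poly m z = 0" using m by (auto simp: min_poly_over_def)
 have inv: "\<exists>a. poly_over \<rat> a \<and> poly a z * poly p z = 1"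
  if "poly_over \<rat> p" "poly p z \<noteq> 0" "degree p < degree m" for p using that
 proof (induction "degree p" arbitrary: p rule: less_induct)
  case less
  show ?case
  proof (cases "degree p = 0")
   case True
   then obtain c where c: "p = [:c:]" by (rule degree_eq_zeroE)
   then have "c \<in> \<rat>" using less.prems(1) by (auto simp: poly_over_def dest: spec[of _ 0])
   then show ?thesis using c less.prems(2) by (intro exI[of _ "[:inverse c:]"]) (simp add: poly_over_Rats)
  next
   case False
   then have p0: "p \<noteq> 0" by auto
   obtain q r where qr: "poly_over \<rat> q" "poly_over \<rat> r" "m = q * p + r" "r = 0 \<or> degree r < degree p"
    using poly_over_division[OF csubfield_Rats_is less.prems(1) p0 mF(1)] by blast
   have pr: "poly r z = - (poly q z * poly p z)"
    using mF(3) qr(3) by (simp add: eq_neg_iff_add_eq_0 add.commute)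
   have rz: "poly r z \<noteq> 0"
   proof
    assume rz: "poly r z = 0"
    then have "r = 0" using m qr less.prems(3) unfolding min_poly_over_def by force
    moreover have "poly q z = 0" using rz pr less.prems(2) by simp
    ultimately have "degree m \<le> degree q" "degree m = degree q + degree p"
     using m qr p0 mF(2) unfolding min_poly_over_def by (auto simp: degree_mult_eq)
    then show False using False by simp
   qed
   then have "degree r < degree p" using qr(4) by auto
   then obtain a where a: "poly_over \<rat> a" "poly a z * poly r z = 1"
    using less.hyps[OF _ qr(2) rz] less.prems(3) by auto
   have "poly_over \<rat> (0 - a * q)" by (intro poly_over_Rats a(1) qr(1))
   then show ?thesis using pr a(2) by (intro exI[of _ "0 - a * q"]) (simp add: mult_ac)
  qed
 qed
 show ?thesis unfolding csubfield_def
 proof (intro conjI ballI)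
  show "1 \<in> rat_adjoin z" using rat_adjoinI[of 1 z] by (simp add: poly_over_Rats one_pCons)
  fix x y assume "x \<in> rat_adjoin z" "y \<in> rat_adjoin z"
  then obtain p q where pq: "poly_over \<rat> p" "poly_over \<rat> q" "x = poly p z" "y = poly q z" by (auto simp: rat_adjoin_def)
  show "x + y \<in> rat_adjoin z" "x * y \<in> rat_adjoin z"
   using pq rat_adjoinI[of "p + q" z] rat_adjoinI[of "p * q" z] by (simp_all add: poly_over_Rats)
 next
  fix x assume "x \<in> rat_adjoin z"
  then obtain p where p: "poly_over \<rat> p" "x = poly p z" by (auto simp: rat_adjoin_def)
  then show "- x \<in> rat_adjoin z" using rat_adjoinI[of "0 - p" z] by (simp only: poly_over_Rats) simp
  obtain q r where qr: "poly_over \<rat> r" "p = q * m + r" "r = 0 \<or> degree r < degree m"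
   using poly_over_division[OF csubfield_Rats_is mF(1,2) p(1)] by blast
  then have xr: "x = poly r z" using p(2) mF(3) by simp
  show "inverse x \<in> rat_adjoin z"
  proof (cases "x = 0")
   case False
   then obtain a where "poly_over \<rat> a" "poly a z * x = 1" using inv[OF qr(1)] qr(3) xr by auto
   then show ?thesis using rat_adjoinI[of a z] by (simp add: inverse_unique mult.commute)
  qed (use rat_adjoinI[of 0 z] in \<open>simp add: poly_over_Rats\<close>)
 qed
qed

text \<open>The integer \<open>t\<close> avoids the finitely many values for which the polynomials
 \<open>g\<close> and \<open>f (c - t X)\<close> have a common root other than \<open>b\<close>.\<close>

lemma primitive_element_two: assumes a: "algebraic a" and b: "algebraic b"
 shows "\<exists>t::int. algebraic (a + of_int t * b) \<and> a \<in> rat_adjoin (a + of_int t * b) \<and> b \<in> rat_adjoin (a + of_int t * b)"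
proof -
 obtain f where f: "min_poly_over \<rat> a f" using algebraic_min_poly[OF a] .
 obtain g where g: "min_poly_over \<rat> b g" using algebraic_min_poly[OF b] .
 have f0: "f \<noteq> 0" "poly f a = 0" "poly_over \<rat> f" and g0: "g \<noteq> 0" "poly g b = 0" "poly_over \<rat> g"
  using f g by (auto simp: min_poly_over_def)
 define B where "B = (\<lambda>(u, v). (u - a) / (b - v)) ` ({u. poly f u = 0} \<times> {v. poly g v = 0})"
 have "finite B" unfolding B_def using f0 g0 by (intro finite_imageI finite_cartesian_product poly_roots_finite)
 then have "finite ((of_int :: int => complex) -` B)" by (rule finite_vimageI) (simp add: inj_on_def)
 then obtain t :: int where t: "of_int t \<notin> B" using ex_new_if_finite[OF infinite_UNIV_int] by blast
 define c where "c = a + of_int t * b"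
 have c: "algebraic c" unfolding c_def by (rule algebraic_add_int_mult[OF a b])
 define F where "F = rat_adjoin c"
 have F: "csubfield F" unfolding F_def by (rule csubfield_rat_adjoin[OF c])
 have cF: "c \<in> F" unfolding F_def by (rule rat_adjoin_self)
 have up: "poly_over \<rat> p ==> poly_over F p" for p using csubfield_Rats[OF F] by (auto simp: poly_over_def)
 define h where "h = pcompose f [:c, - of_int t:]"
 have tF: "- of_int t \<in> F" using csubfield_of_int[OF F, of "- t"] by simp
 have hF: "poly_over F h" unfolding h_def
  by (intro poly_over_pcompose[OF F] up f0 poly_over_simps[OF F] cF tF)
 have hb: "poly h b = 0" unfolding h_def using f0 by (simp add: poly_pcompose c_def mult.commute)
 \<comment> \<open>The minimal polynomial of b over Q(c) divides both g and h; it is separable, so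
   having b as its only root makes it linear, and b lies in Q(c).\<close>
 obtain m where m: "min_poly_over F b m" using min_poly_exists[OF F up[OF g0(3)] g0(1,2)] by blast
 have mF: "poly_over F m" "m \<noteq> 0" "poly m b = 0" using m by (auto simp: min_poly_over_def)
 have "{w. poly m w = 0} = {b}"
 proof (intro equalityI subsetI)
  fix w assume "w \<in> {w. poly m w = 0}"
  then have w: "poly m w = 0" by simp
  have "poly g w = 0" using min_poly_dvd[OF F m up[OF g0(3)] g0(2)] w by auto
  moreover have "poly h w = 0" using min_poly_dvd[OF F m hF hb] w by auto
  then have "poly f (a + of_int t * (b - w)) = 0"
   unfolding h_def by (simp add: poly_pcompose c_def algebra_simps)
  ultimately have "(a + of_int t * (b - w) - a) / (b - w) \<in> B" unfolding B_def by (intro image_eqI[of _ _ "(_, w)"]) auto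
  then show "w \<in> {b}" using t by (cases "w = b") auto
 qed (use mF in auto)
 then have "degree m = 1" using min_poly_roots(1)[OF F m] by simp
 then obtain u v where uv: "m = [:u, v:]" "v \<noteq> 0" using degree1_coeffs by blast
 have "u \<in> F" "v \<in> F" using mF(1) unfolding uv poly_over_def by (metis coeff_pCons_0, metis coeff_pCons_0 coeff_pCons_Suc)
 moreover have "b = - (u / v)" using mF(3) uv by (simp add: field_simps eq_neg_iff_add_eq_0 add.commute)
 ultimately have bF: "b \<in> F" using csubfield_props[OF F] by simp
 have "a = c + (- of_int t) * b" unfolding c_def by simp
 then have "a \<in> F" using csubfield_props(3,4)[OF F] cF bF tF by metis
 then show ?thesis using c bF unfolding c_def F_def by blast
qed

text \<open>The last conjunct says that c lies in every field containing Z, which later gives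
  equality with the generated field and not only an inclusion.\<close>

lemma primitive_element: assumes "finite Z" "\<And>z. z \<in> Z ==> algebraic z"
 shows "\<exists>c. algebraic c \<and> Z \<subseteq> rat_adjoin c \<and> (\<forall>F. csubfield F \<and> Z \<subseteq> F --> c \<in> F)"
 using assms
proof (induction Z rule: finite_induct)
 case empty
 then show ?case by (intro exI[of _ 0]) (auto simp: csubfield_props)
next
 case (insert z Z)
 then obtain c where c: "algebraic c" "Z \<subseteq> rat_adjoin c" "\<And>F. csubfield F ==> Z \<subseteq> F ==> c \<in> F" by auto
 obtain t :: int where t: "algebraic (c + of_int t * z)" "c \<in> rat_adjoin (c + of_int t * z)" "z \<in> rat_adjoin (c + of_int t * z)"
  using primitive_element_two[OF c(1)] insert.prems by blast
 have "rat_adjoin c \<subseteq> rat_adjoin (c + of_int t * z)"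
  by (rule rat_adjoin_subset[OF csubfield_rat_adjoin[OF t(1)] t(2)])
 then have "insert z Z \<subseteq> rat_adjoin (c + of_int t * z)" using c t by blast
 moreover have "c + of_int t * z \<in> F" if F: "csubfield F" "insert z Z \<subseteq> F" for F
  using c(3)[OF F(1)] F csubfield_props(3,4)[OF F(1)] csubfield_of_int[OF F(1)] by simp
 ultimately show ?case using t(1) by blast
qed

lemma poly_eq_sum_le:
 fixes p :: "'a :: comm_semiring_1 poly" assumes "degree p \<le> n"
 shows "poly p x = (\<Sum>i\<le>n. poly.coeff p i * x ^ i)"
 unfolding poly_altdef using assms by (intro sum.mono_neutral_left) (auto simp: coeff_eq_0)

lemma degree_Poly_le: "length xs \<le> Suc n ==> degree (Poly xs) \<le> n"
 by (rule degree_le) (auto simp: coeff_Poly_eq nth_default_def)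

lemma combine_powers: assumes "length Ks = d"
 shows "ring.combine complex_ring Ks (map (\<lambda>i. z ^ i) [0..<d]) = poly (Poly Ks) z"
proof (cases d)
 case 0
 then show ?thesis using assms combine_complex[of Ks "[]"] by simp
next
 case (Suc m)
 have "poly (Poly Ks) z = (\<Sum>i\<le>m. poly.coeff (Poly Ks) i * z ^ i)"
  by (rule poly_eq_sum_le, rule degree_Poly_le) (use assms Suc in simp)
 also have "{..m} = {..<d}" using Suc by auto
 also have "(\<Sum>i<d. poly.coeff (Poly Ks) i * z ^ i) = (\<Sum>i<d. Ks ! i * map (\<lambda>i. z ^ i) [0..<d] ! i)"
  by (intro sum.cong) (use assms in \<open>auto simp: coeff_Poly_eq nth_default_nth\<close>)
 finally show ?thesis using combine_complex[of Ks "map (\<lambda>i. z ^ i) [0..<d]"] assms by simp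
qed

lemma Poly_eq_0_set: "Poly Ks = 0 ==> set Ks \<subseteq> {0}"
 by (metis (no_types, lifting) coeff_0 coeff_Poly_eq in_set_conv_nth nth_default_nth singleton_iff subsetI)

lemma poly_over_Poly: "set Ks \<subseteq> \<rat> ==> poly_over \<rat> (Poly Ks)"
 by (auto simp: poly_over_def coeff_Poly_eq nth_default_def)

text \<open>With n the dimension, the n + 1 powers 1, x, ..., x^n are dependent, so all elements are
  algebraic and the primitive element theorem applies to a basis.\<close>

lemma number_field_rat_adjoin: assumes "number_field K"
 shows "\<exists>e. algebraic e \<and> K = rat_adjoin e"
proof -
 interpret C: field complex_ring by (rule complex_ring_field)
 have K: "csubfield K" and fd: "C.finite_dimension \<rat> K" using assms by (auto simp: number_field_def subfield_complex_iff)
 have Q: "subfield \<rat> complex_ring" by (simp add: subfield_complex_iff csubfield_Rats_is)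
 from fd obtain n where n: "C.dimension n \<rat> K" by (rule C.finite_dimensionE')
 obtain Vs where Vs: "C.independent \<rat> Vs" "length Vs = n" "C.Span \<rat> Vs = K" using C.exists_base[OF Q n] by blast
 have VK: "set Vs \<subseteq> K"
 proof -
  have "set Vs \<subseteq> C.Span \<rat> Vs" using C.Span_base_incl[OF Q] C.independent_in_carrier[OF Vs(1)] by simp
  then show ?thesis using Vs by simp
 qed
 have alg: "algebraic x" if x: "x \<in> K" for x
 proof -
  define Us where "Us = map (\<lambda>i. x ^ i) [0..<Suc n]"
  have "set Us \<subseteq> K" unfolding Us_def using csubfield_power[OF K x] by auto
  then have "\<not> C.independent \<rat> Us"
   using C.independent_length_le_dimension[OF Q n, of Us] by (auto simp: Us_def)
  then obtain Ks where Ks: "length Ks = length Us" "C.combine Ks Us = 0" "set Ks \<subseteq> \<rat>" "set Ks \<noteq> {0}"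
   using C.dependent_imp_non_trivial_combine[OF Q, of Us] by auto
  have l: "length Ks = Suc n" using Ks(1) by (simp add: Us_def)
  then have "Ks \<noteq> []" by auto
  then have "Poly Ks \<noteq> 0" using Ks(4) Poly_eq_0_set[of Ks] by (cases Ks) auto
  moreover have "\<And>i. poly.coeff (Poly Ks) i \<in> \<rat>" using poly_over_Poly[OF Ks(3)] by (simp add: poly_over_def)
  moreover have "poly (Poly Ks) x = 0" using combine_powers[OF l, of x] Ks(2) by (simp only: Us_def)
  ultimately show ?thesis by (intro algebraicI')
 qed
 obtain c where c: "algebraic c" "set Vs \<subseteq> rat_adjoin c" "\<And>F. csubfield F ==> set Vs \<subseteq> F ==> c \<in> F"
  using primitive_element[of "set Vs"] alg VK by blast
 have cF: "csubfield (rat_adjoin c)" by (rule csubfield_rat_adjoin[OF c(1)])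
 have "K \<subseteq> rat_adjoin c"
 proof
  fix x assume "x \<in> K"
  then obtain Ks where Ks: "set Ks \<subseteq> \<rat>" "length Ks = length Vs" "x = C.combine Ks Vs"
   using C.Span_mem_iff_length_version[OF Q, of Vs x] Vs(3) by auto
  have "x = (\<Sum>i<length Vs. Ks ! i * Vs ! i)" using combine_complex[OF Ks(2)] Ks(3) by simp
  also have "... \<in> rat_adjoin c"
  proof (intro csubfield_sum[OF cF] csubfield_props(4)[OF cF])
   fix i assume "i \<in> {..<length Vs}"
   then have "Ks ! i \<in> set Ks" "Vs ! i \<in> set Vs" using Ks(2) by auto
   then show "Ks ! i \<in> rat_adjoin c" "Vs ! i \<in> rat_adjoin c" using Ks(1) csubfield_Rats[OF cF] c(2) by auto
  qed
  finally show "x \<in> rat_adjoin c" .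
 qed
 moreover have "rat_adjoin c \<subseteq> K" by (rule rat_adjoin_subset[OF K c(3)[OF K VK]])
 ultimately show ?thesis using c(1) by blast
qed

lemma rat_adjoin_dimension: assumes m: "min_poly_over \<rat> e m"
 shows "ring.dimension complex_ring (degree m) \<rat> (rat_adjoin e)"
proof -
 interpret C: field complex_ring by (rule complex_ring_field)
 have Q: "subfield \<rat> complex_ring" by (simp add: subfield_complex_iff csubfield_Rats_is)
 define d where "d = degree m"
 have mF: "poly_over \<rat> m" "m \<noteq> 0" "poly m e = 0" using m by (auto simp: min_poly_over_def)
 define Us where "Us = map (\<lambda>i. e ^ i) [0..<d]"
 have comb: "C.combine Ks Us = poly (Poly Ks) e" if "length Ks = length Us" for Ks
  using combine_powers[of Ks d e] that by (simp add: Us_def)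
 have ind: "C.independent \<rat> Us"
 proof (rule ccontr)
  assume "\<not> C.independent \<rat> Us"
  then obtain Ks where Ks: "length Ks = length Us" "C.combine Ks Us = 0" "set Ks \<subseteq> \<rat>" "set Ks \<noteq> {0}"
   using C.dependent_imp_non_trivial_combine[OF Q, of Us] by auto
  have "Poly Ks = 0"
  proof (rule ccontr)
   assume "Poly Ks \<noteq> 0"
   moreover have "poly_over \<rat> (Poly Ks)" by (rule poly_over_Poly[OF Ks(3)])
   ultimately have "d \<le> degree (Poly Ks)" using m comb[OF Ks(1)] Ks(2) unfolding min_poly_over_def d_def by auto
   moreover have "degree (Poly Ks) < d"
   proof (rule degree_lessI)
    show "Poly Ks \<noteq> 0 \<or> d > 0" using \<open>Poly Ks \<noteq> 0\<close> by simp
    show "\<forall>k\<ge>d. poly.coeff (Poly Ks) k = 0" using Ks(1) by (auto simp: coeff_Poly_eq nth_default_def Us_def)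
   qed
   ultimately show False by simp
  qed
  then have "set Ks \<subseteq> {0}" by (rule Poly_eq_0_set)
  then have "Ks = []" using Ks(4) by (cases Ks) auto
  then have "d = 0" using Ks(1) by (simp add: Us_def)
  then show False using min_poly_roots(2)[OF csubfield_Rats_is m] by (simp add: d_def)
 qed
 have "C.Span \<rat> Us = rat_adjoin e"
 proof (intro equalityI subsetI)
  fix x assume "x \<in> C.Span \<rat> Us"
  then obtain Ks where Ks: "set Ks \<subseteq> \<rat>" "length Ks = length Us" "x = C.combine Ks Us"
   using C.Span_mem_iff_length_version[OF Q, of Us x] by auto
  have "poly_over \<rat> (Poly Ks)" by (rule poly_over_Poly[OF Ks(1)])
  then show "x \<in> rat_adjoin e" using Ks comb rat_adjoinI by simp
 next
  fix x assume "x \<in> rat_adjoin e"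
  then obtain p where p: "poly_over \<rat> p" "x = poly p e" by (auto simp: rat_adjoin_def)
  obtain q r where qr: "poly_over \<rat> q" "poly_over \<rat> r" "p = q * m + r" "r = 0 \<or> degree r < degree m"
   using poly_over_division[OF csubfield_Rats_is mF(1,2) p(1)] by blast
  define Ks where "Ks = map (poly.coeff r) [0..<d]"
  have "Poly Ks = r"
  proof (rule poly_eqI)
   fix i show "poly.coeff (Poly Ks) i = poly.coeff r i"
    using qr(4) by (cases "i < d") (auto simp: Ks_def coeff_Poly_eq nth_default_def d_def coeff_eq_0)
  qed
  moreover have "length Ks = length Us" by (simp add: Ks_def Us_def)
  ultimately have "C.combine Ks Us = x" using comb[of Ks] p qr mF by simp
  moreover have "set Ks \<subseteq> \<rat>" using qr(2) by (auto simp: Ks_def poly_over_def)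
  ultimately show "x \<in> C.Span \<rat> Us"
   using C.Span_mem_iff_length_version[OF Q, of Us x] \<open>length Ks = length Us\<close> by auto
 qed
 then show ?thesis using C.dimension_independent[OF ind] by (simp add: Us_def d_def)
qed

lemma rat_adjoin_number_field: assumes "min_poly_over \<rat> e m"
 shows "number_field (rat_adjoin e)" "degree_over_Q (rat_adjoin e) = degree m"
proof -
 interpret C: field complex_ring by (rule complex_ring_field)
 have Q: "subfield \<rat> complex_ring" by (simp add: subfield_complex_iff csubfield_Rats_is)
 note d = rat_adjoin_dimension[OF assms]
 show "number_field (rat_adjoin e)" unfolding number_field_def subfield_complex_iff
  using csubfield_rat_adjoin[OF min_poly_algebraic[OF assms]] C.finite_dimensionI[OF d] by simp
 show "degree_over_Q (rat_adjoin e) = degree m"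
  unfolding degree_over_Q_def using C.dimI[OF Q d] by (simp add: over_def)
qed

section \<open>Embeddings and the Galois closure\<close>

text \<open>Only the behaviour on K is prescribed. Values elsewhere stay free, so that restrictions
  and compositions are covered; \<open>embeddings\<close> adds extensionality.\<close>

definition chom :: "complex set => (complex => complex) => bool" where
 "chom K f \<longleftrightarrow> f 1 = 1 \<and> (\<forall>x\<in>K. \<forall>y\<in>K. f (x + y) = f x + f y \<and> f (x * y) = f x * f y)"

lemma embeddings_iff: "f \<in> embeddings K \<longleftrightarrow> chom K f \<and> f \<in> extensional K"
 by (auto simp: embeddings_def ring_hom_def chom_def)

lemma chom_cong: "chom K f ==> (\<And>x. x \<in> K ==> f x = g x) ==> csubfield K ==> chom K g"
 unfolding chom_def by (simp add: csubfield_props)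

context
 fixes K f assumes K: "csubfield K" and f: "chom K f"
begin

lemma chom_simps:
 "f 1 = 1" "x \<in> K ==> y \<in> K ==> f (x + y) = f x + f y" "x \<in> K ==> y \<in> K ==> f (x * y) = f x * f y"
 "f 0 = 0" "x \<in> K ==> f (- x) = - f x" "x \<in> K ==> y \<in> K ==> f (x - y) = f x - f y"
 "x \<in> K ==> f (inverse x) = inverse (f x)"
proof -
 show 1: "f 1 = 1" and add: "x \<in> K ==> y \<in> K ==> f (x + y) = f x + f y"
  and mult: "x \<in> K ==> y \<in> K ==> f (x * y) = f x * f y" for x y using f by (auto simp: chom_def)
 show 0: "f 0 = 0" using add[OF csubfield_props(2,2)[OF K]] by simp
 show neg: "x \<in> K ==> f (- x) = - f x" for x
  using add[of x "- x"] csubfield_props(5)[OF K, of x] 0 by (simp add: eq_neg_iff_add_eq_0 add.commute)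
 show "x \<in> K ==> y \<in> K ==> f (x - y) = f x - f y"
  using add[of x "- y"] csubfield_props(5)[OF K, of y] neg[of y] by simp
 show "x \<in> K ==> f (inverse x) = inverse (f x)"
  using mult[of x "inverse x"] csubfield_props(6)[OF K, of x] 0 1
  by (cases "x = 0") (auto intro: inverse_unique[symmetric])
qed

lemma chom_eq_0_iff: "x \<in> K ==> f x = 0 \<longleftrightarrow> x = 0"
proof
 assume x: "x \<in> K" "f x = 0"
 show "x = 0"
 proof (rule ccontr)
  assume "x \<noteq> 0"
  then have "f x * f (inverse x) = 1"
   using chom_simps(3)[of x "inverse x"] csubfield_props(6)[OF K x(1)] x chom_simps(1) by simp
  then show False using x by simp
 qed
qed (simp add: chom_simps)

lemma chom_inj: "inj_on f K"
proof (rule inj_onI)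
 fix x y assume "x \<in> K" "y \<in> K" "f x = f y"
 then show "x = y" using chom_eq_0_iff[of "x - y"] chom_simps(6)[of x y] csubfield_props(7)[OF K, of x y] by simp
qed

lemma chom_sum: "(\<And>i. i \<in> A ==> g i \<in> K) ==> f (sum g A) = (\<Sum>i\<in>A. f (g i))"
 by (induction A rule: infinite_finite_induct) (auto simp: chom_simps csubfield_sum[OF K])

lemma chom_prod: "(\<And>i. i \<in> A ==> g i \<in> K) ==> f (prod g A) = (\<Prod>i\<in>A. f (g i))"
 by (induction A rule: infinite_finite_induct) (auto simp: chom_simps csubfield_prod[OF K])

lemma chom_power: "x \<in> K ==> f (x ^ k) = f x ^ k"
 by (induction k) (auto simp: chom_simps csubfield_power[OF K])

lemma chom_of_int: "f (of_int k) = of_int k"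
proof -
 have "f (of_nat n) = of_nat n" for n
 proof (induction n)
  case (Suc n)
  then show ?case using chom_simps(2)[of 1 "of_nat n"] csubfield_props(1)[OF K] csubfield_of_int[OF K, of "int n"]
   by (simp add: chom_simps)
 qed (simp add: chom_simps)
 moreover have "of_nat n \<in> K" for n using csubfield_of_int[OF K, of "int n"] by simp
 ultimately show ?thesis by (cases k rule: int_cases2) (auto simp: chom_simps)
qed

lemma chom_Rats: "x \<in> \<rat> ==> f x = x"
proof (elim Rats_cases')
 fix a b :: int assume "0 < b" "x = of_int a / of_int b"
 then show "f x = x" unfolding divide_inverse using csubfield_of_int[OF K] csubfield_props(6)[OF K]
  by (simp add: chom_simps chom_of_int)
qed

lemma chom_poly: assumes "poly_over \<rat> p" "z \<in> K" shows "f (poly p z) = poly p (f z)"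
proof -
 have c: "poly.coeff p i \<in> K" "f (poly.coeff p i) = poly.coeff p i" for i
  using assms(1) csubfield_Rats[OF K] chom_Rats by (auto simp: poly_over_def)
 have "f (poly p z) = (\<Sum>i\<le>degree p. f (poly.coeff p i * z ^ i))"
  unfolding poly_altdef by (intro chom_sum csubfield_props(4)[OF K] csubfield_power[OF K] c assms)
 also have "... = poly p (f z)" unfolding poly_altdef
  by (intro sum.cong refl) (simp add: chom_simps(3) c csubfield_power[OF K] assms chom_power)
 finally show ?thesis .
qed

lemma csubfield_image: "csubfield (f ` K)" unfolding csubfield_def
proof (intro conjI ballI)
 show "1 \<in> f ` K" using chom_simps(1) csubfield_props(1)[OF K] by (metis imageI)
 fix x y assume "x \<in> f ` K" "y \<in> f ` K"
 then obtain a b where ab: "a \<in> K" "b \<in> K" "x = f a" "y = f b" by auto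
 show "x + y \<in> f ` K" "x * y \<in> f ` K"
  unfolding ab(3,4) chom_simps(2)[OF ab(1,2), symmetric] chom_simps(3)[OF ab(1,2), symmetric]
  using csubfield_props(3,4)[OF K ab(1,2)] by auto
next
 fix x assume "x \<in> f ` K"
 then obtain a where a: "a \<in> K" "x = f a" by auto
 show "- x \<in> f ` K" "inverse x \<in> f ` K"
  unfolding a(2) chom_simps(5)[OF a(1), symmetric] chom_simps(7)[OF a(1), symmetric]
  using csubfield_props(5,6)[OF K a(1)] by auto
qed

lemma chom_algebraic_int: "x \<in> K ==> algebraic_int x ==> algebraic_int (f x)"
proof -
 assume x: "x \<in> K" "algebraic_int x"
 obtain p where p: "lead_coeff p = 1" "\<And>i. poly.coeff p i \<in> \<int>" "poly p x = 0" using x(2) by (rule algebraic_int.cases) blast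
 have pR: "poly_over \<rat> p" using p(2) Ints_subset_Rats by (auto simp: poly_over_def)
 have "poly p (f x) = 0" using chom_poly[OF pR x(1)] p(3) chom_simps(4) by simp
 then show ?thesis using p by (intro algebraic_int.intros) auto
qed

lemma chom_algebraic_int_iff: "x \<in> K ==> algebraic_int (f x) \<longleftrightarrow> algebraic_int x"
proof
 assume x: "x \<in> K" "algebraic_int (f x)"
 obtain p where p: "lead_coeff p = 1" "\<And>i. poly.coeff p i \<in> \<int>" "poly p (f x) = 0" using x(2) by (rule algebraic_int.cases) blast
 have pR: "poly_over \<rat> p" using p(2) Ints_subset_Rats by (auto simp: poly_over_def)
 then have pK: "poly_over K p" using csubfield_Rats[OF K] by (auto simp: poly_over_def)
 have "poly p x = 0" using chom_poly[OF pR x(1)] p(3) chom_eq_0_iff[OF poly_over_simps(9)[OF K pK x(1)]] by simp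
 then show "algebraic_int x" using p by (intro algebraic_int.intros) auto
qed (rule chom_algebraic_int)

end

text \<open>The map p(z) -> p(w) is well defined because two representations of an element differ by
  a multiple of m, which vanishes at w; \<open>P\<close> selects one representation.\<close>

lemma embedding_exists: assumes m: "min_poly_over \<rat> z m" and w: "poly m w = 0"
 shows "\<exists>f\<in>embeddings (rat_adjoin z). f z = w"
proof -
 define P where "P x = (SOME p. poly_over \<rat> p \<and> x = poly p z)" for x
 have P: "poly_over \<rat> (P x)" "x = poly (P x) z" if "x \<in> rat_adjoin z" for x
  using someI_ex[of "\<lambda>p. poly_over \<rat> p \<and> x = poly p z"] that unfolding rat_adjoin_def P_def by auto
 have key: "poly p w = poly q w" if "poly_over \<rat> p" "poly_over \<rat> q" "poly p z = poly q z" for p q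
 proof -
  have "poly_over \<rat> (p - q)" "poly (p - q) z = 0" using that by (auto simp: poly_over_Rats)
  then obtain h where "p - q = h * m" using min_poly_dvd[OF csubfield_Rats_is m] by blast
  then have "poly (p - q) w = 0" using w by simp
  then show ?thesis by simp
 qed
 define f where "f = (\<lambda>x\<in>rat_adjoin z. poly (P x) w)"
 note A = csubfield_rat_adjoin[OF min_poly_algebraic[OF m]]
 have fp: "f (poly p z) = poly p w" if "poly_over \<rat> p" for p
  using that P[OF rat_adjoinI[OF that]] unfolding f_def by (simp add: rat_adjoinI) (metis key)
 have "chom (rat_adjoin z) f" unfolding chom_def
 proof (intro conjI ballI)
  show "f 1 = 1" using fp[of 1] by (simp add: poly_over_Rats one_pCons)
  fix x y assume "x \<in> rat_adjoin z" "y \<in> rat_adjoin z"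
  then obtain p q where pq: "poly_over \<rat> p" "poly_over \<rat> q" "x = poly p z" "y = poly q z" by (auto simp: rat_adjoin_def)
  show "f (x + y) = f x + f y" "f (x * y) = f x * f y"
   using fp[of p] fp[of q] fp[of "p + q"] fp[of "p * q"] pq by (auto simp: poly_over_Rats)
 qed
 moreover have "f z = w" using fp[of "[:0, 1:]"] by (simp add: poly_over_Rats)
 ultimately show ?thesis by (intro bexI[of _ f]) (auto simp: embeddings_iff f_def)
qed

lemma embedding_eqI:
 assumes z: "algebraic z" and f: "chom (rat_adjoin z) f" and g: "chom (rat_adjoin z) g"
  and "f z = g z" "x \<in> rat_adjoin z" shows "f x = g x"
proof -
 obtain p where p: "poly_over \<rat> p" "x = poly p z" using assms(5) by (auto simp: rat_adjoin_def)
 show ?thesis unfolding p(2) using assms(4)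
   chom_poly[OF csubfield_rat_adjoin[OF z] f p(1) rat_adjoin_self] chom_poly[OF csubfield_rat_adjoin[OF z] g p(1) rat_adjoin_self]
  by simp
qed

lemma embeddings_bij: assumes m: "min_poly_over \<rat> z m"
 shows "bij_betw (\<lambda>f. f z) (embeddings (rat_adjoin z)) {w. poly m w = 0}"
 unfolding bij_betw_def
proof
 note a = min_poly_algebraic[OF m]
 have mm: "poly_over \<rat> m" "poly m z = 0" using m by (auto simp: min_poly_over_def)
 show "inj_on (\<lambda>f. f z) (embeddings (rat_adjoin z))"
 proof (rule inj_onI)
  fix f g assume fg: "f \<in> embeddings (rat_adjoin z)" "g \<in> embeddings (rat_adjoin z)" "f z = g z"
  show "f = g"
  proof (rule extensionalityI)
   show "f \<in> extensional (rat_adjoin z)" "g \<in> extensional (rat_adjoin z)" using fg by (auto simp: embeddings_iff)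
   fix x assume "x \<in> rat_adjoin z"
   then show "f x = g x" using embedding_eqI[OF a, of f g x] fg by (auto simp: embeddings_iff)
  qed
 qed
 show "(\<lambda>f. f z) ` embeddings (rat_adjoin z) = {w. poly m w = 0}"
 proof (intro equalityI subsetI)
  fix w assume "w \<in> (\<lambda>f. f z) ` embeddings (rat_adjoin z)"
  then obtain f where f: "f \<in> embeddings (rat_adjoin z)" "w = f z" by auto
  have h: "chom (rat_adjoin z) f" using f by (simp add: embeddings_iff)
  show "w \<in> {w. poly m w = 0}"
   using chom_poly[OF csubfield_rat_adjoin[OF a] h mm(1) rat_adjoin_self]
    chom_simps(4)[OF csubfield_rat_adjoin[OF a] h] mm f(2) by simp
 next
  fix w assume "w \<in> {w. poly m w = 0}"
  then show "w \<in> (\<lambda>f. f z) ` embeddings (rat_adjoin z)" using embedding_exists[OF m, of w] by auto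
 qed
qed

lemma number_field_csubfield: "number_field K ==> csubfield K"
 by (simp add: number_field_def subfield_complex_iff)

lemma embeddings_card: assumes "number_field K"
 shows "finite (embeddings K)" "card (embeddings K) = degree_over_Q K" "degree_over_Q K > 0"
proof -
 obtain z where z: "algebraic z" "K = rat_adjoin z" using number_field_rat_adjoin[OF assms] by blast
 obtain m where m: "min_poly_over \<rat> z m" using algebraic_min_poly[OF z(1)] .
 have m0: "m \<noteq> 0" using m by (simp add: min_poly_over_def)
 show "finite (embeddings K)"
  using bij_betw_finite[OF embeddings_bij[OF m]] poly_roots_finite[OF m0] z(2) by simp
 show "card (embeddings K) = degree_over_Q K" "degree_over_Q K > 0"
  using bij_betw_same_card[OF embeddings_bij[OF m]] min_poly_roots[OF csubfield_Rats_is m]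
   rat_adjoin_number_field(2)[OF m] z(2) by auto
qed

lemma embedding_image_subset: "u \<in> embeddings K ==> x \<in> K ==> u x \<in> galois_closure K"
 unfolding galois_closure_def by (rule subsetD[OF generate_field_complex(2)]) blast

lemma csubfield_galois_closure: "csubfield (galois_closure K)"
 unfolding galois_closure_def by (rule generate_field_complex(1))

lemma galois_closure_least: "csubfield F ==> (\<And>u x. u \<in> embeddings K ==> x \<in> K ==> u x \<in> F) ==> galois_closure K \<subseteq> F"
 unfolding galois_closure_def by (intro generate_field_complex(3)) auto

text \<open>The closure is generated by the finitely many conjugates of a primitive element of K, to
  which the primitive element theorem applies again.\<close>

lemma galois_closure_rat_adjoin: assumes "number_field K"
 shows "\<exists>\<eta>. algebraic \<eta> \<and> galois_closure K = rat_adjoin \<eta>"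
proof -
 obtain z where z: "algebraic z" "K = rat_adjoin z" using number_field_rat_adjoin[OF assms] by blast
 obtain m where m: "min_poly_over \<rat> z m" using algebraic_min_poly[OF z(1)] .
 have mm: "m \<noteq> 0" "poly_over \<rat> m" using m by (auto simp: min_poly_over_def)
 note b = embeddings_bij[OF m, folded z(2)]
 define Z where "Z = (\<lambda>f. f z) ` embeddings K"
 have ZR: "Z = {w. poly m w = 0}" unfolding Z_def using b by (simp add: bij_betw_def)
 have "finite Z" unfolding ZR by (rule poly_roots_finite[OF mm(1)])
 moreover have "algebraic w" if "w \<in> Z" for w
  using that mm unfolding ZR poly_over_def by (auto intro: algebraicI')
 ultimately obtain c where c: "algebraic c" "Z \<subseteq> rat_adjoin c" "\<And>F. csubfield F ==> Z \<subseteq> F ==> c \<in> F"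
  using primitive_element[of Z] by blast
 have "galois_closure K \<subseteq> rat_adjoin c"
 proof (rule galois_closure_least[OF csubfield_rat_adjoin[OF c(1)]])
  fix u x assume s: "u \<in> embeddings K" "x \<in> K"
  then obtain p where p: "poly_over \<rat> p" "x = poly p z" unfolding z(2) by (auto simp: rat_adjoin_def)
  have "u x = poly p (u z)" unfolding p(2)
   using s z(2) by (intro chom_poly[OF csubfield_rat_adjoin[OF z(1)] _ p(1) rat_adjoin_self]) (simp add: embeddings_iff)
  moreover have "u z \<in> rat_adjoin c" using s c(2) by (auto simp: Z_def)
  moreover have "poly_over (rat_adjoin c) p"
   using p csubfield_Rats[OF csubfield_rat_adjoin[OF c(1)]] by (auto simp: poly_over_def)
  ultimately show "u x \<in> rat_adjoin c"
   using poly_over_simps(9)[OF csubfield_rat_adjoin[OF c(1)]] by simp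
 qed
 moreover have "rat_adjoin c \<subseteq> galois_closure K"
 proof (rule rat_adjoin_subset[OF csubfield_galois_closure c(3)[OF csubfield_galois_closure]])
  show "Z \<subseteq> galois_closure K" unfolding Z_def
   using embedding_image_subset[of _ K z] rat_adjoin_self[of z] z(2) by auto
 qed
 ultimately show ?thesis using c(1) by blast
qed

lemma galois_group_iff: "e \<in> carrier (galois_group L) \<longleftrightarrow> chom L e \<and> bij_betw e L L \<and> e \<in> extensional L"
 by (auto simp: galois_group_def ring_iso_def ring_hom_def chom_def bij_betw_def Pi_iff)

lemma compose_embedding:
 assumes K: "csubfield K" and s: "u \<in> embeddings K" and t: "chom (galois_closure K) v"
 shows "compose K v u \<in> embeddings K"
proof -
 have h: "chom K u" using s by (simp add: embeddings_iff)
 have i: "x \<in> K ==> u x \<in> galois_closure K" for x using embedding_image_subset[OF s] .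
 note S = chom_simps[OF K h] and T = chom_simps[OF csubfield_galois_closure t]
 have "chom K (compose K v u)"
  unfolding chom_def compose_def by (auto simp: csubfield_props[OF K] S T i)
 then show ?thesis by (simp add: embeddings_iff compose_def)
qed

lemma compose_embedding_bij: assumes K: "number_field K" and t: "chom (galois_closure K) v"
 shows "bij_betw (compose K v) (embeddings K) (embeddings K)"
proof -
 note C = number_field_csubfield[OF K]
 have "inj_on (compose K v) (embeddings K)"
 proof (rule inj_onI)
  fix u u' assume s: "u \<in> embeddings K" "u' \<in> embeddings K" "compose K v u = compose K v u'"
  show "u = u'"
  proof (rule extensionalityI)
   show "u \<in> extensional K" "u' \<in> extensional K" using s by (auto simp: embeddings_iff)
   fix x assume x: "x \<in> K"
   then have "v (u x) = v (u' x)" using fun_cong[OF s(3), of x] by (simp add: compose_def)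
   then show "u x = u' x" using inj_onD[OF chom_inj[OF csubfield_galois_closure t]] embedding_image_subset s(1,2) x by blast
  qed
 qed
 moreover have "compose K v ` embeddings K \<subseteq> embeddings K" using compose_embedding[OF C _ t] by auto
 ultimately show ?thesis
  using endo_inj_surj[OF embeddings_card(1)[OF K]] by (simp add: bij_betw_def)
qed

text \<open>A homomorphism v on the closure sends embeddings of K to embeddings of K and permutes
  them. Hence v maps the generators into the closure and also reaches all of them.\<close>

lemma galois_closure_normal: assumes K: "number_field K" and t: "chom (galois_closure K) v"
 shows "restrict v (galois_closure K) \<in> carrier (galois_group (galois_closure K))"
proof -
 note C = number_field_csubfield[OF K]
 define L where "L = galois_closure K"
 have L: "csubfield L" unfolding L_def by (rule csubfield_galois_closure)
 note t' = t[folded L_def]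
 have sub: "v (u x) \<in> L" if "u \<in> embeddings K" "x \<in> K" for u x
  using embedding_image_subset[OF compose_embedding[OF C that(1) t] that(2)] that by (simp add: compose_def L_def)
 have "L \<subseteq> {x\<in>L. v x \<in> L}" unfolding L_def
 proof (rule galois_closure_least, fold L_def)
  show "csubfield {x \<in> L. v x \<in> L}"
   unfolding csubfield_def by (auto simp: csubfield_props[OF L] chom_simps[OF L t'])
  show "u x \<in> {x \<in> L. v x \<in> L}" if "u \<in> embeddings K" "x \<in> K" for u x
   using sub[OF that] embedding_image_subset[OF that] by (simp add: L_def)
 qed
 moreover have "L \<subseteq> v ` L" unfolding L_def
 proof (rule galois_closure_least, fold L_def)
  show "csubfield (v ` L)" by (rule csubfield_image[OF L t'])
  fix u x assume s: "u \<in> embeddings K" "x \<in> K"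
  then obtain u' where s': "u' \<in> embeddings K" "u = compose K v u'"
   using compose_embedding_bij[OF K t] unfolding bij_betw_def by blast
  have "u x = v (u' x)" using s' s by (simp add: compose_def)
  then show "u x \<in> v ` L" using embedding_image_subset[OF s'(1) s(2)] by (simp add: L_def)
 qed
 ultimately have "v ` L = L" by blast
 then have "bij_betw (restrict v L) L L"
  using chom_inj[OF L t'] by (simp add: bij_betw_def inj_on_restrict_eq)
 moreover have "chom L (restrict v L)" by (rule chom_cong[OF t' _ L]) simp
 ultimately show ?thesis unfolding galois_group_iff L_def[symmetric] by simp
qed

text \<open>Write x = r(z) with z primitive for the closure and deg r < deg m. By normality every
  conjugate of z comes from an automorphism, so r - x vanishes at all deg m conjugates and must be
  0; thus x is the constant coefficient of r.\<close>

lemma galois_fixed_rational: assumes K: "number_field K" and x: "x \<in> galois_closure K"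
  and fx: "\<And>e. e \<in> carrier (galois_group (galois_closure K)) ==> e x = x"
 shows "x \<in> \<rat>"
proof -
 obtain z where z: "algebraic z" "galois_closure K = rat_adjoin z" using galois_closure_rat_adjoin[OF K] by blast
 obtain m where m: "min_poly_over \<rat> z m" using algebraic_min_poly[OF z(1)] .
 have mF: "poly_over \<rat> m" "m \<noteq> 0" "poly m z = 0" using m by (auto simp: min_poly_over_def)
 obtain p where p: "poly_over \<rat> p" "x = poly p z" using x unfolding z(2) by (auto simp: rat_adjoin_def)
 obtain q r where qr: "poly_over \<rat> q" "poly_over \<rat> r" "p = q * m + r" "r = 0 \<or> degree r < degree m"
  using poly_over_division[OF csubfield_Rats_is mF(1,2) p(1)] by blast
 have xr: "x = poly r z" using p qr mF by simp
 define s where "s = r - [:x:]"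
 have roots: "poly s w = 0" if w: "poly m w = 0" for w
 proof -
  obtain f where f: "f \<in> embeddings (rat_adjoin z)" "f z = w" using embedding_exists[OF m w] by blast
  have h: "chom (rat_adjoin z) f" using f by (simp add: embeddings_iff)
  have "restrict f (rat_adjoin z) x = x" using fx[of "restrict f (galois_closure K)"] galois_closure_normal[OF K, of f] h z(2) by metis
  then have "f x = x" using x z(2) by simp
  moreover have "f x = poly r w"
   unfolding xr using chom_poly[OF csubfield_rat_adjoin[OF z(1)] h qr(2) rat_adjoin_self] f(2) by simp
  ultimately show ?thesis unfolding s_def by simp
 qed
 have "s = 0"
 proof (rule ccontr)
  assume s0: "s \<noteq> 0"
  have "degree m = card {w. poly m w = 0}" using min_poly_roots(1)[OF csubfield_Rats_is m] by simp
  also have "... \<le> card {w. poly s w = 0}" using roots by (intro card_mono poly_roots_finite[OF s0]) auto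
  also have "... \<le> degree s" by (rule card_poly_roots_bound[OF s0])
  also have "... \<le> max (degree r) (degree [:x:])" unfolding s_def by (rule degree_diff_le_max)
  finally show False using qr(4) min_poly_roots(2)[OF csubfield_Rats_is m] by auto
 qed
 then have "poly.coeff r 0 = x" unfolding s_def by (metis coeff_pCons_0 right_minus_eq)
 then show ?thesis using qr(2) unfolding poly_over_def by metis
qed

lemma galois_group_finite: assumes K: "number_field K"
 shows "finite (carrier (galois_group (galois_closure K)))"
proof -
 obtain z where z: "algebraic z" "galois_closure K = rat_adjoin z" using galois_closure_rat_adjoin[OF K] by blast
 obtain m where m: "min_poly_over \<rat> z m" using algebraic_min_poly[OF z(1)] .
 have "number_field (rat_adjoin z)" by (rule rat_adjoin_number_field(1)[OF m])
 then have "finite (embeddings (rat_adjoin z))" by (rule embeddings_card)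
 moreover have "carrier (galois_group (rat_adjoin z)) \<subseteq> embeddings (rat_adjoin z)"
  by (auto simp: galois_group_iff embeddings_iff)
 ultimately show ?thesis unfolding z(2) by (rule finite_subset[rotated])
qed

lemma galois_group_compose:
 assumes L: "csubfield L" and e: "e \<in> carrier (galois_group L)" and l: "l \<in> carrier (galois_group L)"
 shows "compose L l e \<in> carrier (galois_group L)"
proof -
 have h: "chom L e" "bij_betw e L L" "chom L l" "bij_betw l L L" using e l by (auto simp: galois_group_iff)
 have tL: "x \<in> L ==> e x \<in> L" for x using h(2) by (auto simp: bij_betw_def)
 have "bij_betw (compose L l e) L L"
  using bij_betw_trans[OF h(2,4)] by (subst bij_betw_cong[where g = "l \<circ> e"]) (auto simp: compose_def)
 moreover have "chom L (compose L l e)" unfolding chom_def compose_def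
  by (auto simp: csubfield_props[OF L] chom_simps[OF L h(1)] chom_simps[OF L h(3)] tL)
 ultimately show ?thesis by (simp add: galois_group_iff compose_def)
qed

lemma galois_group_compose_bij:
 assumes K: "number_field K" and l: "l \<in> carrier (galois_group (galois_closure K))"
 defines "L \<equiv> galois_closure K"
 shows "bij_betw (compose L l) (carrier (galois_group L)) (carrier (galois_group L))"
proof -
 have L: "csubfield L" unfolding L_def by (rule csubfield_galois_closure)
 have r: "chom L l" "bij_betw l L L" using l by (auto simp: galois_group_iff L_def)
 have "inj_on (compose L l) (carrier (galois_group L))"
 proof (rule inj_onI)
  fix a b assume ab: "a \<in> carrier (galois_group L)" "b \<in> carrier (galois_group L)" "compose L l a = compose L l b"
  show "a = b"
  proof (rule extensionalityI)
   show "a \<in> extensional L" "b \<in> extensional L" using ab by (auto simp: galois_group_iff)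
   fix x assume x: "x \<in> L"
   then have "l (a x) = l (b x)" using fun_cong[OF ab(3), of x] by (simp add: compose_def)
   moreover have "a x \<in> L" "b x \<in> L" using ab x by (auto simp: galois_group_iff bij_betw_def)
   ultimately show "a x = b x" using inj_onD[OF chom_inj[OF L r(1)]] by blast
  qed
 qed
 moreover have "compose L l ` carrier (galois_group L) \<subseteq> carrier (galois_group L)"
  using galois_group_compose[OF L _ l[folded L_def]] by auto
 ultimately show ?thesis
  using endo_inj_surj[OF galois_group_finite[OF K, folded L_def]] by (simp add: bij_betw_def)
qed

section \<open>Integral bases and the discriminant\<close>

text \<open>A numbering J of the embeddings makes them the rows of a matrix; the squared determinant
  turns out not to depend on it.\<close>

locale enumerated_field =
 fixes K :: "complex set" and J :: "nat => complex => complex"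
 assumes number_field: "number_field K"
  and enumeration: "bij_betw J {..<degree_over_Q K} (embeddings K)"
begin

abbreviation n where "n \<equiv> degree_over_Q K"
abbreviation L where "L \<equiv> galois_closure K"

definition emb_mat :: "(nat => complex) => complex mat" where
 "emb_mat g = Matrix.mat n n (\<lambda>(i, j). J i (g j))"

definition emb_det :: "(nat => complex) => complex" where
 "emb_det g = det (emb_mat g)"

lemma csubfields: "csubfield K" "csubfield L"
 using number_field number_field_csubfield csubfield_galois_closure by auto

lemma n_pos: "n > 0" by (rule embeddings_card(3)[OF number_field])

lemma emb: "i < n ==> J i \<in> embeddings K" "i < n ==> chom K (J i)" "i < n ==> x \<in> K ==> J i x \<in> L"
proof -
 show e: "i < n ==> J i \<in> embeddings K" using enumeration by (auto simp: bij_betw_def)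
 show "i < n ==> chom K (J i)" using e by (simp add: embeddings_iff)
 show "i < n ==> x \<in> K ==> J i x \<in> L" using embedding_image_subset e by blast
qed

lemma emb_mat_carrier [simp]: "emb_mat g \<in> carrier_mat n n" by (simp add: emb_mat_def)

lemma permutes_bound: "p permutes {0..<n} ==> i < n ==> p i < n"
 using permutes_in_image[of p "{0..<n}" i] by simp

lemma emb_det_expand: "emb_det g = (\<Sum>p | p permutes {0..<n}. of_int (sign p) * (\<Prod>i=0..<n. J i (g (p i))))"
 unfolding emb_det_def det_def'[OF emb_mat_carrier]
 by (intro sum.cong refl arg_cong2[of _ _ _ _ "(*)"] prod.cong) (auto simp: emb_mat_def permutes_bound)

lemma emb_det_closed: assumes "\<And>j. j < n ==> g j \<in> K" shows "emb_det g \<in> L"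
 unfolding emb_det_expand
 by (intro csubfield_sum[OF csubfields(2)] csubfield_props(4)[OF csubfields(2)] csubfield_of_int[OF csubfields(2)]
   csubfield_prod[OF csubfields(2)] emb(3) assms) (auto simp: permutes_bound)

lemma emb_det_algebraic_int: assumes "\<And>j. j < n ==> g j \<in> K \<and> algebraic_int (g j)"
 shows "algebraic_int (emb_det g)" unfolding emb_det_expand
proof (intro algebraic_int_sum algebraic_int_add_mult(2) algebraic_int_of_int algebraic_int_prod)
 fix p i assume "p \<in> {p. p permutes {0..<n}}" "i \<in> {0..<n}"
 then show "algebraic_int (J i (g (p i)))"
  using assms[of "p i"] chom_algebraic_int[OF csubfields(1) emb(2)] by (auto simp: permutes_bound)
qed

text \<open>Composing with l permutes the rows of the embedding matrix, so the determinant is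
  multiplied by the sign. This links the parity of an automorphism to its action on a square root of
  the discriminant.\<close>

lemma galois_permutation: assumes "l \<in> carrier (galois_group L)"
 shows "\<exists>\<pi>. \<pi> permutes {0..<n} \<and> (\<forall>i<n. compose K l (J i) = J (\<pi> i)) \<and>
   (\<forall>g. (\<forall>j<n. g j \<in> K) --> l (emb_det g) = of_int (sign \<pi>) * emb_det g)"
proof -
 have t: "chom L l" using assms by (simp add: galois_group_iff)
 have eq: "{..<n} = {0..<n}" by auto
 note s = enumeration[unfolded eq]
 define q where "q i = inv_into {0..<n} J (compose K l (J i))" for i
 have "bij_betw (inv_into {0..<n} J \<circ> (compose K l \<circ> J)) {0..<n} {0..<n}"
  using s compose_embedding_bij[OF number_field t] bij_betw_inv_into[OF s] bij_betw_trans by metis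
 then have "bij_betw (\<lambda>i. if i \<in> {0..<n} then q i else i) {0..<n} {0..<n}"
  unfolding q_def by (rule bij_betw_cong[THEN iffD1, rotated]) simp
 then have p: "(\<lambda>i. if i \<in> {0..<n} then q i else i) permutes {0..<n}" (is "?p permutes _")
  by (rule bij_imp_permutes) simp
 have sp: "compose K l (J i) = J (?p i)" if "i < n" for i
 proof -
  have "compose K l (J i) \<in> J ` {0..<n}"
  proof -
   have "J ` {0..<n} = embeddings K" "compose K l ` embeddings K = embeddings K"
    using s compose_embedding_bij[OF number_field t] by (simp_all add: bij_betw_def)
   then show ?thesis using emb(1)[OF that] by blast
  qed
  then show ?thesis using that by (simp add: q_def f_inv_into_f)
 qed
 have "l (emb_det g) = of_int (sign ?p) * emb_det g" if w: "\<forall>j<n. g j \<in> K" for g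
 proof -
  have cl: "(\<Prod>i=0..<n. J i (g (p i))) \<in> L" if "p permutes {0..<n}" for p
   using w that by (intro csubfield_prod[OF csubfields(2)] emb(3)) (auto simp: permutes_bound)
  have "l (emb_det g) = (\<Sum>p | p permutes {0..<n}. l (of_int (sign p) * (\<Prod>i=0..<n. J i (g (p i)))))"
   unfolding emb_det_expand
   by (intro chom_sum[OF csubfields(2) t] csubfield_props(4)[OF csubfields(2)] csubfield_of_int[OF csubfields(2)] cl) auto
  also have "... = (\<Sum>p | p permutes {0..<n}. of_int (sign p) * (\<Prod>i=0..<n. Matrix.mat n n (\<lambda>(i, j). emb_mat g $$ (?p i, j)) $$ (i, p i)))"
  proof (intro sum.cong refl)
   fix p assume "p \<in> {p. p permutes {0..<n}}"
   then have p': "p permutes {0..<n}" by simp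
   have "l (of_int (sign p) * (\<Prod>i=0..<n. J i (g (p i)))) = of_int (sign p) * (\<Prod>i=0..<n. l (J i (g (p i))))"
    using cl[OF p'] w p' chom_prod[OF csubfields(2) t, of "{0..<n}" "\<lambda>i. J i (g (p i))"]
    by (simp add: chom_simps(3)[OF csubfields(2) t] csubfield_of_int[OF csubfields(2)] chom_of_int[OF csubfields(2) t] emb(3) permutes_bound)
   also have "(\<Prod>i=0..<n. l (J i (g (p i)))) = (\<Prod>i=0..<n. Matrix.mat n n (\<lambda>(i, j). emb_mat g $$ (?p i, j)) $$ (i, p i))"
   proof (intro prod.cong refl)
    fix i assume "i \<in> {0..<n}"
    then have i: "i < n" "p i < n" "?p i < n" using permutes_bound[OF p'] permutes_bound[OF p] by auto
    have "l (J i (g (p i))) = compose K l (J i) (g (p i))" using w i by (simp add: compose_def)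
    then show "l (J i (g (p i))) = Matrix.mat n n (\<lambda>(i, j). emb_mat g $$ (?p i, j)) $$ (i, p i)"
     using i sp[of i] by (simp add: emb_mat_def)
   qed
   finally show "l (of_int (sign p) * (\<Prod>i=0..<n. J i (g (p i)))) =
    of_int (sign p) * (\<Prod>i=0..<n. Matrix.mat n n (\<lambda>(i, j). emb_mat g $$ (?p i, j)) $$ (i, p i))" .
  qed
  also have "... = det (Matrix.mat n n (\<lambda>(i, j). emb_mat g $$ (?p i, j)))"
   by (rule det_def'[symmetric]) simp
  also have "... = of_int (sign ?p) * emb_det g"
   unfolding emb_det_def by (rule det_permute_rows[OF emb_mat_carrier p])
  finally show ?thesis .
 qed
 then show ?thesis using p sp by blast
qed

text \<open>An automorphism multiplies both determinants by the same sign, so their product is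
  fixed.\<close>

lemma emb_det_mult_rational:
 assumes u: "\<And>j. j < n ==> u j \<in> K" and v: "\<And>j. j < n ==> v j \<in> K"
 shows "emb_det u * emb_det v \<in> \<rat>"
proof (rule galois_fixed_rational[OF number_field])
 show "emb_det u * emb_det v \<in> L" by (intro csubfield_props(4)[OF csubfields(2)] emb_det_closed u v)
 fix l assume t: "l \<in> carrier (galois_group L)"
 then have c: "chom L l" by (simp add: galois_group_iff)
 obtain \<pi> where p: "\<pi> permutes {0..<n} \<and> (\<forall>i<n. compose K l (J i) = J (\<pi> i)) \<and>
   (\<forall>g. (\<forall>j<n. g j \<in> K) --> l (emb_det g) = of_int (sign \<pi>) * emb_det g)"
  using galois_permutation[OF t] by (rule exE)
 have "l (emb_det u * emb_det v) = l (emb_det u) * l (emb_det v)"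
  using u v by (intro chom_simps(3)[OF csubfields(2) c] emb_det_closed)
 then show "l (emb_det u * emb_det v) = emb_det u * emb_det v"
  using p[THEN conjunct2, THEN conjunct2, rule_format, of u] p[THEN conjunct2, THEN conjunct2, rule_format, of v] u v by (simp add: sign_def)
qed

lemma emb_det_square_int: assumes "\<And>j. j < n ==> g j \<in> K \<and> algebraic_int (g j)"
 shows "\<exists>d::int. (emb_det g)\<^sup>2 = of_int d"
proof -
 have "(emb_det g)\<^sup>2 \<in> \<rat>" unfolding power2_eq_square using assms by (intro emb_det_mult_rational) auto
 moreover have "algebraic_int ((emb_det g)\<^sup>2)" by (intro algebraic_int_power emb_det_algebraic_int assms)
 ultimately have "(emb_det g)\<^sup>2 \<in> \<int>" using rational_algebraic_int_is_int by blast
 then show ?thesis by (elim Ints_cases) blast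
qed

text \<open>The Vandermonde determinant: a kernel vector would be a nonzero polynomial of degree
  less than n vanishing at the n distinct conjugates of z.\<close>

lemma emb_det_powers: assumes z: "K = rat_adjoin z" "algebraic z"
 shows "emb_det (\<lambda>j. z ^ j) \<noteq> 0"
proof
 assume "emb_det (\<lambda>j. z ^ j) = 0"
 then obtain v where v: "v \<in> carrier_vec n" "v \<noteq> 0\<^sub>v n" "emb_mat (\<lambda>j. z ^ j) *\<^sub>v v = 0\<^sub>v n"
  using det_0_iff_vec_prod_zero_field[OF emb_mat_carrier] unfolding emb_det_def by blast
 define p where "p = (\<Sum>j<n. Polynomial.monom (v $ j) j)"
 have zK: "z \<in> K" unfolding z(1) by (rule rat_adjoin_self)
 have root: "poly p (J i z) = 0" if "i < n" for i
 proof -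
  have "0 = (emb_mat (\<lambda>j. z ^ j) *\<^sub>v v) $ i" using v(3) that by simp
  also have "... = (\<Sum>j=0..<n. J i (z ^ j) * v $ j)" using that v(1) by (simp add: emb_mat_def scalar_prod_def)
  also have "... = poly p (J i z)" unfolding p_def poly_sum poly_monom atLeast0LessThan
   using that zK by (intro sum.cong refl) (simp add: chom_power[OF csubfields(1) emb(2)] mult.commute)
  finally show ?thesis by simp
 qed
 have coeff: "poly.coeff p j = (if j < n then v $ j else 0)" for j unfolding p_def by (simp add: coeff_sum)
 have "p \<noteq> 0"
 proof
  assume "p = 0"
  then have "v $ j = 0" if "j < n" for j using coeff[of j] that by simp
  then have "v = 0\<^sub>v n" using v(1) by (intro eq_vecI) auto
  then show False using v(2) by simp
 qed
 have "inj_on (\<lambda>i. J i z) {..<n}"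
 proof (rule inj_onI)
  fix i j assume ij: "i \<in> {..<n}" "j \<in> {..<n}" "J i z = J j z"
  have "J i x = J j x" if "x \<in> K" for x
   using embedding_eqI[OF z(2), of "J i" "J j" x] emb(2)[of i] emb(2)[of j] ij that z(1) by simp
  then have "J i = J j" using emb(1)[of i] emb(1)[of j] ij by (intro extensionalityI[of _ K]) (auto simp: embeddings_iff)
  then show "i = j" using enumeration ij by (auto simp: bij_betw_def inj_on_def)
 qed
 then have "n = card ((\<lambda>i. J i z) ` {..<n})" by (simp add: card_image)
 also have "... \<le> card {w. poly p w = 0}" using root by (intro card_mono poly_roots_finite[OF \<open>p \<noteq> 0\<close>]) auto
 also have "... \<le> degree p" by (rule card_poly_roots_bound[OF \<open>p \<noteq> 0\<close>])
 also have "degree p < n" using coeff n_pos by (intro degree_lessI) auto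
 finally show False by simp
qed

text \<open>Cramer's rule: replacing the k-th member of the system by y multiplies the determinant
  by the k-th coordinate of y.\<close>

lemma emb_det_replace:
 assumes k: "k < n" and y: "\<And>i. i < n ==> J i y = (\<Sum>j<n. q j * J i (g j))"
 shows "emb_det (fun_upd g k y) = q k * emb_det g"
proof -
 have "emb_mat (fun_upd g k y) = replace_col (emb_mat g) (emb_mat g *\<^sub>v Matrix.vec n q) k"
 proof (rule eq_matI)
  fix i j assume "i < dim_row (replace_col (emb_mat g) (emb_mat g *\<^sub>v Matrix.vec n q) k)"
   "j < dim_col (replace_col (emb_mat g) (emb_mat g *\<^sub>v Matrix.vec n q) k)"
  then have ij: "i < n" "j < n" by (auto simp: replace_col_def emb_mat_def)
  show "emb_mat (fun_upd g k y) $$ (i, j) = replace_col (emb_mat g) (emb_mat g *\<^sub>v Matrix.vec n q) k $$ (i, j)"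
   using ij y[OF ij(1)]
   by (auto simp: emb_mat_def replace_col_def scalar_prod_def atLeast0LessThan mult.commute)
 qed (auto simp: replace_col_def emb_mat_def)
 then show ?thesis using cramer_lemma_mat[OF emb_mat_carrier, of "Matrix.vec n q" k g] k by (simp add: emb_det_def)
qed

lemma emb_eqI: "x \<in> K ==> y \<in> K ==> i < n ==> J i x = J i y ==> x = y"
 using inj_onD[OF chom_inj[OF csubfields(1) emb(2)]] by blast

lemma emb_sum:
 assumes "i < n" "\<And>j. j < n ==> g j \<in> K" "\<And>j. j < n ==> q j \<in> \<rat>"
 shows "J i (\<Sum>j<n. q j * g j) = (\<Sum>j<n. q j * J i (g j))"
proof -
 note h = emb(2)[OF assms(1)] and K = csubfields(1)
 have q: "q j \<in> K" "J i (q j) = q j" if "j < n" for j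
  using assms(3)[OF that] csubfield_Rats[OF K] chom_Rats[OF K h] by auto
 have "J i (\<Sum>j<n. q j * g j) = (\<Sum>j<n. J i (q j * g j))"
  using assms(2) q by (intro chom_sum[OF K h] csubfield_props(4)[OF K]) auto
 then show ?thesis using assms(2) q by (simp add: chom_simps(3)[OF K h])
qed

text \<open>The adjugate solves the linear system over the complex numbers. By Cramer's rule each
  coordinate is a quotient of two products of embedding determinants, and such products are
  rational.\<close>

lemma rational_coordinates:
 assumes w: "\<And>j. j < n ==> g j \<in> K" and d: "emb_det g \<noteq> 0" and x: "x \<in> K"
 shows "\<exists>q. (\<forall>j<n. q j \<in> \<rat>) \<and> x = (\<Sum>j<n. q j * g j)"
proof -
 define A where "A = emb_mat g"
 have A: "A \<in> carrier_mat n n" unfolding A_def by simp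
 define b where "b = Matrix.vec n (\<lambda>i. J i x)"
 define v where "v = (1 / det A) \<cdot>\<^sub>v (adj_mat A *\<^sub>v b)"
 have b: "b \<in> carrier_vec n" unfolding b_def by simp
 have adj: "adj_mat A \<in> carrier_mat n n" "A * adj_mat A = det A \<cdot>\<^sub>m 1\<^sub>m n" using adj_mat[OF A] by auto
 have v: "v \<in> carrier_vec n" unfolding v_def using adj b by auto
 have "A *\<^sub>v v = (1 / det A) \<cdot>\<^sub>v (A *\<^sub>v (adj_mat A *\<^sub>v b))"
  unfolding v_def using A adj b by (intro mult_mat_vec) auto
 also have "A *\<^sub>v (adj_mat A *\<^sub>v b) = (A * adj_mat A) *\<^sub>v b" using A adj b by (intro assoc_mult_mat_vec[symmetric]) auto
 also have "... = det A \<cdot>\<^sub>v b" unfolding adj(2) using b by auto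
 finally have Av: "A *\<^sub>v v = b" using d b by (auto simp: A_def emb_det_def)
 have vi: "J i x = (\<Sum>j<n. v $ j * J i (g j))" if "i < n" for i
 proof -
  have "J i x = (A *\<^sub>v v) $ i" unfolding Av using that by (simp add: b_def)
  also have "... = (\<Sum>j<n. v $ j * J i (g j))"
   using that v by (simp add: A_def emb_mat_def scalar_prod_def atLeast0LessThan mult.commute)
  finally show ?thesis .
 qed
 have q: "v $ k \<in> \<rat>" if k: "k < n" for k
 proof -
  have "emb_det (fun_upd g k x) * emb_det g = v $ k * (emb_det g * emb_det g)"
   using emb_det_replace[OF k vi] by simp
  moreover have "emb_det (fun_upd g k x) * emb_det g \<in> \<rat>" "emb_det g * emb_det g \<in> \<rat>"
   using w x by (auto intro!: emb_det_mult_rational)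
  ultimately have "(v $ k * (emb_det g * emb_det g)) / (emb_det g * emb_det g) \<in> \<rat>" by (metis Rats_divide)
  then show ?thesis using d by simp
 qed
 have "x = (\<Sum>j<n. v $ j * g j)"
 proof (rule emb_eqI[OF x _ n_pos])
  show "(\<Sum>j<n. v $ j * g j) \<in> K"
   using w q csubfield_Rats[OF csubfields(1)] by (intro csubfield_sum csubfield_props(4) csubfields) auto
  show "J 0 x = J 0 (\<Sum>j<n. v $ j * g j)" using vi[OF n_pos] emb_sum[OF n_pos, of g "($) v"] w q by simp
 qed
 then show ?thesis using q by blast
qed

definition integral :: "(nat => complex) => bool" where
 "integral g \<longleftrightarrow> (\<forall>j<n. g j \<in> K \<and> algebraic_int (g j))"

definition spanning :: "(nat => complex) => bool" where
 "spanning g \<longleftrightarrow> (\<forall>x\<in>K. algebraic_int x --> (\<exists>a::nat => int. x = (\<Sum>j<n. of_int (a j) * g j)))"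

text \<open>An integral system with nonzero determinant of least absolute value spans the integers:
 otherwise some coordinate is not an integer, and its fractional part gives a smaller determinant.\<close>

lemma spanning_exists: "\<exists>g. integral g \<and> emb_det g \<noteq> 0 \<and> spanning g"
proof -
 obtain z where z: "algebraic z" "K = rat_adjoin z" using number_field_rat_adjoin[OF number_field] by blast
 obtain k :: int where k: "k \<noteq> 0" "algebraic_int (of_int k * z)" using algebraic_int_multiple[OF z(1)] by blast
 define H where "H = of_int k * z"
 have "H \<in> K" unfolding H_def
  using csubfield_props(4)[OF csubfields(1) csubfield_of_int[OF csubfields(1)]] rat_adjoin_self[of z] z(2) by simp
 have kK: "rat_adjoin H = K"
 proof
  have aT: "algebraic H" using k(2) by (simp add: H_def algebraic_int_imp_algebraic)
  show "rat_adjoin H \<subseteq> K" by (rule rat_adjoin_subset[OF csubfields(1) \<open>H \<in> K\<close>])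
  have T: "csubfield (rat_adjoin H)" by (rule csubfield_rat_adjoin[OF aT])
  have "z = H / of_int k" using k(1) by (simp add: H_def)
  also have "... \<in> rat_adjoin H" by (intro csubfield_props(8)[OF T] rat_adjoin_self csubfield_of_int[OF T])
  finally show "K \<subseteq> rat_adjoin H" unfolding z(2) by (rule rat_adjoin_subset[OF T])
 qed
 have "integral (\<lambda>j. H ^ j)"
  unfolding integral_def using csubfield_power[OF csubfields(1) \<open>H \<in> K\<close>] algebraic_int_power k(2) by (auto simp: H_def)
 moreover have "emb_det (\<lambda>j. H ^ j) \<noteq> 0"
  by (rule emb_det_powers[OF kK[symmetric]]) (use k(2) in \<open>simp add: H_def algebraic_int_imp_algebraic\<close>)
 ultimately have ex: "\<exists>g. integral g \<and> emb_det g \<noteq> 0" by blast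
 \<comment> \<open>The integer |det^2| as a natural number, so that a system minimizing it
   exists.\<close>
 define N where "N g = nat (THE a. (\<exists>d. a = \<bar>d\<bar> \<and> (emb_det g)\<^sup>2 = of_int d))" for g
 have N: "real (N g) = (norm (emb_det g))\<^sup>2" if int: "integral g" for g
 proof -
  obtain d :: int where d: "(emb_det g)\<^sup>2 = of_int d" using emb_det_square_int int unfolding integral_def by blast
  have "(THE a. (\<exists>d. a = \<bar>d\<bar> \<and> (emb_det g)\<^sup>2 = of_int d)) = \<bar>d\<bar>"
   using d by (intro the_equality) auto
  then have "real (N g) = \<bar>of_int d\<bar>" unfolding N_def by simp
  also have "... = norm ((emb_det g)\<^sup>2)" unfolding d by simp
  finally show ?thesis by (simp add: norm_power)
 qed
 obtain g where w: "integral g" "emb_det g \<noteq> 0" and min: "\<And>g'. integral g' ==> emb_det g' \<noteq> 0 ==> N g \<le> N g'"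
  using ex_has_least_nat[of "\<lambda>g. integral g \<and> emb_det g \<noteq> 0" _ N] ex by blast
 have wK: "g j \<in> K" if "j < n" for j using w(1) that by (auto simp: integral_def)
 have "spanning g" unfolding spanning_def
 proof (intro ballI impI)
  fix x assume x: "x \<in> K" "algebraic_int x"
  obtain q where q: "\<forall>j<n. q j \<in> \<rat>" "x = (\<Sum>j<n. q j * g j)" using rational_coordinates[OF wK w(2) x(1)] by blast
  have "\<exists>r::real. q j = of_real r" if "j < n" for j
  proof -
   obtain a b :: int where "q j = of_int a / of_int b" using q(1) \<open>j < n\<close> by (metis Rats_cases')
   then have "q j = of_real (of_int a / of_int b)" by simp
   then show ?thesis by blast
  qed
  then have "\<forall>j. \<exists>r::real. j < n --> q j = of_real r" by blast
  then obtain r where r: "\<And>j. j < n ==> q j = of_real (r j :: real)" by metis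
  have "frac (r k) = 0" if k: "k < n" for k
  proof (rule ccontr)
   assume f: "frac (r k) \<noteq> 0"
   define y where "y = x - of_int \<lfloor>r k\<rfloor> * g k"
   define q' where "q' = fun_upd q k (of_real (frac (r k)))"
   have yq: "y = (\<Sum>j<n. q' j * g j)"
   proof -
    have "(\<Sum>j<n. q' j * g j) = (\<Sum>j<n. q j * g j - (if j = k then of_int \<lfloor>r k\<rfloor> * g k else 0))"
     using r[OF k] by (intro sum.cong refl) (auto simp: q'_def frac_def left_diff_distrib)
    also have "... = x - of_int \<lfloor>r k\<rfloor> * g k" unfolding sum_subtractf q(2)[symmetric] using k by simp
    finally show ?thesis by (simp add: y_def)
   qed
   have q'R: "q' j \<in> \<rat>" if "j < n" for j
   proof -
    have "q k - of_int \<lfloor>r k\<rfloor> \<in> \<rat>" using q(1) k by (intro Rats_diff) auto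
    then show ?thesis using q(1) that r[OF k] by (auto simp: q'_def frac_def)
   qed
   have yi: "y \<in> K" "algebraic_int y" unfolding y_def
    using x w(1) k csubfield_props(4,7)[OF csubfields(1)] csubfield_of_int[OF csubfields(1)] algebraic_int_diff algebraic_int_add_mult(2) algebraic_int_of_int
    by (auto simp: integral_def)
   have int': "integral (fun_upd g k y)" using w(1) yi by (auto simp: integral_def)
   have e: "emb_det (fun_upd g k y) = of_real (frac (r k)) * emb_det g"
    using emb_det_replace[OF k, of y q' g] emb_sum[OF _ wK q'R] yq by (simp add: q'_def)
   then have "emb_det (fun_upd g k y) \<noteq> 0" using w(2) f by simp
   then have "N g \<le> N (fun_upd g k y)" by (rule min[OF int'])
   then have "(norm (emb_det g))\<^sup>2 \<le> (norm (emb_det (fun_upd g k y)))\<^sup>2" using N[OF w(1)] N[OF int'] by (metis of_nat_le_iff)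
   also have "... = (frac (r k))\<^sup>2 * (norm (emb_det g))\<^sup>2" unfolding e by (simp add: norm_mult power_mult_distrib)
   also have "... < 1 * (norm (emb_det g))\<^sup>2"
    using w(2) frac_lt_1[of "r k"] frac_ge_0[of "r k"] by (intro mult_strict_right_mono) (auto simp: power_less_one_iff)
   finally show False by simp
  qed
  then have "q j = of_int \<lfloor>r j\<rfloor>" if "j < n" for j
   using r[OF that] that by (metis frac_eq_0_iff Ints_cases floor_of_int of_real_of_int_eq)
  then have "x = (\<Sum>j<n. of_int \<lfloor>r j\<rfloor> * g j)" unfolding q(2) by (intro sum.cong) auto
  then show "\<exists>a::nat => int. x = (\<Sum>j<n. of_int (a j) * g j)" by (rule exI[of _ "\<lambda>j. \<lfloor>r j\<rfloor>"])
 qed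
 then show ?thesis using w by blast
qed

lemma carrier_ring_of_integers: "carrier (ring_of_integers K) = {x \<in> K. algebraic_int x}"
 by (simp add: ring_of_integers_def)

lemma integral_basisI:
 assumes int: "integral g" and d: "emb_det g \<noteq> 0" and span: "spanning g"
 shows "integral_basis K g" unfolding integral_basis_def bij_betw_def carrier_ring_of_integers
proof
 have wK: "g j \<in> K" if "j < n" for j using int that by (auto simp: integral_def)
 show "inj_on (\<lambda>a. \<Sum>i<n. of_int (a i) * g i) ({..<n} \<rightarrow>\<^sub>E (UNIV :: int set))"
 proof (rule inj_onI)
  fix a b :: "nat => int" assume ab: "a \<in> {..<n} \<rightarrow>\<^sub>E UNIV" "b \<in> {..<n} \<rightarrow>\<^sub>E UNIV"
   "(\<Sum>i<n. of_int (a i) * g i) = (\<Sum>i<n. of_int (b i) * g i)"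
  have z: "(\<Sum>j<n. of_int (a j - b j) * g j) = 0" using ab(3) by (simp add: algebra_simps sum_subtractf)
  have "a k = b k" if k: "k < n" for k
  proof -
   have "emb_det (fun_upd g k 0) = of_int (a k - b k) * emb_det g"
   proof (rule emb_det_replace[OF k])
    fix i assume i: "i < n"
    show "J i 0 = (\<Sum>j<n. of_int (a j - b j) * J i (g j))"
     using emb_sum[where g = g and q = "\<lambda>j. of_int (a j - b j)", OF i wK] z chom_simps(4)[OF csubfields(1) emb(2)[OF i]] by simp
   qed
   moreover have "emb_det (fun_upd g k 0) = 0 * emb_det g"
    by (rule emb_det_replace[OF k, of 0 "\<lambda>_. 0"]) (simp add: chom_simps(4)[OF csubfields(1) emb(2)])
   ultimately have "of_int (a k - b k) * emb_det g = 0" by simp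
   then have "(of_int (a k - b k) :: complex) = 0" using d by simp
   then have "a k - b k = 0" by (simp only: of_int_eq_0_iff)
   then show ?thesis by simp
  qed
  then show "a = b" using ab(1,2) by (intro PiE_ext) auto
 qed
 show "(\<lambda>a. \<Sum>i<n. of_int (a i) * g i) ` ({..<n} \<rightarrow>\<^sub>E (UNIV :: int set)) = {x \<in> K. algebraic_int x}"
 proof (intro equalityI subsetI)
  fix x assume "x \<in> (\<lambda>a. \<Sum>i<n. of_int (a i) * g i) ` ({..<n} \<rightarrow>\<^sub>E (UNIV :: int set))"
  then obtain a :: "nat => int" where "x = (\<Sum>i<n. of_int (a i) * g i)" by auto
  then show "x \<in> {x \<in> K. algebraic_int x}"
   using int wK by (auto intro!: csubfield_sum[OF csubfields(1)] csubfield_props(4)[OF csubfields(1)] csubfield_of_int[OF csubfields(1)]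
     algebraic_int_sum algebraic_int_add_mult(2) simp: integral_def)
 next
  fix x assume "x \<in> {x \<in> K. algebraic_int x}"
  then obtain a :: "nat => int" where a: "x = (\<Sum>j<n. of_int (a j) * g j)" using span by (auto simp: spanning_def)
  show "x \<in> (\<lambda>a. \<Sum>i<n. of_int (a i) * g i) ` ({..<n} \<rightarrow>\<^sub>E (UNIV :: int set))"
   by (rule image_eqI[of _ _ "restrict a {..<n}"]) (auto simp: a)
 qed
qed

lemma integral_basisD: assumes b: "integral_basis K g" shows "integral g" "spanning g"
proof -
 note img = bij_betw_imp_surj_on[OF b[unfolded integral_basis_def], unfolded carrier_ring_of_integers]
 show "integral g" unfolding integral_def
 proof (intro allI impI)
  fix j assume j: "j < n"
  have "(\<Sum>i<n. of_int ((\<lambda>i\<in>{..<n}. if i = j then 1 else 0) i) * g i) \<in> {x \<in> K. algebraic_int x}"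
   unfolding img[symmetric] by (rule imageI) (rule restrict_PiE_iff[THEN iffD2], simp)
  also have "(\<Sum>i<n. of_int ((\<lambda>i\<in>{..<n}. if i = j then 1 else 0) i) * g i) = (\<Sum>i<n. if i = j then g i else 0)"
   by (intro sum.cong) auto
  finally show "g j \<in> K \<and> algebraic_int (g j)" using j by simp
 qed
 show "spanning g" unfolding spanning_def
 proof (intro ballI impI)
  fix x assume "x \<in> K" "algebraic_int x"
  then have "x \<in> (\<lambda>a. \<Sum>i<n. of_int (a i) * g i) ` ({..<n} \<rightarrow>\<^sub>E (UNIV :: int set))" unfolding img by simp
  then show "\<exists>a::nat => int. x = (\<Sum>j<n. of_int (a j) * g j)" by auto
 qed
qed

lemma emb_det_change: assumes w: "integral g" and s: "spanning g" and w': "integral g'"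
 shows "\<exists>m::int. emb_det g' = of_int m * emb_det g"
proof -
 have "\<forall>j. \<exists>a::nat => int. j < n --> g' j = (\<Sum>k<n. of_int (a k) * g k)"
  using w' s unfolding integral_def spanning_def by blast
 then obtain M :: "nat => nat => int" where M: "\<And>j. j < n ==> g' j = (\<Sum>k<n. of_int (M j k) * g k)" by metis
 define A where "A = Matrix.mat n n (\<lambda>(k, j). M j k)"
 have A: "A \<in> carrier_mat n n" unfolding A_def by simp
 have "emb_mat g' = emb_mat g * map_mat of_int A"
 proof (rule eq_matI)
  fix i j assume "i < dim_row (emb_mat g * map_mat of_int A)" "j < dim_col (emb_mat g * map_mat of_int A)"
  then have ij: "i < n" "j < n" by (auto simp: emb_mat_def A_def)
  have "emb_mat g' $$ (i, j) = (\<Sum>k<n. of_int (M j k) * J i (g k))"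
   using ij emb_sum[OF ij(1), of g "\<lambda>k. of_int (M j k)"] w M[OF ij(2)] by (simp add: emb_mat_def integral_def)
  then show "emb_mat g' $$ (i, j) = (emb_mat g * map_mat of_int A) $$ (i, j)"
   using ij by (simp add: emb_mat_def A_def scalar_prod_def atLeast0LessThan mult.commute)
 qed (auto simp: emb_mat_def A_def)
 then have "emb_det g' = emb_det g * det (map_mat of_int A)"
  unfolding emb_det_def using det_mult[OF emb_mat_carrier, of "map_mat of_int A" g] A by simp
 also have "det (map_mat of_int A :: complex mat) = of_int (det A)" by (simp add: of_int_hom.hom_det)
 finally show ?thesis by (metis mult.commute)
qed

text \<open>Both bases are compared with one system of nonzero determinant. The changes of basis in
  the two directions scale determinants by integers m and k with m k = 1, so the ratio is 1 or
  -1.\<close>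

lemma emb_det_square_unique: assumes b: "integral_basis K g" "integral_basis K g'"
 shows "(emb_det g)\<^sup>2 = (emb_det g')\<^sup>2" "emb_det g \<noteq> 0"
proof -
 have main: "(emb_det u)\<^sup>2 = (emb_det v)\<^sup>2 \<and> emb_det v \<noteq> 0"
  if u: "integral u" "spanning u" "emb_det u \<noteq> 0" and v: "integral v" "spanning v" for u v
 proof -
  obtain m where m: "emb_det u = of_int m * emb_det v" using emb_det_change[OF v u(1)] by blast
  obtain k where k: "emb_det v = of_int k * emb_det u" using emb_det_change[OF u(1,2) v(1)] by blast
  have "emb_det u = of_int (m * k) * emb_det u" using m k by simp
  then have "(of_int (m * k) :: complex) = of_int 1" using u(3) by simp
  then have "m * k = 1" by (simp only: of_int_eq_iff)
  then have "m = 1 \<or> m = -1" by (metis abs_zmult_eq_1 abs_eq_iff' abs_1)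
  then show ?thesis using m u(3) by auto
 qed
 obtain u where u: "integral u" "emb_det u \<noteq> 0" "spanning u" using spanning_exists by blast
 show "(emb_det g)\<^sup>2 = (emb_det g')\<^sup>2" "emb_det g \<noteq> 0"
  using main[OF u(1,3,2) integral_basisD[OF b(1)]] main[OF u(1,3,2) integral_basisD[OF b(2)]] by auto
qed

end

section \<open>Independence of the discriminant from basis and enumeration\<close>

lemma enumeration_exists: assumes "number_field K"
 obtains J where "enumerated_field K J"
proof -
 obtain J where "bij_betw J {0..<card (embeddings K)} (embeddings K)"
  using ex_bij_betw_nat_finite[OF embeddings_card(1)[OF assms]] by blast
 then show ?thesis using that[of J] assms embeddings_card(2)[OF assms]
  by (simp add: enumerated_field_def atLeast0LessThan)
qed

lemma emb_det_enumeration: assumes "enumerated_field K J" "enumerated_field K J'"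
 shows "(enumerated_field.emb_det K J g)\<^sup>2 = (enumerated_field.emb_det K J' g)\<^sup>2"
proof -
 interpret A: enumerated_field K J by fact
 interpret B: enumerated_field K J' by fact
 let ?n = "degree_over_Q K"
 have eq: "{..<?n} = {0..<?n}" by auto
 note s = A.enumeration[unfolded eq] and s' = B.enumeration[unfolded eq]
 define q where "q i = inv_into {0..<?n} J (J' i)" for i
 have "bij_betw (inv_into {0..<?n} J \<circ> J') {0..<?n} {0..<?n}"
  by (rule bij_betw_trans[OF s' bij_betw_inv_into[OF s]])
 then have "bij_betw (\<lambda>i. if i \<in> {0..<?n} then q i else i) {0..<?n} {0..<?n}"
  unfolding q_def by (rule bij_betw_cong[THEN iffD1, rotated]) simp
 then have p: "(\<lambda>i. if i \<in> {0..<?n} then q i else i) permutes {0..<?n}" (is "?p permutes _")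
  by (rule bij_imp_permutes) simp
 have sq: "J (?p i) = J' i" if "i < ?n" for i
  using that s s' by (auto simp: q_def bij_betw_def intro!: f_inv_into_f)
 have "B.emb_mat g = Matrix.mat ?n ?n (\<lambda>(i, j). A.emb_mat g $$ (?p i, j))"
  by (rule eq_matI) (use sq A.permutes_bound[OF p] in \<open>simp_all add: A.emb_mat_def B.emb_mat_def del: if_split\<close>)
 then have "B.emb_det g = of_int (sign ?p) * A.emb_det g"
  unfolding A.emb_det_def B.emb_det_def using det_permute_rows[OF A.emb_mat_carrier p] by simp
 moreover have "(of_int (sign ?p) :: complex)\<^sup>2 = 1" by (simp add: sign_def)
 ultimately show ?thesis by (simp add: power_mult_distrib)
qed

text \<open>Shows that the definite description in \<open>discriminant\<close> denotes: neither the
  basis nor the enumeration affects the squared determinant.\<close>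

lemma (in enumerated_field) discriminant_eq: assumes b: "integral_basis K g"
 shows "of_int (discriminant K) = (emb_det g)\<^sup>2" "discriminant K \<noteq> 0"
proof -
 obtain d :: int where d: "(emb_det g)\<^sup>2 = of_int d"
  using emb_det_square_int integral_basisD(1)[OF b] unfolding integral_def by blast
 have "discriminant K = d" unfolding discriminant_def
 proof (rule the_equality)
  show "\<exists>g J. integral_basis K g \<and> bij_betw J {..<n} (embeddings K) \<and>
   of_int d = (det (Matrix.mat n n (\<lambda>(i, j). J i (g j))))\<^sup>2"
   using b enumeration d unfolding emb_det_def emb_mat_def by metis
  fix d' assume "\<exists>g J. integral_basis K g \<and> bij_betw J {..<n} (embeddings K) \<and>
   of_int d' = (det (Matrix.mat n n (\<lambda>(i, j). J i (g j))))\<^sup>2"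
  then obtain g' J' where o: "integral_basis K g'" "bij_betw J' {..<n} (embeddings K)"
   "of_int d' = (det (Matrix.mat n n (\<lambda>(i, j). J' i (g' j))))\<^sup>2" by blast
  interpret B: enumerated_field K J' by standard (use number_field o in auto)
  have "of_int d' = (B.emb_det g')\<^sup>2" unfolding B.emb_det_def B.emb_mat_def by (rule o(3))
  also have "... = (B.emb_det g)\<^sup>2" by (rule B.emb_det_square_unique[OF o(1) b])
  also have "... = (emb_det g)\<^sup>2" by (rule emb_det_enumeration[OF B.enumerated_field_axioms enumerated_field_axioms])
  finally have "of_int d' = (of_int d :: complex)" using d by simp
  then show "d' = d" by simp
 qed
 then show e: "of_int (discriminant K) = (emb_det g)\<^sup>2" using d by simp
 show "discriminant K \<noteq> 0" using e emb_det_square_unique(2)[OF b b] by auto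
qed

lemma (in enumerated_field) integral_basis_exists: "\<exists>g. integral_basis K g"
 using spanning_exists integral_basisI by blast

section \<open>Prime ideals and ramification\<close>

text \<open>Kept polymorphic, since it is applied to integers, to algebraic integers and to
  polynomials over these.\<close>

definition ring_closed :: "'a :: comm_ring_1 set => bool" where
 "ring_closed S \<longleftrightarrow> 0 \<in> S \<and> 1 \<in> S \<and> (\<forall>x\<in>S. \<forall>y\<in>S. x + y \<in> S \<and> x * y \<in> S) \<and> (\<forall>x\<in>S. - x \<in> S)"

context
 fixes S :: "'a :: comm_ring_1 set" assumes S: "ring_closed S"
begin

lemma ring_closedD:
 "0 \<in> S" "1 \<in> S" "x \<in> S ==> y \<in> S ==> x + y \<in> S" "x \<in> S ==> y \<in> S ==> x * y \<in> S" "x \<in> S ==> - x \<in> S"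
 using S by (auto simp: ring_closed_def)

lemma ring_closed_sum: "(\<And>i. i \<in> A ==> f i \<in> S) ==> sum f A \<in> S"
 by (induction A rule: infinite_finite_induct) (auto simp: ring_closedD)

lemma ring_closed_prod: "(\<And>i. i \<in> A ==> f i \<in> S) ==> prod f A \<in> S"
 by (induction A rule: infinite_finite_induct) (auto simp: ring_closedD)

lemma ring_closed_power: "x \<in> S ==> x ^ k \<in> S" by (induction k) (auto simp: ring_closedD)

lemma ring_closed_diff: "x \<in> S ==> y \<in> S ==> x - y \<in> S"
 using ring_closedD(3)[of x "- y"] ring_closedD(5)[of y] by simp

lemma ring_closed_of_nat: "of_nat k \<in> S" by (induction k) (auto simp: ring_closedD)

text \<open>The middle binomial coefficients are divisible by p. The quotient c is exhibited in S,
  so the congruence holds modulo p S and not merely modulo p in the ambient ring.\<close>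

lemma freshman_add: assumes p: "prime p" and a: "a \<in> S" and b: "b \<in> S"
 shows "\<exists>c\<in>S. (a + b) ^ p = a ^ p + b ^ p + of_nat p * c"
proof -
 define c where "c = (\<Sum>k=1..<p. of_nat ((p choose k) div p) * a ^ k * b ^ (p - k))"
 have "p > 0" using p by (simp add: prime_gt_0_nat)
 have ch: "of_nat (p choose k) = (of_nat p :: 'a) * of_nat ((p choose k) div p)" if "k \<in> {1..<p}" for k
 proof -
  have "p dvd (p choose k)" using that p \<open>p > 0\<close> by (intro dvd_choose_prime) auto
  then have "(p choose k) = p * ((p choose k) div p)" by simp
  then show ?thesis by (metis of_nat_mult)
 qed
 have "(a + b) ^ p = (\<Sum>k\<le>p. of_nat (p choose k) * a ^ k * b ^ (p - k))" by (rule binomial_ring)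
 also have "{..p} = insert 0 (insert p {1..<p})" using \<open>p > 0\<close> by auto
 also have "(\<Sum>k\<in>insert 0 (insert p {1..<p}). of_nat (p choose k) * a ^ k * b ^ (p - k)) =
  b ^ p + (a ^ p + (\<Sum>k=1..<p. of_nat (p choose k) * a ^ k * b ^ (p - k)))"
  using \<open>p > 0\<close> by simp
 also have "(\<Sum>k=1..<p. of_nat (p choose k) * a ^ k * b ^ (p - k)) = of_nat p * c"
  unfolding c_def sum_distrib_left by (intro sum.cong refl) (simp add: ch mult.assoc)
 finally have "(a + b) ^ p = a ^ p + b ^ p + of_nat p * c" by (simp add: add_ac)
 moreover have "c \<in> S" unfolding c_def
  using a b by (intro ring_closed_sum ring_closedD(4) ring_closed_of_nat ring_closed_power)
 ultimately show ?thesis by blast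
qed

lemma freshman_sum: assumes p: "prime p" and f: "\<And>i. i \<in> A ==> f i \<in> S"
 shows "\<exists>c\<in>S. (\<Sum>i\<in>A. f i) ^ p = (\<Sum>i\<in>A. f i ^ p) + of_nat p * c"
 using f
proof (induction A rule: infinite_finite_induct)
 case (insert x A)
 obtain c where c: "c \<in> S" "(\<Sum>i\<in>A. f i) ^ p = (\<Sum>i\<in>A. f i ^ p) + of_nat p * c" using insert by auto
 obtain d where d: "d \<in> S" "(f x + (\<Sum>i\<in>A. f i)) ^ p = f x ^ p + (\<Sum>i\<in>A. f i) ^ p + of_nat p * d"
  using freshman_add[OF p, of "f x" "\<Sum>i\<in>A. f i"] insert.prems ring_closed_sum[of A f] by auto
 show ?case using insert.hyps c d by (intro bexI[of _ "c + d"]) (auto simp: algebra_simps ring_closedD)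
qed (use prime_gt_0_nat[OF p] in \<open>auto intro!: bexI[of _ 0] simp: ring_closedD zero_power\<close>)

end

lemma fermat_int_add: assumes p: "prime p" shows "\<exists>c::int. z ^ p = z + int p * c"
proof -
 have U: "ring_closed (UNIV :: int set)" by (simp add: ring_closed_def)
 have n: "\<exists>c::int. int k ^ p = int k + int p * c" for k
  using freshman_sum[OF U p, of "{..<k}" "\<lambda>_. 1"] by auto
 show ?thesis
 proof (cases z rule: int_cases2)
  case (nonneg k)
  then show ?thesis using n by simp
 next
  case (nonpos k)
  obtain c where c: "int k ^ p = int k + int p * c" using n by blast
  obtain d where d: "(int k + z) ^ p = int k ^ p + z ^ p + int p * d"
   using freshman_add[OF U p, of "int k" z] by auto
  have "(int k + z) ^ p = 0" using nonpos prime_gt_0_nat[OF p] by (simp add: zero_power)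
  then have "z ^ p = - int k - int p * c - int p * d" using c d by linarith
  then have "z ^ p = z + int p * (- c - d)" using nonpos by (simp add: right_diff_distrib)
  then show ?thesis by blast
 qed
qed

definition integers :: "complex set => complex set" where
 "integers K = {x \<in> K. algebraic_int x}"

lemma ring_closed_integers: "csubfield K ==> ring_closed (integers K)"
 unfolding ring_closed_def integers_def by (auto simp: csubfield_props algebraic_int_add_mult)

lemma ring_closed_algebraic_int: "ring_closed {x :: complex. algebraic_int x}"
 unfolding ring_closed_def by (auto simp: algebraic_int_add_mult)

lemma ring_of_integers_simps:
 "carrier (ring_of_integers K) = integers K" "x \<otimes>\<^bsub>ring_of_integers K\<^esub> y = x * y"
 "x \<oplus>\<^bsub>ring_of_integers K\<^esub> y = x + y" "\<one>\<^bsub>ring_of_integers K\<^esub> = 1" "\<zero>\<^bsub>ring_of_integers K\<^esub> = 0"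
 by (simp_all add: ring_of_integers_def integers_def complex_ring_def)

lemma cring_ring_of_integers: assumes "csubfield K" shows "cring (ring_of_integers K)"
proof (rule cringI)
 note R = ring_closedD[OF ring_closed_integers[OF assms]]
 show "abelian_group (ring_of_integers K)"
 proof (rule abelian_groupI)
  fix x assume "x \<in> carrier (ring_of_integers K)"
  then show "\<exists>y\<in>carrier (ring_of_integers K). y \<oplus>\<^bsub>ring_of_integers K\<^esub> x = \<zero>\<^bsub>ring_of_integers K\<^esub>"
   using R(5)[of x] by (intro bexI[of _ "- x"]) (auto simp: ring_of_integers_simps)
 qed (use R in \<open>auto simp: ring_of_integers_simps add_ac\<close>)
 show "Group.comm_monoid (ring_of_integers K)"
  by (rule comm_monoidI) (use R in \<open>auto simp: ring_of_integers_simps mult_ac\<close>)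
qed (auto simp: ring_of_integers_simps algebra_simps)

lemma ring_of_integers_a_inv: assumes "csubfield K" "x \<in> integers K"
 shows "\<ominus>\<^bsub>ring_of_integers K\<^esub> x = - x"
proof -
 interpret cring "ring_of_integers K" by (rule cring_ring_of_integers[OF assms(1)])
 show ?thesis
  using minus_equality[of "- x" x] assms(2) ring_closedD(5)[OF ring_closed_integers[OF assms(1)] assms(2)]
  by (simp add: ring_of_integers_simps)
qed

lemma primes_aboveD: assumes K: "csubfield K" and P: "P \<in> primes_above K p"
 shows "P \<subseteq> integers K" "0 \<in> P" "x \<in> P ==> y \<in> P ==> x + y \<in> P" "x \<in> P ==> - x \<in> P"
  "a \<in> integers K ==> x \<in> P ==> a * x \<in> P" "1 \<notin> P"
  "a \<in> integers K ==> b \<in> integers K ==> a * b \<in> P ==> a \<in> P \<or> b \<in> P" "of_nat p \<in> P"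
proof -
 have pr: "primeideal P (ring_of_integers K)" and pP: "of_nat p \<in> P" using P by (auto simp: primes_above_def)
 show "of_nat p \<in> P" by (rule pP)
 interpret primeideal P "ring_of_integers K" by (rule pr)
 show sub: "P \<subseteq> integers K" using Icarr by (auto simp: ring_of_integers_simps)
 show "0 \<in> P" using additive_subgroup.zero_closed[OF additive_subgroup_axioms] by (simp add: ring_of_integers_simps)
 show "x \<in> P ==> y \<in> P ==> x + y \<in> P" using additive_subgroup.a_closed[OF additive_subgroup_axioms, of x y] by (simp add: ring_of_integers_simps)
 show l: "a \<in> integers K ==> x \<in> P ==> a * x \<in> P" for a x using I_l_closed[of x a] by (simp add: ring_of_integers_simps)
 show "x \<in> P ==> - x \<in> P"
  using l[of "- 1" x] ring_closedD(2,5)[OF ring_closed_integers[OF K]] by simp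
 show "1 \<notin> P"
 proof
  assume "1 \<in> P"
  then have "integers K \<subseteq> P" using l[of _ 1] by auto
  then show False using I_notcarr sub by (auto simp: ring_of_integers_simps)
 qed
 show "a \<in> integers K ==> b \<in> integers K ==> a * b \<in> P ==> a \<in> P \<or> b \<in> P"
  using I_prime[of a b] by (simp add: ring_of_integers_simps)
qed

lemma of_int_div_prime_not_algebraic_int:
 assumes "algebraic_int (of_int z / of_nat p :: complex)" "p > 0" shows "int p dvd z"
proof -
 have "(of_int z / of_nat p :: complex) \<in> \<int>"
  by (rule rational_algebraic_int_is_int) (use assms in auto)
 then obtain k where "(of_int z / of_nat p :: complex) = of_int k" by (elim Ints_cases)
 then have "(of_int z :: complex) = of_int (k * int p)" using assms(2) by (simp add: field_simps)
 then have "z = k * int p" by (simp only: of_int_eq_iff)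
 then show ?thesis by simp
qed

text \<open>As 1/p is not an algebraic integer, p generates a proper ideal. By Zorn's lemma there is
  a maximal one among the proper ideals containing p, and it is prime by the usual argument.\<close>

lemma primes_above_exists: assumes K: "csubfield K" and p: "prime p"
 shows "\<exists>P. P \<in> primes_above K p"
proof -
 define Z where "Z = integers K"
 have Z: "ring_closed Z" unfolding Z_def by (rule ring_closed_integers[OF K])
 note R = ring_closedD[OF Z]
 define A where "A = {I. I \<subseteq> Z \<and> of_nat p \<in> I \<and> 1 \<notin> I \<and> (\<forall>x\<in>I. \<forall>y\<in>I. x + y \<in> I) \<and> (\<forall>a\<in>Z. \<forall>x\<in>I. a * x \<in> I)}"
 have "(*) (of_nat p) ` Z \<in> A"
  unfolding A_def
 proof (intro CollectI conjI ballI)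
  show "(*) (of_nat p) ` Z \<subseteq> Z" using R(4) ring_closed_of_nat[OF Z] by auto
  show "of_nat p \<in> (*) (of_nat p) ` Z" using R(2) by (intro image_eqI[of _ _ 1]) auto
  show "1 \<notin> (*) (of_nat p) ` Z"
  proof
   assume "1 \<in> (*) (of_nat p) ` Z"
   then obtain x where x: "x \<in> Z" "1 = of_nat p * x" by auto
   then have "x = of_int 1 / of_nat p" using p by (auto simp: field_simps)
   then have "int p dvd 1" using x(1) p by (intro of_int_div_prime_not_algebraic_int) (auto simp: Z_def integers_def prime_gt_0_nat)
   then show False using p by auto
  qed
  fix x y assume "x \<in> (*) (of_nat p) ` Z" "y \<in> (*) (of_nat p) ` Z"
  then show "x + y \<in> (*) (of_nat p) ` Z" using R(3) by (auto simp flip: distrib_left)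
 next
  fix a x assume "a \<in> Z" "x \<in> (*) (of_nat p) ` Z"
  then obtain y where "y \<in> Z" "x = of_nat p * y" by auto
  then show "a * x \<in> (*) (of_nat p) ` Z" using R(4)[of a y] \<open>a \<in> Z\<close> by (intro image_eqI[of _ _ "a * y"]) auto
 qed
 then have ne: "A \<noteq> {}" by blast
 have "\<exists>M\<in>A. \<forall>X\<in>A. M \<subseteq> X --> X = M"
 proof (rule subset_Zorn_nonempty[OF ne])
  fix C assume C: "C \<noteq> {}" "subset.chain A C"
  have CA: "C \<subseteq> A" and ch: "\<And>X Y. X \<in> C ==> Y \<in> C ==> X \<subseteq> Y \<or> Y \<subseteq> X" using C(2) by (auto simp: subset_chain_def)
  show "\<Union>C \<in> A" unfolding A_def
  proof (intro CollectI conjI ballI)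
   show "\<Union>C \<subseteq> Z" "1 \<notin> \<Union>C" using CA by (auto simp: A_def)
   show "of_nat p \<in> \<Union>C" using C(1) CA by (auto simp: A_def)
   fix x y assume "x \<in> \<Union>C" "y \<in> \<Union>C"
   then obtain X Y where XY: "X \<in> C" "Y \<in> C" "x \<in> X" "y \<in> Y" by auto
   have "\<exists>Z\<in>C. x \<in> Z \<and> y \<in> Z" using ch[OF XY(1,2)] XY by blast
   then obtain Z where "Z \<in> C" "x \<in> Z" "y \<in> Z" by blast
   then show "x + y \<in> \<Union>C" using CA by (auto simp: A_def)
  next
   fix a x assume "a \<in> Z" "x \<in> \<Union>C"
   then obtain X where "X \<in> C" "x \<in> X" "X \<in> A" using CA by auto
   then have "a * x \<in> X" using \<open>a \<in> Z\<close> by (auto simp: A_def)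
   then show "a * x \<in> \<Union>C" using \<open>X \<in> C\<close> by blast
  qed
 qed
 then obtain M where M: "M \<in> A" and max: "\<And>X. X \<in> A ==> M \<subseteq> X ==> X = M" by blast
 have M': "M \<subseteq> Z" "of_nat p \<in> M" "1 \<notin> M" "\<And>x y. x \<in> M ==> y \<in> M ==> x + y \<in> M" "\<And>a x. a \<in> Z ==> x \<in> M ==> a * x \<in> M"
  using M by (auto simp: A_def)
 have M0: "0 \<in> M" using M'(5)[OF R(1) M'(2)] by simp
 have Mneg: "- x \<in> M" if "x \<in> M" for x using M'(5)[OF R(5)[OF R(2)] that] by simp
 have prime: "a \<in> M \<or> b \<in> M" if ab: "a \<in> Z" "b \<in> Z" "a * b \<in> M" for a b
 proof (rule ccontr)
  assume n: "\<not> (a \<in> M \<or> b \<in> M)"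
  define X where "X = {m + a * c | m c. m \<in> M \<and> c \<in> Z}"
  have XI: "m + a * c \<in> X" if "m \<in> M" "c \<in> Z" for m c unfolding X_def using that by blast
  have MX: "M \<subseteq> X" using XI[OF _ R(1)] by auto
  have aX: "a \<in> X" using XI[OF M0 R(2)] by simp
  have "1 \<in> X"
  proof (rule ccontr)
   assume "1 \<notin> X"
   have "X \<in> A" unfolding A_def
   proof (intro CollectI conjI ballI \<open>1 \<notin> X\<close>)
    show "X \<subseteq> Z" unfolding X_def using M'(1) R ab(1) by auto
    show "of_nat p \<in> X" using MX M'(2) by blast
    fix x y assume "x \<in> X" "y \<in> X"
    then obtain m c m' c' where m: "m \<in> M" "c \<in> Z" "m' \<in> M" "c' \<in> Z" "x = m + a * c" "y = m' + a * c'" unfolding X_def by blast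
    then have "x + y = (m + m') + a * (c + c')" by (simp add: algebra_simps)
    then show "x + y \<in> X" unfolding X_def using m M'(4) R(3) by blast
   next
    fix d x assume "d \<in> Z" "x \<in> X"
    then obtain m c where m: "m \<in> M" "c \<in> Z" "x = m + a * c" unfolding X_def by blast
    then have "d * x = d * m + a * (d * c)" by (simp add: algebra_simps)
    then show "d * x \<in> X" unfolding X_def using m M'(5) R(4) \<open>d \<in> Z\<close> by blast
   qed
   then have "X = M" using max MX by blast
   then show False using aX n by blast
  qed
  then obtain m c where m: "m \<in> M" "c \<in> Z" "1 = m + a * c" unfolding X_def by blast
  have "b = b * (m + a * c)" using m(3) by simp
  also have "... = b * m + c * (a * b)" by (simp add: algebra_simps)
  also have "... \<in> M" using M'(4,5) m ab by blast
  finally show False using n by blast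
 qed
 interpret cring "ring_of_integers K" by (rule cring_ring_of_integers[OF K])
 have "ideal M (ring_of_integers K)"
 proof (rule idealI)
  show "ring (ring_of_integers K)" by (rule ring_axioms)
  show "subgroup M (add_monoid (ring_of_integers K))"
  proof (rule add.subgroupI)
   show "\<ominus>\<^bsub>ring_of_integers K\<^esub> a \<in> M" if "a \<in> M" for a
    using that Mneg M'(1) ring_of_integers_a_inv[OF K, of a] by (auto simp: Z_def)
  qed (use M' M0 in \<open>auto simp: ring_of_integers_simps Z_def\<close>)
  show "x \<otimes>\<^bsub>ring_of_integers K\<^esub> a \<in> M" "a \<otimes>\<^bsub>ring_of_integers K\<^esub> x \<in> M" if "a \<in> M" "x \<in> carrier (ring_of_integers K)" for a x
   using that M'(5)[of x a] by (simp_all add: ring_of_integers_simps Z_def mult.commute)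
 qed
 then have "primeideal M (ring_of_integers K)"
  by (rule primeidealI) (use prime M'(3) R(2) is_cring in \<open>auto simp: ring_of_integers_simps Z_def\<close>)
 then show ?thesis using M'(2) unfolding primes_above_def by blast
qed

subsection \<open>Primes not dividing the discriminant are unramified\<close>

lemma det_algebraic_int:
 assumes A: "A \<in> carrier_mat n n" and e: "\<And>i j. i < n ==> j < n ==> algebraic_int (A $$ (i, j) :: complex)"
 shows "algebraic_int (det A)" unfolding det_def'[OF A]
proof (intro algebraic_int_sum algebraic_int_add_mult(2) algebraic_int_of_int algebraic_int_prod)
 fix p i assume "p \<in> {p. p permutes {0..<n}}" "i \<in> {0..<n}"
 then show "algebraic_int (A $$ (i, p i))" using e[of i "p i"] permutes_in_image[of p "{0..<n}" i] by auto
qed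

context enumerated_field
begin

lemma trace_int: assumes x: "x \<in> integers K"
 shows "\<exists>t::int. (\<Sum>i<n. J i x) = of_int t"
proof -
 have x': "x \<in> K" "algebraic_int x" using x by (auto simp: integers_def)
 have "(\<Sum>i<n. J i x) \<in> \<rat>"
 proof (rule galois_fixed_rational[OF number_field])
  show "(\<Sum>i<n. J i x) \<in> L" using x' by (intro csubfield_sum[OF csubfields(2)] emb(3)) auto
  fix r assume t: "r \<in> carrier (galois_group L)"
  then have c: "chom L r" by (simp add: galois_group_iff)
  have tr: "(\<Sum>i<n. J i x) = (\<Sum>f\<in>embeddings K. f x)"
   using sum.reindex_bij_betw[OF enumeration, of "\<lambda>f. f x"] by simp
  have "r (\<Sum>f\<in>embeddings K. f x) = (\<Sum>f\<in>embeddings K. r (f x))"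
   using x' embedding_image_subset by (intro chom_sum[OF csubfields(2) c]) auto
  also have "... = (\<Sum>f\<in>embeddings K. compose K r f x)" using x' by (simp add: compose_def)
  also have "... = (\<Sum>f\<in>embeddings K. f x)"
   using sum.reindex_bij_betw[OF compose_embedding_bij[OF number_field c], of "\<lambda>f. f x"] by simp
  finally show "r (\<Sum>i<n. J i x) = (\<Sum>i<n. J i x)" unfolding tr .
 qed
 moreover have "algebraic_int (\<Sum>i<n. J i x)"
  using x' chom_algebraic_int[OF csubfields(1) emb(2)] by (intro algebraic_int_sum) auto
 ultimately have "(\<Sum>i<n. J i x) \<in> \<int>" using rational_algebraic_int_is_int by blast
 then show ?thesis by (elim Ints_cases) blast
qed

context
 fixes p assumes p: "prime p" and pd: "\<not> int p dvd discriminant K"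
begin

text \<open>The trace form is nondegenerate modulo \<open>p\<close> and annihilates nilpotents.\<close>

lemma integers_mod_reduced:
 assumes z: "z \<in> integers K" and sq: "algebraic_int (z\<^sup>2 / of_nat p)"
 shows "algebraic_int (z / of_nat p)"
proof -
 have p0: "p > 0" "(of_nat p :: complex) \<noteq> 0" using p by (auto simp: prime_gt_0_nat)
 have z': "z \<in> K" "algebraic_int z" using z by (auto simp: integers_def)
 obtain g where w: "integral_basis K g" using integral_basis_exists by blast
 have wi: "g j \<in> K" "algebraic_int (g j)" if "j < n" for j using integral_basisD(1)[OF w] that by (auto simp: integral_def)
 note K = csubfields(1)
 \<comment> \<open>For y = z g_j the trace satisfies Tr(y)^p = sum of J_i(y)^p modulo p, and y^p is
   divisible by p because z^2 is and p \<ge> 2. Hence p divides the trace.\<close>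
 have "\<exists>u::int. (\<Sum>i<n. J i (z * g j)) = of_nat p * of_int u" if j: "j < n" for j
 proof -
  define y where "y = z * g j"
  have y: "y \<in> K" "algebraic_int y" unfolding y_def
   using z' wi[OF j] csubfield_props(4)[OF K] algebraic_int_add_mult(2) by auto
  obtain t :: int where t: "(\<Sum>i<n. J i y) = of_int t" using trace_int[of y] y by (auto simp: integers_def)
  have yp: "algebraic_int (y ^ p / of_nat p)"
  proof -
   have "y ^ p = y ^ (p - 2) * (z\<^sup>2 * (g j)\<^sup>2)"
    unfolding power_mult_distrib[symmetric] y_def[symmetric] power_add[symmetric] using prime_ge_2_nat[OF p]
    by (simp only: le_add_diff_inverse2)
   then have "y ^ p / of_nat p = y ^ (p - 2) * ((g j)\<^sup>2 * (z\<^sup>2 / of_nat p))" by simp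
   then show ?thesis using y wi[OF j] sq by (simp only:) (intro algebraic_int_add_mult(2) algebraic_int_power)
  qed
  obtain c where c: "algebraic_int c" "(\<Sum>i<n. J i y) ^ p = (\<Sum>i<n. J i y ^ p) + of_nat p * c"
   using freshman_sum[OF ring_closed_algebraic_int p, of "{..<n}" "\<lambda>i. J i y"] chom_algebraic_int[OF K emb(2)] y by auto
  have "J i y ^ p / of_nat p = J i (y ^ p / of_nat p)" if "i < n" for i
  proof -
   have "of_nat p \<in> K" "J i (of_nat p) = of_nat p"
    using csubfield_of_int[OF K, of "int p"] chom_of_int[OF K emb(2)[OF that], of "int p"] by auto
   then show ?thesis
    unfolding divide_inverse using y(1) chom_simps(3,7)[OF K emb(2)[OF that]] chom_power[OF K emb(2)[OF that]]
     csubfield_power[OF K] csubfield_props(6)[OF K] by simp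
  qed
  moreover have "algebraic_int (J i (y ^ p / of_nat p))" if "i < n" for i
  proof (rule chom_algebraic_int[OF K emb(2)[OF that] _ yp])
   show "y ^ p / of_nat p \<in> K"
    using csubfield_props(8)[OF K csubfield_power[OF K y(1)], of "of_nat p"] csubfield_of_int[OF K, of "int p"] by simp
  qed
  ultimately have "algebraic_int ((\<Sum>i<n. J i y ^ p / of_nat p) + c)"
   using c(1) by (intro algebraic_int_add_mult(1) algebraic_int_sum) auto
  also have "(\<Sum>i<n. J i y ^ p / of_nat p) + c = of_int (t ^ p) / of_nat p"
   using c(2) p0 by (simp add: t field_simps flip: sum_divide_distrib)
  finally have "int p dvd t ^ p" using p0 by (intro of_int_div_prime_not_algebraic_int)
  then have "int p dvd t" using p by (metis prime_dvd_power prime_nat_int_transfer)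
  then show ?thesis using t unfolding y_def by (auto elim!: dvdE)
 qed
 then have "\<forall>j. \<exists>u::int. j < n --> (\<Sum>i<n. J i (z * g j)) = of_nat p * of_int u" by blast
 then obtain u :: "nat => int" where u: "\<And>j. j < n ==> (\<Sum>i<n. J i (z * g j)) = of_nat p * of_int (u j)" by metis
 define A where "A = transpose_mat (emb_mat g)"
 have A: "A \<in> carrier_mat n n" unfolding A_def by simp
 define s where "s = Matrix.vec n (\<lambda>i. J i z / of_nat p)"
 have As: "(A *\<^sub>v s) $ j = of_int (u j)" if j: "j < n" for j
 proof -
  have "(A *\<^sub>v s) $ j = (\<Sum>i<n. J i (g j) * (J i z / of_nat p))"
   using j by (simp add: A_def s_def emb_mat_def scalar_prod_def atLeast0LessThan)
  also have "... = (\<Sum>i<n. J i (z * g j)) / of_nat p"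
   unfolding sum_divide_distrib using z' wi[OF j] by (intro sum.cong) (auto simp: chom_simps(3)[OF K emb(2)])
  finally show ?thesis using u[OF j] p0 by simp
 qed
 \<comment> \<open>Cramer's rule for the transposed matrix expresses the determinant times J_0(z)/p
   by the integral numbers u_j and the matrix entries. A second factor of the determinant produces
   the discriminant, which is invertible modulo p.\<close>
 have "algebraic_int (det (replace_col A (A *\<^sub>v s) 0))"
 proof (rule det_algebraic_int[where n = n])
  show "replace_col A (A *\<^sub>v s) 0 \<in> carrier_mat n n" using A by (auto simp: replace_col_def)
  fix i j assume ij: "i < n" "j < n"
  show "algebraic_int (replace_col A (A *\<^sub>v s) 0 $$ (i, j))"
   using ij A As wi chom_algebraic_int[OF K emb(2)] by (auto simp: replace_col_def A_def emb_mat_def)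
 qed
 then have "algebraic_int (J 0 z / of_nat p * det A)"
  using cramer_lemma_mat[OF A, of s 0] n_pos by (simp add: s_def)
 also have "det A = emb_det g" unfolding A_def emb_det_def by (rule det_transpose[OF emb_mat_carrier])
 finally have "algebraic_int (J 0 z / of_nat p * emb_det g * emb_det g)"
  by (rule algebraic_int_add_mult(2)) (rule emb_det_algebraic_int, use wi in simp)
 then have D: "algebraic_int (of_int (discriminant K) * (J 0 z / of_nat p))"
  unfolding discriminant_eq(1)[OF w] power2_eq_square by (simp add: mult_ac)
 have "coprime (int p) (discriminant K)" using p pd by (intro prime_imp_coprime) auto
 then obtain a b where ab: "a * int p + b * discriminant K = 1"
  using bezout_int[of "int p" "discriminant K"] by auto
 have "J 0 z / of_nat p = of_int (a * int p + b * discriminant K) * (J 0 z / of_nat p)" unfolding ab by simp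
 also have "... = of_int a * J 0 z + of_int b * (of_int (discriminant K) * (J 0 z / of_nat p))"
  using p0 by (simp add: field_simps)
 finally have "J 0 z / of_nat p = of_int a * J 0 z + of_int b * (of_int (discriminant K) * (J 0 z / of_nat p))" .
 moreover have "algebraic_int (of_int a * J 0 z + of_int b * (of_int (discriminant K) * (J 0 z / of_nat p)))"
  by (intro algebraic_int_add_mult algebraic_int_of_int D chom_algebraic_int[OF K emb(2)[OF n_pos]] z')
 ultimately have "algebraic_int (J 0 z / of_nat p)" by (rule ssubst)
 moreover have pK: "of_nat p \<in> K" "J 0 (of_nat p) = of_nat p"
  using csubfield_of_int[OF K, of "int p"] chom_of_int[OF K emb(2)[OF n_pos], of "int p"] by auto
 then have "J 0 (z / of_nat p) = J 0 z / of_nat p"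
  unfolding divide_inverse using z' chom_simps(3,7)[OF K emb(2)[OF n_pos]] csubfield_props(6)[OF K] by simp
 ultimately show ?thesis
  using chom_algebraic_int_iff[OF K emb(2)[OF n_pos], of "z / of_nat p"] csubfield_props(8)[OF K z'(1) pK(1)] by simp
qed

text \<open>The exponent is raised to 2^a \<ge> a, after which the statement for squares is applied
  a times.\<close>

lemma integers_mod_reduced_power:
 assumes z: "z \<in> integers K" and pw: "algebraic_int (z ^ a / of_nat p)"
 shows "algebraic_int (z / of_nat p)"
proof -
 have R: "ring_closed (integers K)" by (rule ring_closed_integers[OF csubfields(1)])
 have "algebraic_int (z ^ (2 ^ k) / of_nat p) ==> algebraic_int (z / of_nat p)" for k
 proof (induction k)
  case (Suc k)
  have "z ^ (2 ^ Suc k) = (z ^ (2 ^ k))\<^sup>2" by (simp add: power_mult[symmetric] mult.commute)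
  then show ?case using Suc integers_mod_reduced[OF ring_closed_power[OF R z, of "2 ^ k"]] by simp
 qed simp
 moreover have "algebraic_int (z ^ (2 ^ a) / of_nat p)"
 proof -
  have "a \<le> 2 ^ a" by (rule less_imp_le) simp
  then have "z ^ (2 ^ a) / of_nat p = z ^ (2 ^ a - a) * (z ^ a / of_nat p)" by (simp flip: power_add)
  then show ?thesis using pw z by (simp only:) (intro algebraic_int_add_mult(2) algebraic_int_power, simp_all add: integers_def)
 qed
 ultimately show ?thesis by blast
qed

text \<open>Pigeonhole on coordinates modulo p with respect to an integral basis: there are at most
  p^n residue classes.\<close>

lemma integers_mod_finite: assumes "range (f :: nat => complex) \<subseteq> integers K"
 shows "\<exists>a b. a < b \<and> algebraic_int ((f b - f a) / of_nat p)"
proof -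
 obtain g where w: "integral_basis K g" using integral_basis_exists by blast
 have wi: "algebraic_int (g j)" if "j < n" for j using integral_basisD(1)[OF w] that by (auto simp: integral_def)
 have "\<forall>k. \<exists>c::nat => int. f k = (\<Sum>j<n. of_int (c j) * g j)"
  using integral_basisD(2)[OF w] assms unfolding spanning_def integers_def by blast
 then obtain c :: "nat => nat => int" where c: "\<And>k. f k = (\<Sum>j<n. of_int (c k j) * g j)" by metis
 define h where "h k = (\<lambda>j\<in>{..<n}. c k j mod int p)" for k
 have p0: "p > 0" using p by (rule prime_gt_0_nat)
 have "range h \<subseteq> {..<n} \<rightarrow>\<^sub>E {0..<int p}" using p0 by (intro image_subsetI) (auto simp: h_def restrict_PiE_iff simp del: restrict_apply)
 then have "finite (range h)" by (rule finite_subset) (simp add: finite_PiE)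
 then have "\<not> inj h" using range_inj_infinite by blast
 then obtain a b where ab: "a < b" "h a = h b" unfolding inj_def by (metis linorder_neqE_nat)
 have "\<exists>k. c b j - c a j = int p * k" if "j < n" for j
 proof -
  have "c a j mod int p = c b j mod int p" using fun_cong[OF ab(2), of j] that by (simp add: h_def)
  then have "int p dvd c b j - c a j" by (simp add: mod_eq_dvd_iff[symmetric])
  then show ?thesis by (simp add: dvd_def)
 qed
 then have "\<forall>j. \<exists>k. j < n --> c b j - c a j = int p * k" by blast
 then obtain k where k: "\<And>j. j < n ==> c b j - c a j = int p * k j" by metis
 have "f b - f a = (\<Sum>j<n. of_int (c b j - c a j) * g j)" unfolding c by (simp add: sum_subtractf left_diff_distrib)
 also have "... = (\<Sum>j<n. of_nat p * (of_int (k j) * g j))"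
  by (intro sum.cong refl) (simp only: lessThan_iff k, simp)
 also have "... = of_nat p * (\<Sum>j<n. of_int (k j) * g j)" by (rule sum_distrib_left[symmetric])
 finally have "(f b - f a) / of_nat p = (\<Sum>j<n. of_int (k j) * g j)" using p0 by simp
 moreover have "algebraic_int (\<Sum>j<n. of_int (k j) * g j)"
  by (intro algebraic_int_sum algebraic_int_add_mult(2) algebraic_int_of_int wi) auto
 ultimately show ?thesis using ab(1) by metis
qed

text \<open>Locally at P, the prime p generates P. The powers of x repeat modulo p, say x^b = x^a;
  then e = 1 - x^(b-a) is outside P and (e x)^(a+1) is divisible by p, hence e x is, the integers
  modulo p having no nilpotents.\<close>

lemma prime_above_annihilator: assumes P: "P \<in> primes_above K p" and x: "x \<in> P"
 shows "\<exists>e\<in>integers K - P. algebraic_int (e * x / of_nat p)"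
proof -
 have R: "ring_closed (integers K)" by (rule ring_closed_integers[OF csubfields(1)])
 note PD = primes_aboveD[OF csubfields(1) P]
 have xi: "x \<in> integers K" using PD(1) x by blast
 obtain a b where ab: "a < b" "algebraic_int ((x ^ b - x ^ a) / of_nat p)"
  using integers_mod_finite[of "\<lambda>k. x ^ k"] ring_closed_power[OF R xi] by blast
 define e where "e = 1 - x ^ (b - a)"
 have xp: "x ^ (b - a) \<in> P"
 proof -
  have "x ^ (b - a) = x ^ (b - a - 1) * x" using ab(1) by (intro power_minus_mult[symmetric]) simp
  then show ?thesis using PD(5)[OF ring_closed_power[OF R xi] x] by simp
 qed
 have ei: "e \<in> integers K" unfolding e_def by (intro ring_closed_diff[OF R] ring_closedD(2)[OF R] ring_closed_power[OF R xi])
 have "e \<notin> P" using PD(3)[OF _ xp, of e] PD(6) by (auto simp: e_def)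
 have exi: "e * x \<in> integers K" using ei xi ring_closedD(4)[OF R] by blast
 have "(e * x) ^ Suc a / of_nat p = - (e ^ a * x) * ((x ^ b - x ^ a) / of_nat p)"
 proof -
  have "x ^ b = x ^ a * x ^ (b - a)" using ab(1) by (simp flip: power_add)
  then have "e * x ^ a = - (x ^ b - x ^ a)" by (simp add: e_def algebra_simps)
  have "(e * x) ^ Suc a = (e ^ a * x) * (e * x ^ a)" by (simp add: power_mult_distrib mult_ac)
  also have "... = (e ^ a * x) * (- (x ^ b - x ^ a))" unfolding \<open>e * x ^ a = - (x ^ b - x ^ a)\<close> ..
  finally show ?thesis by (simp add: field_simps)
 qed
 moreover have "algebraic_int (- (e ^ a * x) * ((x ^ b - x ^ a) / of_nat p))"
 proof (rule algebraic_int_add_mult(2)[OF _ ab(2)])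
  have "- (e ^ a * x) \<in> integers K" by (intro ring_closedD(4,5)[OF R] ring_closed_power[OF R] ei xi)
  then show "algebraic_int (- (e ^ a * x))" by (simp add: integers_def)
 qed
 ultimately have "algebraic_int (e * x / of_nat p)" by (intro integers_mod_reduced_power[OF exi, of "Suc a"]) simp
 then show ?thesis using ei \<open>e \<notin> P\<close> by blast
qed

text \<open>Some e outside P makes e z divisible by p^2, for every z in the product. If z = p were
  in it, e would be a multiple of p and so lie in P. The first factor is any Q inside P, as powers
  of P are built by multiplying with P on the right.\<close>

lemma prime_above_not_square: assumes P: "P \<in> primes_above K p" and Q: "Q \<subseteq> P"
 shows "of_nat p \<notin> ideal_prod (ring_of_integers K) Q P"
proof
 have R: "ring_closed (integers K)" by (rule ring_closed_integers[OF csubfields(1)])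
 note RD = ring_closedD[OF R]
 note PD = primes_aboveD[OF csubfields(1) P]
 have aI: "x \<in> integers K ==> algebraic_int x" for x by (simp add: integers_def)
 have "\<exists>e\<in>integers K - P. algebraic_int (e * z / (of_nat p)\<^sup>2)" if "z \<in> ideal_prod (ring_of_integers K) Q P" for z
  using that
 proof (induction z rule: ideal_prod.induct)
  case (prod x y)
  obtain d where d: "d \<in> integers K - P" "algebraic_int (d * x / of_nat p)" using prime_above_annihilator[OF P] prod(1) Q by blast
  obtain e where e: "e \<in> integers K - P" "algebraic_int (e * y / of_nat p)" using prime_above_annihilator[OF P prod(2)] by blast
  have "d * e \<in> integers K - P" using d e RD(4) PD(7) by blast
  moreover have "d * e * (x \<otimes>\<^bsub>ring_of_integers K\<^esub> y) / (of_nat p)\<^sup>2 = (d * x / of_nat p) * (e * y / of_nat p)"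
   by (simp add: ring_of_integers_simps power2_eq_square)
  ultimately show ?case using algebraic_int_add_mult(2)[OF d(2) e(2)] by metis
 next
  case (sum x y)
  obtain d where d: "d \<in> integers K - P" "algebraic_int (d * x / (of_nat p)\<^sup>2)" using sum by blast
  obtain e where e: "e \<in> integers K - P" "algebraic_int (e * y / (of_nat p)\<^sup>2)" using sum by blast
  have "d * e \<in> integers K - P" using d e RD(4) PD(7) by blast
  moreover have "d * e * (x \<oplus>\<^bsub>ring_of_integers K\<^esub> y) / (of_nat p)\<^sup>2 = e * (d * x / (of_nat p)\<^sup>2) + d * (e * y / (of_nat p)\<^sup>2)"
   by (simp add: ring_of_integers_simps add_divide_distrib algebra_simps)
  moreover have "algebraic_int (e * (d * x / (of_nat p)\<^sup>2) + d * (e * y / (of_nat p)\<^sup>2))"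
   using d e aI by (intro algebraic_int_add_mult) auto
  ultimately show ?case by metis
 qed
 moreover assume "of_nat p \<in> ideal_prod (ring_of_integers K) Q P"
 ultimately obtain e where e: "e \<in> integers K - P" "algebraic_int (e * of_nat p / (of_nat p)\<^sup>2)" by blast
 have p0: "(of_nat p :: complex) \<noteq> 0" using p by auto
 have "algebraic_int (e / of_nat p)" using e(2) p0 by (simp add: power2_eq_square)
 moreover have "e / of_nat p \<in> K"
  using e(1) csubfield_props(8)[OF csubfields(1), of e "of_nat p"] csubfield_of_int[OF csubfields(1), of "int p"] by (simp add: integers_def)
 ultimately have "(e / of_nat p) * of_nat p \<in> P" by (intro PD(5,8)) (simp add: integers_def)
 then show False using e(1) p0 by simp
qed

text \<open>The power P^(k+2) is the product of P^(k+1), which is contained in P, with P, so it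
  omits p; hence 1 is the greatest exponent.\<close>

lemma unramified_if_not_dvd_discriminant: "unramified K p" unfolding unramified_def
proof
 fix P assume P: "P \<in> primes_above K p"
 define R where "R = ring_of_integers K"
 note PD = primes_aboveD[OF csubfields(1) P]
 have Rc: "ring_closed (integers K)" by (rule ring_closed_integers[OF csubfields(1)])
 have pw: "P [^]\<^bsub>ideals_set R\<^esub> (0::nat) = integers K" "\<And>e. P [^]\<^bsub>ideals_set R\<^esub> (Suc e) = ideal_prod R (P [^]\<^bsub>ideals_set R\<^esub> e) P"
  by (simp_all add: nat_pow_def ideals_set_def R_def ring_of_integers_simps)
 have sub: "ideal_prod R A P \<subseteq> P" if "A \<subseteq> integers K" for A
 proof
  fix z assume "z \<in> ideal_prod R A P"
  then show "z \<in> P"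
   by (induction z rule: ideal_prod.induct) (use that PD in \<open>auto simp: R_def ring_of_integers_simps\<close>)
 qed
 have subO: "P [^]\<^bsub>ideals_set R\<^esub> e \<subseteq> integers K" for e :: nat
 proof (induction e)
  case (Suc e)
  then show ?case unfolding pw(2) using sub PD(1) by blast
 qed (simp only: pw(1) order_refl)
 show "ramification_index K p P = 1" unfolding ramification_index_def
 proof (rule Greatest_equality, fold R_def)
  have "1 \<otimes>\<^bsub>R\<^esub> of_nat p \<in> ideal_prod R (integers K) P"
   by (rule ideal_prod.prod) (use PD ring_closedD[OF Rc] in auto)
  then show "of_nat p \<in> P [^]\<^bsub>ideals_set R\<^esub> (1::nat)"
   using pw(2)[of 0] pw(1) by (simp add: R_def ring_of_integers_simps)
  fix e :: nat assume e: "of_nat p \<in> P [^]\<^bsub>ideals_set R\<^esub> e"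
  show "e \<le> 1"
  proof (rule ccontr)
   assume "\<not> e \<le> 1"
   then obtain k where "e = Suc (Suc k)" by (metis One_nat_def not_less_eq_eq le0 old.nat.exhaust)
   then show False using e prime_above_not_square[OF P sub[OF subO[of k]]] unfolding R_def[symmetric] by (simp only: pw(2))
  qed
 qed
qed

end

end

section \<open>Frobenius elements\<close>

text \<open>The k-th elementary symmetric function with its sign: the coefficient of y^(|A|-k) in
  the product of the factors y - h x.\<close>

definition esym :: "'b set => nat => ('b => 'a :: comm_ring_1) => 'a" where
 "esym A k h = (-1) ^ k * (\<Sum>X | X \<subseteq> A \<and> card X = k. \<Prod>x\<in>X. h x)"

lemma prod_diff_esym: assumes A: "finite A"
 shows "(\<Prod>x\<in>A. y - h x) = (\<Sum>k\<le>card A. esym A k h * y ^ (card A - k))"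
proof -
 have "(\<Prod>x\<in>A. y - h x) = (\<Sum>X\<in>Pow A. (-1) ^ card X * (\<Prod>x\<in>X. h x) * y ^ card (A - X))"
  using prod_diff_conv_sum[OF A, of "\<lambda>_. y" h] by simp
 also have "... = (\<Sum>k\<le>card A. \<Sum>X | X \<in> Pow A \<and> card X = k. (-1) ^ card X * (\<Prod>x\<in>X. h x) * y ^ card (A - X))"
  by (rule sum.group[symmetric]) (use A in \<open>auto intro: card_mono\<close>)
 also have "... = (\<Sum>k\<le>card A. esym A k h * y ^ (card A - k))"
  unfolding esym_def sum_distrib_left sum_distrib_right
 proof (intro sum.cong refl)
  fix k X assume "X \<in> {X. X \<subseteq> A \<and> card X = k}"
  then show "(-1) ^ card X * (\<Prod>x\<in>X. h x) * y ^ card (A - X) = (-1) ^ k * prod h X * y ^ (card A - k)"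
   using card_Diff_subset[of X A] finite_subset[OF _ A] by auto
 qed auto
 finally show ?thesis .
qed

lemma esym_reindex: assumes "bij_betw l A A" shows "esym A k (\<lambda>x. h (l x)) = esym A k h"
proof -
 have inj: "inj_on l X" if "X \<subseteq> A" for X using assms that by (auto simp: bij_betw_def intro: inj_on_subset)
 have "bij_betw (image l) {X. X \<subseteq> A \<and> card X = k} {X. X \<subseteq> A \<and> card X = k}"
 proof (rule bij_betw_byWitness[where f' = "image (inv_into A l)"])
  have i: "inv_into A l (l x) = x" if "x \<in> A" for x using assms that by (auto simp: bij_betw_def)
  have j: "l (inv_into A l x) = x" "inv_into A l x \<in> A" if "x \<in> A" for x
   using assms that by (auto simp: bij_betw_def f_inv_into_f inv_into_into)
  show "\<forall>X\<in>{X. X \<subseteq> A \<and> card X = k}. inv_into A l ` l ` X = X"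
   using i by (force simp: image_image)
  show "\<forall>X\<in>{X. X \<subseteq> A \<and> card X = k}. l ` inv_into A l ` X = X"
   using j by (force simp: image_image)
  show "image l ` {X. X \<subseteq> A \<and> card X = k} \<subseteq> {X. X \<subseteq> A \<and> card X = k}"
   using inj assms by (auto simp: card_image bij_betw_def)
  have "inj_on (inv_into A l) X" if "X \<subseteq> A" for X
   by (rule inj_on_inverseI[where g = l]) (use j(1) that in blast)
  then show "image (inv_into A l) ` {X. X \<subseteq> A \<and> card X = k} \<subseteq> {X. X \<subseteq> A \<and> card X = k}"
   using j by (auto simp: card_image)
 qed
 from sum.reindex_bij_betw[OF this, of "prod h"]
 have "(\<Sum>X | X \<subseteq> A \<and> card X = k. prod h (l ` X)) = (\<Sum>X | X \<subseteq> A \<and> card X = k. prod h X)" .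
 moreover have "(\<Sum>X | X \<subseteq> A \<and> card X = k. prod h (l ` X)) = (\<Sum>X | X \<subseteq> A \<and> card X = k. \<Prod>x\<in>X. h (l x))"
  by (intro sum.cong refl) (simp add: prod.reindex inj)
 ultimately show ?thesis by (simp add: esym_def)
qed

lemma ring_closed_esym: "ring_closed S ==> (\<And>x. x \<in> A ==> h x \<in> S) ==> esym A k h \<in> S"
 unfolding esym_def by (intro ring_closedD(4) ring_closed_power ring_closedD(5) ring_closedD(2) ring_closed_sum ring_closed_prod) auto

lemma pcompose_esym: "pcompose (esym A k h) q = esym A k (\<lambda>x. pcompose (h x) q)"
proof -
 have "pcompose ((-1) ^ k * r) q = (-1) ^ k * pcompose r q" for r :: "'a poly"
  by (cases "even k") (auto simp: pcompose_uminus)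
 then show ?thesis unfolding esym_def by (simp add: pcompose_sum pcompose_prod)
qed

lemma ring_closed_poly:
 fixes S :: "complex set" assumes S: "ring_closed S" shows "ring_closed {q. poly_over S q}"
proof -
 note R = ring_closedD[OF S]
 have "poly_over S (p * q)" if "poly_over S p" "poly_over S q" for p q
  using that unfolding poly_over_def coeff_mult by (auto intro!: ring_closed_sum[OF S] R(4))
 moreover have "poly_over S 1" using R by (auto simp: poly_over_def one_pCons coeff_pCons split: nat.splits)
 ultimately show ?thesis using R unfolding ring_closed_def by (auto simp: poly_over_def)
qed

lemma pcompose_monom: "pcompose (Polynomial.monom a i) (Polynomial.monom 1 p) = Polynomial.monom (a :: complex) (i * p)"
 by (rule poly_eq_poly_eq_iff[THEN iffD1], rule ext) (simp add: poly_pcompose poly_monom power_mult[symmetric] mult.commute)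

text \<open>The identity q(T)^p = q(T^p) modulo p for integer polynomials, from the binomial
  congruence and Fermat's little theorem on the coefficients.\<close>

lemma int_poly_frobenius: assumes p: "prime p" and q: "poly_over \<int> q" and S: "ring_closed S"
 shows "\<exists>c. poly_over S c \<and> q ^ p = pcompose q (Polynomial.monom 1 p) + of_nat p * c"
proof -
 note T = ring_closed_poly[OF S]
 have Z: "of_int z \<in> S" for z
 proof (cases z rule: int_cases2)
  case (nonneg n)
  then show ?thesis using ring_closed_of_nat[OF S, of n] by simp
 next
  case (nonpos n)
  then show ?thesis using ring_closedD(5)[OF S ring_closed_of_nat[OF S, of n]] by simp
 qed
 have M: "poly_over S (Polynomial.monom (of_int z) i)" for z i
  using Z ring_closedD(1)[OF S] by (auto simp: poly_over_def)
 have "\<forall>i. \<exists>z::int. poly.coeff q i = of_int z" using q by (auto simp: poly_over_def elim: Ints_cases)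
 then obtain z :: "nat => int" where z: "\<And>i. poly.coeff q i = of_int (z i)" by metis
 have qs: "q = (\<Sum>i\<le>degree q. Polynomial.monom (of_int (z i)) i)"
  using poly_as_sum_of_monoms[of q] by (simp add: z)
 obtain c where c: "poly_over S c"
  "(\<Sum>i\<le>degree q. Polynomial.monom (of_int (z i)) i) ^ p = (\<Sum>i\<le>degree q. Polynomial.monom (of_int (z i)) i ^ p) + of_nat p * c"
  using freshman_sum[OF T p, of "{..degree q}" "\<lambda>i. Polynomial.monom (of_int (z i)) i"] M by auto
 have "\<forall>i. \<exists>u::int. z i ^ p = z i + int p * u" using fermat_int_add[OF p] by blast
 then obtain u :: "nat => int" where u: "\<And>i. z i ^ p = z i + int p * u i" by metis
 define d where "d = (\<Sum>i\<le>degree q. Polynomial.monom (of_int (u i) :: complex) (i * p))"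
 have "Polynomial.monom (of_int (z i) :: complex) i ^ p = Polynomial.monom (of_int (z i)) (i * p) + of_nat p * Polynomial.monom (of_int (u i)) (i * p)" for i
 proof -
  have "Polynomial.monom (of_int (z i) :: complex) i ^ p = Polynomial.monom (of_int (z i ^ p)) (i * p)"
   by (simp add: monom_power mult.commute)
  also have "(of_int (z i ^ p) :: complex) = of_int (z i) + of_nat p * of_int (u i)" unfolding u by simp
  also have "Polynomial.monom ... (i * p) = Polynomial.monom (of_int (z i)) (i * p) + of_nat p * Polynomial.monom (of_int (u i)) (i * p)"
   by (simp add: add_monom[symmetric] of_nat_poly smult_monom)
  finally show ?thesis .
 qed
 moreover have "pcompose q (Polynomial.monom 1 p) = (\<Sum>i\<le>degree q. Polynomial.monom (of_int (z i)) (i * p))"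
  by (subst qs) (simp only: pcompose_sum pcompose_monom)
 ultimately have "q ^ p = pcompose q (Polynomial.monom 1 p) + of_nat p * (d + c)"
  using c(2) unfolding qs[symmetric] d_def by (simp add: sum.distrib sum_distrib_left distrib_left)
 moreover have "poly_over S (d + c)"
  using ring_closedD(3)[OF T, of d c] ring_closed_sum[OF T, of "{..degree q}" "\<lambda>i. Polynomial.monom (of_int (u i)) (i * p)"] M c(1)
  by (simp add: d_def)
 ultimately show ?thesis by blast
qed

lemma map_poly_hom: assumes K: "csubfield K" and f: "chom K f"
 shows "poly_over K p ==> poly_over K q ==> map_poly f (p * q) = map_poly f p * map_poly f q"
  "map_poly f 1 = 1"
  "(\<And>i. i \<in> A ==> poly_over K (g i)) ==> map_poly f (sum g A) = (\<Sum>i\<in>A. map_poly f (g i))"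
  "(\<And>i. i \<in> A ==> poly_over K (g i)) ==> map_poly f (prod g A) = (\<Prod>i\<in>A. map_poly f (g i))"
  "poly_over K p ==> map_poly f (- p) = - map_poly f p"
proof -
 note h = chom_simps[OF K f]
 have c: "poly.coeff (map_poly f p) i = f (poly.coeff p i)" for p i by (rule coeff_map_poly) (rule h(4))
 show m: "map_poly f (p * q) = map_poly f p * map_poly f q" if "poly_over K p" "poly_over K q" for p q
 proof (rule poly_eqI)
  fix i
  have "f (\<Sum>j\<le>i. poly.coeff p j * poly.coeff q (i - j)) = (\<Sum>j\<le>i. f (poly.coeff p j * poly.coeff q (i - j)))"
   using that csubfield_props(4)[OF K] by (intro chom_sum[OF K f]) (auto simp: poly_over_def)
  then show "poly.coeff (map_poly f (p * q)) i = poly.coeff (map_poly f p * map_poly f q) i"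
   using that by (simp add: c coeff_mult h poly_over_def)
 qed
 show one: "map_poly f 1 = 1" by (rule poly_eqI) (simp add: c h one_pCons coeff_pCons split: nat.splits)
 show "(\<And>i. i \<in> A ==> poly_over K (g i)) ==> map_poly f (sum g A) = (\<Sum>i\<in>A. map_poly f (g i))"
  by (rule poly_eqI) (simp add: c coeff_sum chom_sum[OF K f] poly_over_def)
 have P: "ring_closed {q. poly_over K q}"
  by (rule ring_closed_poly) (use csubfield_props[OF K] in \<open>auto simp: ring_closed_def\<close>)
 show "(\<And>i. i \<in> A ==> poly_over K (g i)) ==> map_poly f (prod g A) = (\<Prod>i\<in>A. map_poly f (g i))"
 proof (induction A rule: infinite_finite_induct)
  case (insert x A)
  then show ?case using m ring_closed_prod[OF P, of A g] by simp
 qed (simp_all add: one)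
 show "poly_over K p ==> map_poly f (- p) = - map_poly f p"
  by (rule poly_eqI) (simp add: c h poly_over_def)
qed

lemma map_poly_esym:
 assumes K: "csubfield K" and f: "chom K f" and h: "\<And>x. x \<in> A ==> poly_over K (h x)"
 shows "map_poly f (esym A k h) = esym A k (\<lambda>x. map_poly f (h x))"
proof -
 have P: "ring_closed {q. poly_over K q}"
  by (rule ring_closed_poly) (use csubfield_props[OF K] in \<open>auto simp: ring_closed_def\<close>)
 have prods: "poly_over K (\<Prod>x\<in>X. h x)" if "X \<subseteq> A" for X
  using ring_closed_prod[OF P, of X h] that h by auto
 have s: "poly_over K (\<Sum>X | X \<subseteq> A \<and> card X = k. \<Prod>x\<in>X. h x)"
  using ring_closed_sum[OF P, of "{X. X \<subseteq> A \<and> card X = k}" "\<lambda>X. \<Prod>x\<in>X. h x"] prods by auto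
 have e: "map_poly f (\<Sum>X | X \<subseteq> A \<and> card X = k. \<Prod>x\<in>X. h x) = (\<Sum>X | X \<subseteq> A \<and> card X = k. \<Prod>x\<in>X. map_poly f (h x))"
  by (subst map_poly_hom(3)[OF K f]) (use prods h in \<open>auto intro!: sum.cong map_poly_hom(4)[OF K f]\<close>)
 show ?thesis unfolding esym_def by (cases "even k") (simp_all add: e map_poly_hom(5)[OF K f s])
qed

text \<open>Gauss's lemma: with i and j the lowest coefficients of a and b outside P, the
  coefficient of degree i + j of the product is a_i b_j modulo P.\<close>

lemma poly_over_prime: assumes K: "csubfield K" and P: "P \<in> primes_above K p"
  and a: "poly_over (integers K) a" and b: "poly_over (integers K) b" and ab: "poly_over P (a * b)"
 shows "poly_over P a \<or> poly_over P b"
proof (rule ccontr)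
 note PD = primes_aboveD[OF K P]
 note R = ring_closedD[OF ring_closed_integers[OF K]]
 assume n: "\<not> (poly_over P a \<or> poly_over P b)"
 define i where "i = (LEAST i. poly.coeff a i \<notin> P)"
 define j where "j = (LEAST j. poly.coeff b j \<notin> P)"
 have i: "poly.coeff a i \<notin> P" "\<And>k. k < i ==> poly.coeff a k \<in> P"
 proof -
  have ex: "\<exists>i. poly.coeff a i \<notin> P" using n by (auto simp: poly_over_def)
  show "poly.coeff a i \<notin> P" unfolding i_def by (rule LeastI_ex[OF ex])
  show "poly.coeff a k \<in> P" if "k < i" for k using not_less_Least[OF that[unfolded i_def]] by simp
 qed
 have j: "poly.coeff b j \<notin> P" "\<And>k. k < j ==> poly.coeff b k \<in> P"
 proof -
  have ex: "\<exists>i. poly.coeff b i \<notin> P" using n by (auto simp: poly_over_def)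
  show "poly.coeff b j \<notin> P" unfolding j_def by (rule LeastI_ex[OF ex])
  show "poly.coeff b k \<in> P" if "k < j" for k using not_less_Least[OF that[unfolded j_def]] by simp
 qed
 have ai: "poly.coeff a k \<in> integers K" "poly.coeff b k \<in> integers K" for k using a b by (auto simp: poly_over_def)
 have sumP: "sum g A \<in> P" if "\<And>k. k \<in> A ==> g k \<in> P" for A :: "nat set" and g
  using that by (induction A rule: infinite_finite_induct) (auto simp: PD)
 have "poly.coeff (a * b) (i + j) = (\<Sum>k\<le>i + j. poly.coeff a k * poly.coeff b (i + j - k))" by (rule coeff_mult)
 also have "... = poly.coeff a i * poly.coeff b j + (\<Sum>k\<in>{..i + j} - {i}. poly.coeff a k * poly.coeff b (i + j - k))"
  by (subst sum.remove[of _ i]) auto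
 finally have e: "poly.coeff a i * poly.coeff b j = poly.coeff (a * b) (i + j) + - (\<Sum>k\<in>{..i + j} - {i}. poly.coeff a k * poly.coeff b (i + j - k))" by simp
 have "(\<Sum>k\<in>{..i + j} - {i}. poly.coeff a k * poly.coeff b (i + j - k)) \<in> P"
 proof (rule sumP)
  fix k assume k: "k \<in> {..i + j} - {i}"
  show "poly.coeff a k * poly.coeff b (i + j - k) \<in> P"
  proof (cases "k < i")
   case True
   then show ?thesis using PD(5)[OF ai(2) i(2)[OF True], of "i + j - k"] by (simp add: mult.commute)
  next
   case False
   then show ?thesis using k by (intro PD(5) ai j(2)) auto
  qed
 qed
 then have "poly.coeff a i * poly.coeff b j \<in> P" unfolding e using ab by (intro PD(3,4)) (auto simp: poly_over_def)
 then show False using PD(7)[OF ai(1) ai(2)] i(1) j(1) by blast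
qed

lemma galois_fixed_algebraic_int:
 assumes "number_field K" "x \<in> galois_closure K" "algebraic_int x"
  and "\<And>v. v \<in> carrier (galois_group (galois_closure K)) ==> v x = x"
 shows "x \<in> \<int>"
proof -
 have "x \<in> \<rat>" by (rule galois_fixed_rational[OF assms(1,2)]) (rule assms(4))
 then show ?thesis using assms(3) rational_algebraic_int_is_int by blast
qed

lemma galois_group_integers: "csubfield L ==> v \<in> carrier (galois_group L) ==> x \<in> integers L ==> v x \<in> integers L"
 using chom_algebraic_int[of L v x] by (auto simp: integers_def galois_group_iff bij_betw_def)

text \<open>If every \<open>v\<close> failed to be a Frobenius element, at a witness \<open>x\<^sub>v\<close> say, then so would it at
 the polynomial \<open>g = \<Sum>\<^sub>v x\<^sub>v T\<^bsup>k(v)\<^esup>\<close>. But \<open>\<Prod>\<^sub>v (g\<^sup>p - (v g)(T\<^sup>p))\<close> vanishes modulo \<open>p\<close>, being congruent to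
 the \<open>p\<close>-th power of \<open>\<Prod>\<^sub>v (g - v g) = 0\<close>: the coefficients of \<open>\<Prod>\<^sub>v (Y - v g)\<close> are integral polynomials.\<close>

theorem frobenius_exists:
 assumes K: "number_field K" and p: "prime p" and P: "P \<in> primes_above (galois_closure K) p"
 shows "\<exists>v\<in>carrier (galois_group (galois_closure K)). \<forall>x\<in>integers (galois_closure K). v x - x ^ p \<in> P"
proof (rule ccontr)
 define L where "L = galois_closure K"
 define G where "G = carrier (galois_group L)"
 define Z where "Z = integers L"
 define T where "T = Polynomial.monom (1::complex) p"
 have L: "csubfield L" unfolding L_def by (rule csubfield_galois_closure)
 have Zc: "ring_closed Z" unfolding Z_def by (rule ring_closed_integers[OF L])
 have ZT: "ring_closed {q. poly_over Z q}" by (rule ring_closed_poly[OF Zc])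
 note R = ring_closedD[OF ZT]
 note PD = primes_aboveD[OF L P[folded L_def]]
 have fin: "finite G" unfolding G_def L_def by (rule galois_group_finite[OF K])
 have hom: "chom L v" if "v \<in> G" for v using that by (simp add: G_def galois_group_iff)
 have tZ: "v x \<in> Z" if "v \<in> G" "x \<in> Z" for v x using galois_group_integers[OF L] that by (simp add: G_def Z_def)
 assume "\<not> (\<exists>v\<in>carrier (galois_group (galois_closure K)). \<forall>x\<in>integers (galois_closure K). v x - x ^ p \<in> P)"
 then have "\<forall>v. \<exists>x. v \<in> G --> x \<in> Z \<and> v x - x ^ p \<notin> P" by (auto simp: G_def L_def Z_def)
 then obtain w where w: "\<And>v. v \<in> G ==> w v \<in> Z" "\<And>v. v \<in> G ==> v (w v) - w v ^ p \<notin> P" by metis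
 \<comment> \<open>The numbering of the group supplies the exponents k(v): the witness for
   \<open>e k\<close> becomes the coefficient of T^k in g.\<close>
 obtain e where e: "bij_betw e {0..<card G} G" using ex_bij_betw_nat_finite[OF fin] by blast
 define x where "x k = w (e k)" for k
 have eG: "e k \<in> G" if "k < card G" for k using e that by (auto simp: bij_betw_def)
 have x: "x k \<in> Z" if "k < card G" for k unfolding x_def using w(1) eG[OF that] by blast
 define g where "g = (\<Sum>k<card G. Polynomial.monom (x k) k)"
 define h where "h v = map_poly v g" for v :: "complex => complex"
 have gc: "poly.coeff g k = (if k < card G then x k else 0)" for k unfolding g_def by (simp add: coeff_sum)
 have g: "poly_over Z g" using x ring_closedD(1)[OF Zc] by (auto simp: poly_over_def gc)
 have hc: "poly.coeff (h v) k = v (poly.coeff g k)" if "v \<in> G" for v k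
  unfolding h_def by (rule coeff_map_poly) (rule chom_simps(4)[OF L hom[OF that]])
 have h: "poly_over Z (h v)" if "v \<in> G" for v using g tZ that by (auto simp: poly_over_def hc)
 have ZL: "poly_over Z q ==> poly_over L q" for q by (auto simp: poly_over_def Z_def integers_def)
 define N where "N = card G"
 define F where "F k = esym G k h" for k :: nat
 have FZ: "poly_over Z (F k)" for k using ring_closed_esym[OF ZT, of G h k] h by (auto simp: F_def)
 \<comment> \<open>The group permutes the polynomials \<open>h v\<close>, so the coefficients of
   their symmetric functions are Galois-fixed algebraic integers, hence integers.\<close>
 have Fint: "poly_over \<int> (F k)" for k unfolding poly_over_def
 proof
  fix i
  have c: "poly.coeff (F k) i \<in> L" "algebraic_int (poly.coeff (F k) i)" using FZ[of k] by (auto simp: poly_over_def Z_def integers_def)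
  show "poly.coeff (F k) i \<in> \<int>"
  proof (rule galois_fixed_algebraic_int[OF K c[unfolded L_def]])
   fix B assume "B \<in> carrier (galois_group (galois_closure K))"
   then have r: "B \<in> G" by (simp add: G_def L_def)
   have hr: "map_poly B (h v) = h (compose L B v)" if t: "v \<in> G" for v
   proof (rule poly_eqI)
    fix i
    have "compose L B v \<in> G" using galois_group_compose[OF L] t r by (simp add: G_def)
    then show "poly.coeff (map_poly B (h v)) i = poly.coeff (h (compose L B v)) i"
     using coeff_map_poly[of B "h v" i, OF chom_simps(4)[OF L hom[OF r]]] t ZL[OF g]
     by (simp add: hc compose_def poly_over_def)
   qed
   have "map_poly B (F k) = esym G k (\<lambda>v. map_poly B (h v))"
    unfolding F_def by (rule map_poly_esym[OF L hom[OF r]]) (rule ZL[OF h])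
   also have "... = esym G k (\<lambda>v. h (compose L B v))"
    unfolding esym_def by (intro arg_cong2[of _ _ _ _ "(*)"] sum.cong prod.cong refl) (auto simp: hr)
   also have "... = F k"
    unfolding F_def using galois_group_compose_bij[OF K r[unfolded G_def L_def]]
    by (intro esym_reindex) (simp add: G_def L_def)
   finally show "B (poly.coeff (F k) i) = poly.coeff (F k) i"
    using coeff_map_poly[of B "F k" i, OF chom_simps(4)[OF L hom[OF r]]] by simp
  qed
 qed
 have "\<forall>k. \<exists>c. poly_over Z c \<and> F k ^ p = pcompose (F k) T + of_nat p * c"
  unfolding T_def using int_poly_frobenius[OF p Fint Zc] by blast
 then obtain c where c: "\<And>k. poly_over Z (c k)" "\<And>k. F k ^ p = pcompose (F k) T + of_nat p * c k" by metis
 \<comment> \<open>The identity contributes the factor g - g = 0.\<close>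
 have id: "(\<lambda>x\<in>L. x) \<in> G"
  unfolding G_def galois_group_iff using csubfield_props[OF L] by (auto simp: chom_def bij_betw_def inj_on_def)
 have "h (\<lambda>x\<in>L. x) = g"
  by (rule poly_eqI) (use hc[OF id] ZL[OF g] in \<open>simp add: poly_over_def\<close>)
 then have z: "0 = (\<Prod>v\<in>G. g - h v)" using fin id by (intro prod_zero[symmetric]) (auto intro!: bexI[of _ "\<lambda>x\<in>L. x"])
 have gpow: "poly_over Z (g ^ k)" for k using ring_closed_power[OF ZT, of g k] g by simp
 obtain d where d: "poly_over Z d" "(\<Sum>k\<le>N. F k * g ^ (N - k)) ^ p = (\<Sum>k\<le>N. (F k * g ^ (N - k)) ^ p) + of_nat p * d"
  using freshman_sum[OF ZT p, of "{..N}" "\<lambda>k. F k * g ^ (N - k)"] FZ gpow R(4) by auto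
 have "(\<Sum>k\<le>N. F k * g ^ (N - k)) = 0"
  using prod_diff_esym[OF fin, of g h] z by (simp add: F_def N_def)
 then have "0 = (\<Sum>k\<le>N. (F k * g ^ (N - k)) ^ p) + of_nat p * d"
  using d(2) prime_gt_0_nat[OF p] by (simp add: zero_power)
 also have "(\<Sum>k\<le>N. (F k * g ^ (N - k)) ^ p) = (\<Sum>k\<le>N. pcompose (F k) T * (g ^ p) ^ (N - k) + of_nat p * (c k * (g ^ p) ^ (N - k)))"
  by (intro sum.cong refl) (simp add: power_mult_distrib c(2) distrib_right mult.assoc power_mult[symmetric] mult.commute[of p])
 also have "... = (\<Sum>k\<le>N. pcompose (F k) T * (g ^ p) ^ (N - k)) + of_nat p * (\<Sum>k\<le>N. c k * (g ^ p) ^ (N - k))"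
  by (simp add: sum.distrib sum_distrib_left)
 also have "(\<Sum>k\<le>N. pcompose (F k) T * (g ^ p) ^ (N - k)) = (\<Prod>v\<in>G. g ^ p - pcompose (h v) T)"
  unfolding F_def pcompose_esym N_def by (rule prod_diff_esym[OF fin, symmetric])
 finally have key: "(\<Prod>v\<in>G. g ^ p - pcompose (h v) T) = of_nat p * - ((\<Sum>k\<le>N. c k * (g ^ p) ^ (N - k)) + d)"
  by (simp add: algebra_simps eq_neg_iff_add_eq_0)
 define C where "C = - ((\<Sum>k\<le>N. c k * (g ^ p) ^ (N - k)) + d)"
 have C: "poly_over Z C"
 proof -
  have "(\<Sum>k\<le>N. c k * (g ^ p) ^ (N - k)) \<in> {q. poly_over Z q}"
   by (intro ring_closed_sum[OF ZT] R(4) ring_closed_power[OF ZT]) (use c(1) g in auto)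
  then have "(\<Sum>k\<le>N. c k * (g ^ p) ^ (N - k)) + d \<in> {q. poly_over Z q}" using d(1) by (intro R(3)) auto
  from R(5)[OF this] show ?thesis unfolding C_def by simp
 qed
 have pP: "poly_over P (of_nat p * q)" if "poly_over Z q" for q unfolding poly_over_def
 proof
  fix i show "poly.coeff (of_nat p * q) i \<in> P"
   using PD(5)[of "poly.coeff q i" "of_nat p"] PD(8) that by (simp add: of_nat_poly poly_over_def Z_def mult.commute)
 qed
 have prodP: "poly_over P (\<Prod>v\<in>G. g ^ p - pcompose (h v) T)" unfolding key C_def[symmetric] by (rule pP[OF C])
 define H where "H v = (\<Sum>k<card G. Polynomial.monom (v (x k)) (k * p))" for v :: "complex => complex"
 have hH: "pcompose (h v) T = H v" if t: "v \<in> G" for v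
 proof -
  have "h v = (\<Sum>k<card G. Polynomial.monom (v (x k)) k)"
   by (rule poly_eqI) (use hc[OF t] chom_simps(4)[OF L hom[OF t]] in \<open>simp add: gc coeff_sum\<close>)
  then show ?thesis unfolding H_def T_def by (simp add: pcompose_sum pcompose_monom)
 qed
 have HZ: "poly_over Z (H v)" if t: "v \<in> G" for v unfolding H_def poly_over_def coeff_sum
  using tZ[OF t x] ring_closedD(1)[OF Zc] by (intro allI ring_closed_sum[OF Zc]) auto
 have fact: "poly_over Z (g ^ p - pcompose (h v) T)" if "v \<in> G" for v
  using ring_closed_diff[OF ZT, of "g ^ p" "H v"] gpow HZ[OF that] hH[OF that] by simp
 \<comment> \<open>Primality of P for polynomials singles out one factor. The induction runs over
   subsets of the group, the empty product being excluded because 1 is not in P.\<close>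
 have "\<exists>v\<in>A. poly_over P (g ^ p - pcompose (h v) T)" if "A \<subseteq> G" "poly_over P (\<Prod>v\<in>A. g ^ p - pcompose (h v) T)" for A
  using finite_subset[OF that(1) fin] that
 proof (induction A rule: finite_induct)
  case empty
  then have "poly.coeff (1 :: complex poly) 0 \<in> P" unfolding poly_over_def by (metis prod.empty)
  then show ?case using PD(6) by simp
 next
  case (insert v A)
  have "poly_over Z (\<Prod>v\<in>A. g ^ p - pcompose (h v) T)"
   using ring_closed_prod[OF ZT, of A "\<lambda>v. g ^ p - pcompose (h v) T"] fact insert.prems(1) by auto
  moreover have "poly_over Z (g ^ p - pcompose (h v) T)" using fact insert.prems(1) by auto
  ultimately have "poly_over P (g ^ p - pcompose (h v) T) \<or> poly_over P (\<Prod>v\<in>A. g ^ p - pcompose (h v) T)"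
   using insert.prems(2) insert.hyps unfolding Z_def by (intro poly_over_prime[OF L P[folded L_def]]) auto
  then show ?case using insert by auto
 qed
 then obtain v where t: "v \<in> G" "poly_over P (g ^ p - H v)" using prodP hH by (metis subset_refl)
 obtain b where b: "poly_over Z b" "g ^ p = (\<Sum>k<card G. Polynomial.monom (x k) k ^ p) + of_nat p * b"
 proof -
  have "Polynomial.monom (x k) k \<in> {q. poly_over Z q}" if "k \<in> {..<card G}" for k
   using that x ring_closedD(1)[OF Zc] by (auto simp: poly_over_def)
  then show ?thesis
   using freshman_sum[OF ZT p, of "{..<card G}" "\<lambda>k. Polynomial.monom (x k) k"] that
   unfolding g_def[symmetric] by blast
 qed
 obtain k where k: "k < card G" "e k = v"
 proof -
  have "v \<in> e ` {0..<card G}" using e t(1) by (simp add: bij_betw_def)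
  then show ?thesis using that by auto
 qed
 have p0: "p > 0" using p by (rule prime_gt_0_nat)
 \<comment> \<open>For k the index of v, the coefficient of T^(kp) isolates the witness belonging to
   v itself and contradicts its choice.\<close>
 have "poly.coeff (g ^ p - H v) (k * p) = (x k ^ p - v (x k)) + poly.coeff (of_nat p * b) (k * p)"
  unfolding b(2) H_def using k(1) p0 by (simp add: coeff_sum monom_power mult.commute[of p])
 then have "v (x k) - x k ^ p = - poly.coeff (g ^ p - H v) (k * p) + poly.coeff (of_nat p * b) (k * p)" by simp
 also have "... \<in> P" using t(2) pP[OF b(1)] by (intro PD(3,4)) (auto simp: poly_over_def)
 finally show False using w(2)[OF t(1)] k(2) by (simp add: x_def)
qed

subsection \<open>Conjugacy classes and signs\<close>

lemma conj_classes_action: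
 "group_action (sym_group n) (carrier (sym_group n))
   (\<lambda>g. \<lambda>h\<in>carrier (sym_group n). g \<otimes>\<^bsub>sym_group n\<^esub> h \<otimes>\<^bsub>sym_group n\<^esub> inv\<^bsub>sym_group n\<^esub> g)"
 by (rule group.action_by_conjugation[OF sym_group_is_group])

lemma finite_sym_group: "finite (carrier (sym_group n))"
 unfolding sym_group_def by (simp add: finite_permutations)

lemma conj_classes_cover: "\<Union> (conj_classes n) = carrier (sym_group n)"
 unfolding conj_classes_def by (rule group_action.orbits_coverture[OF conj_classes_action])

lemma finite_conj_classes: "finite (conj_classes n)"
proof (rule finite_subset)
 show "conj_classes n \<subseteq> Pow (carrier (sym_group n))" using conj_classes_cover by blast
qed (simp add: finite_sym_group)

lemma sum_conj_classes: "(\<Sum>C\<in>conj_classes n. \<Sum>x\<in>C. f x) = (\<Sum>x\<in>carrier (sym_group n). f x)"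
 unfolding conj_classes_def by (rule group_action.disjoint_sum[OF conj_classes_action finite_sym_group])

lemma conj_classes_sign: assumes "C \<in> conj_classes n" "x \<in> C" "y \<in> C"
 shows "sign x = sign y"
proof -
 interpret G: group "sym_group n" by (rule sym_group_is_group)
 obtain z where z: "z \<in> carrier (sym_group n)"
  "C = orbit (sym_group n) (\<lambda>g. \<lambda>h\<in>carrier (sym_group n). g \<otimes>\<^bsub>sym_group n\<^esub> h \<otimes>\<^bsub>sym_group n\<^esub> inv\<^bsub>sym_group n\<^esub> g) z"
  using assms(1) unfolding conj_classes_def orbits_def by blast
 have "sign u = sign z" if "u \<in> C" for u
 proof -
  from that[unfolded z(2) orbit_def, THEN CollectD]
  obtain g where g: "u = (\<lambda>h\<in>carrier (sym_group n). g \<otimes>\<^bsub>sym_group n\<^esub> h \<otimes>\<^bsub>sym_group n\<^esub> inv\<^bsub>sym_group n\<^esub> g) z \<and>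
    g \<in> carrier (sym_group n)" by (rule exE)
  note g = conjunct2[OF g] conjunct1[OF g, unfolded restrict_apply'[OF z(1)]]
  have p: "permutation g" "permutation z" using g z sym_group_carrier' by auto
  then have "sign u = sign g * sign z * sign (inv' g)"
   unfolding g(2) sym_group_inv_equality[OF g(1)] sym_group_mult by (simp add: sign_compose permutation_compose permutation_inverse)
  then show ?thesis using p by (simp add: sign_inverse)
 qed
 then show ?thesis using assms by metis
qed

lemma conj_classes_subset_alt: assumes C: "C \<in> conj_classes n" and x: "x \<in> C"
 shows "C \<subseteq> carrier (alt_group n) \<longleftrightarrow> evenperm x"
proof
 show "C \<subseteq> carrier (alt_group n) ==> evenperm x" using x by (auto simp: alt_group_carrier)
 assume e: "evenperm x"
 show "C \<subseteq> carrier (alt_group n)"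
 proof
  fix y assume y: "y \<in> C"
  have "sign y = 1" using conj_classes_sign[OF C y x] e by (simp add: sign_def)
  then have "evenperm y" by (simp add: sign_def split: if_splits)
  moreover have "y \<in> carrier (sym_group n)" using y C conj_classes_cover by blast
  ultimately show "y \<in> carrier (alt_group n)" by (simp add: alt_group_carrier sym_group_carrier)
 qed
qed

lemma card_odd_even_classes: assumes n: "n \<ge> 2"
 shows "(\<Sum>C | C \<in> conj_classes n \<and> \<not> C \<subseteq> carrier (alt_group n). real (card C)) = fact n / 2"
  "(\<Sum>C | C \<in> conj_classes n \<and> C \<subseteq> carrier (alt_group n). real (card C)) = fact n / 2"
proof -
 have alt: "real (card (carrier (alt_group n))) = fact n / 2"
  using arg_cong[OF alt_group_card_carrier[OF n], of real] by simp
 have sub: "{C \<in> conj_classes n. Q C} \<subseteq> conj_classes n" for Q by blast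
 have "(\<Sum>C | C \<in> conj_classes n \<and> C \<subseteq> carrier (alt_group n). real (card C)) = (\<Sum>C\<in>conj_classes n. \<Sum>x\<in>C. if evenperm x then 1 else 0)"
 proof (rule sum.mono_neutral_cong_left[OF finite_conj_classes])
  show "\<forall>C\<in>conj_classes n - {C. C \<in> conj_classes n \<and> C \<subseteq> carrier (alt_group n)}. (\<Sum>x\<in>C. if evenperm x then 1 else 0) = (0::real)"
   using conj_classes_subset_alt by (intro ballI sum.neutral) auto
  show "real (card C) = (\<Sum>x\<in>C. if evenperm x then 1 else 0)" if "C \<in> {C. C \<in> conj_classes n \<and> C \<subseteq> carrier (alt_group n)}" for C
  proof -
   have "(\<Sum>x\<in>C. if evenperm x then 1 else 0) = (\<Sum>x\<in>C. (1::real))"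
    using that conj_classes_subset_alt by (intro sum.cong) auto
   then show ?thesis by simp
  qed
 qed auto
 also have "... = (\<Sum>x\<in>carrier (sym_group n). if evenperm x then 1 else 0)" by (rule sum_conj_classes)
 also have "... = (\<Sum>x\<in>carrier (alt_group n). 1)"
  by (rule sum.mono_neutral_cong_right[OF finite_sym_group]) (auto simp: alt_group_carrier sym_group_carrier)
 finally show e: "(\<Sum>C | C \<in> conj_classes n \<and> C \<subseteq> carrier (alt_group n). real (card C)) = fact n / 2" using alt by simp
 have "(\<Sum>C\<in>conj_classes n. \<Sum>x\<in>C. (1::real)) = (\<Sum>x\<in>carrier (sym_group n). 1)" by (rule sum_conj_classes)
 then have all: "(\<Sum>C\<in>conj_classes n. real (card C)) = fact n" by (simp add: sym_group_card_carrier)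
 have "conj_classes n = {C. C \<in> conj_classes n \<and> C \<subseteq> carrier (alt_group n)} \<union> {C. C \<in> conj_classes n \<and> \<not> C \<subseteq> carrier (alt_group n)}" by blast
 then have "(\<Sum>C\<in>conj_classes n. real (card C)) =
   (\<Sum>C | C \<in> conj_classes n \<and> C \<subseteq> carrier (alt_group n). real (card C)) +
   (\<Sum>C | C \<in> conj_classes n \<and> \<not> C \<subseteq> carrier (alt_group n). real (card C))"
  using finite_conj_classes by (subst sum.union_disjoint[symmetric]) auto
 then show "(\<Sum>C | C \<in> conj_classes n \<and> \<not> C \<subseteq> carrier (alt_group n). real (card C)) = fact n / 2" using e all by simp
qed

text \<open>A conjugacy class has constant sign, so the classes not contained in the alternating
  group consist of odd permutations only.\<close>

lemma in_outside_alt: "q \<in> outside_alt n \<longleftrightarrow> q permutes {1..n} \<and> sign q = -1"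
proof
 assume "q \<in> outside_alt n"
 then obtain C where C: "C \<in> conj_classes n" "\<not> C \<subseteq> carrier (alt_group n)" "q \<in> C" by (auto simp: outside_alt_def)
 then show "q permutes {1..n} \<and> sign q = -1"
  using conj_classes_subset_alt[OF C(1,3)] conj_classes_cover[of n] by (auto simp: sign_def sym_group_carrier)
next
 assume p: "q permutes {1..n} \<and> sign q = -1"
 then have "q \<in> \<Union> (conj_classes n)" unfolding conj_classes_cover by (simp add: sym_group_carrier)
 then obtain C where C: "C \<in> conj_classes n" "q \<in> C" by blast
 then have "\<not> C \<subseteq> carrier (alt_group n)" using conj_classes_subset_alt[OF C] p by (auto simp: sign_def)
 then show "q \<in> outside_alt n" using C by (auto simp: outside_alt_def)
qed

lemma frob_in_outside_alt: "frob_in n K p (outside_alt n) \<longleftrightarrow> (\<exists>C\<in>conj_classes n. \<not> C \<subseteq> carrier (alt_group n) \<and> frob_in n K p C)"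
 unfolding frob_in_def outside_alt_def by blast

context enumerated_field
begin

text \<open>Euler's criterion turns \<open>l \<delta> \<equiv> \<delta>\<^sup>p = \<delta> d\<^bsup>(p-1)/2\<^esup>\<close> into \<open>l \<delta> \<equiv> -\<delta>\<close>, where \<open>\<delta>\<^sup>2 = d\<close>.\<close>

lemma frobenius_permutation: assumes p: "prime p"
 shows "\<exists>q. q permutes {1..n} \<and> (\<forall>C. q \<in> C --> frob_in n K p C) \<and>
   (2 < p \<and> \<not> int p dvd discriminant K \<and> Legendre (discriminant K) (int p) = -1 --> sign q = -1)"
proof -
 obtain P where P: "P \<in> primes_above L p" using primes_above_exists[OF csubfields(2) p] by blast
 obtain l where t: "l \<in> carrier (galois_group L)" "\<forall>x\<in>integers L. l x - x ^ p \<in> P"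
  using frobenius_exists[OF number_field p P] by blast
 have frob: "is_frobenius L p l" unfolding is_frobenius_def ring_of_integers_simps using t P by blast
 obtain q where pi: "q permutes {0..<n} \<and> (\<forall>i<n. compose K l (J i) = J (q i)) \<and>
   (\<forall>v. (\<forall>j<n. v j \<in> K) --> l (emb_det v) = of_int (sign q) * emb_det v)"
  using galois_permutation[OF t(1)] by (rule exE)
 \<comment> \<open>Rows are numbered from 0, whereas the symmetric group acts on 1, ..., n; the
   shift by \<open>Suc\<close> preserves the sign.\<close>
 define q' where "q' = map_permutation {0..<n} Suc q"
 have b: "bij_betw Suc {0..<n} {1..n}" by (simp add: bij_betw_def atLeastLessThanSuc_atLeastAtMost)
 have p': "q' permutes {1..n}" unfolding q'_def by (rule map_permutation_permutes) (use b pi in auto)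
 have s': "sign q' = sign q" unfolding q'_def by (rule sign_map_permutation) (use pi in auto)
 define e where "e i = J (i - 1)" for i
 have e: "bij_betw e {1..n} (embeddings K)"
 proof -
  have "bij_betw (\<lambda>i. i - 1) {1..n} {0..<n}" by (rule bij_betw_byWitness[where f' = Suc]) auto
  from bij_betw_trans[OF this] enumeration show ?thesis unfolding e_def comp_def by (simp add: atLeast0LessThan)
 qed
 have ep: "compose K l (e i) = e (q' i)" if i: "i \<in> {1..n}" for i
 proof -
  have "q' (Suc (i - 1)) = Suc (q (i - 1))" unfolding q'_def by (rule map_permutation_apply) (use i in auto)
  then have "q' i = Suc (q (i - 1))" using i by simp
  moreover have "i - 1 < n" using i by auto
  ultimately show ?thesis using pi by (simp add: e_def)
 qed
 have fr: "frob_in n K p C" if "q' \<in> C" for C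
  unfolding frob_in_def using frob e ep that by blast
 have "sign q = -1" if h: "2 < p \<and> \<not> int p dvd discriminant K \<and> Legendre (discriminant K) (int p) = -1"
 \<comment> \<open>With sign 1 the square root \<delta> of d would be fixed by l and also congruent
   to -\<delta> modulo P. So 2 \<delta> and 4 d lie in P, although p is prime to 4 d.\<close>
 proof (rule ccontr)
  assume "sign q \<noteq> -1"
  then have s1: "sign q = 1" by (simp add: sign_def split: if_splits)
  obtain v where w: "integral_basis K v" using integral_basis_exists by blast
  have wi: "v j \<in> K" "algebraic_int (v j)" if "j < n" for j using integral_basisD(1)[OF w] that by (auto simp: integral_def)
  define d where "d = discriminant K"
  define \<delta> where "\<delta> = emb_det v"
  have dd: "\<delta>\<^sup>2 = of_int d" unfolding \<delta>_def d_def by (rule discriminant_eq(1)[OF w, symmetric])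
  have dZ: "\<delta> \<in> integers L" unfolding \<delta>_def integers_def using wi emb_det_closed emb_det_algebraic_int by blast
  have td: "l \<delta> = \<delta>" using pi wi s1 by (simp add: \<delta>_def)
  note PD = primes_aboveD[OF csubfields(2) P]
  note R = ring_closedD[OF ring_closed_integers[OF csubfields(2)]]
  have Zi: "of_int k \<in> integers L" for k using csubfield_of_int[OF csubfields(2)] by (simp add: integers_def)
  have "[Legendre d (int p) = d ^ ((p - 1) div 2)] (mod int p)" using euler_criterion[OF p, of d] h by simp
  then have "[d ^ ((p - 1) div 2) = -1] (mod int p)" using h by (simp add: d_def cong_sym)
  then have "int p dvd d ^ ((p - 1) div 2) - -1" by (simp only: cong_iff_dvd_diff)
  then obtain k where "d ^ ((p - 1) div 2) - -1 = int p * k" by (auto elim: dvdE)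
  then have k: "d ^ ((p - 1) div 2) = int p * k - 1" by simp
  have "odd p" using h p prime_odd_nat[of p] by auto
  then have "p = Suc (2 * ((p - 1) div 2))" by simp
  then have "\<delta> ^ p = \<delta> * (\<delta>\<^sup>2) ^ ((p - 1) div 2)" by (metis power_Suc power_mult)
  also have "... = \<delta> * of_int (d ^ ((p - 1) div 2))" by (simp add: dd)
  also have "... = (\<delta> * of_int k) * of_nat p - \<delta>" unfolding k by (simp add: algebra_simps)
  finally have "l \<delta> - \<delta> ^ p = 2 * \<delta> - (\<delta> * of_int k) * of_nat p" using td by simp
  then have "2 * \<delta> = (l \<delta> - \<delta> ^ p) + (\<delta> * of_int k) * of_nat p" by simp
  also have "... \<in> P" using t(2) dZ Zi R(4) by (intro PD(3,5,8)) auto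
  finally have "2 * \<delta> \<in> P" .
  then have "(2 * \<delta>) * (2 * \<delta>) \<in> P" using PD(5)[of "2 * \<delta>" "2 * \<delta>"] R(4)[OF Zi[of 2] dZ] by simp
  also have "(2 * \<delta>) * (2 * \<delta>) = of_int (4 * d)" using dd by (simp add: power2_eq_square)
  finally have 4: "of_int (4 * d) \<in> P" .
  have "\<not> int p dvd 4 * d"
  proof
   assume "int p dvd 4 * d"
   then have "int p dvd 2 * 2" using p h prime_dvd_mult_iff[of "int p" 4 d] by (simp add: d_def)
   then have "int p dvd 2" using p prime_dvd_mult_iff[of "int p" 2 2] by simp
   then show False using h zdvd_imp_le[of "int p" 2] by simp
  qed
  then have "coprime (int p) (4 * d)" using p by (intro prime_imp_coprime) auto
  then obtain a b where ab: "a * int p + b * (4 * d) = 1" using bezout_int[of "int p" "4 * d"] by auto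
  have "of_int a * of_nat p + of_int b * of_int (4 * d) \<in> P" by (intro PD(3,5,8) Zi 4)
  also have "of_int a * of_nat p + of_int b * of_int (4 * d) = (of_int (a * int p + b * (4 * d)) :: complex)" by simp
  finally show False using PD(6) unfolding ab by simp
 qed
 then show ?thesis using p' fr s' by metis
qed

text \<open>A transposition of the embeddings extends to an automorphism changing the sign of \<open>\<delta>\<close>.\<close>

lemma discriminant_not_square: assumes "Sn_field n K" "n \<ge> 2"
 shows "discriminant K \<noteq> k\<^sup>2"
proof
 assume dk: "discriminant K = k\<^sup>2"
 define t where "t = Transposition.transpose 0 (1::nat)"
 have tp: "t permutes {0..<n}" unfolding t_def using assms(2) by (intro permutes_swap_id) auto
 have tn: "t i < n" if "i < n" for i using permutes_in_image[OF tp, of i] that by simp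
 define T where "T = (\<lambda>s\<in>embeddings K. J (t (inv_into {..<n} J s)))"
 have tb: "bij_betw t {..<n} {..<n}" using permutes_imp_bij[OF tp] by (simp add: atLeast0LessThan)
 have "bij_betw (J \<circ> (t \<circ> inv_into {..<n} J)) (embeddings K) (embeddings K)"
  by (intro bij_betw_trans[OF bij_betw_trans[OF bij_betw_inv_into[OF enumeration] tb] enumeration])
 then have "bij_betw T (embeddings K) (embeddings K)"
  unfolding T_def by (rule bij_betw_cong[THEN iffD1, rotated]) simp
 then have "T \<in> carrier (BijGroup (embeddings K))" by (simp add: BijGroup_def Bij_def T_def)
 moreover have "(\<lambda>l\<in>carrier (galois_group L). \<lambda>J\<in>embeddings K. compose K l J)
    ` carrier (galois_group L) = carrier (BijGroup (embeddings K))"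
  using assms(1) unfolding Sn_field_def by (simp add: iso_def bij_betw_def)
 ultimately obtain l where tau: "l \<in> carrier (galois_group L)" "T = (\<lambda>s\<in>embeddings K. compose K l s)" by auto
 obtain q where pi: "q permutes {0..<n} \<and> (\<forall>i<n. compose K l (J i) = J (q i)) \<and>
   (\<forall>v. (\<forall>j<n. v j \<in> K) --> l (emb_det v) = of_int (sign q) * emb_det v)"
  using galois_permutation[OF tau(1)] by (rule exE)
 have inj: "inj_on J {..<n}" using enumeration by (simp add: bij_betw_def)
 have "q = t"
 proof
  fix i show "q i = t i"
  proof (cases "i < n")
   case True
   have "J (q i) = T (J i)" using pi True emb(1)[OF True] by (simp add: tau(2))
   also have "... = J (t i)" using emb(1)[OF True] inj True by (simp add: T_def inv_into_f_f)
   finally show ?thesis using inj_onD[OF inj] tn[OF True] permutes_bound[of q i] pi True by auto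
  next
   case False
   then have i: "i \<notin> {0..<n}" by simp
   then show ?thesis using permutes_not_in[OF conjunct1[OF pi] i] permutes_not_in[OF tp i] by simp
  qed
 qed
 then have sgn: "sign q = -1" unfolding t_def by (simp add: sign_swap_id)
 obtain v where w: "integral_basis K v" using integral_basis_exists by blast
 have wi: "v j \<in> K" if "j < n" for j using integral_basisD(1)[OF w] that by (auto simp: integral_def)
 have "(emb_det v)\<^sup>2 = (of_int k)\<^sup>2" using discriminant_eq(1)[OF w] dk by simp
 then have "emb_det v = of_int k \<or> emb_det v = of_int (- k)" by (simp add: power2_eq_iff)
 then have "l (emb_det v) = emb_det v"
  using chom_of_int[OF csubfields(2), of l] tau(1) by (auto simp: galois_group_iff simp flip: of_int_minus)
 then have "emb_det v = 0" using pi wi sgn by simp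
 then show False using emb_det_square_unique(2)[OF w w] by simp
qed

end

section \<open>The quadratic resolvent\<close>

lemma squarefree_prod_primes: assumes "finite T" "\<forall>q\<in>T. prime q"
 shows "squarefree (int (\<Prod>T))"
proof -
 have "squarefree (\<Prod>q\<in>T. int q)"
  using assms by (intro squarefree_prod_coprime) (auto intro!: primes_coprime squarefree_prime)
 then show ?thesis by simp
qed

text \<open>For b = u/v in lowest terms the square of the denominator divides D.\<close>

lemma rational_square_mult_squarefree:
 fixes b :: complex and D k :: int
 assumes D: "squarefree D" and b: "b \<in> \<rat>" and e: "b\<^sup>2 * of_int D = of_int k"
 shows "b \<in> \<int>"
proof -
 obtain r :: rat where r: "b = of_rat r" using b by (auto simp: Rats_def)
 obtain u v :: int where uv: "quotient_of r = (u, v)" by fastforce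
 then have r': "r = of_int u / of_int v" "v > 0" "coprime u v"
  using quotient_of_div quotient_of_denom_pos quotient_of_coprime by auto
 have bc: "b = of_int u / of_int v" unfolding r r'(1) by (simp add: of_rat_divide)
 have "(of_int (u\<^sup>2 * D) :: complex) = of_int (k * v\<^sup>2)"
  using e r'(2) unfolding bc by (simp add: field_simps power2_eq_square)
 then have "u\<^sup>2 * D = k * v\<^sup>2" by (simp only: of_int_eq_iff)
 then have "v\<^sup>2 dvd u\<^sup>2 * D" by simp
 moreover have "coprime (v\<^sup>2) (u\<^sup>2)" using r'(3) by (simp add: coprime_commute)
 ultimately have "v\<^sup>2 dvd D" by (simp add: coprime_dvd_mult_right_iff)
 then have "is_unit v" using D by (auto simp: squarefree_def)
 then have "v = 1" using r'(2) by auto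
 then show ?thesis using bc by simp
qed

context
 fixes D :: int and q :: complex
 assumes D: "squarefree D" "D \<noteq> 1" and q: "q\<^sup>2 = of_int D"
begin

lemma sqrt_irrational: "q \<notin> \<rat>"
proof
 assume Q: "q \<in> \<rat>"
 have "q\<^sup>2 * of_int 1 = of_int D" using q by simp
 then have "q \<in> \<int>" by (rule rational_square_mult_squarefree[OF squarefree_unit Q, rotated]) simp
 then obtain k where k: "q = of_int k" by (elim Ints_cases)
 have "(of_int (k\<^sup>2) :: complex) = of_int D" using q k by simp
 then have kD: "k\<^sup>2 = D" by (simp only: of_int_eq_iff)
 then have "is_unit k" using D(1) by (auto simp: squarefree_def)
 then have "k\<^sup>2 = 1" by (auto simp: zdvd1_eq abs_if split: if_splits)
 then show False using kD D(2) by simp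
qed

lemma sqrt_min_poly: "min_poly_over \<rat> q [:- of_int D, 0, 1:]" unfolding min_poly_over_def
proof (intro conjI allI impI)
 show "poly_over \<rat> [:- of_int D, 0, 1:]" by (intro poly_over_Rats) auto
 show "poly [:- of_int D, 0, 1:] q = 0" using q by (simp add: power2_eq_square)
 fix p assume p: "poly_over \<rat> p \<and> p \<noteq> 0 \<and> poly p q = 0"
 show "degree [:- of_int D, 0, 1:] \<le> degree p"
 proof (rule ccontr)
  assume "\<not> degree [:- of_int D, 0, 1:] \<le> degree p"
  then have "degree p \<le> 1" by simp
  then have e: "poly.coeff p 0 + poly.coeff p 1 * q = 0" using poly_eq_sum_le[of p 1 q] p by simp
  show False
  proof (cases "poly.coeff p 1 = 0")
   case True
   then have "poly.coeff p 0 = 0" using e by simp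
   then have "poly.coeff p i = 0" for i using True coeff_eq_0[of p i] \<open>degree p \<le> 1\<close> by (cases "i \<le> 1") (auto simp: le_Suc_eq)
   then show False using p by (auto simp: poly_eq_iff)
  next
   case False
   then have "q = - poly.coeff p 0 / poly.coeff p 1" using e by (simp add: field_simps eq_neg_iff_add_eq_0)
   also have "... \<in> \<rat>" using p by (intro Rats_divide Rats_minus_iff[THEN iffD2]) (auto simp: poly_over_def)
   finally show False using sqrt_irrational by simp
  qed
 qed
qed simp

lemma quadratic_field: "number_field (rat_adjoin q)" "degree_over_Q (rat_adjoin q) = 2"
 using rat_adjoin_number_field[OF sqrt_min_poly] by simp_all

text \<open>The powers 1, q have embedding determinant V with V^2 = 4 D. Its product c with the
  determinant of an integral basis is rational, so d_F = b^2 D with b = c/(2D) rational, and b is an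
  integer as D is squarefree.\<close>

lemma quadratic_field_discriminant: "\<bar>D\<bar> \<le> \<bar>discriminant (rat_adjoin q)\<bar>"
proof -
 define F where "F = rat_adjoin q"
 have F: "number_field F" "degree_over_Q F = 2" using quadratic_field by (simp_all add: F_def)
 obtain J where s: "enumerated_field F J" using enumeration_exists[OF F(1)] by blast
 interpret enumerated_field F J by (rule s)
 have aq: "algebraic q" by (rule min_poly_algebraic[OF sqrt_min_poly])
 have qF: "q \<in> F" unfolding F_def by (rule rat_adjoin_self)
 have D0: "D \<noteq> 0" using D(1) by auto
 define V where "V = emb_det (\<lambda>j. q ^ j)"
 have V0: "V \<noteq> 0" unfolding V_def by (rule emb_det_powers) (auto simp: F_def aq)
 have "{p. p permutes {0..<n}} = {id, Transposition.transpose 0 1}"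
 proof -
  have "{0..<n} = {0, 1}" unfolding F(2) by auto
  then show ?thesis by (auto simp: permutes_doubleton_iff)
 qed
 moreover have "id \<noteq> Transposition.transpose 0 (1::nat)" by (auto simp: fun_eq_iff transpose_def intro!: exI[of _ 0])
 moreover have "{0..<n} = {0, 1}" unfolding F(2) by auto
 ultimately have "V = J 0 1 * J 1 q - J 0 q * J 1 1"
  unfolding V_def emb_det_expand by (simp add: sign_swap_id)
 also have "... = J 1 q - J 0 q" using chom_simps(1)[OF csubfields(1) emb(2)] F(2) by simp
 finally have V: "V = J 1 q - J 0 q" .
 have sq: "(J i q)\<^sup>2 = of_int D" if "i < 2" for i
  using chom_power[OF csubfields(1) emb(2) qF, of i 2] chom_of_int[OF csubfields(1) emb(2), of i D] that F(2) q by simp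
 have "(J 1 q)\<^sup>2 = (J 0 q)\<^sup>2" using sq[of 0] sq[of 1] by simp
 then have "J 1 q = J 0 q \<or> J 1 q = - J 0 q" by (simp add: power2_eq_iff)
 then have "J 1 q = - J 0 q" using V V0 by auto
 then have "V\<^sup>2 = 4 * (J 0 q)\<^sup>2" unfolding V by (simp add: power2_eq_square)
 then have V2: "V\<^sup>2 = of_int (4 * D)" using sq[of 0] by simp
 obtain g where w: "integral_basis F g" using integral_basis_exists by blast
 have wi: "g j \<in> F" if "j < n" for j using integral_basisD(1)[OF w] that by (auto simp: integral_def)
 define c where "c = emb_det g * V"
 have cR: "c \<in> \<rat>" unfolding c_def V_def
  by (intro emb_det_mult_rational wi csubfield_power[OF csubfields(1) qF])
 define b where "b = c / of_int (2 * D)"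
 have bR: "b \<in> \<rat>" unfolding b_def using cR by (intro Rats_divide) auto
 have "c\<^sup>2 = of_int (discriminant F) * of_int (4 * D)"
  unfolding c_def power_mult_distrib V2 discriminant_eq(1)[OF w] ..
 then have bD: "b\<^sup>2 * of_int D = of_int (discriminant F)"
  unfolding b_def using D0 by (simp add: power_divide power_mult_distrib field_simps power2_eq_square)
 then have "b \<in> \<int>" by (rule rational_square_mult_squarefree[OF D(1) bR])
 then obtain k where k: "b = of_int k" by (elim Ints_cases)
 have "(of_int (k\<^sup>2 * D) :: complex) = of_int (discriminant F)" using bD k by simp
 then have kD: "discriminant F = k\<^sup>2 * D" by (simp only: of_int_eq_iff)
 have "k \<noteq> 0" using kD discriminant_eq(2)[OF w] by auto
 then have "1 \<le> k\<^sup>2" by (metis int_one_le_iff_zero_less zero_less_power2)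
 then have "1 * \<bar>D\<bar> \<le> k\<^sup>2 * \<bar>D\<bar>" by (intro mult_right_mono) auto
 then show ?thesis unfolding F_def[symmetric] kD by (simp add: abs_mult)
qed

end

text \<open>The chosen square roots of m^2 D and of D differ by the factor m or -m, so they generate
  the same field.\<close>

lemma quadratic_resolvent_eq:
 assumes d: "discriminant K = m\<^sup>2 * D" and m: "m \<noteq> 0" and D: "squarefree D" "D \<noteq> 1"
 shows "quadratic_resolvent K = rat_adjoin (csqrt (of_int D))"
proof -
 define q where "q = csqrt (of_int D)"
 define r where "r = csqrt (of_int (discriminant K))"
 have q: "q\<^sup>2 = of_int D" by (simp add: q_def)
 have "r\<^sup>2 = (of_int m * q)\<^sup>2" unfolding r_def q_def d by (simp add: power_mult_distrib)
 then have r: "r = of_int m * q \<or> r = - (of_int m * q)" by (simp add: power2_eq_iff)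
 have Q: "csubfield (rat_adjoin q)"
  by (rule csubfield_rat_adjoin[OF min_poly_algebraic[OF sqrt_min_poly[OF D q]]])
 have G: "csubfield (quadratic_resolvent K)" "r \<in> quadratic_resolvent K"
  using generate_field_complex(1,2)[of "{r}"] by (auto simp: quadratic_resolvent_def r_def)
 have "of_int m * q \<in> rat_adjoin q" by (intro csubfield_props(4)[OF Q] csubfield_of_int[OF Q] rat_adjoin_self)
 then have "r \<in> rat_adjoin q" using r csubfield_props(5)[OF Q] by auto
 then have "quadratic_resolvent K \<subseteq> rat_adjoin q"
  unfolding quadratic_resolvent_def r_def[symmetric] by (intro generate_field_complex(3)[OF Q]) auto
 moreover have "rat_adjoin q \<subseteq> quadratic_resolvent K"
 proof (rule rat_adjoin_subset[OF G(1)])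
  have "q = r / of_int m \<or> q = r / of_int (- m)" using r m by auto
  then show "q \<in> quadratic_resolvent K" using csubfield_props(8)[OF G] csubfield_of_int[OF G(1)] by blast
 qed
 ultimately show ?thesis by (simp add: q_def)
qed

section \<open>Invariance under isomorphism\<close>

lemma iso_cong:
 assumes f: "f \<in> iso G H" and m: "\<And>x y. x \<in> carrier G ==> y \<in> carrier G ==> x \<otimes>\<^bsub>G\<^esub> y \<in> carrier G"
  and e: "\<And>x. x \<in> carrier G ==> g x = f x" shows "g \<in> iso G H"
proof -
 have "bij_betw g (carrier G) (carrier H)" using f e by (simp add: iso_def cong: bij_betw_cong)
 moreover have "g \<in> hom G H" using f e m unfolding iso_def hom_def by (auto simp: Pi_iff)
 ultimately show ?thesis by (simp add: iso_def)
qed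

lemma BijGroup_conj: assumes F: "bij_betw F E' E"
 shows "(\<lambda>f\<in>carrier (BijGroup E). \<lambda>s\<in>E'. inv_into E' F (f (F s))) \<in> iso (BijGroup E) (BijGroup E')"
proof -
 define P where "P = inv_into E' F"
 have P: "bij_betw P E E'" unfolding P_def by (rule bij_betw_inv_into[OF F])
 have pe: "F s \<in> E" "P (F s) = s" if "s \<in> E'" for s using F that by (auto simp: P_def bij_betw_def)
 have ep: "P t \<in> E'" "F (P t) = t" if "t \<in> E" for t
  using F P that by (auto simp: P_def bij_betw_def f_inv_into_f)
 have B: "carrier (BijGroup X) = Bij X" for X by (simp add: BijGroup_def)
 define c where "c f = (\<lambda>s\<in>E'. P (f (F s)))" for f
 have cB: "c f \<in> Bij E'" if f: "f \<in> Bij E" for f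
 proof -
  have fb: "bij_betw f E E" using f by (simp add: Bij_def)
  have "bij_betw (P \<circ> (f \<circ> F)) E' E'" by (rule bij_betw_trans[OF bij_betw_trans[OF F fb] P])
  then have "bij_betw (c f) E' E'" unfolding c_def by (rule bij_betw_cong[THEN iffD1, rotated]) simp
  then show ?thesis by (simp add: Bij_def c_def)
 qed
 have fE: "f t \<in> E" if "f \<in> Bij E" "t \<in> E" for f t using that by (auto simp: Bij_def bij_betw_def)
 have "(\<lambda>f\<in>Bij E. c f) \<in> hom (BijGroup E) (BijGroup E')" unfolding hom_def B
 proof (intro CollectI conjI ballI)
  show "(\<lambda>f\<in>Bij E. c f) \<in> Bij E \<rightarrow> Bij E'" using cB by auto
  fix f g assume fg: "f \<in> Bij E" "g \<in> Bij E"
  have "c (compose E f g) = compose E' (c f) (c g)"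
  proof
   fix s show "c (compose E f g) s = compose E' (c f) (c g) s"
    using fg fE pe ep by (cases "s \<in> E'") (auto simp: c_def compose_def)
  qed
  then show "(\<lambda>f\<in>Bij E. c f) (f \<otimes>\<^bsub>BijGroup E\<^esub> g) = (\<lambda>f\<in>Bij E. c f) f \<otimes>\<^bsub>BijGroup E'\<^esub> (\<lambda>f\<in>Bij E. c f) g"
   using fg cB by (simp add: BijGroup_def compose_Bij)
 qed
 moreover have "bij_betw (\<lambda>f\<in>Bij E. c f) (Bij E) (Bij E')" unfolding bij_betw_def
 proof
  show "inj_on (\<lambda>f\<in>Bij E. c f) (Bij E)"
  proof (rule inj_onI)
   fix f g assume fg: "f \<in> Bij E" "g \<in> Bij E" "(\<lambda>f\<in>Bij E. c f) f = (\<lambda>f\<in>Bij E. c f) g"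
   then have e: "c f = c g" by simp
   show "f = g"
   proof (rule extensionalityI)
    show "f \<in> extensional E" "g \<in> extensional E" using fg by (auto simp: Bij_def)
    fix t assume t: "t \<in> E"
    have "P (f t) = P (g t)" using fun_cong[OF e, of "P t"] ep[OF t] by (simp add: c_def)
    then show "f t = g t" using ep(2)[OF fE[OF fg(1) t]] ep(2)[OF fE[OF fg(2) t]] by metis
   qed
  qed
  show "(\<lambda>f\<in>Bij E. c f) ` Bij E = Bij E'"
  proof (intro equalityI subsetI)
   fix g assume "g \<in> (\<lambda>f\<in>Bij E. c f) ` Bij E" then show "g \<in> Bij E'" using cB by auto
  next
   fix g assume g: "g \<in> Bij E'"
   define f where "f = (\<lambda>t\<in>E. F (g (P t)))"
   have gb: "bij_betw g E' E'" using g by (simp add: Bij_def)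
   have "bij_betw (F \<circ> (g \<circ> P)) E E" by (rule bij_betw_trans[OF bij_betw_trans[OF P gb] F])
   then have "bij_betw f E E" unfolding f_def by (rule bij_betw_cong[THEN iffD1, rotated]) simp
   then have f: "f \<in> Bij E" by (simp add: Bij_def f_def)
   have "c f = g"
   proof (rule extensionalityI[of _ E'])
    show "c f \<in> extensional E'" "g \<in> extensional E'" using g by (auto simp: c_def Bij_def)
    fix s assume s: "s \<in> E'"
    have "g s \<in> E'" using gb s by (auto simp: bij_betw_def)
    then show "c f s = g s" using s pe by (simp add: c_def f_def)
   qed
   then show "g \<in> (\<lambda>f\<in>Bij E. c f) ` Bij E" using f by (auto intro!: image_eqI[of _ _ f])
  qed
 qed
 ultimately have "(\<lambda>f\<in>Bij E. c f) \<in> iso (BijGroup E) (BijGroup E')" by (simp add: iso_def B)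
 then show ?thesis by (simp add: B c_def[abs_def] P_def)
qed

context
 fixes K K' :: "complex set" and h :: "complex => complex"
 assumes K: "number_field K" and K': "number_field K'" and h: "chom K h" and hb: "bij_betw h K K'"
begin

lemma transfer_embedding: assumes s: "s \<in> embeddings K'"
 shows "compose K s h \<in> embeddings K" "compose K s h ` K = s ` K'"
proof -
 have hK: "h x \<in> K'" if "x \<in> K" for x using hb that by (auto simp: bij_betw_def)
 have c: "chom K' s" using s by (simp add: embeddings_iff)
 note C = number_field_csubfield[OF K] and C' = number_field_csubfield[OF K']
 have "chom K (compose K s h)"
  unfolding chom_def by (auto simp: compose_def csubfield_props[OF C] chom_simps[OF C h] chom_simps[OF C' c] hK)
 then show "compose K s h \<in> embeddings K" by (simp add: embeddings_iff compose_def)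
 have "compose K s h ` K = s ` (h ` K)" by (auto simp: compose_def image_iff)
 then show "compose K s h ` K = s ` K'" using hb by (simp add: bij_betw_def)
qed

lemma inverse_chom: "chom K' (inv_into K h)" "bij_betw (inv_into K h) K' K"
proof -
 show b: "bij_betw (inv_into K h) K' K" by (rule bij_betw_inv_into[OF hb])
 note C = number_field_csubfield[OF K]
 have inj: "inj_on h K" using hb by (simp add: bij_betw_def)
 have i: "inv_into K h x \<in> K" "h (inv_into K h x) = x" if "x \<in> K'" for x
  using b hb that by (auto simp: bij_betw_def f_inv_into_f inv_into_into)
 have u: "inv_into K h y = x" if "x \<in> K" "h x = y" for x y using inj that by (auto simp: inv_into_f_f)
 show "chom K' (inv_into K h)" unfolding chom_def
 proof (intro conjI ballI)
  show "inv_into K h 1 = 1" by (rule u) (use C csubfield_props chom_simps(1)[OF C h] in auto)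
  fix x y assume "x \<in> K'" "y \<in> K'"
  then show "inv_into K h (x + y) = inv_into K h x + inv_into K h y" "inv_into K h (x * y) = inv_into K h x * inv_into K h y"
   by (intro u; simp add: csubfield_props[OF C] chom_simps[OF C h] i)+
 qed
qed

end

context
 fixes K K' :: "complex set" and h :: "complex => complex"
 assumes K: "number_field K" and K': "number_field K'" and h: "chom K h" and hb: "bij_betw h K K'"
begin

text \<open>The inverse is composition with the inverse isomorphism, to which the lemmas of the
  preceding context apply once that context is closed.\<close>

lemma transfer_embeddings_bij: "bij_betw (\<lambda>s. compose K s h) (embeddings K') (embeddings K)"
proof (rule bij_betw_byWitness[where f' = "\<lambda>s. compose K' s (inv_into K h)"])
 note g = inverse_chom[OF K K' h hb]
 have hK: "h x \<in> K'" "inv_into K h (h x) = x" if "x \<in> K" for x using hb that by (auto simp: bij_betw_def inv_into_f_f)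
 have i: "inv_into K h x \<in> K" "h (inv_into K h x) = x" if "x \<in> K'" for x
  using g hb that by (auto simp: bij_betw_def f_inv_into_f inv_into_into)
 show "\<forall>s\<in>embeddings K'. compose K' (compose K s h) (inv_into K h) = s"
  using i by (auto intro!: extensionalityI[of _ K'] simp: embeddings_iff compose_def)
 show "\<forall>s\<in>embeddings K. compose K (compose K' s (inv_into K h)) h = s"
  using hK by (auto intro!: extensionalityI[of _ K] simp: embeddings_iff compose_def)
 show "(\<lambda>s. compose K s h) ` embeddings K' \<subseteq> embeddings K" using transfer_embedding(1)[OF K K' h hb] by auto
 show "(\<lambda>s. compose K' s (inv_into K h)) ` embeddings K \<subseteq> embeddings K'" using transfer_embedding(1)[OF K' K g] by auto
qed

text \<open>The embeddings of isomorphic fields have the same images, so the closures coincide as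
  sets of complex numbers and the Galois groups are literally equal.\<close>

lemma transfer_galois_closure: "galois_closure K = galois_closure K'"
proof -
 have e: "embeddings K = (\<lambda>s. compose K s h) ` embeddings K'"
  by (rule bij_betw_imp_surj_on[OF transfer_embeddings_bij, symmetric])
 have "(\<Union>J\<in>embeddings K. J ` K) = (\<Union>s\<in>embeddings K'. compose K s h ` K)"
  by (subst e, rule arg_cong[of _ _ Union], simp only: image_image)
 also have "... = (\<Union>s\<in>embeddings K'. s ` K')" using transfer_embedding(2)[OF K K' h hb] by simp
 finally show ?thesis by (simp add: galois_closure_def)
qed

lemma transfer_degree: "degree_over_Q K = degree_over_Q K'"
 using bij_betw_same_card[OF transfer_embeddings_bij] embeddings_card(2)[OF K] embeddings_card(2)[OF K'] by simp

lemma transfer_signature: "has_signature K r1 r2 \<longleftrightarrow> has_signature K' r1 r2"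
proof -
 have "card {J \<in> embeddings K. Q (J ` K)} = card {J \<in> embeddings K'. Q (J ` K')}" for Q
 proof -
  have "bij_betw (\<lambda>s. compose K s h) {J \<in> embeddings K'. Q (J ` K')} {J \<in> embeddings K. Q (J ` K)}"
   unfolding bij_betw_def
  proof
   show "inj_on (\<lambda>s. compose K s h) {J \<in> embeddings K'. Q (J ` K')}"
    using transfer_embeddings_bij by (auto simp: bij_betw_def intro: inj_on_subset)
   have "embeddings K = (\<lambda>s. compose K s h) ` embeddings K'" using transfer_embeddings_bij by (simp add: bij_betw_def)
   then show "(\<lambda>s. compose K s h) ` {J \<in> embeddings K'. Q (J ` K')} = {J \<in> embeddings K. Q (J ` K)}"
    using transfer_embedding(2)[OF K K' h hb] by auto
  qed
  then show ?thesis by (simp add: bij_betw_same_card)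
 qed
 from this[of "\<lambda>S. S \<subseteq> \<real>"] this[of "\<lambda>S. \<not> S \<subseteq> \<real>"] show ?thesis by (simp add: has_signature_def)
qed

text \<open>If the basis is carried over by h and the embeddings are pulled back along h, the two
  embedding matrices have identical entries.\<close>

lemma transfer_discriminant: "discriminant K = discriminant K'"
proof -
 obtain J' where s': "enumerated_field K' J'" using enumeration_exists[OF K'] by blast
 interpret B: enumerated_field K' J' by (rule s')
 define J where "J i = compose K (J' i) h" for i
 interpret A: enumerated_field K J
 proof
  show "bij_betw J {..<degree_over_Q K} (embeddings K)"
   using bij_betw_trans[OF B.enumeration transfer_embeddings_bij] unfolding J_def comp_def transfer_degree .
 qed (rule K)
 obtain v where w: "integral_basis K v" using A.integral_basis_exists by blast
 note C = number_field_csubfield[OF K]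
 have wi: "v j \<in> K" "algebraic_int (v j)" if "j < degree_over_Q K" for j
  using A.integral_basisD(1)[OF w] that by (auto simp: A.integral_def)
 have hK: "h x \<in> K'" if "x \<in> K" for x using hb that by (auto simp: bij_betw_def)
 define v' where "v' j = h (v j)" for j
 have e: "B.emb_det v' = A.emb_det v"
 proof -
  have "B.emb_mat v' = A.emb_mat v" unfolding A.emb_mat_def B.emb_mat_def transfer_degree[symmetric]
   by (intro eq_matI) (auto simp: J_def v'_def compose_def wi)
  then show ?thesis by (simp add: A.emb_det_def B.emb_det_def)
 qed
 have "integral_basis K' v'"
 proof (rule B.integral_basisI)
  show "B.integral v'"
   unfolding B.integral_def v'_def transfer_degree[symmetric] using wi hK chom_algebraic_int[OF C h] by auto
  show "B.emb_det v' \<noteq> 0" unfolding e by (rule A.emb_det_square_unique(2)[OF w w])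
  show "B.spanning v'" unfolding B.spanning_def
  proof (intro ballI impI)
   fix y assume y: "y \<in> K'" "algebraic_int y"
   obtain x where x: "x \<in> K" "y = h x" using y(1) hb by (auto simp: bij_betw_def)
   have "algebraic_int x" using y(2) chom_algebraic_int_iff[OF C h x(1)] x(2) by simp
   then obtain a :: "nat => int" where a: "x = (\<Sum>j<degree_over_Q K. of_int (a j) * v j)"
    using A.integral_basisD(2)[OF w] x(1) unfolding A.spanning_def by blast
   have "y = (\<Sum>j<degree_over_Q K. h (of_int (a j) * v j))"
    unfolding x(2) a by (intro chom_sum[OF C h] csubfield_props(4)[OF C] csubfield_of_int[OF C] wi) auto
   also have "... = (\<Sum>j<degree_over_Q K'. of_int (a j) * v' j)"
    unfolding transfer_degree v'_def
    by (intro sum.cong refl) (simp add: chom_simps(3)[OF C h] chom_of_int[OF C h] csubfield_of_int[OF C] wi transfer_degree)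
   finally show "\<exists>a::nat => int. y = (\<Sum>j<degree_over_Q K'. of_int (a j) * v' j)" by blast
  qed
 qed
 then have "of_int (discriminant K') = (of_int (discriminant K) :: complex)"
  using A.discriminant_eq(1)[OF w] B.discriminant_eq(1) e by simp
 then show ?thesis by simp
qed

text \<open>The two fields share the Galois closure, so the action on the embeddings of K' is the
  action for K followed by conjugation with the bijection of embeddings.\<close>

lemma transfer_Sn_field: assumes S: "Sn_field n K" shows "Sn_field n K'"
proof -
 define L where "L = galois_closure K"
 have L': "galois_closure K' = L" unfolding L_def by (rule transfer_galois_closure[symmetric])
 define F where "F s = compose K s h" for s :: "complex => complex"
 have F: "bij_betw F (embeddings K') (embeddings K)" unfolding F_def by (rule transfer_embeddings_bij)
 define M where "M = (\<lambda>l\<in>carrier (galois_group L). \<lambda>J\<in>embeddings K. compose K l J)"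
 have M: "M \<in> iso (galois_group L) (BijGroup (embeddings K))" using S by (simp add: Sn_field_def M_def L_def)
 define c where "c = (\<lambda>f\<in>carrier (BijGroup (embeddings K)). \<lambda>s\<in>embeddings K'. inv_into (embeddings K') F (f (F s)))"
 have c: "c \<in> iso (BijGroup (embeddings K)) (BijGroup (embeddings K'))" unfolding c_def by (rule BijGroup_conj[OF F])
 have "compose (carrier (galois_group L)) c M = (\<lambda>l\<in>carrier (galois_group L). \<lambda>J\<in>embeddings K'. compose K' l J)"
 proof (rule extensionalityI[of _ "carrier (galois_group L)"])
  fix l assume t: "l \<in> carrier (galois_group L)"
  have Mt: "M l \<in> carrier (BijGroup (embeddings K))" using M t by (auto simp: iso_def bij_betw_def)
  have "c (M l) s = compose K' l s" if s: "s \<in> embeddings K'" for s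
  proof -
   have sK: "F s \<in> embeddings K" using F s by (auto simp: bij_betw_def)
   have ts: "compose K' l s \<in> embeddings K'"
    by (rule compose_embedding[OF number_field_csubfield[OF K'] s]) (use t L' in \<open>simp add: galois_group_iff\<close>)
   have "M l (F s) = F (compose K' l s)"
    using t sK hb by (auto simp: M_def F_def compose_def bij_betw_def fun_eq_iff)
   then have "c (M l) s = inv_into (embeddings K') F (F (compose K' l s))" using Mt s by (simp add: c_def)
   also have "... = compose K' l s" by (rule inv_into_f_f) (use F ts in \<open>auto simp: bij_betw_def\<close>)
   finally show ?thesis .
  qed
  then show "compose (carrier (galois_group L)) c M l = (\<lambda>l\<in>carrier (galois_group L). \<lambda>J\<in>embeddings K'. compose K' l J) l"
   using t Mt by (auto simp: compose_def c_def fun_eq_iff)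
 qed (auto simp: compose_def)
 moreover have "compose (carrier (galois_group L)) c M \<in> iso (galois_group L) (BijGroup (embeddings K'))"
 proof (rule iso_cong[OF iso_set_trans[OF M c]])
  have L: "csubfield L" unfolding L_def by (rule csubfield_galois_closure)
  fix a b assume ab: "a \<in> carrier (galois_group L)" "b \<in> carrier (galois_group L)"
  then have "a \<in> Bij L" "b \<in> Bij L" by (auto simp: galois_group_iff Bij_def)
  then have "a \<otimes>\<^bsub>galois_group L\<^esub> b = compose L a b" by (simp add: galois_group_def BijGroup_def)
  then show "a \<otimes>\<^bsub>galois_group L\<^esub> b \<in> carrier (galois_group L)" using galois_group_compose[OF L ab(2,1)] by simp
 qed (simp add: compose_def)
 ultimately show ?thesis using S K' transfer_degree unfolding Sn_field_def L' by simp
qed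

end

lemma ring_subring_of_complex: "csubfield K ==> ring (subring_of_complex K)"
proof -
 interpret C: field complex_ring by (rule complex_ring_field)
 assume "csubfield K"
 then have "subfield K complex_ring" by (simp add: subfield_complex_iff)
 then show ?thesis by (intro C.subring_is_ring subfieldE(1))
qed

lemma field_iso_relD: assumes "(K, K') \<in> field_iso_rel"
 shows "number_field K" "number_field K'" "\<exists>h. chom K h \<and> bij_betw h K K'"
proof -
 show "number_field K" "number_field K'" using assms by (auto simp: field_iso_rel_def)
 obtain h where "h \<in> ring_iso (subring_of_complex K) (subring_of_complex K')"
  using assms by (auto simp: field_iso_rel_def is_ring_iso_def)
 then show "\<exists>h. chom K h \<and> bij_betw h K K'"
  by (intro exI[of _ h]) (auto simp: ring_iso_def ring_hom_def chom_def)
qed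

lemma field_iso_rel_sym: "(K, K') \<in> field_iso_rel ==> (K', K) \<in> field_iso_rel"
 unfolding field_iso_rel_def
 using ring_iso_sym[OF ring_subring_of_complex] number_field_csubfield by (auto simp: )

lemma field_iso_rel_trans: "(K, K') \<in> field_iso_rel ==> (K', K'') \<in> field_iso_rel ==> (K, K'') \<in> field_iso_rel"
 unfolding field_iso_rel_def using ring_iso_trans by blast

lemma class_rep_iso_class:
 assumes k: "k \<in> iso_classes A" and A: "A \<subseteq> Collect number_field"
 shows "\<exists>K\<in>A. (K, class_rep k) \<in> field_iso_rel" "k = field_iso_rel `` {class_rep k}"
proof -
 obtain K where K: "K \<in> A" "k = field_iso_rel `` {K}" using k by (auto simp: iso_classes_def quotient_def)
 have "(K, K) \<in> field_iso_rel" using K(1) A ring_iso_refl by (auto simp: field_iso_rel_def)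
 then have "K \<in> k" using K(2) by simp
 then have "class_rep k \<in> k" unfolding class_rep_def by (rule someI)
 then have r: "(K, class_rep k) \<in> field_iso_rel" using K(2) by simp
 then show "\<exists>K\<in>A. (K, class_rep k) \<in> field_iso_rel" using K(1) by blast
 show "k = field_iso_rel `` {class_rep k}"
  unfolding K(2)[symmetric] using r K(2) field_iso_rel_sym field_iso_rel_trans by blast
qed

text \<open>The representative chosen by \<open>class_rep\<close> may differ from the field that put
  the class into the set; invariance of all defining properties carries them over to it.\<close>

lemma Sn_classes_rep: assumes "k \<in> Sn_classes n r1 r2 X"
 shows "class_rep k \<in> Sn_fields n r1 r2 X" "k = field_iso_rel `` {class_rep k}"
proof -
 have A: "Sn_fields n r1 r2 X \<subseteq> Collect number_field" by (auto simp: Sn_fields_def Sn_field_def)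
 note c = class_rep_iso_class[OF assms[unfolded Sn_classes_def] A]
 show "k = field_iso_rel `` {class_rep k}" by (rule c(2))
 obtain K where K: "K \<in> Sn_fields n r1 r2 X" "(K, class_rep k) \<in> field_iso_rel" using c(1) by blast
 obtain h where "chom K h \<and> bij_betw h K (class_rep k)" using field_iso_relD(3)[OF K(2)] by blast
 then have h: "chom K h" "bij_betw h K (class_rep k)" by auto
 note t = field_iso_relD(1,2)[OF K(2)] h
 show "class_rep k \<in> Sn_fields n r1 r2 X"
  using K(1) transfer_Sn_field[OF t] transfer_signature[OF t] transfer_discriminant[OF t]
  by (auto simp: Sn_fields_def)
qed

section \<open>Counting fields by local conditions\<close>

definition conds :: "nat => nat => local_cond set" where
 "conds n w = {LC. valid_cond n w LC}"

definition odd_conds :: "nat => local_cond set" where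
 "odd_conds n = Unram ` {C \<in> conj_classes n. \<not> C \<subseteq> carrier (alt_group n)}"

definition outside_primes :: "nat => complex set set => nat set" where
 "outside_primes n v = {p. prime p \<and> unramified (class_rep v) p \<and> frob_in n (class_rep v) p (outside_alt n)}"

lemma conds_eq: "conds n w = Unram ` conj_classes n \<union> Ram ` {1..w}"
proof (intro equalityI subsetI)
 fix LC assume "LC \<in> conds n w"
 then show "LC \<in> Unram ` conj_classes n \<union> Ram ` {1..w}" by (cases LC) (auto simp: conds_def)
qed (auto simp: conds_def)

lemma finite_conds: "finite (conds n w)" unfolding conds_eq using finite_conj_classes by simp

lemma odd_conds_subset: "odd_conds n \<subseteq> conds n w" unfolding conds_eq odd_conds_def by auto

text \<open>The odd classes make up half of the symmetric group. The complementary conditions are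
  the even classes, with the other half, and the ramified types, with total weight f p.\<close>

lemma sum_cond_density:
 assumes n: "n \<ge> 2" and c: "(\<Sum>j=1..w. c j p) = f p" and f: "f p \<ge> 0"
 shows "(\<Sum>LC\<in>odd_conds n. cond_density n c f p LC) = (1/2) / (1 + f p)"
  "(\<Sum>LC\<in>conds n w - odd_conds n. cond_density n c f p LC) = (1/2 + f p) / (1 + f p)"
  "(\<Sum>LC\<in>conds n w. cond_density n c f p LC) = 1"
proof -
 have o: "real (Coset.order (sym_group n)) = fact n" by (simp add: Coset.order_def sym_group_card_carrier)
 have half: "(\<Sum>LC\<in>Unram ` Q. cond_density n c f p LC) = (1/2) / (1 + f p)"
  if Q: "(\<Sum>C\<in>Q. real (card C)) = fact n / 2" for Q
 proof -
  have "(\<Sum>LC\<in>Unram ` Q. cond_density n c f p LC) = (\<Sum>C\<in>Q. real (card C) / (fact n * (1 + f p)))"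
   by (subst sum.reindex) (auto simp: inj_on_def o)
  also have "... = (\<Sum>C\<in>Q. real (card C)) / (fact n * (1 + f p))" by (rule sum_divide_distrib[symmetric])
  also have "... = (1/2) / (1 + f p)" unfolding Q by simp
  finally show ?thesis .
 qed
 show 1: "(\<Sum>LC\<in>odd_conds n. cond_density n c f p LC) = (1/2) / (1 + f p)"
  unfolding odd_conds_def by (rule half) (rule card_odd_even_classes(1)[OF n])
 have "(\<Sum>LC\<in>Ram ` {1..w}. cond_density n c f p LC) = (\<Sum>j=1..w. c j p / (1 + f p))"
  by (subst sum.reindex) (auto simp: inj_on_def)
 also have "... = f p / (1 + f p)" using c by (simp add: sum_divide_distrib[symmetric])
 finally have R: "(\<Sum>LC\<in>Ram ` {1..w}. cond_density n c f p LC) = f p / (1 + f p)" .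
 have "conds n w - odd_conds n = Unram ` {C. C \<in> conj_classes n \<and> C \<subseteq> carrier (alt_group n)} \<union> Ram ` {1..w}"
  unfolding conds_eq odd_conds_def by auto
 then have "(\<Sum>LC\<in>conds n w - odd_conds n. cond_density n c f p LC) =
   (\<Sum>LC\<in>Unram ` {C. C \<in> conj_classes n \<and> C \<subseteq> carrier (alt_group n)}. cond_density n c f p LC) +
   (\<Sum>LC\<in>Ram ` {1..w}. cond_density n c f p LC)"
  using finite_conj_classes[of n] by (simp only:) (rule sum.union_disjoint, auto)
 also have "... = (1/2) / (1 + f p) + f p / (1 + f p)"
  unfolding R by (subst half) (rule card_odd_even_classes(2)[OF n], simp)
 finally show 2: "(\<Sum>LC\<in>conds n w - odd_conds n. cond_density n c f p LC) = (1/2 + f p) / (1 + f p)"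
  by (simp add: add_divide_distrib)
 have "(\<Sum>LC\<in>conds n w. cond_density n c f p LC) = (1/2 + f p) / (1 + f p) + (1/2) / (1 + f p)"
  using sum.subset_diff[OF odd_conds_subset finite_conds, of "cond_density n c f p" n w] 1 2 by simp
 also have "... = 1" using f by (simp add: field_simps)
 finally show "(\<Sum>LC\<in>conds n w. cond_density n c f p LC) = 1" .
qed

text \<open>Only existence of a condition of the right kind is asserted, so the counts below rest on
  covers of the fields by local conditions and not on partitions. For an unramified prime that is
  not in \<open>outside_primes\<close>, the class of a Frobenius permutation must be even.\<close>

lemma satisfies_some_cond:
 assumes K: "Sn_field n (class_rep v)" and p: "prime p" and r: "bij_betw r {1..w} (ramified_splitting_types n)"
 shows "\<exists>LC\<in>(if p \<in> outside_primes n v then odd_conds n else conds n w - odd_conds n). satisfies_cond n r (class_rep v) p LC"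
proof -
 define F where "F = class_rep v"
 have nf: "number_field F" "degree_over_Q F = n" using K by (auto simp: Sn_field_def F_def)
 show ?thesis
 proof (cases "p \<in> outside_primes n v")
  case True
  then have "unramified F p" "frob_in n F p (outside_alt n)" by (auto simp: outside_primes_def F_def)
  then obtain C where "C \<in> conj_classes n" "\<not> C \<subseteq> carrier (alt_group n)" "frob_in n F p C"
   by (auto simp: frob_in_outside_alt)
  then show ?thesis using True \<open>unramified F p\<close>
   by (simp add: F_def[symmetric]) (intro bexI[of _ "Unram C"], auto simp: odd_conds_def)
 next
  case False
  show ?thesis
  proof (cases "unramified F p")
   case True
   obtain J where s: "enumerated_field F J" using enumeration_exists[OF nf(1)] by blast
   obtain \<pi> where pi: "\<pi> permutes {1..n} \<and> (\<forall>C. \<pi> \<in> C --> frob_in n F p C)"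
    using enumerated_field.frobenius_permutation[OF s p] unfolding nf(2) by metis
   then have "\<pi> \<in> \<Union> (conj_classes n)" unfolding conj_classes_cover by (simp add: sym_group_carrier)
   then obtain C where C: "C \<in> conj_classes n" "\<pi> \<in> C" by blast
   have fC: "frob_in n F p C" using pi C by blast
   have "C \<subseteq> carrier (alt_group n)"
    using False True p C(1) fC by (auto simp: outside_primes_def frob_in_outside_alt F_def)
   then show ?thesis using False True fC C(1)
    by (simp add: F_def[symmetric]) (intro bexI[of _ "Unram C"], auto simp: odd_conds_def conds_def)
  next
   case ram: False
   then have "splitting_type F p \<in> ramified_splitting_types n"
    using K p unfolding ramified_splitting_types_def F_def by blast
   then have "splitting_type F p \<in> r ` {1..w}" using r by (simp add: bij_betw_def)
   then obtain j where "j \<in> {1..w}" "splitting_type F p = r j" by blast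
   then show ?thesis using False ram
    by (simp add: F_def[symmetric]) (intro bexI[of _ "Ram j"], auto simp: odd_conds_def conds_def)
  qed
 qed
qed

context
 fixes n r1 r2 w :: nat and r :: "nat => (nat \<times> nat) multiset" and c :: "nat => nat => real"
  and f :: "nat => real" and A \<delta> \<gamma> B :: real assumes n: "n \<ge> 2"
  and r: "bij_betw r {1..w} (ramified_splitting_types n)"
  and c: "\<And>p. prime p ==> (\<Sum>j=1..w. c j p) = f p" and f: "\<And>p. prime p ==> f p \<ge> 0"
  and par: "A > 0" "0 < \<delta>" "\<delta> < 1" "0 < \<gamma>"
  and cnt: "\<And>X. X \<ge> 1 ==> finite (Sn_classes n r1 r2 X) \<and>
       \<bar>real (card (Sn_classes n r1 r2 X)) - A * X\<bar> \<le> B * X powr \<delta>"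
  and cond: "\<And>X S LC. X \<ge> 1 ==> finite S ==> (\<forall>p\<in>S. prime p \<and> valid_cond n w (LC p)) ==>
       \<bar>real (card (Sn_classes_cond n r1 r2 r S LC X)) - (\<Prod>p\<in>S. cond_density n c f p (LC p)) * A * X\<bar>
       \<le> B * real (\<Prod>p\<in>S. p) powr \<gamma> * X powr \<delta>"
begin

abbreviation "Cl \<equiv> Sn_classes n r1 r2"
abbreviation "CC S LC X \<equiv> Sn_classes_cond n r1 r2 r S LC X"
abbreviation "dens S LC \<equiv> \<Prod>p\<in>S. cond_density n c f p (LC p)"
abbreviation "sat v LC p \<equiv> satisfies_cond n r (class_rep v) p (LC p)"
abbreviation "out v p \<equiv> p \<in> outside_primes n v"
abbreviation "R y \<equiv> real (card (conds n w) + 1) * real y powr \<gamma>"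

lemma finite_Sn_classes: "X \<ge> 1 ==> finite (Cl X)" using cnt by blast

lemma B_nonneg: "B \<ge> 0"
proof -
 have "\<bar>real (card (Sn_classes n r1 r2 1)) - A\<bar> \<le> B" using cnt[of 1] by simp
 then show ?thesis using abs_ge_zero order_trans by blast
qed

lemma Sn_classes_cond_subset: "CC S LC X \<subseteq> Cl X"
 unfolding Sn_classes_cond_def Sn_classes_def iso_classes_def quotient_def by blast

lemma Sn_classes_condI: assumes "v \<in> Cl X" "\<And>p. p \<in> S ==> sat v LC p"
 shows "v \<in> CC S LC X" unfolding Sn_classes_cond_def iso_classes_def
 by (subst Sn_classes_rep(2)[OF assms(1)], rule quotientI) (use Sn_classes_rep(1)[OF assms(1)] assms(2) in simp)

text \<open>A union bound over the assignments in D. There are at most (card conds + 1)^y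
  assignments, and the product of the primes up to y is at most y^y; the added 1 keeps the base at
  least 1, so that the exponent card S may be raised to y.\<close>

lemma card_cover:
 assumes X: "X \<ge> 1" and S: "S \<subseteq> {p. prime p \<and> p \<le> y}" and y: "y \<ge> 1"
  and D: "D \<subseteq> S \<rightarrow>\<^sub>E conds n w" and Q: "Q \<subseteq> Cl X"
  and QD: "\<And>v. v \<in> Q ==> \<exists>LC\<in>D. \<forall>p\<in>S. sat v LC p"
 shows "real (card Q) \<le> (\<Sum>LC\<in>D. dens S LC) * A * X
   + B * (R y) ^ y * X powr \<delta>"
proof -
 have finS: "finite S" using finite_subset[OF S finite_primes_le] .
 have finD: "finite D" by (rule finite_subset[OF D]) (simp add: finite_PiE finS finite_conds)
 have cS: "card S \<le> y"
 proof -
  have "card S \<le> card {1..y}" using S prime_ge_1_nat by (intro card_mono) auto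
  then show ?thesis by simp
 qed
 have pS: "real (\<Prod>p\<in>S. p) powr \<gamma> \<le> (real y powr \<gamma>) ^ y"
 proof -
  have "(\<Prod>p\<in>S. p) \<le> (\<Prod>p\<in>S. y)" using S by (intro prod_mono) auto
  also have "... = y ^ card S" by simp
  also have "... \<le> y ^ y" using y cS by (intro power_increasing) auto
  finally have "real (\<Prod>p\<in>S. p) \<le> real y ^ y" by (metis of_nat_le_iff of_nat_power)
  then have "real (\<Prod>p\<in>S. p) powr \<gamma> \<le> (real y ^ y) powr \<gamma>" using par by (intro powr_mono2) (auto intro: prod_nonneg)
  also have "... = (real y powr \<gamma>) ^ y" using y by (simp add: powr_power powr_powr powr_realpow[symmetric] mult.commute)
  finally show ?thesis .
 qed
 have cD: "real (card D) \<le> real (card (conds n w) + 1) ^ y"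
 proof -
  have "card D \<le> card (S \<rightarrow>\<^sub>E conds n w)" by (intro card_mono D) (simp add: finite_PiE finS finite_conds)
  also have "... = card (conds n w) ^ card S" by (simp add: card_PiE finS)
  also have "... \<le> (card (conds n w) + 1) ^ card S" by (intro power_mono) auto
  also have "... \<le> (card (conds n w) + 1) ^ y" using cS by (intro power_increasing) auto
  finally show ?thesis by (metis of_nat_le_iff of_nat_power)
 qed
 have "Q \<subseteq> (\<Union>LC\<in>D. CC S LC X)"
 proof
  fix v assume k: "v \<in> Q"
  then obtain LC where LC: "LC \<in> D" "\<forall>p\<in>S. sat v LC p" using QD by blast
  have "v \<in> CC S LC X" using LC(2) k Q by (intro Sn_classes_condI) auto
  then show "v \<in> (\<Union>LC\<in>D. CC S LC X)" using LC(1) by blast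
 qed
 moreover have "finite (\<Union>LC\<in>D. CC S LC X)"
  using finD finite_subset[OF Sn_classes_cond_subset finite_Sn_classes[OF X]] by blast
 ultimately have "card Q \<le> card (\<Union>LC\<in>D. CC S LC X)" by (intro card_mono)
 also have "... \<le> (\<Sum>LC\<in>D. card (CC S LC X))" by (rule card_UN_le[OF finD])
 finally have "real (card Q) \<le> (\<Sum>LC\<in>D. real (card (CC S LC X)))" by (metis of_nat_le_iff of_nat_sum)
 also have "... \<le> (\<Sum>LC\<in>D. dens S LC * A * X + B * (real y powr \<gamma>) ^ y * X powr \<delta>)"
 proof (rule sum_mono)
  fix LC assume "LC \<in> D"
  then have "\<forall>p\<in>S. prime p \<and> valid_cond n w (LC p)" using D S by (auto simp: conds_def)
  from cond[OF X finS this]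
  have "real (card (CC S LC X)) \<le> dens S LC * A * X + B * real (\<Prod>p\<in>S. p) powr \<gamma> * X powr \<delta>" by linarith
  moreover have "B * real (\<Prod>p\<in>S. p) powr \<gamma> * X powr \<delta> \<le> B * (real y powr \<gamma>) ^ y * X powr \<delta>"
   by (intro mult_right_mono mult_left_mono pS B_nonneg) auto
  ultimately show "real (card (CC S LC X)) \<le> dens S LC * A * X + B * (real y powr \<gamma>) ^ y * X powr \<delta>" by linarith
 qed
 also have "... = (\<Sum>LC\<in>D. dens S LC) * A * X + real (card D) * (B * (real y powr \<gamma>) ^ y * X powr \<delta>)"
  by (simp add: sum.distrib sum_distrib_right)
 also have "real (card D) * (B * (real y powr \<gamma>) ^ y * X powr \<delta>) \<le> real (card (conds n w) + 1) ^ y * (B * (real y powr \<gamma>) ^ y * X powr \<delta>)"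
  using B_nonneg by (intro mult_right_mono cD) auto
 also have "... = B * (R y) ^ y * X powr \<delta>" by (simp add: power_mult_distrib)
 finally show ?thesis by simp
qed

lemma choose_conds: assumes v: "v \<in> Cl X" and S: "\<And>p. p \<in> S ==> prime p"
 shows "\<exists>LC\<in>S \<rightarrow>\<^sub>E conds n w. (\<forall>p\<in>S. sat v LC p \<and> (LC p \<in> odd_conds n \<longleftrightarrow> out v p))"
proof -
 have K: "Sn_field n (class_rep v)" using Sn_classes_rep(1)[OF v] by (simp add: Sn_fields_def)
 have "\<forall>p. \<exists>LC. p \<in> S --> LC \<in> conds n w \<and> satisfies_cond n r (class_rep v) p LC \<and> (LC \<in> odd_conds n \<longleftrightarrow> out v p)"
 proof
  fix p
  show "\<exists>LC. p \<in> S --> LC \<in> conds n w \<and> satisfies_cond n r (class_rep v) p LC \<and> (LC \<in> odd_conds n \<longleftrightarrow> out v p)"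
   using satisfies_some_cond[OF K S r, of p] odd_conds_subset[of n w] by (cases "out v p") (auto split: if_splits)
 qed
 then obtain LC where LC: "\<And>p. p \<in> S ==> LC p \<in> conds n w \<and> sat v LC p \<and> (LC p \<in> odd_conds n \<longleftrightarrow> out v p)" by metis
 then show ?thesis by (intro bexI[of _ "restrict LC S"]) auto
qed

lemma sum_PiE_density: assumes "finite S" "\<And>p. D p \<subseteq> conds n w"
 shows "(\<Sum>LC\<in>PiE S D. dens S LC) = (\<Prod>p\<in>S. \<Sum>L\<in>D p. cond_density n c f p L)"
 by (rule prod_sum_PiE[symmetric]) (use assms finite_subset[OF assms(2) finite_conds] in auto)

lemma survivors_le: assumes X: "X \<ge> 1" and y: "y \<ge> 1"
 shows "real (card {v \<in> Cl X. \<forall>p\<le>y. \<not> out v p})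
  \<le> survival f y * A * X + B * (R y) ^ y * X powr \<delta>"
proof -
 define S where "S = {p. prime p \<and> p \<le> y}"
 have finS: "finite S" unfolding S_def by (rule finite_primes_le)
 have "(\<Sum>LC\<in>S \<rightarrow>\<^sub>E (conds n w - odd_conds n). dens S LC) = (\<Prod>p\<in>S. (1/2 + f p) / (1 + f p))"
  by (subst sum_PiE_density[OF finS]) (auto simp: S_def intro!: prod.cong sum_cond_density(2) n c f)
 also have "... = survival f y" by (simp add: survival_def S_def)
 finally have d: "(\<Sum>LC\<in>S \<rightarrow>\<^sub>E (conds n w - odd_conds n). dens S LC) = survival f y" .
 show ?thesis unfolding d[symmetric]
 proof (rule card_cover[OF X _ y])
  show "S \<subseteq> {p. prime p \<and> p \<le> y}" by (simp add: S_def)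
  show "S \<rightarrow>\<^sub>E (conds n w - odd_conds n) \<subseteq> S \<rightarrow>\<^sub>E conds n w" by (intro PiE_mono) auto
  fix v assume "v \<in> {v \<in> Cl X. \<forall>p\<le>y. \<not> out v p}"
  then have k: "v \<in> Cl X" "\<And>p. p \<in> S ==> \<not> out v p" by (auto simp: S_def)
  obtain LC where "LC \<in> S \<rightarrow>\<^sub>E conds n w" "\<forall>p\<in>S. sat v LC p \<and> (LC p \<in> odd_conds n \<longleftrightarrow> out v p)"
   using choose_conds[OF k(1), of S] by (auto simp: S_def)
  then show "\<exists>LC\<in>S \<rightarrow>\<^sub>E (conds n w - odd_conds n). \<forall>p\<in>S. sat v LC p"
   using k(2) by (intro bexI[of _ LC]) (auto simp: PiE_iff)
 qed auto
qed

text \<open>The lower bound comes from the upper bound for the complement, as the densities of all local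
 conditions at a prime sum to 1.\<close>

lemma first_count: assumes X: "X \<ge> 1" and q: "prime q"
 shows "\<bar>real (card {v \<in> Cl X. out v q \<and> (\<forall>p<q. \<not> out v p)}) - first_density f q * A * X\<bar>
  \<le> 2 * B * (R q) ^ q * X powr \<delta>"
proof -
 define E where "E = {v \<in> Cl X. out v q \<and> (\<forall>p<q. \<not> out v p)}"
 define S where "S = {p. prime p \<and> p \<le> q}"
 define D where "D p = (if p = q then odd_conds n else conds n w - odd_conds n)" for p
 define err where "err = B * (R q) ^ q * X powr \<delta>"
 have finS: "finite S" unfolding S_def by (rule finite_primes_le)
 have q1: "q \<ge> 1" using q by (rule prime_ge_1_nat)
 have Dc: "D p \<subseteq> conds n w" for p using odd_conds_subset by (auto simp: D_def)
 have Sins: "S = insert q {p. prime p \<and> p < q}" using q by (auto simp: S_def)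
 have "(\<Sum>LC\<in>PiE S D. dens S LC) = (\<Prod>p\<in>S. \<Sum>L\<in>D p. cond_density n c f p L)"
  by (rule sum_PiE_density[OF finS Dc])
 also have "... = (\<Sum>L\<in>odd_conds n. cond_density n c f q L) * (\<Prod>p | prime p \<and> p < q. \<Sum>L\<in>D p. cond_density n c f p L)"
  unfolding Sins by (subst prod.insert) (auto simp: D_def)
 also have "(\<Prod>p | prime p \<and> p < q. \<Sum>L\<in>D p. cond_density n c f p L) = (\<Prod>p | prime p \<and> p < q. (1/2 + f p) / (1 + f p))"
  by (intro prod.cong refl) (simp add: D_def sum_cond_density(2)[OF n c f])
 also have "(\<Sum>L\<in>odd_conds n. cond_density n c f q L) = (1/2) / (1 + f q)" by (rule sum_cond_density(1)[where w = w and c = c and f = f and p = q, OF n c[OF q] f[OF q]])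
 finally have d: "(\<Sum>LC\<in>PiE S D. dens S LC) = first_density f q" by (simp add: first_density_def)
 have "(\<Sum>LC\<in>S \<rightarrow>\<^sub>E conds n w. dens S LC) = (\<Prod>p\<in>S. 1)"
  unfolding sum_PiE_density[OF finS subset_refl]
  by (intro prod.cong refl sum_cond_density(3)[OF n c f]) (simp_all add: S_def)
 then have d1: "(\<Sum>LC\<in>S \<rightarrow>\<^sub>E conds n w. dens S LC) = 1" by simp
 have PS: "PiE S D \<subseteq> S \<rightarrow>\<^sub>E conds n w" using Dc by (intro PiE_mono) auto
 have d2: "(\<Sum>LC\<in>(S \<rightarrow>\<^sub>E conds n w) - PiE S D. dens S LC) = 1 - first_density f q"
  using sum.subset_diff[OF PS, of "\<lambda>LC. dens S LC"] d d1 finS finite_conds by (simp add: finite_PiE)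
 have LC: "\<exists>LC\<in>S \<rightarrow>\<^sub>E conds n w. (\<forall>p\<in>S. sat v LC p \<and> (LC p \<in> odd_conds n \<longleftrightarrow> out v p))"
  if "v \<in> Cl X" for v using choose_conds[of v X S] that by (auto simp: S_def)
 have up: "real (card E) \<le> first_density f q * A * X + err" unfolding d[symmetric] err_def
 proof (rule card_cover[OF X _ q1 PS])
  show "S \<subseteq> {p. prime p \<and> p \<le> q}" by (simp add: S_def)
  show "E \<subseteq> Cl X" by (auto simp: E_def)
  fix v assume k: "v \<in> E"
  then obtain LC where LC: "LC \<in> S \<rightarrow>\<^sub>E conds n w" "\<forall>p\<in>S. sat v LC p \<and> (LC p \<in> odd_conds n \<longleftrightarrow> out v p)"
   using LC[of v] by (auto simp: E_def)
  have "LC p \<in> D p" if "p \<in> S" for p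
   using LC that k by (cases "p = q") (auto simp: D_def E_def S_def)
  then have "LC \<in> PiE S D" using LC(1) by (auto simp: PiE_iff)
  then show "\<exists>LC\<in>PiE S D. \<forall>p\<in>S. sat v LC p" using LC(2) by blast
 qed
 have low: "real (card (Cl X - E)) \<le> (1 - first_density f q) * A * X + err"
  unfolding d2[symmetric] err_def
 proof (rule card_cover[OF X _ q1])
  show "S \<subseteq> {p. prime p \<and> p \<le> q}" by (simp add: S_def)
  show "Cl X - E \<subseteq> Cl X" by auto
  fix v assume k: "v \<in> Cl X - E"
  then obtain LC where LC: "LC \<in> S \<rightarrow>\<^sub>E conds n w" "\<forall>p\<in>S. sat v LC p \<and> (LC p \<in> odd_conds n \<longleftrightarrow> out v p)"
   using LC[of v] by auto
  have "LC \<notin> PiE S D"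
  proof
   assume "LC \<in> PiE S D"
   then have P: "LC p \<in> D p" if "p \<in> S" for p using that by auto
   have "out v q" using P[of q] LC(2) q by (auto simp: S_def D_def)
   moreover have "\<not> out v p" if "p < q" for p
   proof
    assume o: "out v p"
    then have "p \<in> S" using that by (auto simp: outside_primes_def S_def)
    then show False using P[of p] LC(2) o that by (auto simp: D_def)
   qed
   ultimately show False using k by (auto simp: E_def)
  qed
  then show "\<exists>LC\<in>(S \<rightarrow>\<^sub>E conds n w) - PiE S D. \<forall>p\<in>S. sat v LC p" using LC by blast
 qed auto
 have fin: "finite (Cl X)" by (rule finite_Sn_classes[OF X])
 have EC: "E \<subseteq> Cl X" by (auto simp: E_def)
 have "card (Cl X - E) = card (Cl X) - card E" using EC fin finite_subset by (intro card_Diff_subset) auto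
 moreover have "card E \<le> card (Cl X)" by (rule card_mono[OF fin EC])
 ultimately have "real (card (Cl X - E)) = real (card (Cl X)) - real (card E)" by simp
 moreover have "\<bar>real (card (Cl X)) - A * X\<bar> \<le> B * X powr \<delta>" using cnt[OF X] by simp
 moreover have "B * X powr \<delta> \<le> err"
 proof -
  have "1 * 1 \<le> R q" using q1 par by (intro mult_mono) (auto intro: ge_one_powr_ge_zero)
  then have "1 \<le> (R q) ^ q" by (intro one_le_power) simp
  then have "B * 1 * X powr \<delta> \<le> B * (R q) ^ q * X powr \<delta>"
   using B_nonneg by (intro mult_right_mono mult_left_mono) auto
  then show ?thesis by (simp add: err_def)
 qed
 moreover have "(1 - first_density f q) * A * X = A * X - first_density f q * A * X" by (simp add: algebra_simps)
 ultimately have "\<bar>real (card E) - first_density f q * A * X\<bar> \<le> 2 * err"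
  using up low B_nonneg by (smt (verit) mult_nonneg_nonneg powr_ge_zero)
 then show ?thesis unfolding E_def err_def by (simp add: mult.assoc)
qed

end

section \<open>The resolvent conjecture in terms of discriminants, and the conclusion\<close>

lemma sqfree_disc_squarefree: assumes "sqfree_disc s T"
 shows "squarefree (s * int (\<Prod>T))" "s * int (\<Prod>T) \<noteq> 1" "\<bar>s * int (\<Prod>T)\<bar> = int (\<Prod>T)" "\<Prod>T > 0"
proof -
 have T: "finite T" "\<forall>q\<in>T. prime q" "s = -1 \<or> s = 1" "s \<noteq> 1 \<or> T \<noteq> {}" using assms by (auto simp: sqfree_disc_def)
 show "squarefree (s * int (\<Prod>T))"
  using squarefree_prod_primes[OF T(1,2)] T(3) by (auto simp: squarefree_def simp del: of_nat_prod)
 show pos: "\<Prod>T > 0" using T(1,2) by (intro prod_pos) (auto simp: prime_gt_0_nat)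
 show "\<bar>s * int (\<Prod>T)\<bar> = int (\<Prod>T)" using T(3) by (auto simp del: of_nat_prod)
 show "s * int (\<Prod>T) \<noteq> 1"
 proof
  assume e: "s * int (\<Prod>T) = 1"
  then have s: "s = 1" using T(3) by (auto simp del: of_nat_prod)
  then obtain t where t: "t \<in> T" using T(4) by auto
  have "t dvd \<Prod>T" using dvd_prodI[OF T(1) t, of "\<lambda>x. x"] by simp
  moreover have "\<Prod>T = 1" using e s by (simp del: of_nat_prod)
  ultimately show False using t T(2) by auto
 qed
qed

text \<open>Fields whose discriminants have the same squarefree part D share the resolvent F =
  Q(sqrt D). As |D| \<le> |d_F|, the conjectured bound may be stated with the product of T in place
  of |d_F|.\<close>

lemma resolvent_count: assumes QC: "\<forall>F. number_field F \<and> degree_over_Q F = 2 -->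
    (\<forall>X\<ge>1. finite (Defs.QR n X F) \<and>
      real (card (Defs.QR n X F)) \<le> B * (X / real_of_int \<bar>discriminant F\<bar>) powr (1 - \<beta>))"
  and \<beta>: "\<beta> < 1" and X: "X \<ge> 1" and s: "sqfree_disc s T"
 shows "real (card {v \<in> Sn_classes n r1 r2 X. \<exists>m. discriminant (class_rep v) = m\<^sup>2 * (s * int (\<Prod>T))})
   \<le> \<bar>B\<bar> * (X / real (\<Prod>T)) powr (1 - \<beta>)"
proof -
 define D where "D = s * int (\<Prod>T)"
 note D = sqfree_disc_squarefree[OF s, folded D_def]
 define q where "q = csqrt (of_int D)"
 have q: "q\<^sup>2 = of_int D" by (simp add: q_def)
 define F where "F = rat_adjoin q"
 have F: "number_field F" "degree_over_Q F = 2" "\<bar>D\<bar> \<le> \<bar>discriminant F\<bar>"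
  using quadratic_field[OF D(1,2) q] quadratic_field_discriminant[OF D(1,2) q] by (auto simp: F_def)
 have Q: "finite (Defs.QR n X F)" "real (card (Defs.QR n X F)) \<le> B * (X / real_of_int \<bar>discriminant F\<bar>) powr (1 - \<beta>)"
  using QC F X by auto
 have "{v \<in> Sn_classes n r1 r2 X. \<exists>m. discriminant (class_rep v) = m\<^sup>2 * D} \<subseteq> Defs.QR n X F"
 proof
  fix v assume "v \<in> {v \<in> Sn_classes n r1 r2 X. \<exists>m. discriminant (class_rep v) = m\<^sup>2 * D}"
  then obtain m where k: "v \<in> Sn_classes n r1 r2 X" "discriminant (class_rep v) = m\<^sup>2 * D" by blast
  have K: "class_rep v \<in> Sn_fields n r1 r2 X" "v = field_iso_rel `` {class_rep v}" using Sn_classes_rep[OF k(1)] by auto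
  have nf: "number_field (class_rep v)" using K(1) by (simp add: Sn_fields_def Sn_field_def)
  obtain J where J: "enumerated_field (class_rep v) J" using enumeration_exists[OF nf] by blast
  obtain g where g: "integral_basis (class_rep v) g" using enumerated_field.integral_basis_exists[OF J] by blast
  have "m \<noteq> 0" using enumerated_field.discriminant_eq(2)[OF J g] k(2) by auto
  then have "quadratic_resolvent (class_rep v) = F"
   unfolding F_def q_def by (rule quadratic_resolvent_eq[OF k(2) _ D(1,2)])
  then have "class_rep v \<in> {K. Sn_field n K \<and> quadratic_resolvent K = F \<and> real_of_int \<bar>discriminant K\<bar> \<le> X}"
   using K(1) by (simp add: Sn_fields_def)
  then have "field_iso_rel `` {class_rep v} \<in> Defs.QR n X F" unfolding Defs.QR_def iso_classes_def by (rule quotientI)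
  then show "v \<in> Defs.QR n X F" using K(2) by simp
 qed
 then have "real (card {v \<in> Sn_classes n r1 r2 X. \<exists>m. discriminant (class_rep v) = m\<^sup>2 * D}) \<le> real (card (Defs.QR n X F))"
  using Q(1) by (simp add: card_mono)
 also have "... \<le> B * (X / real_of_int \<bar>discriminant F\<bar>) powr (1 - \<beta>)" by (rule Q(2))
 also have "... \<le> \<bar>B\<bar> * (X / real_of_int \<bar>discriminant F\<bar>) powr (1 - \<beta>)" by (intro mult_right_mono) auto
 also have "... \<le> \<bar>B\<bar> * (X / real (\<Prod>T)) powr (1 - \<beta>)"
 proof -
  have "int (\<Prod>T) \<le> \<bar>discriminant F\<bar>" using F(3) D(3) by simp
  then have "real (\<Prod>T) \<le> real_of_int \<bar>discriminant F\<bar>" by (metis of_int_le_iff of_int_of_nat_eq)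
  moreover have "real (\<Prod>T) > 0" using D(4) by (simp only: of_nat_0_less_iff)
  ultimately have "X / real_of_int \<bar>discriminant F\<bar> \<le> X / real (\<Prod>T)" using X by (intro divide_left_mono mult_pos_pos) linarith+
  then show ?thesis using X \<beta> by (intro mult_left_mono powr_mono2) auto
 qed
 finally show ?thesis by (simp add: D_def)
qed

theorem theorem8p1:
  fixes n r1 r2 :: nat and f :: "nat \<Rightarrow> real" and \<beta> :: real
  assumes "n \<ge> 3"
    and "r1 + 2 * r2 = n"
    and "counting_conjectures n r1 r2 f"
    and "quadratic_resolvent_conjecture n \<beta>"
    and "\<beta> > 1 / (4 * sqrt (exp 1))"
  shows "\<exists>M. ((\<lambda>q. (1 / 2 * real q) / (1 + f q) *
                 (\<Prod>p | prime p \<and> p < q. (1 / 2 + f p) / (1 + f p))) has_sum M) {q. prime q} \<and>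
             (\<lambda>X. (\<Sum>\<kappa>\<in>Sn_classes n r1 r2 X.
                      real (least_frob_prime n (outside_alt n) (class_rep \<kappa>)))
                    / real (card (Sn_classes n r1 r2 X)) - M)
               \<in> O(\<lambda>X. 1 / ln X)"
proof -
 define Cl where "Cl X = Sn_classes n r1 r2 X" for X
 define d where "d v = discriminant (class_rep v)" for v
 have n2: "n \<ge> 2" using assms(1) by simp
 obtain w r c Mf A \<delta> \<gamma> B where cc: "bij_betw r {1..w} (ramified_splitting_types n)"
   "\<forall>j\<in>{1..w}. \<forall>p. prime p --> 0 < c j p" "\<forall>p. prime p --> (\<Sum>j=1..w. c j p) = f p"
  and Mf: "\<forall>p. prime p --> f p \<le> Mf / real p"
  and par: "0 < A" "0 < \<delta>" "\<delta> < 1" "0 < \<gamma>"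
  and cnt: "\<forall>X\<ge>1. finite (Sn_classes n r1 r2 X) \<and> \<bar>real (card (Sn_classes n r1 r2 X)) - A * X\<bar> \<le> B * X powr \<delta>"
  and cond: "\<forall>X\<ge>1. \<forall>S LC. finite S \<and> (\<forall>p\<in>S. prime p \<and> valid_cond n w (LC p)) -->
       \<bar>real (card (Sn_classes_cond n r1 r2 r S LC X)) - (\<Prod>p\<in>S. cond_density n c f p (LC p)) * A * X\<bar>
       \<le> B * real (\<Prod>p\<in>S. p) powr \<gamma> * X powr \<delta>"
  using assms(3) unfolding counting_conjectures_def by (elim exE conjE) (rule that; assumption)
 have cf: "(\<Sum>j=1..w. c j p) = f p" if "prime p" for p using cc(3) that by blast
 have f0: "f p \<ge> 0" if "prime p" for p
  unfolding cf[OF that, symmetric] using cc(2) that by (intro sum_nonneg) (auto intro: less_imp_le)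
 have cnt': "finite (Sn_classes n r1 r2 X) \<and> \<bar>real (card (Sn_classes n r1 r2 X)) - A * X\<bar> \<le> B * X powr \<delta>" if "X \<ge> 1" for X
  using cnt that by blast
 have cond': "\<bar>real (card (Sn_classes_cond n r1 r2 r S LC X)) - (\<Prod>p\<in>S. cond_density n c f p (LC p)) * A * X\<bar>
       \<le> B * real (\<Prod>p\<in>S. p) powr \<gamma> * X powr \<delta>"
  if "X \<ge> 1" "finite S" "\<forall>p\<in>S. prime p \<and> valid_cond n w (LC p)" for X S LC
  using cond that by blast
 note ctx = n2 cc(1) cf f0 par cnt' cond'
 have B0: "B \<ge> 0" by (rule B_nonneg[OF ctx])
 obtain BQ where \<beta>: "0 < \<beta>" "\<beta> < 1/2" and QC: "\<forall>F. number_field F \<and> degree_over_Q F = 2 -->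
    (\<forall>X\<ge>1. finite (Defs.QR n X F) \<and>
      real (card (Defs.QR n X F)) \<le> BQ * (X / real_of_int \<bar>discriminant F\<bar>) powr (1 - \<beta>))"
  using assms(4) unfolding quadratic_resolvent_conjecture_def by blast
 have rep: "Sn_field n (class_rep v)" "real_of_int \<bar>d v\<bar> < X" "number_field (class_rep v)" "degree_over_Q (class_rep v) = n"
  if "v \<in> Cl X" for v X
  using Sn_classes_rep(1)[of v n r1 r2 X] that by (auto simp: Cl_def d_def Sn_fields_def Sn_field_def)
 have nonsq: "\<nexists>k. d v = k\<^sup>2" if k: "v \<in> Cl X" for v X
 proof -
  obtain J where J: "enumerated_field (class_rep v) J" using enumeration_exists[OF rep(3)[OF k]] by blast
  show ?thesis
   using enumerated_field.discriminant_not_square[OF J] rep(1,4)[OF k] n2 by (simp add: d_def)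
 qed
 have "\<exists>A' C. \<forall>\<^sub>F X in at_top.
  (\<Sum>v\<in>{v \<in> Cl X. \<forall>p\<in>outside_primes n v. ln X ^ A' < real p}. real (LEAST p. p \<in> outside_primes n v)) \<le> C * X powr (1 - \<beta>/8)"
 proof (rule tail_bound[OF \<beta>, where d = d and B = "\<bar>BQ\<bar>"])
  show "finite (Cl X)" if "X \<ge> 1" for X using cnt'[OF that] by (simp add: Cl_def)
  show "d v \<noteq> 0 \<and> real_of_int \<bar>d v\<bar> < X \<and> (\<nexists>k. d v = k\<^sup>2)" if "v \<in> Cl X" for X v
   using nonsq[OF that] rep(2)[OF that] by (metis zero_power2)
  \<comment> \<open>An odd prime not dividing d with symbol -1 is unramified and has an odd
    Frobenius permutation, whose conjugacy class lies outside the alternating group.\<close>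
  show "p \<in> outside_primes n v" if k: "v \<in> Cl X" and p: "prime p" "2 < p" "\<not> int p dvd d v" "Legendre (d v) (int p) = -1" for X v p
  proof -
   obtain J where J: "enumerated_field (class_rep v) J" using enumeration_exists[OF rep(3)[OF k]] by blast
   obtain \<pi> where pi: "\<pi> permutes {1..n} \<and> (\<forall>C. \<pi> \<in> C --> frob_in n (class_rep v) p C) \<and>
     (2 < p \<and> \<not> int p dvd discriminant (class_rep v) \<and> Legendre (discriminant (class_rep v)) (int p) = -1 --> sign \<pi> = -1)"
    using enumerated_field.frobenius_permutation[OF J p(1)] unfolding rep(4)[OF k] by (rule exE)
   then have "sign \<pi> = -1" using p by (simp add: d_def)
   then have "\<pi> \<in> outside_alt n" using pi by (simp add: in_outside_alt)
   then show ?thesis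
    using pi p enumerated_field.unramified_if_not_dvd_discriminant[OF J p(1)] by (simp add: outside_primes_def d_def)
  qed
  show "real (card {v \<in> Cl X. \<exists>m. d v = m\<^sup>2 * (s * int (\<Prod>T))}) \<le> \<bar>BQ\<bar> * (X / real (\<Prod>T)) powr (1 - \<beta>)"
   if "X \<ge> 1" "sqfree_disc s T" for X s T
   using resolvent_count[OF QC _ that] \<beta>(2) by (simp add: Cl_def d_def)
 qed
 then obtain A' C where tail: "\<forall>\<^sub>F X in at_top.
  (\<Sum>v\<in>{v \<in> Cl X. \<forall>p\<in>outside_primes n v. ln X ^ A' < real p}. real (LEAST p. p \<in> outside_primes n v)) \<le> C * X powr (1 - \<beta>/8)" by blast
 define W where "W = real (card (conds n w) + 1)"
 have "\<exists>M. ((\<lambda>q. real q * first_density f q) has_sum M) {q. prime q} \<and>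
  (\<lambda>X. (\<Sum>v\<in>Cl X. real (LEAST p. p \<in> outside_primes n v)) / real (card (Cl X)) - M) \<in> O(\<lambda>X. 1 / ln X)"
 proof (rule average_of_least_prime[OF f0 _ _ _ par(1-3), where Mf = Mf and K = "2 * B" and W = W and \<gamma> = \<gamma> and B = B and \<eta> = "\<beta>/8"])
  show "f p \<le> Mf / real p" if "prime p" for p using Mf that by blast
  show "finite (Cl X)" if "X \<ge> 1" for X using cnt'[OF that] by (simp add: Cl_def)
  show "prime p" if "p \<in> outside_primes n v" for p v using that by (simp add: outside_primes_def)
  show "0 \<le> 2 * B" "1 \<le> W" "0 \<le> \<gamma>" "0 < \<beta>/8" using B0 par \<beta> by (auto simp: W_def)
  show "\<bar>real (card (Cl X)) - A * X\<bar> \<le> B * X powr \<delta>" if "X \<ge> 1" for X using cnt'[OF that] by (simp add: Cl_def)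
  show "\<bar>real (card {v \<in> Cl X. q \<in> outside_primes n v \<and> (\<forall>p<q. p \<notin> outside_primes n v)}) - first_density f q * A * X\<bar>
    \<le> 2 * B * (W * real q powr \<gamma>) ^ q * X powr \<delta>" if "X \<ge> 1" "prime q" for X q
   unfolding Cl_def W_def by (rule first_count[OF ctx that])
  show "real (card {v \<in> Cl X. \<forall>p\<le>y. p \<notin> outside_primes n v}) \<le> survival f y * A * X + 2 * B * (W * real y powr \<gamma>) ^ y * X powr \<delta>"
   if "X \<ge> 1" "y \<ge> 1" for X y
  proof -
   have "real (card {v \<in> Cl X. \<forall>p\<le>y. p \<notin> outside_primes n v}) \<le> survival f y * A * X + B * (W * real y powr \<gamma>) ^ y * X powr \<delta>"
    unfolding Cl_def W_def by (rule survivors_le[OF ctx that])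
   moreover have "B * ((W * real y powr \<gamma>) ^ y * X powr \<delta>) \<ge> 0" using B0 by (simp add: W_def)
   ultimately show ?thesis by (simp add: mult.assoc)
  qed
  show "\<forall>\<^sub>F X in at_top. (\<Sum>v\<in>{v \<in> Cl X. \<forall>p\<in>outside_primes n v. ln X ^ A' < real p}. real (LEAST p. p \<in> outside_primes n v)) \<le> C * X powr (1 - \<beta>/8)"
   by (rule tail)
 qed
 moreover have "least_frob_prime n (outside_alt n) (class_rep v) = (LEAST p. p \<in> outside_primes n v)" for v
  by (simp add: least_frob_prime_def outside_primes_def)
 moreover have "(\<lambda>q. (1 / 2 * real q) / (1 + f q) * (\<Prod>p | prime p \<and> p < q. (1 / 2 + f p) / (1 + f p))) = (\<lambda>q. real q * first_density f q)"
  by (simp add: first_density_def fun_eq_iff)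
 ultimately show ?thesis by (simp only: Cl_def)
qed

end
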